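(* Let $R$ be a commutative ring. With the product operation $\otimes$ (internal tensor product of biset functors) and unit $B$ (the Burnside ring functor), the category $\mathcal F=\mathcal F_R$ of biset functors is a symmetric monoidal tensor category. Furthermore, if $P$ and $Q$ are projective biset functors then $P\otimes Q$ and $\mathcal H(P,Q)$ are also projective.
   Context: All categories are finite and $\mathrm{Set}$ is the category of finite sets. A $(\mathcal C,\mathcal D)$-biset is a functor $\Omega:\mathcal C\times\mathcal D^{\mathrm{op}}\to\mathrm{Set}$. The composite of a $(\mathcal C,\mathcal D)$-biset $\Omega$ and a $(\mathcal D,\mathcal E)$-biset $\Psi$ is $(\Omega\circ\Psi)(x,z)=\left(\bigsqcup_{y}\Omega(x,y)\times\Psi(y,z)\right)/\sim$, with $\sim$ generated by $(u\beta,v)\sim(u,\beta v)$ for morphisms $\beta$ of $\mathcal D$. $\mathbb B=\mathbb B_R$ has finite categories as objects; $\mathrm{Hom}_{\mathbb B}(\mathcal C,\mathcal D)$ is $R\otimes_{\mathbb Z}$ of the Grothendieck group of finite $(\mathcal D,\mathcal C)$-bisets with respect to disjoint union, and composition is the $R$-bilinear extension of $\circ$. A biset functor is an $R$-linear functor $\mathbb B\to R$-mod; $\mathcal F$ is the category of biset functors with natural transformations as morphisms. $B=\mathrm{Hom}_{\mathbb B}(\mathbf 1,-)$, where $\mathbf 1$ is the category with one object and one morphism. Duality $\tau:\mathbb B^{\mathrm{op}}\to\mathbb B$: $\tau(\mathcal C)=\mathcal C^{\mathrm{op}}$, and a $(\mathcal C,\mathcal D)$-biset is sent to the same functor regarded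 as a $(\mathcal D^{\mathrm{op}},\mathcal C^{\mathrm{op}})$-biset. Yoneda–Dress construction: for a category $\mathcal K$ and a biset functor $M$, $\mathsf P_{\mathcal K}(M)$ is the biset functor $\mathcal C\mapsto M(\mathcal C\times\mathcal K)$, $\Omega\mapsto M(\Omega\times{}_{\mathcal K}\mathcal K_{\mathcal K})$, where ${}_{\mathcal K}\mathcal K_{\mathcal K}$ is the identity biset $(x,y)\mapsto\mathrm{Hom}_{\mathcal K}(y,x)$. It is functorial in $\mathcal K\in\mathbb B$: a $(\mathcal K,\mathcal J)$-biset $\Omega$ induces $\mathsf P_{\mathcal J}M\to\mathsf P_{\mathcal K}M$ given at $\mathcal C$ by $M({}_{\mathcal C}\mathcal C_{\mathcal C}\times\Omega)$. Internal Hom: $\mathcal H(M,N)$ is the biset functor $\mathcal K\mapsto\mathrm{Hom}_{\mathcal F}(M,\mathsf P_{\mathcal K}(N))$. For a right biset functor $L:\mathbb B^{\mathrm{op}}\to R$-mod and a biset functor $M$, $L\otimes_{\mathbb B}M$ is $\bigoplus_{\mathcal D}L(\mathcal D)\otimes_RM(\mathcal D)$ modulo the relations $(a\cdot\Omega)\otimes b=a\otimes(\Omega\cdot b)$ for $a\in L(\mathcal E)$, $b\in M(\mathcal D)$, $\Omega$ an $(\mathcal E,\mathcal D)$-biset. Internal tensor product: $L\otimes M$ is the biset functor $\mathcal C\mapsto(\mathsf P_{\mathcal C}(L)\circ\tau)\otimes_{\mathbb B}M$, i.e. $(L\otimes M)(\mathcal C)=L(\tau(-)\times\mathcal C)\otimes_{\mathbb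 B}M(-)$.
   Formalization: The claim that H(P,Q) is projective is proved for finitely generated projective P (Q any projective); it is false for arbitrary P: for R = Z, P a countable direct sum of copies of B and Q = B, H(P,Q) is a countable product of copies of B, with value Z^N at 1, which is not free. *)

theory Defs
  imports "HOL-Algebra.Module" "HOL-Algebra.AbelCoset" "HOL-Library.Nat_Bijection"
begin

section \<open>Categories, projective objects, symmetric monoidal structures\<close>

record ('o, 'a) cat =
  Ob :: "'o set"
  Ar :: "'a set"
  src :: "'a \<Rightarrow> 'o"
  tgt :: "'a \<Rightarrow> 'o"
  ident :: "'o \<Rightarrow> 'a"
  cmp :: "'a \<Rightarrow> 'a \<Rightarrow> 'a"  \<comment> \<open>\<open>cmp C g f\<close> is the composite \<open>g \<circ> f\<close>: first \<open>f\<close>, then \<open>g\<close>\<close>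

definition Hom :: "('o, 'a) cat \<Rightarrow> 'o \<Rightarrow> 'o \<Rightarrow> 'a set" where
  "Hom C x y = {f \<in> Ar C. src C f = x \<and> tgt C f = y}"

locale category =
  fixes C :: "('o, 'a) cat"
  assumes src_Ob: "f \<in> Ar C \<Longrightarrow> src C f \<in> Ob C"
    and tgt_Ob: "f \<in> Ar C \<Longrightarrow> tgt C f \<in> Ob C"
    and ident_Hom: "x \<in> Ob C \<Longrightarrow> ident C x \<in> Hom C x x"
    and cmp_Hom: "f \<in> Hom C x y \<Longrightarrow> g \<in> Hom C y z \<Longrightarrow> cmp C g f \<in> Hom C x z"
    and cmp_ident_left: "f \<in> Hom C x y \<Longrightarrow> cmp C (ident C y) f = f"
    and cmp_ident_right: "f \<in> Hom C x y \<Longrightarrow> cmp C f (ident C x) = f"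
    and cmp_assoc: "f \<in> Hom C w x \<Longrightarrow> g \<in> Hom C x y \<Longrightarrow> h \<in> Hom C y z \<Longrightarrow>
      cmp C (cmp C h g) f = cmp C h (cmp C g f)"

definition epi :: "('o, 'a) cat \<Rightarrow> 'a \<Rightarrow> bool" where
  "epi C e \<longleftrightarrow> e \<in> Ar C \<and>
     (\<forall>z. \<forall>f\<in>Hom C (tgt C e) z. \<forall>g\<in>Hom C (tgt C e) z. cmp C f e = cmp C g e \<longrightarrow> f = g)"

definition iso_arrow :: "('o, 'a) cat \<Rightarrow> 'a \<Rightarrow> bool" where
  "iso_arrow C f \<longleftrightarrow> f \<in> Ar C \<and>
     (\<exists>g\<in>Hom C (tgt C f) (src C f). cmp C g f = ident C (src C f) \<and> cmp C f g = ident C (tgt C f))"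

definition projective :: "('o, 'a) cat \<Rightarrow> 'o \<Rightarrow> bool" where
  "projective C P \<longleftrightarrow> P \<in> Ob C \<and>
     (\<forall>x y. \<forall>e\<in>Hom C x y. \<forall>f\<in>Hom C P y. epi C e \<longrightarrow> (\<exists>g\<in>Hom C P x. cmp C e g = f))"

text \<open>
  A symmetric monoidal structure with tensor functor \<open>(T, Tm)\<close> (on objects and on morphisms)
  and unit \<open>I\<close>; \<open>a\<close>, \<open>l\<close>, \<open>r\<close>, \<open>s\<close> are the associator, the unitors and the symmetry.
\<close>

locale symmetric_monoidal = category C for C :: "('o, 'a) cat" +
  fixes T :: "'o \<Rightarrow> 'o \<Rightarrow> 'o" and Tm :: "'a \<Rightarrow> 'a \<Rightarrow> 'a" and I :: 'o
    and a :: "'o \<Rightarrow> 'o \<Rightarrow> 'o \<Rightarrow> 'a" and l :: "'o \<Rightarrow> 'a" and r :: "'o \<Rightarrow> 'a" and s :: "'o \<Rightarrow> 'o \<Rightarrow> 'a"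
  assumes T_Ob: "x \<in> Ob C \<Longrightarrow> y \<in> Ob C \<Longrightarrow> T x y \<in> Ob C"
    and Tm_Hom: "f \<in> Hom C x x' \<Longrightarrow> g \<in> Hom C y y' \<Longrightarrow> Tm f g \<in> Hom C (T x y) (T x' y')"
    and Tm_ident: "x \<in> Ob C \<Longrightarrow> y \<in> Ob C \<Longrightarrow> Tm (ident C x) (ident C y) = ident C (T x y)"
    and Tm_cmp: "f \<in> Hom C x x' \<Longrightarrow> f' \<in> Hom C x' x'' \<Longrightarrow> g \<in> Hom C y y' \<Longrightarrow> g' \<in> Hom C y' y'' \<Longrightarrow>
      Tm (cmp C f' f) (cmp C g' g) = cmp C (Tm f' g') (Tm f g)"
    and I_Ob: "I \<in> Ob C"
    and a_Hom: "x \<in> Ob C \<Longrightarrow> y \<in> Ob C \<Longrightarrow> z \<in> Ob C \<Longrightarrow> a x y z \<in> Hom C (T (T x y) z) (T x (T y z))"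
    and l_Hom: "x \<in> Ob C \<Longrightarrow> l x \<in> Hom C (T I x) x"
    and r_Hom: "x \<in> Ob C \<Longrightarrow> r x \<in> Hom C (T x I) x"
    and s_Hom: "x \<in> Ob C \<Longrightarrow> y \<in> Ob C \<Longrightarrow> s x y \<in> Hom C (T x y) (T y x)"
    and a_iso: "x \<in> Ob C \<Longrightarrow> y \<in> Ob C \<Longrightarrow> z \<in> Ob C \<Longrightarrow> iso_arrow C (a x y z)"
    and l_iso: "x \<in> Ob C \<Longrightarrow> iso_arrow C (l x)"
    and r_iso: "x \<in> Ob C \<Longrightarrow> iso_arrow C (r x)"
    and a_natural: "f \<in> Hom C x x' \<Longrightarrow> g \<in> Hom C y y' \<Longrightarrow> h \<in> Hom C z z' \<Longrightarrow>
      cmp C (a x' y' z') (Tm (Tm f g) h) = cmp C (Tm f (Tm g h)) (a x y z)"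
    and l_natural: "f \<in> Hom C x x' \<Longrightarrow> cmp C (l x') (Tm (ident C I) f) = cmp C f (l x)"
    and r_natural: "f \<in> Hom C x x' \<Longrightarrow> cmp C (r x') (Tm f (ident C I)) = cmp C f (r x)"
    and s_natural: "f \<in> Hom C x x' \<Longrightarrow> g \<in> Hom C y y' \<Longrightarrow>
      cmp C (s x' y') (Tm f g) = cmp C (Tm g f) (s x y)"
    and pentagon: "w \<in> Ob C \<Longrightarrow> x \<in> Ob C \<Longrightarrow> y \<in> Ob C \<Longrightarrow> z \<in> Ob C \<Longrightarrow>
      cmp C (Tm (ident C w) (a x y z)) (cmp C (a w (T x y) z) (Tm (a w x y) (ident C z)))
        = cmp C (a w x (T y z)) (a (T w x) y z)"
    and triangle: "x \<in> Ob C \<Longrightarrow> y \<in> Ob C \<Longrightarrow>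
      cmp C (Tm (ident C x) (l y)) (a x I y) = Tm (r x) (ident C y)"
    and symmetry: "x \<in> Ob C \<Longrightarrow> y \<in> Ob C \<Longrightarrow> cmp C (s y x) (s x y) = ident C (T x y)"
    and hexagon: "x \<in> Ob C \<Longrightarrow> y \<in> Ob C \<Longrightarrow> z \<in> Ob C \<Longrightarrow>
      cmp C (a y z x) (cmp C (s x (T y z)) (a x y z))
        = cmp C (Tm (ident C y) (s x z)) (cmp C (a y x z) (Tm (s x y) (ident C z)))"


section \<open>Modules by generators and relations\<close>

text \<open>
  The records of \<^theory>\<open>HOL-Algebra.Module\<close> extend ring records; the locale
  \<^locale>\<open>module\<close> ignores the fields \<open>mult\<close> and \<open>one\<close> of the module.
\<close>

definition lin_map :: "'r ring \<Rightarrow> ('r, 'a) module \<Rightarrow> ('r, 'b) module \<Rightarrow> ('a \<Rightarrow> 'b) \<Rightarrow> bool" where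
  "lin_map R A B h \<longleftrightarrow> h \<in> carrier A \<rightarrow> carrier B \<and>
     (\<forall>x\<in>carrier A. \<forall>y\<in>carrier A. h (x \<oplus>\<^bsub>A\<^esub> y) = h x \<oplus>\<^bsub>B\<^esub> h y) \<and>
     (\<forall>r\<in>carrier R. \<forall>x\<in>carrier A. h (r \<odot>\<^bsub>A\<^esub> x) = r \<odot>\<^bsub>B\<^esub> h x)"

definition bilin_map ::
  "'r ring \<Rightarrow> ('r, 'a) module \<Rightarrow> ('r, 'b) module \<Rightarrow> ('r, 'c) module \<Rightarrow> ('a \<Rightarrow> 'b \<Rightarrow> 'c) \<Rightarrow> bool" where
  "bilin_map R A B D h \<longleftrightarrow>
     (\<forall>x\<in>carrier A. lin_map R B D (h x)) \<and> (\<forall>y\<in>carrier B. lin_map R A D (\<lambda>x. h x y))"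

definition free_mod :: "'r ring \<Rightarrow> 'x set \<Rightarrow> ('r, 'x \<Rightarrow> 'r) module" where
  "free_mod R X =
    \<lparr>carrier = {f \<in> X \<rightarrow> carrier R. (\<forall>x. x \<notin> X \<longrightarrow> f x = \<zero>\<^bsub>R\<^esub>) \<and> finite {x. f x \<noteq> \<zero>\<^bsub>R\<^esub>}},
     mult = undefined, one = undefined,
     zero = (\<lambda>x. \<zero>\<^bsub>R\<^esub>), add = (\<lambda>f g x. f x \<oplus>\<^bsub>R\<^esub> g x), smult = (\<lambda>r f x. r \<otimes>\<^bsub>R\<^esub> f x)\<rparr>"

definition basis_elt :: "'r ring \<Rightarrow> 'x \<Rightarrow> 'x \<Rightarrow> 'r" where
  "basis_elt R x = (\<lambda>y. if y = x then \<one>\<^bsub>R\<^esub> else \<zero>\<^bsub>R\<^esub>)"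

definition mod_span :: "'r ring \<Rightarrow> ('r, 'a) module \<Rightarrow> 'a set \<Rightarrow> 'a set" where
  "mod_span R M S = \<Inter>{N. submodule N R M \<and> S \<subseteq> N}"

definition quot_mod :: "('r, 'a) module \<Rightarrow> 'a set \<Rightarrow> ('r, 'a set) module" where
  "quot_mod M N =
    \<lparr>carrier = a_rcosets\<^bsub>M\<^esub> N, mult = undefined, one = undefined,
     zero = N, add = (\<lambda>K L. K <+>\<^bsub>M\<^esub> L), smult = (\<lambda>r K. \<Union>x\<in>K. N +>\<^bsub>M\<^esub> (r \<odot>\<^bsub>M\<^esub> x))\<rparr>"

text \<open>The \<open>R\<close>-module with generators \<open>X\<close> and relators \<open>S\<close>, and the image in it of a generator.\<close>

definition pres :: "'r ring \<Rightarrow> 'x set \<Rightarrow> ('x \<Rightarrow> 'r) set \<Rightarrow> ('r, ('x \<Rightarrow> 'r) set) module" where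
  "pres R X S = quot_mod (free_mod R X) (mod_span R (free_mod R X) S)"

definition pgen :: "'r ring \<Rightarrow> 'x set \<Rightarrow> ('x \<Rightarrow> 'r) set \<Rightarrow> 'x \<Rightarrow> ('x \<Rightarrow> 'r) set" where
  "pgen R X S x = mod_span R (free_mod R X) S +>\<^bsub>free_mod R X\<^esub> basis_elt R x"

text \<open>
  The linear map from a presented module to \<open>M\<close> that sends the generator \<open>x\<close> to \<open>h x\<close>. The choice
  of representative is immaterial as soon as \<open>h\<close> respects the relators.
\<close>

definition plift :: "'r ring \<Rightarrow> ('r, 'a) module \<Rightarrow> ('x \<Rightarrow> 'a) \<Rightarrow> ('x \<Rightarrow> 'r) set \<Rightarrow> 'a" where
  "plift R M h K = (let f = SOME f. f \<in> K
     in finsum M (\<lambda>x. f x \<odot>\<^bsub>M\<^esub> h x) {x. f x \<noteq> \<zero>\<^bsub>R\<^esub>})"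


section \<open>Finite categories\<close>

text \<open>
  Finite categories have natural numbers as objects and as morphisms; every finite category is
  isomorphic to such a one. The structure maps take the value \<open>undefined\<close> outside their domains,
  so that \<open>fincats\<close> is a (countable) set without redundant copies. Pairs are coded
  by \<^const>\<open>prod_encode\<close>.
\<close>

type_synonym fcat = "(nat, nat) cat"

abbreviation pr :: "nat \<Rightarrow> nat \<Rightarrow> nat" (\<open>\<langle>_, _\<rangle>\<close>) where "\<langle>m, n\<rangle> \<equiv> prod_encode (m, n)"
abbreviation pi1 :: "nat \<Rightarrow> nat" where "pi1 n \<equiv> fst (prod_decode n)"
abbreviation pi2 :: "nat \<Rightarrow> nat" where "pi2 n \<equiv> snd (prod_decode n)"

definition norm_cat :: "fcat \<Rightarrow> fcat" where
  "norm_cat C = \<lparr>Ob = Ob C, Ar = Ar C,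
     src = restrict (src C) (Ar C), tgt = restrict (tgt C) (Ar C), ident = restrict (ident C) (Ob C),
     cmp = (\<lambda>g f. if g \<in> Ar C \<and> f \<in> Ar C \<and> tgt C f = src C g then cmp C g f else undefined)\<rparr>"

definition fincats :: "fcat set" where
  "fincats = {C. category C \<and> finite (Ob C) \<and> finite (Ar C) \<and> norm_cat C = C}"

definition one_cat :: fcat where
  "one_cat = norm_cat \<lparr>Ob = {0}, Ar = {0}, src = (\<lambda>_. 0), tgt = (\<lambda>_. 0), ident = (\<lambda>_. 0), cmp = (\<lambda>_ _. 0)\<rparr>"

definition op_cat :: "fcat \<Rightarrow> fcat" where
  "op_cat C = \<lparr>Ob = Ob C, Ar = Ar C, src = tgt C, tgt = src C, ident = ident C, cmp = (\<lambda>g f. cmp C f g)\<rparr>"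

definition prod_cat :: "fcat \<Rightarrow> fcat \<Rightarrow> fcat" (infixr \<open>\<times>\<^sub>c\<close> 75) where
  "C \<times>\<^sub>c D = norm_cat
    \<lparr>Ob = prod_encode ` (Ob C \<times> Ob D), Ar = prod_encode ` (Ar C \<times> Ar D),
     src = (\<lambda>f. \<langle>src C (pi1 f), src D (pi2 f)\<rangle>), tgt = (\<lambda>f. \<langle>tgt C (pi1 f), tgt D (pi2 f)\<rangle>),
     ident = (\<lambda>x. \<langle>ident C (pi1 x), ident D (pi2 x)\<rangle>),
     cmp = (\<lambda>g f. \<langle>cmp C (pi1 g) (pi1 f), cmp D (pi2 g) (pi2 f)\<rangle>)\<rparr>"


section \<open>Bisets\<close>

text \<open>
  A \<open>(C, D)\<close>-biset \<open>\<Omega>\<close> is a functor from \<open>C \<times> D\<^sup>o\<^sup>p\<close> to finite sets, whose elements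
  are again natural numbers. For morphisms \<open>\<alpha> : x \<rightarrow> x'\<close> of \<open>C\<close> and \<open>\<beta> : y' \<rightarrow> y\<close> of \<open>D\<close>,
  \<open>bmap \<Omega> \<alpha> \<beta>\<close> maps \<open>bob \<Omega> x y\<close> to \<open>bob \<Omega> x' y'\<close>; it is the map \<open>u \<mapsto> \<alpha>u\<beta>\<close>.
\<close>

record biset =
  bob :: "nat \<Rightarrow> nat \<Rightarrow> nat set"
  bmap :: "nat \<Rightarrow> nat \<Rightarrow> nat \<Rightarrow> nat"

definition norm_biset :: "fcat \<Rightarrow> fcat \<Rightarrow> biset \<Rightarrow> biset" where
  "norm_biset C D \<Omega> =
    \<lparr>bob = (\<lambda>x y. if x \<in> Ob C \<and> y \<in> Ob D then bob \<Omega> x y else {}),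
     bmap = (\<lambda>\<alpha> \<beta> u. if \<alpha> \<in> Ar C \<and> \<beta> \<in> Ar D \<and> u \<in> bob \<Omega> (src C \<alpha>) (tgt D \<beta>)
                     then bmap \<Omega> \<alpha> \<beta> u else undefined)\<rparr>"

definition bisets :: "fcat \<Rightarrow> fcat \<Rightarrow> biset set" where
  "bisets C D = {\<Omega>. norm_biset C D \<Omega> = \<Omega> \<and>
     (\<forall>x\<in>Ob C. \<forall>y\<in>Ob D. finite (bob \<Omega> x y)) \<and>
     (\<forall>\<alpha>\<in>Ar C. \<forall>\<beta>\<in>Ar D. bmap \<Omega> \<alpha> \<beta> \<in> bob \<Omega> (src C \<alpha>) (tgt D \<beta>) \<rightarrow> bob \<Omega> (tgt C \<alpha>) (src D \<beta>)) \<and>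
     (\<forall>x\<in>Ob C. \<forall>y\<in>Ob D. \<forall>u\<in>bob \<Omega> x y. bmap \<Omega> (ident C x) (ident D y) u = u) \<and>
     (\<forall>\<alpha>\<in>Ar C. \<forall>\<alpha>'\<in>Ar C. \<forall>\<beta>\<in>Ar D. \<forall>\<beta>'\<in>Ar D. tgt C \<alpha> = src C \<alpha>' \<longrightarrow> tgt D \<beta>' = src D \<beta> \<longrightarrow>
        (\<forall>u\<in>bob \<Omega> (src C \<alpha>) (tgt D \<beta>).
           bmap \<Omega> (cmp C \<alpha>' \<alpha>) (cmp D \<beta> \<beta>') u = bmap \<Omega> \<alpha>' \<beta>' (bmap \<Omega> \<alpha> \<beta> u)))}"

text \<open>Isomorphism, i.e. natural bijection, of \<open>(C, D)\<close>-bisets.\<close>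

definition biset_iso :: "fcat \<Rightarrow> fcat \<Rightarrow> biset \<Rightarrow> biset \<Rightarrow> bool" where
  "biset_iso C D \<Omega> \<Psi> \<longleftrightarrow> (\<exists>\<theta>.
     (\<forall>x\<in>Ob C. \<forall>y\<in>Ob D. bij_betw (\<theta> x y) (bob \<Omega> x y) (bob \<Psi> x y)) \<and>
     (\<forall>\<alpha>\<in>Ar C. \<forall>\<beta>\<in>Ar D. \<forall>u\<in>bob \<Omega> (src C \<alpha>) (tgt D \<beta>).
        \<theta> (tgt C \<alpha>) (src D \<beta>) (bmap \<Omega> \<alpha> \<beta> u) = bmap \<Psi> \<alpha> \<beta> (\<theta> (src C \<alpha>) (tgt D \<beta>) u)))"

definition bsum :: "fcat \<Rightarrow> fcat \<Rightarrow> biset \<Rightarrow> biset \<Rightarrow> biset" where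
  "bsum C D \<Omega> \<Psi> = norm_biset C D
    \<lparr>bob = (\<lambda>x y. sum_encode ` (bob \<Omega> x y <+> bob \<Psi> x y)),
     bmap = (\<lambda>\<alpha> \<beta> u. sum_encode (map_sum (bmap \<Omega> \<alpha> \<beta>) (bmap \<Psi> \<alpha> \<beta>) (sum_decode u)))\<rparr>"

definition idb :: "fcat \<Rightarrow> biset" where
  "idb C = norm_biset C C
    \<lparr>bob = (\<lambda>x y. Hom C y x), bmap = (\<lambda>\<alpha> \<beta> u. cmp C \<alpha> (cmp C u \<beta>))\<rparr>"

text \<open>
  Composition of a \<open>(C, D)\<close>-biset with a \<open>(D, E)\<close>-biset. The triple \<open>\<langle>y, \<langle>u, v\<rangle>\<rangle>\<close> codes
  \<open>(u, v) \<in> \<Omega>(x, y) \<times> \<Psi>(y, z)\<close>, and equivalence classes are coded by \<^const>\<open>set_encode\<close>.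
\<close>

definition bcomp_dom :: "fcat \<Rightarrow> biset \<Rightarrow> biset \<Rightarrow> nat \<Rightarrow> nat \<Rightarrow> nat set" where
  "bcomp_dom D \<Omega> \<Psi> x z = {\<langle>y, \<langle>u, v\<rangle>\<rangle> | y u v. y \<in> Ob D \<and> u \<in> bob \<Omega> x y \<and> v \<in> bob \<Psi> y z}"

definition bcomp_rel :: "fcat \<Rightarrow> fcat \<Rightarrow> fcat \<Rightarrow> biset \<Rightarrow> biset \<Rightarrow> nat \<Rightarrow> nat \<Rightarrow> nat rel" where
  "bcomp_rel C D E \<Omega> \<Psi> x z =
     {(\<langle>src D \<beta>, \<langle>bmap \<Omega> (ident C x) \<beta> u, v\<rangle>\<rangle>, \<langle>tgt D \<beta>, \<langle>u, bmap \<Psi> \<beta> (ident E z) v\<rangle>\<rangle>) | \<beta> u v.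
        \<beta> \<in> Ar D \<and> u \<in> bob \<Omega> x (tgt D \<beta>) \<and> v \<in> bob \<Psi> (src D \<beta>) z}"

definition bcomp_eq :: "fcat \<Rightarrow> fcat \<Rightarrow> fcat \<Rightarrow> biset \<Rightarrow> biset \<Rightarrow> nat \<Rightarrow> nat \<Rightarrow> nat rel" where
  "bcomp_eq C D E \<Omega> \<Psi> x z = (bcomp_rel C D E \<Omega> \<Psi> x z \<union> (bcomp_rel C D E \<Omega> \<Psi> x z)\<inverse>)\<^sup>*"

definition bcomp :: "fcat \<Rightarrow> fcat \<Rightarrow> fcat \<Rightarrow> biset \<Rightarrow> biset \<Rightarrow> biset" where
  "bcomp C D E \<Omega> \<Psi> = norm_biset C E
    \<lparr>bob = (\<lambda>x z. set_encode ` (bcomp_dom D \<Omega> \<Psi> x z // bcomp_eq C D E \<Omega> \<Psi> x z)),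
     bmap = (\<lambda>\<alpha> \<gamma> k. set_encode (bcomp_eq C D E \<Omega> \<Psi> (tgt C \<alpha>) (src E \<gamma>) ``
        ((\<lambda>t. let y = pi1 t; u = pi1 (pi2 t); v = pi2 (pi2 t)
              in \<langle>y, \<langle>bmap \<Omega> \<alpha> (ident D y) u, bmap \<Psi> (ident D y) \<gamma> v\<rangle>\<rangle>) ` set_decode k)))\<rparr>"

text \<open>
  The \<open>(C \<times> C', D \<times> D')\<close>-biset \<open>\<Omega> \<times> \<Psi>\<close> of a \<open>(C, D)\<close>-biset \<open>\<Omega>\<close> and a
  \<open>(C', D')\<close>-biset \<open>\<Psi>\<close>.
\<close>

definition bprod :: "fcat \<Rightarrow> fcat \<Rightarrow> fcat \<Rightarrow> fcat \<Rightarrow> biset \<Rightarrow> biset \<Rightarrow> biset" where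
  "bprod C D C' D' \<Omega> \<Psi> = norm_biset (C \<times>\<^sub>c C') (D \<times>\<^sub>c D')
    \<lparr>bob = (\<lambda>x y. prod_encode ` (bob \<Omega> (pi1 x) (pi1 y) \<times> bob \<Psi> (pi2 x) (pi2 y))),
     bmap = (\<lambda>\<alpha> \<beta> w. \<langle>bmap \<Omega> (pi1 \<alpha>) (pi1 \<beta>) (pi1 w), bmap \<Psi> (pi2 \<alpha>) (pi2 \<beta>) (pi2 w)\<rangle>)\<rparr>"

text \<open>\<open>\<tau>\<close> on bisets: a \<open>(C, D)\<close>-biset regarded as a \<open>(D\<^sup>o\<^sup>p, C\<^sup>o\<^sup>p)\<close>-biset.\<close>

definition bdual :: "biset \<Rightarrow> biset" where
  "bdual \<Omega> = \<lparr>bob = (\<lambda>y x. bob \<Omega> x y), bmap = (\<lambda>\<beta> \<alpha>. bmap \<Omega> \<alpha> \<beta>)\<rparr>"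


section \<open>The category \<open>\<bbbB>\<^sub>R\<close>\<close>

text \<open>
  The objects of \<open>\<bbbB>\<^sub>R\<close> are the finite categories. The Grothendieck group of \<open>(D, C)\<close>-bisets is the
  abelian group generated by the bisets, subject to \<open>[\<Omega>] = [\<Psi>]\<close> if \<open>\<Omega> \<cong> \<Psi>\<close>
  and \<open>[\<Omega> \<squnion> \<Psi>] = [\<Omega>] + [\<Psi>]\<close>; by right exactness of \<open>R \<otimes>\<^sub>\<int> -\<close>, tensoring it with \<open>R\<close> gives the
  \<open>R\<close>-module with the same generators and relations, which is \<open>bhom R C D\<close>.
\<close>

type_synonym 'r bmor = "(biset \<Rightarrow> 'r) set"

definition brels :: "'r ring \<Rightarrow> fcat \<Rightarrow> fcat \<Rightarrow> (biset \<Rightarrow> 'r) set" where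
  "brels R C D =
     {\<lambda>x. basis_elt R \<Omega> x \<ominus>\<^bsub>R\<^esub> basis_elt R \<Psi> x | \<Omega> \<Psi>.
        \<Omega> \<in> bisets D C \<and> \<Psi> \<in> bisets D C \<and> biset_iso D C \<Omega> \<Psi>} \<union>
     {\<lambda>x. basis_elt R (bsum D C \<Omega> \<Psi>) x \<ominus>\<^bsub>R\<^esub> (basis_elt R \<Omega> x \<oplus>\<^bsub>R\<^esub> basis_elt R \<Psi> x) | \<Omega> \<Psi>.
        \<Omega> \<in> bisets D C \<and> \<Psi> \<in> bisets D C}"

definition bhom :: "'r ring \<Rightarrow> fcat \<Rightarrow> fcat \<Rightarrow> ('r, 'r bmor) module" where
  "bhom R C D = pres R (bisets D C) (brels R C D)"

text \<open>The class of a \<open>(D, C)\<close>-biset in \<open>bhom R C D\<close>.\<close>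

definition bcls :: "'r ring \<Rightarrow> fcat \<Rightarrow> fcat \<Rightarrow> biset \<Rightarrow> 'r bmor" where
  "bcls R C D \<Omega> = pgen R (bisets D C) (brels R C D) \<Omega>"

definition bident :: "'r ring \<Rightarrow> fcat \<Rightarrow> 'r bmor" where
  "bident R C = bcls R C C (idb C)"

definition bcmp :: "'r ring \<Rightarrow> fcat \<Rightarrow> fcat \<Rightarrow> fcat \<Rightarrow> 'r bmor \<Rightarrow> 'r bmor \<Rightarrow> 'r bmor" where
  "bcmp R C D E g f =
     plift R (bhom R C E) (\<lambda>\<Omega>. plift R (bhom R C E) (\<lambda>\<Psi>. bcls R C E (bcomp E D C \<Omega> \<Psi>)) f) g"

text \<open>
  The linear extensions of \<open>bprod\<close>, from \<open>bhom R C D\<close> and \<open>bhom R C' D'\<close> to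
  \<open>bhom R (C \<times>\<^sub>c C') (D \<times>\<^sub>c D')\<close>, and of \<open>bdual\<close>, from \<open>bhom R C D\<close> to
  \<open>bhom R (op_cat D) (op_cat C)\<close>.
\<close>

definition mprod :: "'r ring \<Rightarrow> fcat \<Rightarrow> fcat \<Rightarrow> fcat \<Rightarrow> fcat \<Rightarrow> 'r bmor \<Rightarrow> 'r bmor \<Rightarrow> 'r bmor" where
  "mprod R C D C' D' f g =
     plift R (bhom R (C \<times>\<^sub>c C') (D \<times>\<^sub>c D'))
       (\<lambda>\<Omega>. plift R (bhom R (C \<times>\<^sub>c C') (D \<times>\<^sub>c D'))
          (\<lambda>\<Psi>. bcls R (C \<times>\<^sub>c C') (D \<times>\<^sub>c D') (bprod D C D' C' \<Omega> \<Psi>)) g) f"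

definition mdual :: "'r ring \<Rightarrow> fcat \<Rightarrow> fcat \<Rightarrow> 'r bmor \<Rightarrow> 'r bmor" where
  "mdual R C D f =
     plift R (bhom R (op_cat D) (op_cat C)) (\<lambda>\<Omega>. bcls R (op_cat D) (op_cat C) (bdual \<Omega>)) f"


section \<open>Biset functors\<close>

text \<open>
  A biset functor is a functor \<open>\<bbbB>\<^sub>R \<rightarrow> R\<close>-mod that is linear in the morphisms of \<open>\<bbbB>\<^sub>R\<close>. The type
  \<open>'m\<close> is the universe from which the elements of the modules are drawn.
\<close>

record ('r, 'm) bfun =
  vob :: "fcat \<Rightarrow> ('r, 'm) module"
  vmap :: "fcat \<Rightarrow> fcat \<Rightarrow> 'r bmor \<Rightarrow> 'm \<Rightarrow> 'm"

definition biset_functor :: "'r ring \<Rightarrow> ('r, 'm) bfun \<Rightarrow> bool" where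
  "biset_functor R M \<longleftrightarrow>
     (\<forall>C\<in>fincats. module R (vob M C)) \<and>
     (\<forall>C\<in>fincats. \<forall>D\<in>fincats. bilin_map R (bhom R C D) (vob M C) (vob M D) (vmap M C D)) \<and>
     (\<forall>C\<in>fincats. \<forall>x\<in>carrier (vob M C). vmap M C C (bident R C) x = x) \<and>
     (\<forall>C\<in>fincats. \<forall>D\<in>fincats. \<forall>E\<in>fincats. \<forall>f\<in>carrier (bhom R C D). \<forall>g\<in>carrier (bhom R D E).
        \<forall>x\<in>carrier (vob M C). vmap M C E (bcmp R C D E g f) x = vmap M D E g (vmap M C D f x))"

definition nat_trans :: "'r ring \<Rightarrow> ('r, 'm) bfun \<Rightarrow> ('r, 'n) bfun \<Rightarrow> (fcat \<Rightarrow> 'm \<Rightarrow> 'n) set" where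
  "nat_trans R M N = {\<eta> \<in> extensional fincats.
     (\<forall>C\<in>fincats. \<eta> C \<in> extensional (carrier (vob M C)) \<and> lin_map R (vob M C) (vob N C) (\<eta> C)) \<and>
     (\<forall>C\<in>fincats. \<forall>D\<in>fincats. \<forall>f\<in>carrier (bhom R C D). \<forall>x\<in>carrier (vob M C).
        \<eta> D (vmap M C D f x) = vmap N C D f (\<eta> C x))}"

definition nat_mod :: "'r ring \<Rightarrow> ('r, 'm) bfun \<Rightarrow> ('r, 'n) bfun \<Rightarrow> ('r, fcat \<Rightarrow> 'm \<Rightarrow> 'n) module" where
  "nat_mod R M N =
    \<lparr>carrier = nat_trans R M N, mult = undefined, one = undefined,
     zero = (\<lambda>C\<in>fincats. \<lambda>x\<in>carrier (vob M C). \<zero>\<^bsub>vob N C\<^esub>),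
     add = (\<lambda>\<eta> \<theta>. \<lambda>C\<in>fincats. \<lambda>x\<in>carrier (vob M C). \<eta> C x \<oplus>\<^bsub>vob N C\<^esub> \<theta> C x),
     smult = (\<lambda>r \<eta>. \<lambda>C\<in>fincats. \<lambda>x\<in>carrier (vob M C). r \<odot>\<^bsub>vob N C\<^esub> \<eta> C x)\<rparr>"

text \<open>
  The category \<open>\<F>\<^sub>R\<close>. A morphism carries its source and target.
\<close>

type_synonym ('r, 'm) bfun_arr = "('r, 'm) bfun \<times> ('r, 'm) bfun \<times> (fcat \<Rightarrow> 'm \<Rightarrow> 'm)"

definition bfun_cat :: "'r ring \<Rightarrow> (('r, 'm) bfun, ('r, 'm) bfun_arr) cat" where
  "bfun_cat R =
    \<lparr>Ob = {M. biset_functor R M},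
     Ar = {(M, N, \<eta>). biset_functor R M \<and> biset_functor R N \<and> \<eta> \<in> nat_trans R M N},
     src = (\<lambda>(M, N, \<eta>). M), tgt = (\<lambda>(M, N, \<eta>). N),
     ident = (\<lambda>M. (M, M, \<lambda>C\<in>fincats. \<lambda>x\<in>carrier (vob M C). x)),
     cmp = (\<lambda>(M', N', \<theta>) (M, N, \<eta>). (M, N', \<lambda>C\<in>fincats. compose (carrier (vob M C)) (\<theta> C) (\<eta> C)))\<rparr>"

text \<open>
  \<open>M\<close> is finitely generated: some finite set of elements of its values lies in no proper
  subfunctor of \<open>M\<close>. For the projectivity of \<open>\<H>(P, Q)\<close> this hypothesis on \<open>P\<close> cannot be
  dropped: over the integers, if \<open>P\<close> is the direct sum of countably many copies of the Burnside
  functor \<open>B\<close>, then \<open>\<H>(P, B)\<close> is the product of countably many copies of \<open>B\<close>. Its value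
  at the one-morphism category is \<open>\<int>\<^sup>\<nat>\<close>, which is not free, while the value there of a projective
  biset functor is a direct summand of a free abelian group.
\<close>

definition fin_gen :: "'r ring \<Rightarrow> ('r, 'm) bfun \<Rightarrow> bool" where
  "fin_gen R M \<longleftrightarrow> (\<exists>S. finite S \<and> S \<subseteq> (SIGMA C:fincats. carrier (vob M C)) \<and>
     (\<forall>N. (\<forall>C\<in>fincats. submodule (N C) R (vob M C)) \<and>
          (\<forall>C\<in>fincats. \<forall>D\<in>fincats. \<forall>f\<in>carrier (bhom R C D). \<forall>x\<in>N C. vmap M C D f x \<in> N D) \<and>
          (\<forall>(C, x)\<in>S. x \<in> N C)
        \<longrightarrow> (\<forall>C\<in>fincats. N C = carrier (vob M C))))"


section \<open>Yoneda--Dress construction and internal Hom\<close>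

definition yd :: "'r ring \<Rightarrow> fcat \<Rightarrow> ('r, 'm) bfun \<Rightarrow> ('r, 'm) bfun" where
  "yd R K M =
    \<lparr>vob = (\<lambda>C. vob M (C \<times>\<^sub>c K)),
     vmap = (\<lambda>C D f. vmap M (C \<times>\<^sub>c K) (D \<times>\<^sub>c K) (mprod R C D K K f (bident R K)))\<rparr>"

text \<open>The component at \<open>C\<close> of the map \<open>yd R J M \<rightarrow> yd R K M\<close> induced by \<open>f\<close> in \<open>bhom R J K\<close>.\<close>

definition yd_map :: "'r ring \<Rightarrow> fcat \<Rightarrow> fcat \<Rightarrow> 'r bmor \<Rightarrow> ('r, 'm) bfun \<Rightarrow> fcat \<Rightarrow> 'm \<Rightarrow> 'm" where
  "yd_map R J K f M C = vmap M (C \<times>\<^sub>c J) (C \<times>\<^sub>c K) (mprod R C C J K (bident R C) f)"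

definition ihom :: "'r ring \<Rightarrow> ('r, 'm) bfun \<Rightarrow> ('r, 'm) bfun \<Rightarrow> ('r, fcat \<Rightarrow> 'm \<Rightarrow> 'm) bfun" where
  "ihom R M N =
    \<lparr>vob = (\<lambda>K. nat_mod R M (yd R K N)),
     vmap = (\<lambda>J K f \<eta>. \<lambda>C\<in>fincats. \<lambda>x\<in>carrier (vob M C). yd_map R J K f N C (\<eta> C x))\<rparr>"


section \<open>Tensor products\<close>

text \<open>
  A right biset functor \<open>L\<close> is also held in a \<open>bfun\<close> record: for \<open>f\<close> in \<open>bhom R D E\<close> and
  \<open>a\<close> in \<open>vob L E\<close>, \<open>vmap L D E f a\<close> is \<open>a \<cdot> f\<close> in \<open>vob L D\<close>.
  The direct sum of the \<open>L(D) \<otimes>\<^sub>R M(D)\<close> modulo \<open>(a \<cdot> \<Omega>) \<otimes> b = a \<otimes> (\<Omega> \<cdot> b)\<close> is presented at once: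
  the generator \<open>(D, a, b)\<close> is \<open>a \<otimes> b\<close> in the summand at \<open>D\<close>.
\<close>

definition tens_gens :: "('r, 'a) bfun \<Rightarrow> ('r, 'b) bfun \<Rightarrow> (fcat \<times> 'a \<times> 'b) set" where
  "tens_gens L M = (SIGMA D:fincats. carrier (vob L D) \<times> carrier (vob M D))"

definition tens_rels :: "'r ring \<Rightarrow> ('r, 'a) bfun \<Rightarrow> ('r, 'b) bfun \<Rightarrow> (fcat \<times> 'a \<times> 'b \<Rightarrow> 'r) set" where
  "tens_rels R L M =
     {\<lambda>t. basis_elt R (D, a \<oplus>\<^bsub>vob L D\<^esub> a', b) t \<ominus>\<^bsub>R\<^esub> (basis_elt R (D, a, b) t \<oplus>\<^bsub>R\<^esub> basis_elt R (D, a', b) t) | D a a' b.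
        D \<in> fincats \<and> a \<in> carrier (vob L D) \<and> a' \<in> carrier (vob L D) \<and> b \<in> carrier (vob M D)} \<union>
     {\<lambda>t. basis_elt R (D, a, b \<oplus>\<^bsub>vob M D\<^esub> b') t \<ominus>\<^bsub>R\<^esub> (basis_elt R (D, a, b) t \<oplus>\<^bsub>R\<^esub> basis_elt R (D, a, b') t) | D a b b'.
        D \<in> fincats \<and> a \<in> carrier (vob L D) \<and> b \<in> carrier (vob M D) \<and> b' \<in> carrier (vob M D)} \<union>
     {\<lambda>t. basis_elt R (D, r \<odot>\<^bsub>vob L D\<^esub> a, b) t \<ominus>\<^bsub>R\<^esub> r \<otimes>\<^bsub>R\<^esub> basis_elt R (D, a, b) t | D r a b.
        D \<in> fincats \<and> r \<in> carrier R \<and> a \<in> carrier (vob L D) \<and> b \<in> carrier (vob M D)} \<union>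
     {\<lambda>t. basis_elt R (D, a, r \<odot>\<^bsub>vob M D\<^esub> b) t \<ominus>\<^bsub>R\<^esub> r \<otimes>\<^bsub>R\<^esub> basis_elt R (D, a, b) t | D r a b.
        D \<in> fincats \<and> r \<in> carrier R \<and> a \<in> carrier (vob L D) \<and> b \<in> carrier (vob M D)} \<union>
     {\<lambda>t. basis_elt R (D, vmap L D E (bcls R D E \<Omega>) a, b) t \<ominus>\<^bsub>R\<^esub> basis_elt R (E, a, vmap M D E (bcls R D E \<Omega>) b) t | D E \<Omega> a b.
        D \<in> fincats \<and> E \<in> fincats \<and> \<Omega> \<in> bisets E D \<and> a \<in> carrier (vob L E) \<and> b \<in> carrier (vob M D)}"

definition tens_B :: "'r ring \<Rightarrow> ('r, 'a) bfun \<Rightarrow> ('r, 'b) bfun \<Rightarrow> ('r, (fcat \<times> 'a \<times> 'b \<Rightarrow> 'r) set) module" where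
  "tens_B R L M = pres R (tens_gens L M) (tens_rels R L M)"

definition tens_elt :: "'r ring \<Rightarrow> ('r, 'a) bfun \<Rightarrow> ('r, 'b) bfun \<Rightarrow> fcat \<Rightarrow> 'a \<Rightarrow> 'b \<Rightarrow> (fcat \<times> 'a \<times> 'b \<Rightarrow> 'r) set" where
  "tens_elt R L M D a b = pgen R (tens_gens L M) (tens_rels R L M) (D, a, b)"

text \<open>The right biset functor \<open>L \<circ> \<tau>\<close>.\<close>

definition dual_fun :: "'r ring \<Rightarrow> ('r, 'm) bfun \<Rightarrow> ('r, 'm) bfun" where
  "dual_fun R L =
    \<lparr>vob = (\<lambda>D. vob L (op_cat D)), vmap = (\<lambda>D E f. vmap L (op_cat E) (op_cat D) (mdual R D E f))\<rparr>"

definition raw_tens ::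
  "'r ring \<Rightarrow> ('r, 'a) bfun \<Rightarrow> ('r, 'b) bfun \<Rightarrow> ('r, (fcat \<times> 'a \<times> 'b \<Rightarrow> 'r) set) bfun" where
  "raw_tens R L M =
    \<lparr>vob = (\<lambda>C. tens_B R (dual_fun R (yd R C L)) M),
     vmap = (\<lambda>C C' f. plift R (tens_B R (dual_fun R (yd R C' L)) M)
        (\<lambda>(D, a, b). tens_elt R (dual_fun R (yd R C' L)) M D (yd_map R C C' f L (op_cat D) a) b))\<rparr>"

text \<open>The natural transformation \<open>\<phi> \<otimes> \<psi>\<close> for \<open>\<phi> : L \<rightarrow> L'\<close> and \<open>\<psi> : M \<rightarrow> M'\<close>.\<close>

definition raw_tens_map ::
  "'r ring \<Rightarrow> ('r, 'a) bfun \<Rightarrow> ('r, 'a) bfun \<Rightarrow> ('r, 'b) bfun \<Rightarrow> ('r, 'b) bfun \<Rightarrow>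
   (fcat \<Rightarrow> 'a \<Rightarrow> 'a) \<Rightarrow> (fcat \<Rightarrow> 'b \<Rightarrow> 'b) \<Rightarrow>
   fcat \<Rightarrow> (fcat \<times> 'a \<times> 'b \<Rightarrow> 'r) set \<Rightarrow> (fcat \<times> 'a \<times> 'b \<Rightarrow> 'r) set" where
  "raw_tens_map R L L' M M' \<phi> \<psi> = (\<lambda>C\<in>fincats. \<lambda>k\<in>carrier (vob (raw_tens R L M) C).
     plift R (vob (raw_tens R L' M') C)
       (\<lambda>(D, a, b). tens_elt R (dual_fun R (yd R C L')) M' D (\<phi> (op_cat D \<times>\<^sub>c C) a) (\<psi> D b)) k)"

definition raw_burnside :: "'r ring \<Rightarrow> ('r, 'r bmor) bfun" where
  "raw_burnside R = \<lparr>vob = bhom R one_cat, vmap = (\<lambda>C D f. bcmp R one_cat C D f)\<rparr>"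

text \<open>
  The elements of \<open>raw_tens R L M\<close> and \<open>raw_burnside R\<close> are cosets, not elements of the universe
  \<open>'m\<close>. They are moved into \<open>'m\<close> along chosen injections of their carriers. Such
  injections exist whenever \<open>'m\<close> is infinite and at least as large as \<open>R\<close>, because there are
  only countably many finite categories and isomorphism classes of bisets.
\<close>

definition emb :: "'a set \<Rightarrow> 'a \<Rightarrow> 'b" where
  "emb A = (SOME e. inj_on e A)"

definition unemb :: "'a set \<Rightarrow> 'b \<Rightarrow> 'a" where
  "unemb A = inv_into A (emb A)"

definition move_mod :: "('r, 'a) module \<Rightarrow> ('r, 'b) module" where
  "move_mod M = (let e = emb (carrier M); d = unemb (carrier M) in
    \<lparr>carrier = e ` carrier M, mult = undefined, one = undefined, zero = e \<zero>\<^bsub>M\<^esub>,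
     add = (\<lambda>x y. e (d x \<oplus>\<^bsub>M\<^esub> d y)), smult = (\<lambda>r x. e (r \<odot>\<^bsub>M\<^esub> d x))\<rparr>)"

definition move_fun :: "('r, 'a) bfun \<Rightarrow> ('r, 'b) bfun" where
  "move_fun M =
    \<lparr>vob = (\<lambda>C. move_mod (vob M C)),
     vmap = (\<lambda>C D f x. emb (carrier (vob M D)) (vmap M C D f (unemb (carrier (vob M C)) x)))\<rparr>"

definition move_nat :: "('r, 'a) bfun \<Rightarrow> ('r, 'a) bfun \<Rightarrow> (fcat \<Rightarrow> 'a \<Rightarrow> 'a) \<Rightarrow> fcat \<Rightarrow> 'b \<Rightarrow> 'b" where
  "move_nat M N \<eta> = (\<lambda>C\<in>fincats. \<lambda>x\<in>emb (carrier (vob M C)) ` carrier (vob M C).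
     emb (carrier (vob N C)) (\<eta> C (unemb (carrier (vob M C)) x)))"

definition burnside :: "'r ring \<Rightarrow> ('r, 'm) bfun" where
  "burnside R = move_fun (raw_burnside R)"

definition tens :: "'r ring \<Rightarrow> ('r, 'm) bfun \<Rightarrow> ('r, 'm) bfun \<Rightarrow> ('r, 'm) bfun" where
  "tens R L M = move_fun (raw_tens R L M)"

definition tens_map ::
  "'r ring \<Rightarrow> ('r, 'm) bfun \<Rightarrow> ('r, 'm) bfun \<Rightarrow> ('r, 'm) bfun \<Rightarrow> ('r, 'm) bfun \<Rightarrow>
   (fcat \<Rightarrow> 'm \<Rightarrow> 'm) \<Rightarrow> (fcat \<Rightarrow> 'm \<Rightarrow> 'm) \<Rightarrow> fcat \<Rightarrow> 'm \<Rightarrow> 'm" where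
  "tens_map R L L' M M' \<phi> \<psi> =
     move_nat (raw_tens R L M) (raw_tens R L' M') (raw_tens_map R L L' M M' \<phi> \<psi>)"

definition tens_arr :: "'r ring \<Rightarrow> ('r, 'm) bfun_arr \<Rightarrow> ('r, 'm) bfun_arr \<Rightarrow> ('r, 'm) bfun_arr" where
  "tens_arr R = (\<lambda>(L, L', \<phi>) (M, M', \<psi>). (tens R L M, tens R L' M', tens_map R L L' M M' \<phi> \<psi>))"

end

theory Submission
  imports Defs
begin

text \<open>
  In \<open>\<bbbB>\<close> the category \<open>C\<^sup>o\<^sup>p\<close> is dual to \<open>C\<close>: a biset with source \<open>C \<times> D\<close> and target \<open>E\<close> is the same thing as one with
  source \<open>C\<close> and target \<open>D\<^sup>o\<^sup>p \<times> E\<close>. Hence \<open>L \<otimes> M\<close> represents the natural bilinear families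
  \<open>L(C) \<times> M(D) \<rightarrow> N(C \<times> D)\<close>, and it is generated under the action of \<open>\<bbbB>\<close> by the values \<open>x \<otimes> y \<in> (L \<otimes> M)(C \<times> D)\<close> of
  the universal one. The structure maps of the monoidal category are prescribed on such elements, where every coherence
  law reduces to an identity between functors that permute the factors of a product of categories.

  Epimorphisms of biset functors are pointwise surjective, and \<open>P\<close> is projective iff it is a retract of a direct sum of
  representable functors \<open>Hom(C\<^sub>i, -)\<close>; so \<open>P\<close> lifts against pointwise surjective maps between functors with values in any
  universe. For \<open>P \<otimes> Q\<close> this is combined with \<open>Hom(P \<otimes> Q, Y) = Hom(Q, \<H>(P, Y))\<close>. A finite dual basis of \<open>P\<close>
  exhibits \<open>\<H>(P, Q)\<close> as a retract of a finite direct sum of functors \<open>Q(C\<^sub>i \<times> -)\<close>, which lift against pointwise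
  surjective maps because \<open>Q(C \<times> -)\<close> is the value at \<open>Q\<close> of a left adjoint of \<open>Y \<mapsto> Y(- \<times> C\<^sup>o\<^sup>p)\<close>.
\<close>

text \<open>The tensor product is Day convolution along the product of categories. Its values, and
  those of the unit, are cosets carried into \<open>'m\<close> along arbitrarily chosen injections.
  Maps out of them are therefore handled only through their values on universal elements, and
  equality of such maps is tested on elements that generate.

  The predicate \<open>projective\<close> quantifies over functors with values in one fixed type,
  but the argument keeps leaving that type: a quotient functor consists of sets, a direct sum of
  representables consists of families, and an internal Hom consists of natural transformations.
  Hence the lifting property \<open>lifts\<close> is kept separate from \<open>projective\<close>,
  with independent types for its three functors. Passing from one to the other requires that a free
  cover of \<open>P\<close> fit into \<open>'m\<close>, and the cardinality conditions on
  \<open>'m\<close> serve this as well as the transport of the tensor product and the unit.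

  For the internal Hom, the section of a free cover supplies coordinates of the elements of
  \<open>P\<close>. A transformation is rebuilt from its values at the generators by a sum over all
  of them, and finite generation makes this sum finite.\<close>

abbreviation fincat :: "fcat \<Rightarrow> bool" where "fincat C \<equiv> C \<in> fincats"

abbreviation el :: "('r, 'm) bfun \<Rightarrow> fcat \<Rightarrow> 'm set" where "el M C \<equiv> carrier (vob M C)"

section \<open>Modules\<close>

locale coefficients = cring R for R :: "'r ring" (structure)
begin

text \<open>Negatives come from scalars: once zero acts as zero, the multiple of \<open>x\<close> by
  minus one cancels \<open>x\<close>. The hypothesis \<open>null\<close> thus stands in for the
  existence of additive inverses.\<close>

lemma modI:
  fixes M :: "('r, 'a) module"
  assumes "\<zero>\<^bsub>M\<^esub> \<in> carrier M"
    and "\<And>x y. x \<in> carrier M \<Longrightarrow> y \<in> carrier M \<Longrightarrow> x \<oplus>\<^bsub>M\<^esub> y \<in> carrier M"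
    and sm: "\<And>r x. r \<in> carrier R \<Longrightarrow> x \<in> carrier M \<Longrightarrow> r \<odot>\<^bsub>M\<^esub> x \<in> carrier M"
    and "\<And>x y z. \<lbrakk>x \<in> carrier M; y \<in> carrier M; z \<in> carrier M\<rbrakk> \<Longrightarrow>
      (x \<oplus>\<^bsub>M\<^esub> y) \<oplus>\<^bsub>M\<^esub> z = x \<oplus>\<^bsub>M\<^esub> (y \<oplus>\<^bsub>M\<^esub> z)"
    and "\<And>x y. x \<in> carrier M \<Longrightarrow> y \<in> carrier M \<Longrightarrow> x \<oplus>\<^bsub>M\<^esub> y = y \<oplus>\<^bsub>M\<^esub> x"
    and "\<And>x. x \<in> carrier M \<Longrightarrow> \<zero>\<^bsub>M\<^esub> \<oplus>\<^bsub>M\<^esub> x = x"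
    and ld: "\<And>r s x. \<lbrakk>r \<in> carrier R; s \<in> carrier R; x \<in> carrier M\<rbrakk> \<Longrightarrow>
      (r \<oplus> s) \<odot>\<^bsub>M\<^esub> x = r \<odot>\<^bsub>M\<^esub> x \<oplus>\<^bsub>M\<^esub> s \<odot>\<^bsub>M\<^esub> x"
    and "\<And>r x y. \<lbrakk>r \<in> carrier R; x \<in> carrier M; y \<in> carrier M\<rbrakk> \<Longrightarrow>
      r \<odot>\<^bsub>M\<^esub> (x \<oplus>\<^bsub>M\<^esub> y) = r \<odot>\<^bsub>M\<^esub> x \<oplus>\<^bsub>M\<^esub> r \<odot>\<^bsub>M\<^esub> y"
    and "\<And>r s x. \<lbrakk>r \<in> carrier R; s \<in> carrier R; x \<in> carrier M\<rbrakk> \<Longrightarrow>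
      (r \<otimes> s) \<odot>\<^bsub>M\<^esub> x = r \<odot>\<^bsub>M\<^esub> (s \<odot>\<^bsub>M\<^esub> x)"
    and one: "\<And>x. x \<in> carrier M \<Longrightarrow> \<one> \<odot>\<^bsub>M\<^esub> x = x"
    and null: "\<And>x. x \<in> carrier M \<Longrightarrow> \<zero> \<odot>\<^bsub>M\<^esub> x = \<zero>\<^bsub>M\<^esub>"
  shows "module R M"
proof -
  have "\<exists>y\<in>carrier M. y \<oplus>\<^bsub>M\<^esub> x = \<zero>\<^bsub>M\<^esub>" if x: "x \<in> carrier M" for x
  proof
    have "(\<ominus> \<one>) \<odot>\<^bsub>M\<^esub> x \<oplus>\<^bsub>M\<^esub> x = (\<ominus> \<one>) \<odot>\<^bsub>M\<^esub> x \<oplus>\<^bsub>M\<^esub> \<one> \<odot>\<^bsub>M\<^esub> x"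
      using x one by simp
    also have "\<dots> = (\<ominus> \<one> \<oplus> \<one>) \<odot>\<^bsub>M\<^esub> x" using x ld by simp
    finally show "(\<ominus> \<one>) \<odot>\<^bsub>M\<^esub> x \<oplus>\<^bsub>M\<^esub> x = \<zero>\<^bsub>M\<^esub>" using x null by (simp add: l_neg)
    show "(\<ominus> \<one>) \<odot>\<^bsub>M\<^esub> x \<in> carrier M" using x sm by simp
  qed
  then have "abelian_group M" using assms by (intro abelian_groupI) auto
  then show ?thesis using assms by (intro moduleI) (auto intro: cring_axioms)
qed

end

lemma lin_mapI:
  assumes "\<And>x. x \<in> carrier A \<Longrightarrow> h x \<in> carrier B"
    and "\<And>x y. x \<in> carrier A \<Longrightarrow> y \<in> carrier A \<Longrightarrow> h (x \<oplus>\<^bsub>A\<^esub> y) = h x \<oplus>\<^bsub>B\<^esub> h y"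
    and "\<And>r x. r \<in> carrier R \<Longrightarrow> x \<in> carrier A \<Longrightarrow> h (r \<odot>\<^bsub>A\<^esub> x) = r \<odot>\<^bsub>B\<^esub> h x"
  shows "lin_map R A B h"
  using assms by (auto simp: lin_map_def)

lemma lin_map_closed: "lin_map R A B h \<Longrightarrow> x \<in> carrier A \<Longrightarrow> h x \<in> carrier B"
  by (auto simp: lin_map_def)

lemma lin_map_add: "\<lbrakk>lin_map R A B h; x \<in> carrier A; y \<in> carrier A\<rbrakk> \<Longrightarrow>
    h (x \<oplus>\<^bsub>A\<^esub> y) = h x \<oplus>\<^bsub>B\<^esub> h y"
  by (auto simp: lin_map_def)

lemma lin_map_smult: "\<lbrakk>lin_map R A B h; r \<in> carrier R; x \<in> carrier A\<rbrakk> \<Longrightarrow>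
    h (r \<odot>\<^bsub>A\<^esub> x) = r \<odot>\<^bsub>B\<^esub> h x"
  by (auto simp: lin_map_def)

lemma lin_map_cong:
  assumes "module R A" and "\<And>x. x \<in> carrier A \<Longrightarrow> h x = h' x"
  shows "lin_map R A B h \<longleftrightarrow> lin_map R A B h'"
proof -
  interpret module R A by fact
  show ?thesis using assms(2) by (auto simp: lin_map_def Pi_def)
qed

lemma lin_map_comp: "lin_map R A B h \<Longrightarrow> lin_map R B D k \<Longrightarrow> lin_map R A D (\<lambda>x. k (h x))"
  by (auto simp: lin_map_def Pi_def)

lemma lin_map_zero:
  assumes "module R A" "module R B" "lin_map R A B h"
  shows "h \<zero>\<^bsub>A\<^esub> = \<zero>\<^bsub>B\<^esub>"
proof -
  interpret A: module R A by fact
  interpret B: module R B by fact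
  have "h (\<zero>\<^bsub>R\<^esub> \<odot>\<^bsub>A\<^esub> \<zero>\<^bsub>A\<^esub>) = \<zero>\<^bsub>R\<^esub> \<odot>\<^bsub>B\<^esub> h \<zero>\<^bsub>A\<^esub>"
    by (rule lin_map_smult[OF assms(3)]) auto
  then show ?thesis using lin_map_closed[OF assms(3) A.zero_closed] by simp
qed

lemma lin_map_const_zero: "module R B \<Longrightarrow> lin_map R A B (\<lambda>x. \<zero>\<^bsub>B\<^esub>)"
proof -
  assume "module R B"
  interpret B: module R B by fact
  show ?thesis by (rule lin_mapI) simp_all
qed

lemma lin_map_minus:
  assumes "module R A" "module R B" "lin_map R A B h" "x \<in> carrier A" "y \<in> carrier A"
  shows "h (x \<ominus>\<^bsub>A\<^esub> y) = h x \<ominus>\<^bsub>B\<^esub> h y"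
proof -
  interpret A: module R A by fact
  interpret B: module R B by fact
  have m1: "\<ominus>\<^bsub>R\<^esub> \<one>\<^bsub>R\<^esub> \<in> carrier R" by simp
  have "\<ominus>\<^bsub>A\<^esub> y = (\<ominus>\<^bsub>R\<^esub> \<one>\<^bsub>R\<^esub>) \<odot>\<^bsub>A\<^esub> y" "\<ominus>\<^bsub>B\<^esub> h y = (\<ominus>\<^bsub>R\<^esub> \<one>\<^bsub>R\<^esub>) \<odot>\<^bsub>B\<^esub> h y"
    using assms lin_map_closed[OF assms(3)] by (simp_all add: A.smult_l_minus B.smult_l_minus)
  then show ?thesis using assms(4,5) m1
    by (simp add: a_minus_def lin_map_add[OF assms(3)] lin_map_smult[OF assms(3)])
qed

lemma lin_map_finsum:
  assumes "module R A" "module R B" "lin_map R A B h" "finite I" "\<And>i. i \<in> I \<Longrightarrow> f i \<in> carrier A"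
  shows "h (finsum A f I) = finsum B (\<lambda>i. h (f i)) I"
proof -
  interpret A: module R A by fact
  interpret B: module R B by fact
  show ?thesis using assms(4,5)
  proof (induction I)
    case empty
    show ?case using lin_map_zero[OF assms(1-3)] by simp
  next
    case (insert i I)
    have "h (finsum A f (insert i I)) = h (f i) \<oplus>\<^bsub>B\<^esub> h (finsum A f I)"
      using insert lin_map_add[OF assms(3), of "f i" "finsum A f I"]
      by (subst A.finsum_insert) (auto intro!: A.finsum_closed)
    also have "\<dots> = finsum B (\<lambda>i. h (f i)) (insert i I)"
      using insert by (subst B.finsum_insert) (auto intro!: lin_map_closed[OF assms(3)])
    finally show ?case .
  qed
qed

lemma bilin_mapI:
  assumes "\<And>x y. x \<in> carrier A \<Longrightarrow> y \<in> carrier B \<Longrightarrow> h x y \<in> carrier D"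
    and "\<And>x x' y. \<lbrakk>x \<in> carrier A; x' \<in> carrier A; y \<in> carrier B\<rbrakk> \<Longrightarrow> h (x \<oplus>\<^bsub>A\<^esub> x') y = h x y \<oplus>\<^bsub>D\<^esub> h x' y"
    and "\<And>x y y'. \<lbrakk>x \<in> carrier A; y \<in> carrier B; y' \<in> carrier B\<rbrakk> \<Longrightarrow> h x (y \<oplus>\<^bsub>B\<^esub> y') = h x y \<oplus>\<^bsub>D\<^esub> h x y'"
    and "\<And>r x y. \<lbrakk>r \<in> carrier R; x \<in> carrier A; y \<in> carrier B\<rbrakk> \<Longrightarrow> h (r \<odot>\<^bsub>A\<^esub> x) y = r \<odot>\<^bsub>D\<^esub> h x y"
    and "\<And>r x y. \<lbrakk>r \<in> carrier R; x \<in> carrier A; y \<in> carrier B\<rbrakk> \<Longrightarrow> h x (r \<odot>\<^bsub>B\<^esub> y) = r \<odot>\<^bsub>D\<^esub> h x y"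
  shows "bilin_map R A B D h"
  using assms by (auto simp: bilin_map_def lin_map_def)

lemma bilin_mapD:
  assumes "bilin_map R A B D h"
  shows "x \<in> carrier A \<Longrightarrow> lin_map R B D (h x)" "y \<in> carrier B \<Longrightarrow> lin_map R A D (\<lambda>x. h x y)"
  using assms by (auto simp: bilin_map_def)

context coefficients
begin

section \<open>Free modules and linear extension\<close>

lemma free_mod_simps [simp]:
  "\<zero>\<^bsub>free_mod R X\<^esub> = (\<lambda>x. \<zero>)"
  "f \<oplus>\<^bsub>free_mod R X\<^esub> g = (\<lambda>x. f x \<oplus> g x)"
  "r \<odot>\<^bsub>free_mod R X\<^esub> f = (\<lambda>x. r \<otimes> f x)"
  by (auto simp: free_mod_def)

lemma free_mod_carrier:
  "f \<in> carrier (free_mod R X) \<longleftrightarrow>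
    (\<forall>x. f x \<in> carrier R) \<and> {x. f x \<noteq> \<zero>} \<subseteq> X \<and> finite {x. f x \<noteq> \<zero>}"
proof
  assume "f \<in> carrier (free_mod R X)"
  then show "(\<forall>x. f x \<in> carrier R) \<and> {x. f x \<noteq> \<zero>} \<subseteq> X \<and> finite {x. f x \<noteq> \<zero>}"
    by (fastforce simp: free_mod_def)
qed (auto simp: free_mod_def)

lemma free_mod_module: "module R (free_mod R X)"
proof (rule modI)
  show "\<zero>\<^bsub>free_mod R X\<^esub> \<in> carrier (free_mod R X)" by (auto simp: free_mod_carrier)
next
  fix f g assume fg: "f \<in> carrier (free_mod R X)" "g \<in> carrier (free_mod R X)"
  have "{x. f x \<oplus> g x \<noteq> \<zero>} \<subseteq> {x. f x \<noteq> \<zero>} \<union> {x. g x \<noteq> \<zero>}" by auto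
  then have "finite {x. f x \<oplus> g x \<noteq> \<zero>}"
    by (rule finite_subset) (use fg in \<open>auto simp: free_mod_carrier\<close>)
  then show "f \<oplus>\<^bsub>free_mod R X\<^esub> g \<in> carrier (free_mod R X)"
    using fg \<open>{x. f x \<oplus> g x \<noteq> \<zero>} \<subseteq> _\<close> by (auto simp: free_mod_carrier)
next
  fix r f assume rf: "r \<in> carrier R" "f \<in> carrier (free_mod R X)"
  have "{x. r \<otimes> f x \<noteq> \<zero>} \<subseteq> {x. f x \<noteq> \<zero>}" using rf by auto
  then have "finite {x. r \<otimes> f x \<noteq> \<zero>}"
    by (rule finite_subset) (use rf in \<open>auto simp: free_mod_carrier\<close>)
  then show "r \<odot>\<^bsub>free_mod R X\<^esub> f \<in> carrier (free_mod R X)"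
    using rf \<open>{x. r \<otimes> f x \<noteq> \<zero>} \<subseteq> _\<close> by (auto simp: free_mod_carrier)
qed (auto simp: free_mod_carrier a_ac m_assoc l_distr r_distr)

lemma basis_elt_closed [simp, intro]: "x \<in> X \<Longrightarrow> basis_elt R x \<in> carrier (free_mod R X)"
  by (auto simp: free_mod_carrier basis_elt_def)

lemma free_mod_diff:
  assumes "f \<in> carrier (free_mod R X)" "g \<in> carrier (free_mod R X)"
  shows "f \<ominus>\<^bsub>free_mod R X\<^esub> g = (\<lambda>x. f x \<ominus> g x)"
proof -
  interpret F: module R "free_mod R X" by (rule free_mod_module)
  have "\<ominus>\<^bsub>free_mod R X\<^esub> g = (\<ominus> \<one>) \<odot>\<^bsub>free_mod R X\<^esub> g"
    using assms by (simp only: F.smult_l_minus one_closed F.smult_one)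
  then show ?thesis
    using assms by (auto simp: a_minus_def free_mod_carrier l_minus)
qed

text \<open>The induction runs over a finite set containing the support, not over the support
  itself. Each step clears one point of that set, whether or not the function vanishes
  there.\<close>

lemma free_mod_induct [consumes 1, case_names zero add basis]:
  assumes f: "f \<in> carrier (free_mod R X)"
    and z: "P (\<lambda>x. \<zero>)"
    and a: "\<And>f g. \<lbrakk>f \<in> carrier (free_mod R X); g \<in> carrier (free_mod R X); P f; P g\<rbrakk> \<Longrightarrow>
      P (f \<oplus>\<^bsub>free_mod R X\<^esub> g)"
    and b: "\<And>r x. r \<in> carrier R \<Longrightarrow> x \<in> X \<Longrightarrow> P (r \<odot>\<^bsub>free_mod R X\<^esub> basis_elt R x)"
  shows "P f"
proof -
  interpret F: module R "free_mod R X" by (rule free_mod_module)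
  have "P f" if "finite A" "{x. f x \<noteq> \<zero>} \<subseteq> A" "f \<in> carrier (free_mod R X)" for A f
    using that
  proof (induction A arbitrary: f)
    case empty
    then have "f = (\<lambda>x. \<zero>)" by auto
    then show ?case using z by simp
  next
    case (insert y A)
    let ?g = "f(y := \<zero>)"
    have sub: "{x. ?g x \<noteq> \<zero>} \<subseteq> {x. f x \<noteq> \<zero>}" by auto
    have g: "?g \<in> carrier (free_mod R X)"
      using insert.prems sub finite_subset[OF sub] by (auto simp: free_mod_carrier)
    have "{x. ?g x \<noteq> \<zero>} \<subseteq> A" using insert.prems by (auto split: if_splits)
    then have Pg: "P ?g" using g by (rule insert.IH)
    show ?case
    proof (cases "f y = \<zero>")
      case True
      then have "?g = f" by auto
      then show ?thesis using Pg by simp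
    next
      case False
      then have y: "y \<in> X" "f y \<in> carrier R" using insert.prems by (auto simp: free_mod_carrier)
      have fc: "f x \<in> carrier R" for x using insert.prems by (auto simp: free_mod_carrier)
      have "f = ?g \<oplus>\<^bsub>free_mod R X\<^esub> (f y \<odot>\<^bsub>free_mod R X\<^esub> basis_elt R y)"
        using fc by (auto simp: basis_elt_def fun_eq_iff)
      then show ?thesis using a[OF g _ Pg b] y
        by (metis F.smult_closed[OF y(2) basis_elt_closed[OF y(1)]])
    qed
  qed
  then show ?thesis using f by (auto simp: free_mod_carrier)
qed

text \<open>The sum that \<open>plift\<close> evaluates, for a given element of the free module
  instead of a chosen member of a coset.\<close>

definition lin_ext :: "('r, 'a) module \<Rightarrow> ('x \<Rightarrow> 'a) \<Rightarrow> ('x \<Rightarrow> 'r) \<Rightarrow> 'a" where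
  "lin_ext M h f = finsum M (\<lambda>x. f x \<odot>\<^bsub>M\<^esub> h x) {x. f x \<noteq> \<zero>}"

text \<open>Two functions and their sum have different supports. Additivity of
  \<open>lin_ext\<close> is proved by writing all three sums over the union of the two supports,
  where the extra terms are zero.\<close>

lemma lin_ext_superset:
  assumes "module R M" and h: "h \<in> X \<rightarrow> carrier M" and f: "f \<in> carrier (free_mod R X)"
    and A: "finite A" "{x. f x \<noteq> \<zero>} \<subseteq> A" "A \<subseteq> X"
  shows "lin_ext M h f = finsum M (\<lambda>x. f x \<odot>\<^bsub>M\<^esub> h x) A"
proof -
  interpret M: module R M by fact
  show ?thesis unfolding lin_ext_def
    by (rule M.add.finprod_mono_neutral_cong_left)
      (use A f h in \<open>auto simp: free_mod_carrier Pi_iff subset_iff\<close>)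
qed

lemma lin_ext:
  assumes M: "module R M" and h: "h \<in> X \<rightarrow> carrier M"
  shows "lin_map R (free_mod R X) M (lin_ext M h)"
    and "x \<in> X \<Longrightarrow> lin_ext M h (basis_elt R x) = h x"
proof -
  interpret M: module R M by fact
  interpret F: module R "free_mod R X" by (rule free_mod_module)
  show "lin_map R (free_mod R X) M (lin_ext M h)"
  proof (rule lin_mapI)
    fix f assume f: "f \<in> carrier (free_mod R X)"
    then show "lin_ext M h f \<in> carrier M"
      unfolding lin_ext_def using h by (auto simp: free_mod_carrier intro!: M.finsum_closed)
    fix r assume r: "r \<in> carrier R"
    let ?A = "{x. f x \<noteq> \<zero>}"
    have A: "finite ?A" "?A \<subseteq> X" using f by (auto simp: free_mod_carrier)
    have rf: "r \<odot>\<^bsub>free_mod R X\<^esub> f \<in> carrier (free_mod R X)" using r f by blast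
    have "lin_ext M h (r \<odot>\<^bsub>free_mod R X\<^esub> f) = finsum M (\<lambda>x. (r \<otimes> f x) \<odot>\<^bsub>M\<^esub> h x) ?A"
      using r f A by (subst lin_ext_superset[OF M h rf]) (auto simp: free_mod_carrier)
    also have "\<dots> = finsum M (\<lambda>x. r \<odot>\<^bsub>M\<^esub> (f x \<odot>\<^bsub>M\<^esub> h x)) ?A"
      using r f h A
      by (intro M.finsum_cong') (auto simp: free_mod_carrier M.smult_assoc1 Pi_iff subset_iff)
    also have "\<dots> = r \<odot>\<^bsub>M\<^esub> lin_ext M h f"
      unfolding lin_ext_def using r f h A
      by (subst M.finsum_smult_ldistr) (auto simp: free_mod_carrier Pi_iff subset_iff)
    finally show "lin_ext M h (r \<odot>\<^bsub>free_mod R X\<^esub> f) = r \<odot>\<^bsub>M\<^esub> lin_ext M h f" .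
  next
    fix f g assume f: "f \<in> carrier (free_mod R X)" and g: "g \<in> carrier (free_mod R X)"
    let ?A = "{x. f x \<noteq> \<zero>} \<union> {x. g x \<noteq> \<zero>}"
    have A: "finite ?A" "?A \<subseteq> X" using f g by (auto simp: free_mod_carrier)
    have fg: "f \<oplus>\<^bsub>free_mod R X\<^esub> g \<in> carrier (free_mod R X)" using f g by blast
    have "lin_ext M h (f \<oplus>\<^bsub>free_mod R X\<^esub> g) = finsum M (\<lambda>x. (f x \<oplus> g x) \<odot>\<^bsub>M\<^esub> h x) ?A"
      using f g A by (subst lin_ext_superset[OF M h fg, of ?A]) auto
    also have "\<dots> = finsum M (\<lambda>x. f x \<odot>\<^bsub>M\<^esub> h x \<oplus>\<^bsub>M\<^esub> g x \<odot>\<^bsub>M\<^esub> h x) ?A"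
      using f g h A
      by (intro M.finsum_cong') (auto simp: free_mod_carrier M.smult_l_distr Pi_iff subset_iff)
    also have "\<dots> = lin_ext M h f \<oplus>\<^bsub>M\<^esub> lin_ext M h g"
      using f g h A
      by (subst (1 2) lin_ext_superset[OF M h _ A(1)])
        (auto simp: free_mod_carrier Pi_iff subset_iff intro!: M.finsum_addf)
    finally show "lin_ext M h (f \<oplus>\<^bsub>free_mod R X\<^esub> g) = lin_ext M h f \<oplus>\<^bsub>M\<^esub> lin_ext M h g" .
  qed
  assume x: "x \<in> X"
  have "lin_ext M h (basis_elt R x) = finsum M (\<lambda>y. basis_elt R x y \<odot>\<^bsub>M\<^esub> h y) {x}"
    using x basis_elt_closed[OF x]
    by (intro lin_ext_superset[OF M h]) (auto simp: basis_elt_def split: if_splits)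
  also have "\<dots> = h x"
  proof -
    have hx: "h x \<in> carrier M" using h x by auto
    then have "finsum M (\<lambda>y. basis_elt R x y \<odot>\<^bsub>M\<^esub> h y) {x} = basis_elt R x x \<odot>\<^bsub>M\<^esub> h x"
      by (subst M.finsum_insert) (auto simp: basis_elt_def)
    also have "\<dots> = h x" using hx unfolding basis_elt_def by simp
    finally show ?thesis .
  qed
  finally show "lin_ext M h (basis_elt R x) = h x" .
qed

section \<open>Quotients, spans and kernels\<close>

lemma quot_mod_simps [simp]:
  "carrier (quot_mod M N) = a_rcosets\<^bsub>M\<^esub> N"
  "\<zero>\<^bsub>quot_mod M N\<^esub> = N"
  "K \<oplus>\<^bsub>quot_mod M N\<^esub> L = K <+>\<^bsub>M\<^esub> L"
  by (auto simp: quot_mod_def)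

lemma quot_mod:
  fixes M :: "('r, 'a) module"
  assumes M: "module R M" and N: "submodule N R M"
  shows "module R (quot_mod M N)" (is ?M)
    and "lin_map R M (quot_mod M N) (\<lambda>x. N +>\<^bsub>M\<^esub> x)" (is ?lin)
    and "carrier (quot_mod M N) = (\<lambda>x. N +>\<^bsub>M\<^esub> x) ` carrier M" (is ?car)
    and "\<And>x. x \<in> carrier M \<Longrightarrow> N +>\<^bsub>M\<^esub> x = N \<longleftrightarrow> x \<in> N"
    and "\<And>K x. K \<in> carrier (quot_mod M N) \<Longrightarrow> x \<in> K \<Longrightarrow> x \<in> carrier M \<and> K = N +>\<^bsub>M\<^esub> x"
    and "\<And>x. x \<in> carrier M \<Longrightarrow> x \<in> N +>\<^bsub>M\<^esub> x"
proof -
  interpret M: module R M by fact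
  interpret N: submodule N R M by fact
  have sg: "subgroup N (add_monoid M)" by (rule N.subgroup_axioms)
  interpret A: abelian_subgroup N M
    by (rule abelian_subgroupI3[OF additive_subgroup.intro[OF sg] M.abelian_group_axioms])
  show car: ?car by (auto simp: A_RCOSETS_def' image_def)
  \<comment> \<open>Scalar multiplication in \<open>quot_mod\<close> is a union over all members of
    a coset. It is a single coset because every member contributes the same one.\<close>
  have sm: "r \<odot>\<^bsub>quot_mod M N\<^esub> (N +>\<^bsub>M\<^esub> x) = N +>\<^bsub>M\<^esub> (r \<odot>\<^bsub>M\<^esub> x)"
    if "r \<in> carrier R" "x \<in> carrier M" for r x
  proof -
    have "N +>\<^bsub>M\<^esub> (r \<odot>\<^bsub>M\<^esub> y) = N +>\<^bsub>M\<^esub> (r \<odot>\<^bsub>M\<^esub> x)" if y: "y \<in> N +>\<^bsub>M\<^esub> x" for y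
    proof -
      obtain n where n: "n \<in> N" "y = n \<oplus>\<^bsub>M\<^esub> x" using y by (auto simp: a_r_coset_def')
      then have "r \<odot>\<^bsub>M\<^esub> y = r \<odot>\<^bsub>M\<^esub> n \<oplus>\<^bsub>M\<^esub> r \<odot>\<^bsub>M\<^esub> x"
        using \<open>r \<in> carrier R\<close> \<open>x \<in> carrier M\<close> A.a_Hcarr by (auto simp: M.smult_r_distr)
      then have "r \<odot>\<^bsub>M\<^esub> y \<in> N +>\<^bsub>M\<^esub> (r \<odot>\<^bsub>M\<^esub> x)"
        using n \<open>r \<in> carrier R\<close> by (auto simp: a_r_coset_def')
      then show ?thesis using A.a_repr_independence' \<open>r \<in> carrier R\<close> \<open>x \<in> carrier M\<close> by blast
    qed
    moreover have "x \<in> N +>\<^bsub>M\<^esub> x" using A.a_rcos_self that by blast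
    ultimately have "(\<Union>y\<in>N +>\<^bsub>M\<^esub> x. N +>\<^bsub>M\<^esub> (r \<odot>\<^bsub>M\<^esub> y)) = N +>\<^bsub>M\<^esub> (r \<odot>\<^bsub>M\<^esub> x)" by blast
    then show ?thesis by (simp add: quot_mod_def)
  qed
  note sum = A.a_rcos_sum
  have N0: "N = N +>\<^bsub>M\<^esub> \<zero>\<^bsub>M\<^esub>" using A.a_rcos_const A.zero_closed by simp
  have in_car: "x \<in> carrier M \<Longrightarrow> N +>\<^bsub>M\<^esub> x \<in> carrier (quot_mod M N)" for x
    unfolding car by simp
  have ex: "K \<in> carrier (quot_mod M N) \<Longrightarrow> \<exists>x\<in>carrier M. K = N +>\<^bsub>M\<^esub> x" for K
    unfolding car by auto
  show ?lin
    by (rule lin_mapI) (auto simp: sm sum simp del: quot_mod_simps(1) intro: in_car)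
  show ?M
  proof (rule modI)
    show "\<zero>\<^bsub>quot_mod M N\<^esub> \<in> carrier (quot_mod M N)"
      by (simp del: quot_mod_simps(1)) (subst N0, rule in_car, simp)
  next
    fix x assume "x \<in> carrier (quot_mod M N)"
    then obtain a where a: "a \<in> carrier M" "x = N +>\<^bsub>M\<^esub> a" using ex by blast
    then show "\<zero>\<^bsub>quot_mod M N\<^esub> \<oplus>\<^bsub>quot_mod M N\<^esub> x = x" "\<one> \<odot>\<^bsub>quot_mod M N\<^esub> x = x"
      using sum[of "\<zero>\<^bsub>M\<^esub>" a] by (simp_all add: sm N0[symmetric])
    show "\<zero> \<odot>\<^bsub>quot_mod M N\<^esub> x = \<zero>\<^bsub>quot_mod M N\<^esub>" using a by (simp add: sm N0[symmetric])
  next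
    fix x y assume "x \<in> carrier (quot_mod M N)" "y \<in> carrier (quot_mod M N)"
    then obtain a b where a: "a \<in> carrier M" "x = N +>\<^bsub>M\<^esub> a" "b \<in> carrier M" "y = N +>\<^bsub>M\<^esub> b"
      using ex by metis
    then show "x \<oplus>\<^bsub>quot_mod M N\<^esub> y \<in> carrier (quot_mod M N)"
      "x \<oplus>\<^bsub>quot_mod M N\<^esub> y = y \<oplus>\<^bsub>quot_mod M N\<^esub> x"
      using in_car[of "a \<oplus>\<^bsub>M\<^esub> b"] by (simp_all add: sum M.a_comm del: quot_mod_simps(1))
  next
    fix x y z assume "x \<in> carrier (quot_mod M N)" "y \<in> carrier (quot_mod M N)" "z \<in> carrier (quot_mod M N)"
    then obtain a b c where "a \<in> carrier M" "x = N +>\<^bsub>M\<^esub> a" "b \<in> carrier M" "y = N +>\<^bsub>M\<^esub> b"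
      "c \<in> carrier M" "z = N +>\<^bsub>M\<^esub> c"
      using ex by metis
    then show "x \<oplus>\<^bsub>quot_mod M N\<^esub> y \<oplus>\<^bsub>quot_mod M N\<^esub> z = x \<oplus>\<^bsub>quot_mod M N\<^esub> (y \<oplus>\<^bsub>quot_mod M N\<^esub> z)"
      by (simp add: sum M.a_assoc)
  next
    fix r x assume r: "r \<in> carrier R" and "x \<in> carrier (quot_mod M N)"
    then obtain a where a: "a \<in> carrier M" "x = N +>\<^bsub>M\<^esub> a" using ex by blast
    then show "r \<odot>\<^bsub>quot_mod M N\<^esub> x \<in> carrier (quot_mod M N)"
      using r in_car[of "r \<odot>\<^bsub>M\<^esub> a"] by (simp add: sm del: quot_mod_simps(1))
    fix s assume s: "s \<in> carrier R"
    show "(r \<oplus> s) \<odot>\<^bsub>quot_mod M N\<^esub> x = r \<odot>\<^bsub>quot_mod M N\<^esub> x \<oplus>\<^bsub>quot_mod M N\<^esub> s \<odot>\<^bsub>quot_mod M N\<^esub> x"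
      "(r \<otimes> s) \<odot>\<^bsub>quot_mod M N\<^esub> x = r \<odot>\<^bsub>quot_mod M N\<^esub> (s \<odot>\<^bsub>quot_mod M N\<^esub> x)"
      using r s a by (simp_all add: sm sum M.smult_l_distr M.smult_assoc1)
  next
    fix r x y assume r: "r \<in> carrier R" and "x \<in> carrier (quot_mod M N)" "y \<in> carrier (quot_mod M N)"
    then obtain a b where "a \<in> carrier M" "x = N +>\<^bsub>M\<^esub> a" "b \<in> carrier M" "y = N +>\<^bsub>M\<^esub> b"
      using ex by metis
    then show "r \<odot>\<^bsub>quot_mod M N\<^esub> (x \<oplus>\<^bsub>quot_mod M N\<^esub> y) =
        r \<odot>\<^bsub>quot_mod M N\<^esub> x \<oplus>\<^bsub>quot_mod M N\<^esub> r \<odot>\<^bsub>quot_mod M N\<^esub> y"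
      using r by (simp add: sm sum M.smult_r_distr)
  qed
  show "N +>\<^bsub>M\<^esub> x = N \<longleftrightarrow> x \<in> N" if "x \<in> carrier M" for x
    using A.a_rcos_const A.a_rcos_self that by blast
  show "x \<in> carrier M \<and> K = N +>\<^bsub>M\<^esub> x" if "K \<in> carrier (quot_mod M N)" "x \<in> K" for K x
    using ex[OF that(1)] that(2) A.a_repr_independence' A.a_elemrcos_carrier by blast
  show "x \<in> N +>\<^bsub>M\<^esub> x" if "x \<in> carrier M" for x using A.a_rcos_self that by blast
qed

lemma mod_span:
  assumes M: "module R M" and S: "S \<subseteq> carrier M"
  shows "submodule (mod_span R M S) R M" and "S \<subseteq> mod_span R M S"
    and "submodule N R M \<Longrightarrow> S \<subseteq> N \<Longrightarrow> mod_span R M S \<subseteq> N"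
proof -
  interpret M: module R M by fact
  show "S \<subseteq> mod_span R M S" by (auto simp: mod_span_def)
  show "submodule N R M \<Longrightarrow> S \<subseteq> N \<Longrightarrow> mod_span R M S \<subseteq> N" by (auto simp: mod_span_def)
  have c: "submodule (carrier M) R M" by (rule M.carrier_is_submodule)
  have z: "\<zero>\<^bsub>M\<^esub> \<in> N" if "submodule N R M" for N
    using subgroup.one_closed[OF submodule.axioms(1)[OF that]] by simp
  show "submodule (mod_span R M S) R M"
    by (rule M.submoduleI)
      (use c S in \<open>auto simp: mod_span_def z M.submoduleE(3-5)\<close>)
qed

lemma kernel_submodule:
  assumes A: "module R A" and B: "module R B" and h: "lin_map R A B h"
  shows "submodule {x \<in> carrier A. h x = \<zero>\<^bsub>B\<^esub>} R A"
proof -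
  interpret A: module R A by fact
  interpret B: module R B by fact
  have "h (\<ominus>\<^bsub>A\<^esub> x) = \<ominus>\<^bsub>B\<^esub> h x" if x: "x \<in> carrier A" for x
    using lin_map_minus[OF A B h A.zero_closed x] lin_map_zero[OF A B h] x
      lin_map_closed[OF h x] by (simp add: a_minus_def)
  then show ?thesis
    by (intro A.submoduleI)
      (auto simp: lin_map_zero[OF A B h] lin_map_add[OF h] lin_map_smult[OF h])
qed

lemma image_submodule:
  assumes A: "module R A" and B: "module R B" and h: "lin_map R A B h"
  shows "submodule (h ` carrier A) R B"
proof -
  interpret A: module R A by fact
  interpret B: module R B by fact
  show ?thesis
  proof (rule B.submoduleI)
    show "h ` carrier A \<subseteq> carrier B" using lin_map_closed[OF h] by auto
    show "\<zero>\<^bsub>B\<^esub> \<in> h ` carrier A" using lin_map_zero[OF A B h] A.zero_closed by force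
  next
    fix b assume "b \<in> h ` carrier A"
    then obtain a where a: "a \<in> carrier A" "b = h a" by auto
    have "h (\<zero>\<^bsub>A\<^esub> \<ominus>\<^bsub>A\<^esub> a) = \<ominus>\<^bsub>B\<^esub> b"
      using a lin_map_minus[OF A B h A.zero_closed a(1)] lin_map_zero[OF A B h] lin_map_closed[OF h a(1)]
      by (simp add: a_minus_def)
    then show "\<ominus>\<^bsub>B\<^esub> b \<in> h ` carrier A" using a by (metis A.minus_closed A.zero_closed imageI)
  next
    fix b b' assume "b \<in> h ` carrier A" "b' \<in> h ` carrier A"
    then show "b \<oplus>\<^bsub>B\<^esub> b' \<in> h ` carrier A"
      by clarsimp (metis A.a_closed imageI lin_map_add[OF h])
  next
    fix r b assume "r \<in> carrier R" "b \<in> h ` carrier A"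
    then show "r \<odot>\<^bsub>B\<^esub> b \<in> h ` carrier A"
      by clarsimp (metis A.smult_closed imageI lin_map_smult[OF h])
  qed
qed

section \<open>Modules by generators and relations\<close>

definition pcls :: "'x set \<Rightarrow> ('x \<Rightarrow> 'r) set \<Rightarrow> ('x \<Rightarrow> 'r) \<Rightarrow> ('x \<Rightarrow> 'r) set" where
  "pcls X S f = mod_span R (free_mod R X) S +>\<^bsub>free_mod R X\<^esub> f"

lemma pgen_pcls: "pgen R X S x = pcls X S (basis_elt R x)"
  by (simp add: pgen_def pcls_def)

context
  fixes X :: "'x set" and S
  assumes S: "S \<subseteq> carrier (free_mod R X)"
begin

lemma pres_module: "module R (pres R X S)"
  unfolding pres_def by (rule quot_mod(1)[OF free_mod_module mod_span(1)[OF free_mod_module S]])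

lemma pcls_lin: "lin_map R (free_mod R X) (pres R X S) (pcls X S)"
  using quot_mod(2)[OF free_mod_module mod_span(1)[OF free_mod_module S]]
  unfolding pres_def pcls_def[abs_def] .

lemma pgen_closed: "x \<in> X \<Longrightarrow> pgen R X S x \<in> carrier (pres R X S)"
  unfolding pgen_pcls by (rule lin_map_closed[OF pcls_lin]) auto

lemma pres_carrier: "carrier (pres R X S) = pcls X S ` carrier (free_mod R X)"
  unfolding pres_def pcls_def
  by (rule quot_mod(3)[OF free_mod_module mod_span(1)[OF free_mod_module S]])

text \<open>The relators in \<open>brels\<close> and \<open>tens_rels\<close> are written as
  pointwise differences; here such a difference becomes an equation between classes.\<close>

lemma pcls_eq:
  assumes "f \<in> carrier (free_mod R X)" "g \<in> carrier (free_mod R X)" "(\<lambda>x. f x \<ominus> g x) \<in> S"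
  shows "pcls X S f = pcls X S g"
proof -
  interpret F: module R "free_mod R X" by (rule free_mod_module)
  interpret P: module R "pres R X S" by (rule pres_module)
  have s: "f \<ominus>\<^bsub>free_mod R X\<^esub> g \<in> mod_span R (free_mod R X) S"
    using assms mod_span(2)[OF free_mod_module S] by (auto simp: free_mod_diff)
  have "pcls X S (f \<ominus>\<^bsub>free_mod R X\<^esub> g) = \<zero>\<^bsub>pres R X S\<^esub>"
    using quot_mod(4)[OF free_mod_module mod_span(1)[OF free_mod_module S]] s assms
    unfolding pres_def pcls_def by simp
  then have "pcls X S f \<ominus>\<^bsub>pres R X S\<^esub> pcls X S g = \<zero>\<^bsub>pres R X S\<^esub>"
    using lin_map_minus[OF free_mod_module pres_module pcls_lin assms(1,2)] by simp
  then show ?thesis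
    using lin_map_closed[OF pcls_lin assms(1)] lin_map_closed[OF pcls_lin assms(2)]
    by (metis P.add.inv_closed P.minus_eq P.minus_minus P.minus_equality)
qed

lemma pres_induct [consumes 1, case_names zero add gen]:
  assumes k: "k \<in> carrier (pres R X S)"
    and z: "P \<zero>\<^bsub>pres R X S\<^esub>"
    and a: "\<And>k l. \<lbrakk>k \<in> carrier (pres R X S); l \<in> carrier (pres R X S); P k; P l\<rbrakk> \<Longrightarrow>
      P (k \<oplus>\<^bsub>pres R X S\<^esub> l)"
    and g: "\<And>r x. r \<in> carrier R \<Longrightarrow> x \<in> X \<Longrightarrow> P (r \<odot>\<^bsub>pres R X S\<^esub> pgen R X S x)"
  shows "P k"
proof -
  obtain f where f: "f \<in> carrier (free_mod R X)" "k = pcls X S f"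
    using k pres_carrier by auto
  interpret F: module R "free_mod R X" by (rule free_mod_module)
  have "P (pcls X S f)" using f(1)
  proof (induction rule: free_mod_induct)
    case zero
    then show ?case using z lin_map_zero[OF free_mod_module pres_module pcls_lin] by simp
  next
    case (add f g)
    then show ?case
      using a lin_map_add[OF pcls_lin] lin_map_closed[OF pcls_lin] by metis
  next
    case (basis r x)
    then show ?case using g lin_map_smult[OF pcls_lin] unfolding pgen_pcls by simp
  qed
  then show ?thesis using f by simp
qed

text \<open>Universal property of a presented module. The kernel of the linear extension is a
  submodule that contains the relators, hence their span. So every member of a coset gives the same
  value, in particular the one that \<open>plift\<close> picks.\<close>

lemma plift:
  assumes M: "module R M" and h: "h \<in> X \<rightarrow> carrier M"
    and rel: "\<And>s. s \<in> S \<Longrightarrow> lin_ext M h s = \<zero>\<^bsub>M\<^esub>"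
  shows "lin_map R (pres R X S) M (plift R M h)"
    and "x \<in> X \<Longrightarrow> plift R M h (pgen R X S x) = h x"
proof -
  interpret M: module R M by fact
  interpret F: module R "free_mod R X" by (rule free_mod_module)
  note N = mod_span(1)[OF free_mod_module S]
  note lin = lin_ext(1)[OF M h]
  have "mod_span R (free_mod R X) S \<subseteq> {f \<in> carrier (free_mod R X). lin_ext M h f = \<zero>\<^bsub>M\<^esub>}"
    by (rule mod_span(3)[OF free_mod_module S kernel_submodule[OF free_mod_module M lin]])
      (use S rel in auto)
  then have ker: "lin_ext M h n = \<zero>\<^bsub>M\<^esub>" "n \<in> carrier (free_mod R X)"
    if "n \<in> mod_span R (free_mod R X) S" for n using that by auto
  have val: "plift R M h (pcls X S f) = lin_ext M h f" if f: "f \<in> carrier (free_mod R X)" for f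
  proof -
    define g where "g = (SOME g. g \<in> pcls X S f)"
    have "f \<in> pcls X S f" using quot_mod(6)[OF free_mod_module N f] by (simp add: pcls_def)
    then have "g \<in> pcls X S f" unfolding g_def by (metis someI)
    then obtain n where n: "n \<in> mod_span R (free_mod R X) S" "g = n \<oplus>\<^bsub>free_mod R X\<^esub> f"
      by (auto simp: pcls_def a_r_coset_def')
    have "lin_ext M h g = lin_ext M h f"
      unfolding n(2) using ker[OF n(1)] f lin_map_closed[OF lin f] by (subst lin_map_add[OF lin]) auto
    then show ?thesis by (simp add: plift_def Let_def g_def[symmetric] lin_ext_def)
  qed
  show "x \<in> X \<Longrightarrow> plift R M h (pgen R X S x) = h x"
    using lin_ext(2)[OF M h] by (simp add: pgen_pcls val)
  have pe: "\<exists>f. f \<in> carrier (free_mod R X) \<and> k = pcls X S f" if "k \<in> carrier (pres R X S)" for k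
    using that pres_carrier by auto
  show "lin_map R (pres R X S) M (plift R M h)"
  proof (rule lin_mapI)
    fix k assume "k \<in> carrier (pres R X S)"
    then obtain f where f: "f \<in> carrier (free_mod R X)" "k = pcls X S f" using pe by blast
    then show "plift R M h k \<in> carrier M" using lin_map_closed[OF lin] by (simp add: val)
    fix r assume r: "r \<in> carrier R"
    have "r \<odot>\<^bsub>pres R X S\<^esub> k = pcls X S (r \<odot>\<^bsub>free_mod R X\<^esub> f)"
      using lin_map_smult[OF pcls_lin r f(1)] f(2) by simp
    then show "plift R M h (r \<odot>\<^bsub>pres R X S\<^esub> k) = r \<odot>\<^bsub>M\<^esub> plift R M h k"
      using f r val[OF F.smult_closed[OF r f(1)]] lin_map_smult[OF lin r f(1)] by (simp add: val)
  next
    fix k l assume "k \<in> carrier (pres R X S)" "l \<in> carrier (pres R X S)"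
    then obtain f g where f: "f \<in> carrier (free_mod R X)" "k = pcls X S f"
        "g \<in> carrier (free_mod R X)" "l = pcls X S g" using pe by metis
    have "k \<oplus>\<^bsub>pres R X S\<^esub> l = pcls X S (f \<oplus>\<^bsub>free_mod R X\<^esub> g)"
      using lin_map_add[OF pcls_lin f(1,3)] f by simp
    then show "plift R M h (k \<oplus>\<^bsub>pres R X S\<^esub> l) = plift R M h k \<oplus>\<^bsub>M\<^esub> plift R M h l"
      using f val[OF F.a_closed[OF f(1,3)]] lin_map_add[OF lin f(1,3)] val by metis
  qed
qed

lemma pres_ext:
  assumes M: "module R M" and h: "lin_map R (pres R X S) M h" and h': "lin_map R (pres R X S) M h'"
    and eq: "\<And>x. x \<in> X \<Longrightarrow> h (pgen R X S x) = h' (pgen R X S x)" and k: "k \<in> carrier (pres R X S)"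
  shows "h k = h' k"
  using k
proof (induction rule: pres_induct)
  case zero
  then show ?case using lin_map_zero[OF pres_module M] h h' by metis
next
  case (add k l)
  then show ?case by (simp add: lin_map_add[OF h] lin_map_add[OF h'])
next
  case (gen r x)
  then show ?case
    by (simp add: lin_map_smult[OF h] lin_map_smult[OF h'] eq pgen_closed)
qed

end

end

section \<open>Finite categories, bisets and their composition\<close>

lemma fincats_category: "fincat C \<Longrightarrow> category C"
  by (simp add: fincats_def)

lemma fincats_finite [simp]: "fincat C \<Longrightarrow> finite (Ob C)" "fincat C \<Longrightarrow> finite (Ar C)"
  by (simp_all add: fincats_def)

lemma fincat_simps [simp]:
  assumes "fincat C"
  shows "f \<in> Ar C \<Longrightarrow> src C f \<in> Ob C"
    and "f \<in> Ar C \<Longrightarrow> tgt C f \<in> Ob C"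
    and "x \<in> Ob C \<Longrightarrow> ident C x \<in> Ar C"
    and "x \<in> Ob C \<Longrightarrow> src C (ident C x) = x"
    and "x \<in> Ob C \<Longrightarrow> tgt C (ident C x) = x"
    and "\<lbrakk>f \<in> Ar C; g \<in> Ar C; tgt C f = src C g\<rbrakk> \<Longrightarrow> cmp C g f \<in> Ar C"
    and "\<lbrakk>f \<in> Ar C; g \<in> Ar C; tgt C f = src C g\<rbrakk> \<Longrightarrow> src C (cmp C g f) = src C f"
    and "\<lbrakk>f \<in> Ar C; g \<in> Ar C; tgt C f = src C g\<rbrakk> \<Longrightarrow> tgt C (cmp C g f) = tgt C g"
    and "f \<in> Ar C \<Longrightarrow> y = tgt C f \<Longrightarrow> cmp C (ident C y) f = f"
    and "f \<in> Ar C \<Longrightarrow> x = src C f \<Longrightarrow> cmp C f (ident C x) = f"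
    and "\<lbrakk>f \<in> Ar C; g \<in> Ar C; h \<in> Ar C; tgt C f = src C g; tgt C g = src C h\<rbrakk> \<Longrightarrow>
      cmp C (cmp C h g) f = cmp C h (cmp C g f)"
proof -
  interpret category C using assms by (rule fincats_category)
  show "f \<in> Ar C \<Longrightarrow> src C f \<in> Ob C" "f \<in> Ar C \<Longrightarrow> tgt C f \<in> Ob C"
    by (auto intro: src_Ob tgt_Ob)
  show "x \<in> Ob C \<Longrightarrow> ident C x \<in> Ar C" "x \<in> Ob C \<Longrightarrow> src C (ident C x) = x"
    "x \<in> Ob C \<Longrightarrow> tgt C (ident C x) = x"
    using ident_Hom by (auto simp: Hom_def)
  show "\<lbrakk>f \<in> Ar C; g \<in> Ar C; tgt C f = src C g\<rbrakk> \<Longrightarrow> cmp C g f \<in> Ar C"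
    "\<lbrakk>f \<in> Ar C; g \<in> Ar C; tgt C f = src C g\<rbrakk> \<Longrightarrow> src C (cmp C g f) = src C f"
    "\<lbrakk>f \<in> Ar C; g \<in> Ar C; tgt C f = src C g\<rbrakk> \<Longrightarrow> tgt C (cmp C g f) = tgt C g"
    using cmp_Hom[of f "src C f" "tgt C f" g "tgt C g"] by (auto simp: Hom_def)
  show "f \<in> Ar C \<Longrightarrow> y = tgt C f \<Longrightarrow> cmp C (ident C y) f = f"
    using cmp_ident_left[of f "src C f" "tgt C f"] by (auto simp: Hom_def)
  show "f \<in> Ar C \<Longrightarrow> x = src C f \<Longrightarrow> cmp C f (ident C x) = f"
    using cmp_ident_right[of f "src C f" "tgt C f"] by (auto simp: Hom_def)
  show "\<lbrakk>f \<in> Ar C; g \<in> Ar C; h \<in> Ar C; tgt C f = src C g; tgt C g = src C h\<rbrakk> \<Longrightarrow>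
      cmp C (cmp C h g) f = cmp C h (cmp C g f)"
    using cmp_assoc[of f "src C f" "tgt C f" g "tgt C g" h "tgt C h"] by (auto simp: Hom_def)
qed

lemma categoryI:
  assumes "\<And>f. f \<in> Ar C \<Longrightarrow> src C f \<in> Ob C"
    and "\<And>f. f \<in> Ar C \<Longrightarrow> tgt C f \<in> Ob C"
    and "\<And>x. x \<in> Ob C \<Longrightarrow> ident C x \<in> Ar C"
    and "\<And>x. x \<in> Ob C \<Longrightarrow> src C (ident C x) = x"
    and "\<And>x. x \<in> Ob C \<Longrightarrow> tgt C (ident C x) = x"
    and "\<And>f g. \<lbrakk>f \<in> Ar C; g \<in> Ar C; tgt C f = src C g\<rbrakk> \<Longrightarrow> cmp C g f \<in> Ar C"
    and "\<And>f g. \<lbrakk>f \<in> Ar C; g \<in> Ar C; tgt C f = src C g\<rbrakk> \<Longrightarrow> src C (cmp C g f) = src C f"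
    and "\<And>f g. \<lbrakk>f \<in> Ar C; g \<in> Ar C; tgt C f = src C g\<rbrakk> \<Longrightarrow> tgt C (cmp C g f) = tgt C g"
    and "\<And>f. f \<in> Ar C \<Longrightarrow> cmp C (ident C (tgt C f)) f = f"
    and "\<And>f. f \<in> Ar C \<Longrightarrow> cmp C f (ident C (src C f)) = f"
    and "\<And>f g h. \<lbrakk>f \<in> Ar C; g \<in> Ar C; h \<in> Ar C; tgt C f = src C g; tgt C g = src C h\<rbrakk> \<Longrightarrow>
      cmp C (cmp C h g) f = cmp C h (cmp C g f)"
  shows "category C"
  by unfold_locales (use assms in \<open>auto simp: Hom_def\<close>)

lemma norm_cat_simps [simp]:
  "Ob (norm_cat C) = Ob C" "Ar (norm_cat C) = Ar C"
  "f \<in> Ar C \<Longrightarrow> src (norm_cat C) f = src C f" "f \<in> Ar C \<Longrightarrow> tgt (norm_cat C) f = tgt C f"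
  "x \<in> Ob C \<Longrightarrow> ident (norm_cat C) x = ident C x"
  "\<lbrakk>f \<in> Ar C; g \<in> Ar C; tgt C f = src C g\<rbrakk> \<Longrightarrow> cmp (norm_cat C) g f = cmp C g f"
  by (auto simp: norm_cat_def)

lemma norm_cat_idem: "norm_cat (norm_cat C) = norm_cat C"
  by (auto simp: norm_cat_def fun_eq_iff)

lemma norm_cat_fincats:
  assumes "category C" "finite (Ob C)" "finite (Ar C)"
  shows "norm_cat C \<in> fincats"
proof -
  interpret category C by fact
  have H: "Hom (norm_cat C) = Hom C" by (auto simp: Hom_def fun_eq_iff)
  have e: "cmp (norm_cat C) g f = cmp C g f" if "f \<in> Hom C x y" "g \<in> Hom C y z" for f g x y z
    using that by (auto simp: Hom_def)
  have i: "ident (norm_cat C) x = ident C x" if "x \<in> Ob C" for x using that by simp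
  have o: "x \<in> Ob C" "y \<in> Ob C" if "f \<in> Hom C x y" for f x y
    using that src_Ob tgt_Ob by (auto simp: Hom_def)
  have "category (norm_cat C)"
  proof
    show "\<And>f. f \<in> Ar (norm_cat C) \<Longrightarrow> src (norm_cat C) f \<in> Ob (norm_cat C)"
      "\<And>f. f \<in> Ar (norm_cat C) \<Longrightarrow> tgt (norm_cat C) f \<in> Ob (norm_cat C)"
      by (auto intro: src_Ob tgt_Ob)
    show "\<And>x. x \<in> Ob (norm_cat C) \<Longrightarrow> ident (norm_cat C) x \<in> Hom (norm_cat C) x x"
      by (auto simp: H ident_Hom)
    show "cmp (norm_cat C) g f \<in> Hom (norm_cat C) x z"
      if "f \<in> Hom (norm_cat C) x y" "g \<in> Hom (norm_cat C) y z" for f g x y z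
      using that unfolding H by (simp add: e cmp_Hom)
    show "cmp (norm_cat C) (ident (norm_cat C) y) f = f" if "f \<in> Hom (norm_cat C) x y" for f x y
      using that o[OF that[unfolded H]] e[of f x y "ident C y" y] ident_Hom[of y] unfolding H
      by (simp add: cmp_ident_left)
    show "cmp (norm_cat C) f (ident (norm_cat C) x) = f" if "f \<in> Hom (norm_cat C) x y" for f x y
      using that o[OF that[unfolded H]] e[of "ident C x" x x f y] ident_Hom[of x] unfolding H
      by (simp add: cmp_ident_right)
    show "cmp (norm_cat C) (cmp (norm_cat C) h g) f = cmp (norm_cat C) h (cmp (norm_cat C) g f)"
      if "f \<in> Hom (norm_cat C) w x" "g \<in> Hom (norm_cat C) x y" "h \<in> Hom (norm_cat C) y z" for f g h w x y z
      using that cmp_Hom[of f w x g y] cmp_Hom[of g x y h z] unfolding H by (simp add: e cmp_assoc)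
  qed
  then show ?thesis using assms unfolding fincats_def by (simp add: norm_cat_idem)
qed

lemma op_cat_simps [simp]:
  "Ob (op_cat C) = Ob C" "Ar (op_cat C) = Ar C" "src (op_cat C) = tgt C" "tgt (op_cat C) = src C"
  "ident (op_cat C) = ident C" "cmp (op_cat C) g f = cmp C f g" "op_cat (op_cat C) = C"
  by (simp_all add: op_cat_def)

text \<open>\<open>op_cat\<close> does not renormalise, so it is an involution on the nose.
  Normality must then be inherited: composition in \<open>C\<close> is \<open>undefined\<close> off
  the composable pairs, and a pair is composable in the opposite category exactly when the reversed
  pair is composable in \<open>C\<close>.\<close>

lemma op_cat_fincats [simp]: assumes "fincat C" shows "op_cat C \<in> fincats"
proof -
  have "norm_cat C = C" using assms unfolding fincats_def by simp
  then have n: "src (norm_cat C) f = src C f" "tgt (norm_cat C) f = tgt C f"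
    "ident (norm_cat C) x = ident C x" "cmp (norm_cat C) g f = cmp C g f" for f g x by (rule arg_cong)+
  have u: "f \<notin> Ar C \<Longrightarrow> src C f = undefined" "f \<notin> Ar C \<Longrightarrow> tgt C f = undefined"
    "x \<notin> Ob C \<Longrightarrow> ident C x = undefined" for f x
    using n(1)[of f] n(2)[of f] n(3)[of x] by (simp_all add: norm_cat_def)
  have c: "cmp C g f = undefined" if "\<not> (g \<in> Ar C \<and> f \<in> Ar C \<and> tgt C f = src C g)" for g f
    using n(4)[of g f] that unfolding norm_cat_def by simp
  have "norm_cat (op_cat C) = op_cat C"
    unfolding norm_cat_def op_cat_def cat.simps
    by (intro cat.equality) (auto simp: fun_eq_iff restrict_def u intro!: c[symmetric])
  moreover have "category (op_cat C)" by (rule categoryI) (use assms in auto)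
  ultimately show ?thesis using assms unfolding fincats_def by simp
qed

lemma prod_encode_image: "x \<in> prod_encode ` (A \<times> B) \<longleftrightarrow> pi1 x \<in> A \<and> pi2 x \<in> B"
proof
  assume "pi1 x \<in> A \<and> pi2 x \<in> B"
  then show "x \<in> prod_encode ` (A \<times> B)"
    by (intro image_eqI[of _ _ "prod_decode x"]) (auto simp: mem_Times_iff)
qed auto

lemma pr_eq_iff: "\<langle>a, b\<rangle> = x \<longleftrightarrow> a = pi1 x \<and> b = pi2 x"
  by auto

lemma prod_cat_simps [simp]:
  "x \<in> Ob (C \<times>\<^sub>c D) \<longleftrightarrow> pi1 x \<in> Ob C \<and> pi2 x \<in> Ob D"
  "f \<in> Ar (C \<times>\<^sub>c D) \<longleftrightarrow> pi1 f \<in> Ar C \<and> pi2 f \<in> Ar D"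
  "pi1 f \<in> Ar C \<Longrightarrow> pi2 f \<in> Ar D \<Longrightarrow> src (C \<times>\<^sub>c D) f = \<langle>src C (pi1 f), src D (pi2 f)\<rangle>"
  "pi1 f \<in> Ar C \<Longrightarrow> pi2 f \<in> Ar D \<Longrightarrow> tgt (C \<times>\<^sub>c D) f = \<langle>tgt C (pi1 f), tgt D (pi2 f)\<rangle>"
  "pi1 x \<in> Ob C \<Longrightarrow> pi2 x \<in> Ob D \<Longrightarrow> ident (C \<times>\<^sub>c D) x = \<langle>ident C (pi1 x), ident D (pi2 x)\<rangle>"
  "\<lbrakk>pi1 f \<in> Ar C; pi2 f \<in> Ar D; pi1 g \<in> Ar C; pi2 g \<in> Ar D;
    tgt C (pi1 f) = src C (pi1 g); tgt D (pi2 f) = src D (pi2 g)\<rbrakk> \<Longrightarrow>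
    cmp (C \<times>\<^sub>c D) g f = \<langle>cmp C (pi1 g) (pi1 f), cmp D (pi2 g) (pi2 f)\<rangle>"
  by (simp_all add: prod_cat_def prod_encode_image norm_cat_def)

lemma prod_cat_fincats [simp]: assumes "fincat C" "fincat D" shows "C \<times>\<^sub>c D \<in> fincats"
  unfolding prod_cat_def
  by (intro norm_cat_fincats categoryI) (use assms in \<open>auto simp: prod_encode_image\<close>)

lemma one_cat_simps [simp]:
  "Ob one_cat = {0}" "Ar one_cat = {0}" "src one_cat 0 = 0" "tgt one_cat 0 = 0" "ident one_cat 0 = 0"
  "cmp one_cat 0 0 = 0"
  by (simp_all add: one_cat_def)

lemma one_cat_fincats [simp]: "fincat one_cat"
  unfolding one_cat_def by (intro norm_cat_fincats categoryI) auto

section \<open>Bisets and natural bijections\<close>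

lemma bob_norm [simp]: "u \<in> bob (norm_biset C D B) x y \<longleftrightarrow> x \<in> Ob C \<and> y \<in> Ob D \<and> u \<in> bob B x y"
  by (auto simp: norm_biset_def)

lemma bmap_norm [simp]:
  "\<lbrakk>\<alpha> \<in> Ar C; \<beta> \<in> Ar D; u \<in> bob B (src C \<alpha>) (tgt D \<beta>)\<rbrakk> \<Longrightarrow>
    bmap (norm_biset C D B) \<alpha> \<beta> u = bmap B \<alpha> \<beta> u"
  by (simp add: norm_biset_def)

lemma norm_biset_idem:
  assumes "fincat C" "fincat D"
  shows "norm_biset C D (norm_biset C D B) = norm_biset C D B"
  using assms by (auto simp: norm_biset_def fun_eq_iff)

lemma bisetsI:
  assumes "fincat C" "fincat D"
    and "\<And>x y. x \<in> Ob C \<Longrightarrow> y \<in> Ob D \<Longrightarrow> finite (bob B x y)"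
    and cl: "\<And>\<alpha> \<beta> u. \<alpha> \<in> Ar C \<Longrightarrow> \<beta> \<in> Ar D \<Longrightarrow> u \<in> bob B (src C \<alpha>) (tgt D \<beta>) \<Longrightarrow>
      bmap B \<alpha> \<beta> u \<in> bob B (tgt C \<alpha>) (src D \<beta>)"
    and "\<And>x y u. \<lbrakk>x \<in> Ob C; y \<in> Ob D; u \<in> bob B x y\<rbrakk> \<Longrightarrow> bmap B (ident C x) (ident D y) u = u"
    and "\<And>\<alpha> \<alpha>' \<beta> \<beta>' u. \<alpha> \<in> Ar C \<Longrightarrow> \<alpha>' \<in> Ar C \<Longrightarrow> \<beta> \<in> Ar D \<Longrightarrow> \<beta>' \<in> Ar D \<Longrightarrow> tgt C \<alpha> = src C \<alpha>' \<Longrightarrow>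
      tgt D \<beta>' = src D \<beta> \<Longrightarrow> u \<in> bob B (src C \<alpha>) (tgt D \<beta>) \<Longrightarrow>
      bmap B (cmp C \<alpha>' \<alpha>) (cmp D \<beta> \<beta>') u = bmap B \<alpha>' \<beta>' (bmap B \<alpha> \<beta> u)"
  shows "norm_biset C D B \<in> bisets C D"
proof -
  have fin: "finite (bob (norm_biset C D B) x y)" for x y
    using assms(3) by (simp add: norm_biset_def)
  have cl': "bmap B \<alpha> \<beta> u \<in> bob B x y"
    if "\<alpha> \<in> Ar C" "\<beta> \<in> Ar D" "u \<in> bob B (src C \<alpha>) (tgt D \<beta>)" "x = tgt C \<alpha>" "y = src D \<beta>"
    for \<alpha> \<beta> x y u using cl[OF that(1-3)] that(4,5) by simp
  show ?thesis
    unfolding bisets_def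
    using assms(1,2) by (auto simp: norm_biset_idem fin assms(5-) cl')
qed

text \<open>The normal form empties the value sets away from the objects, so membership of an
  element already certifies that both its indices are objects. Later proofs obtain their typing
  facts in this way.\<close>

lemma bisetsD:
  assumes "\<Omega> \<in> bisets C D"
  shows "u \<in> bob \<Omega> x y \<Longrightarrow> x \<in> Ob C" and "u \<in> bob \<Omega> x y \<Longrightarrow> y \<in> Ob D"
    and "finite (bob \<Omega> x y)"
    and "\<lbrakk>\<alpha> \<in> Ar C; \<beta> \<in> Ar D; u \<in> bob \<Omega> (src C \<alpha>) (tgt D \<beta>); x = tgt C \<alpha>; y = src D \<beta>\<rbrakk> \<Longrightarrow>
      bmap \<Omega> \<alpha> \<beta> u \<in> bob \<Omega> x y"
    and "u \<in> bob \<Omega> x y \<Longrightarrow> bmap \<Omega> (ident C x) (ident D y) u = u"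
    and "\<lbrakk>\<alpha> \<in> Ar C; \<alpha>' \<in> Ar C; \<beta> \<in> Ar D; \<beta>' \<in> Ar D; tgt C \<alpha> = src C \<alpha>'; tgt D \<beta>' = src D \<beta>;
      u \<in> bob \<Omega> (src C \<alpha>) (tgt D \<beta>)\<rbrakk> \<Longrightarrow>
      bmap \<Omega> \<alpha>' \<beta>' (bmap \<Omega> \<alpha> \<beta> u) = bmap \<Omega> (cmp C \<alpha>' \<alpha>) (cmp D \<beta> \<beta>') u"
    and "norm_biset C D \<Omega> = \<Omega>"
proof -
  show n: "norm_biset C D \<Omega> = \<Omega>" using assms by (simp add: bisets_def)
  have o: "bob (norm_biset C D \<Omega>) x y = bob \<Omega> x y" for x y by (simp only: n)
  show x: "u \<in> bob \<Omega> x y \<Longrightarrow> x \<in> Ob C" "u \<in> bob \<Omega> x y \<Longrightarrow> y \<in> Ob D" for x y u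
    using bob_norm[of u C D \<Omega> x y] unfolding o by auto
  show "finite (bob \<Omega> x y)"
  proof (cases "x \<in> Ob C \<and> y \<in> Ob D")
    case False
    then have "bob \<Omega> x y = {}" using x by blast
    then show ?thesis by simp
  qed (use assms in \<open>auto simp: bisets_def\<close>)
  show "\<lbrakk>\<alpha> \<in> Ar C; \<beta> \<in> Ar D; u \<in> bob \<Omega> (src C \<alpha>) (tgt D \<beta>); x = tgt C \<alpha>; y = src D \<beta>\<rbrakk> \<Longrightarrow>
      bmap \<Omega> \<alpha> \<beta> u \<in> bob \<Omega> x y"
    using assms by (simp add: bisets_def Pi_iff)
  show "u \<in> bob \<Omega> x y \<Longrightarrow> bmap \<Omega> (ident C x) (ident D y) u = u"
    using assms x by (auto simp: bisets_def)
  show "\<lbrakk>\<alpha> \<in> Ar C; \<alpha>' \<in> Ar C; \<beta> \<in> Ar D; \<beta>' \<in> Ar D; tgt C \<alpha> = src C \<alpha>'; tgt D \<beta>' = src D \<beta>;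
      u \<in> bob \<Omega> (src C \<alpha>) (tgt D \<beta>)\<rbrakk> \<Longrightarrow>
      bmap \<Omega> \<alpha>' \<beta>' (bmap \<Omega> \<alpha> \<beta> u) = bmap \<Omega> (cmp C \<alpha>' \<alpha>) (cmp D \<beta> \<beta>') u"
    using assms by (auto simp: bisets_def)
qed

text \<open>The normal form fixes all values outside the domain, which turns agreement on the domain
  into equality of records.\<close>

lemma biset_eqI:
  assumes "\<Omega> \<in> bisets C D" "\<Psi> \<in> bisets C D"
    and "\<And>x y. x \<in> Ob C \<Longrightarrow> y \<in> Ob D \<Longrightarrow> bob \<Omega> x y = bob \<Psi> x y"
    and "\<And>\<alpha> \<beta> u. \<alpha> \<in> Ar C \<Longrightarrow> \<beta> \<in> Ar D \<Longrightarrow> u \<in> bob \<Omega> (src C \<alpha>) (tgt D \<beta>) \<Longrightarrow> bmap \<Omega> \<alpha> \<beta> u = bmap \<Psi> \<alpha> \<beta> u"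
  shows "\<Omega> = \<Psi>"
proof -
  have b: "bob \<Omega> x y = bob \<Psi> x y" for x y
    using bisetsD(1,2)[OF assms(1)] bisetsD(1,2)[OF assms(2)] assms(3) by blast
  then have "norm_biset C D \<Omega> = norm_biset C D \<Psi>"
    using assms(4) by (auto simp: norm_biset_def fun_eq_iff)
  then show ?thesis using bisetsD(7) assms(1,2) by metis
qed

lemma biset_isoI:
  assumes "\<And>x y. x \<in> Ob C \<Longrightarrow> y \<in> Ob D \<Longrightarrow> bij_betw (\<theta> x y) (bob \<Omega> x y) (bob \<Psi> x y)"
    and "\<And>\<alpha> \<beta> u. \<alpha> \<in> Ar C \<Longrightarrow> \<beta> \<in> Ar D \<Longrightarrow> u \<in> bob \<Omega> (src C \<alpha>) (tgt D \<beta>) \<Longrightarrow>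
      \<theta> (tgt C \<alpha>) (src D \<beta>) (bmap \<Omega> \<alpha> \<beta> u) = bmap \<Psi> \<alpha> \<beta> (\<theta> (src C \<alpha>) (tgt D \<beta>) u)"
  shows "biset_iso C D \<Omega> \<Psi>"
  unfolding biset_iso_def using assms by (intro exI[of _ \<theta>]) auto

lemma biset_iso_obtain:
  assumes "biset_iso C D \<Omega> \<Psi>"
  obtains \<theta> where "\<And>x y. x \<in> Ob C \<Longrightarrow> y \<in> Ob D \<Longrightarrow> bij_betw (\<theta> x y) (bob \<Omega> x y) (bob \<Psi> x y)"
    and "\<And>\<alpha> \<beta> u. \<alpha> \<in> Ar C \<Longrightarrow> \<beta> \<in> Ar D \<Longrightarrow> u \<in> bob \<Omega> (src C \<alpha>) (tgt D \<beta>) \<Longrightarrow>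
      \<theta> (tgt C \<alpha>) (src D \<beta>) (bmap \<Omega> \<alpha> \<beta> u) = bmap \<Psi> \<alpha> \<beta> (\<theta> (src C \<alpha>) (tgt D \<beta>) u)"
proof -
  obtain \<theta> where \<theta>: "\<forall>x\<in>Ob C. \<forall>y\<in>Ob D. bij_betw (\<theta> x y) (bob \<Omega> x y) (bob \<Psi> x y)"
    "\<forall>\<alpha>\<in>Ar C. \<forall>\<beta>\<in>Ar D. \<forall>u\<in>bob \<Omega> (src C \<alpha>) (tgt D \<beta>).
      \<theta> (tgt C \<alpha>) (src D \<beta>) (bmap \<Omega> \<alpha> \<beta> u) = bmap \<Psi> \<alpha> \<beta> (\<theta> (src C \<alpha>) (tgt D \<beta>) u)"
    using assms unfolding biset_iso_def by blast
  show thesis by (rule that[of \<theta>]) (use \<theta> in auto)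
qed

lemma biset_iso_refl: "biset_iso C D \<Omega> \<Omega>"
  by (rule biset_isoI[of _ _ "\<lambda>x y u. u"]) (auto simp: bij_betw_def)

text \<open>A natural bijection together with a chosen inverse. The first two clauses range over all
  \<open>x\<close> and \<open>y\<close>, because the sets are empty off the objects. Both directions
  are then available as rewrite rules without side conditions on objects.\<close>

definition biset_inv :: "fcat \<Rightarrow> fcat \<Rightarrow> biset \<Rightarrow> biset \<Rightarrow> (nat \<Rightarrow> nat \<Rightarrow> nat \<Rightarrow> nat) \<Rightarrow> (nat \<Rightarrow> nat \<Rightarrow> nat \<Rightarrow> nat) \<Rightarrow> bool" where
  "biset_inv C D \<Omega> \<Psi> \<theta> \<sigma> \<longleftrightarrow>
    (\<forall>x y. \<forall>u\<in>bob \<Omega> x y. \<theta> x y u \<in> bob \<Psi> x y \<and> \<sigma> x y (\<theta> x y u) = u) \<and>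
    (\<forall>x y. \<forall>v\<in>bob \<Psi> x y. \<sigma> x y v \<in> bob \<Omega> x y \<and> \<theta> x y (\<sigma> x y v) = v) \<and>
    (\<forall>\<alpha>\<in>Ar C. \<forall>\<beta>\<in>Ar D. \<forall>u\<in>bob \<Omega> (src C \<alpha>) (tgt D \<beta>).
      \<theta> (tgt C \<alpha>) (src D \<beta>) (bmap \<Omega> \<alpha> \<beta> u) = bmap \<Psi> \<alpha> \<beta> (\<theta> (src C \<alpha>) (tgt D \<beta>) u)) \<and>
    (\<forall>\<alpha>\<in>Ar C. \<forall>\<beta>\<in>Ar D. \<forall>v\<in>bob \<Psi> (src C \<alpha>) (tgt D \<beta>).
      \<sigma> (tgt C \<alpha>) (src D \<beta>) (bmap \<Psi> \<alpha> \<beta> v) = bmap \<Omega> \<alpha> \<beta> (\<sigma> (src C \<alpha>) (tgt D \<beta>) v))"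

lemma biset_invD:
  assumes "biset_inv C D \<Omega> \<Psi> \<theta> \<sigma>"
  shows "u \<in> bob \<Omega> x y \<Longrightarrow> \<theta> x y u \<in> bob \<Psi> x y" "u \<in> bob \<Omega> x y \<Longrightarrow> \<sigma> x y (\<theta> x y u) = u"
    "v \<in> bob \<Psi> x y \<Longrightarrow> \<sigma> x y v \<in> bob \<Omega> x y" "v \<in> bob \<Psi> x y \<Longrightarrow> \<theta> x y (\<sigma> x y v) = v"
    "\<lbrakk>\<alpha> \<in> Ar C; \<beta> \<in> Ar D; u \<in> bob \<Omega> (src C \<alpha>) (tgt D \<beta>); x = tgt C \<alpha>; y = src D \<beta>\<rbrakk> \<Longrightarrow>
      \<theta> x y (bmap \<Omega> \<alpha> \<beta> u) = bmap \<Psi> \<alpha> \<beta> (\<theta> (src C \<alpha>) (tgt D \<beta>) u)"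
    "\<lbrakk>\<alpha> \<in> Ar C; \<beta> \<in> Ar D; v \<in> bob \<Psi> (src C \<alpha>) (tgt D \<beta>); x = tgt C \<alpha>; y = src D \<beta>\<rbrakk> \<Longrightarrow>
      \<sigma> x y (bmap \<Psi> \<alpha> \<beta> v) = bmap \<Omega> \<alpha> \<beta> (\<sigma> (src C \<alpha>) (tgt D \<beta>) v)"
  using assms unfolding biset_inv_def by blast+

lemma biset_iso_inv:
  assumes iso: "biset_iso C D \<Omega> \<Psi>" and cats: "fincat C" "fincat D"
    and bs: "\<Omega> \<in> bisets C D" "\<Psi> \<in> bisets C D"
  shows "\<exists>\<theta> \<sigma>. biset_inv C D \<Omega> \<Psi> \<theta> \<sigma>"
proof -
  obtain \<theta> where bij: "\<And>x y. x \<in> Ob C \<Longrightarrow> y \<in> Ob D \<Longrightarrow> bij_betw (\<theta> x y) (bob \<Omega> x y) (bob \<Psi> x y)"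
    and nat: "\<And>\<alpha> \<beta> u. \<alpha> \<in> Ar C \<Longrightarrow> \<beta> \<in> Ar D \<Longrightarrow> u \<in> bob \<Omega> (src C \<alpha>) (tgt D \<beta>) \<Longrightarrow>
      \<theta> (tgt C \<alpha>) (src D \<beta>) (bmap \<Omega> \<alpha> \<beta> u) = bmap \<Psi> \<alpha> \<beta> (\<theta> (src C \<alpha>) (tgt D \<beta>) u)"
    using biset_iso_obtain[OF iso] by metis
  define \<sigma> where "\<sigma> x y = inv_into (bob \<Omega> x y) (\<theta> x y)" for x y
  have 1: "\<theta> x y u \<in> bob \<Psi> x y" "\<sigma> x y (\<theta> x y u) = u" if "u \<in> bob \<Omega> x y" for x y u
    using bij[of x y] that bisetsD(1,2)[OF bs(1) that] unfolding \<sigma>_def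
    by (auto simp: bij_betw_def intro: inv_into_f_f)
  have 2: "\<sigma> x y v \<in> bob \<Omega> x y" "\<theta> x y (\<sigma> x y v) = v" if "v \<in> bob \<Psi> x y" for x y v
  proof -
    have b: "bij_betw (\<theta> x y) (bob \<Omega> x y) (bob \<Psi> x y)" using bij bisetsD(1,2)[OF bs(2) that] by simp
    then have v: "v \<in> \<theta> x y ` bob \<Omega> x y" using that by (simp add: bij_betw_def)
    show "\<sigma> x y v \<in> bob \<Omega> x y" unfolding \<sigma>_def by (rule inv_into_into[OF v])
    show "\<theta> x y (\<sigma> x y v) = v" unfolding \<sigma>_def by (rule f_inv_into_f[OF v])
  qed
  have 3: "\<sigma> (tgt C \<alpha>) (src D \<beta>) (bmap \<Psi> \<alpha> \<beta> v) = bmap \<Omega> \<alpha> \<beta> (\<sigma> (src C \<alpha>) (tgt D \<beta>) v)"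
    if a: "\<alpha> \<in> Ar C" "\<beta> \<in> Ar D" and v: "v \<in> bob \<Psi> (src C \<alpha>) (tgt D \<beta>)" for \<alpha> \<beta> v
  proof -
    let ?u = "\<sigma> (src C \<alpha>) (tgt D \<beta>) v"
    have "bmap \<Psi> \<alpha> \<beta> v = \<theta> (tgt C \<alpha>) (src D \<beta>) (bmap \<Omega> \<alpha> \<beta> ?u)"
      using nat[OF a 2(1)[OF v]] 2(2)[OF v] by simp
    then show ?thesis using 1(2) bisetsD(4)[OF bs(1) a 2(1)[OF v]] by simp
  qed
  have "biset_inv C D \<Omega> \<Psi> \<theta> \<sigma>"
    unfolding biset_inv_def by (intro conjI allI ballI) (simp_all add: 1 2 3 nat)
  then show ?thesis by blast
qed

section \<open>Composition of bisets\<close>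

locale bpair =
  fixes C D E :: fcat and \<Omega> \<Psi> :: biset
  assumes cats [simp]: "fincat C" "fincat D" "fincat E"
    and bs: "\<Omega> \<in> bisets C D" "\<Psi> \<in> bisets D E"
begin

text \<open>The element \<open>[u, v]\<close> of the composite at \<open>(x, z)\<close>, represented
  by a pair with middle object \<open>y\<close>.\<close>

definition cc :: "nat \<Rightarrow> nat \<Rightarrow> nat \<Rightarrow> nat \<Rightarrow> nat \<Rightarrow> nat" where
  "cc x z y u v = set_encode (bcomp_eq C D E \<Omega> \<Psi> x z `` {\<langle>y, \<langle>u, v\<rangle>\<rangle>})"

lemmas bL [simp] = bisetsD(3-6)[OF bs(1)]
lemmas bR [simp] = bisetsD(3-6)[OF bs(2)]
lemmas oL = bisetsD(1,2)[OF bs(1)]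
lemmas oR = bisetsD(1,2)[OF bs(2)]

lemma dom_iff: "t \<in> bcomp_dom D \<Omega> \<Psi> x z \<longleftrightarrow>
    pi1 (pi2 t) \<in> bob \<Omega> x (pi1 t) \<and> pi2 (pi2 t) \<in> bob \<Psi> (pi1 t) z"
proof
  assume "pi1 (pi2 t) \<in> bob \<Omega> x (pi1 t) \<and> pi2 (pi2 t) \<in> bob \<Psi> (pi1 t) z"
  moreover have "t = \<langle>pi1 t, \<langle>pi1 (pi2 t), pi2 (pi2 t)\<rangle>\<rangle>" by simp
  ultimately show "t \<in> bcomp_dom D \<Omega> \<Psi> x z" unfolding bcomp_dom_def using oL(2) by blast
qed (auto simp: bcomp_dom_def)

lemma dom_finite: "finite (bcomp_dom D \<Omega> \<Psi> x z)"
proof -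
  have "bcomp_dom D \<Omega> \<Psi> x z \<subseteq>
      (\<lambda>(y, u, v). \<langle>y, \<langle>u, v\<rangle>\<rangle>) ` (SIGMA y:Ob D. bob \<Omega> x y \<times> bob \<Psi> y z)"
    by (force simp: bcomp_dom_def)
  then show ?thesis by (rule finite_subset) auto
qed

lemma rel_dom:
  assumes "x \<in> Ob C" "z \<in> Ob E" "(s, t) \<in> bcomp_rel C D E \<Omega> \<Psi> x z"
  shows "s \<in> bcomp_dom D \<Omega> \<Psi> x z" "t \<in> bcomp_dom D \<Omega> \<Psi> x z"
  using assms by (auto simp: bcomp_rel_def dom_iff)

lemma eq_dom:
  assumes "x \<in> Ob C" "z \<in> Ob E" "(s, t) \<in> bcomp_eq C D E \<Omega> \<Psi> x z" "s \<in> bcomp_dom D \<Omega> \<Psi> x z"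
  shows "t \<in> bcomp_dom D \<Omega> \<Psi> x z"
  using assms(3,4) unfolding bcomp_eq_def
  by (induction rule: rtrancl_induct) (use rel_dom assms(1,2) in auto)

lemma eq_sym: "(s, t) \<in> bcomp_eq C D E \<Omega> \<Psi> x z \<Longrightarrow> (t, s) \<in> bcomp_eq C D E \<Omega> \<Psi> x z"
proof -
  have "sym (bcomp_eq C D E \<Omega> \<Psi> x z)"
    unfolding bcomp_eq_def by (rule sym_rtrancl) (auto simp: sym_def)
  then show "(s, t) \<in> bcomp_eq C D E \<Omega> \<Psi> x z \<Longrightarrow> (t, s) \<in> bcomp_eq C D E \<Omega> \<Psi> x z"
    by (auto simp: sym_def)
qed

lemma eq_trans: "(s, t) \<in> bcomp_eq C D E \<Omega> \<Psi> x z \<Longrightarrow> (t, r) \<in> bcomp_eq C D E \<Omega> \<Psi> x z \<Longrightarrow>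
    (s, r) \<in> bcomp_eq C D E \<Omega> \<Psi> x z"
  unfolding bcomp_eq_def by (rule rtrancl_trans)

lemma class_eq_iff: "bcomp_eq C D E \<Omega> \<Psi> x z `` {s} = bcomp_eq C D E \<Omega> \<Psi> x z `` {t} \<longleftrightarrow>
    (s, t) \<in> bcomp_eq C D E \<Omega> \<Psi> x z"
proof
  assume "bcomp_eq C D E \<Omega> \<Psi> x z `` {s} = bcomp_eq C D E \<Omega> \<Psi> x z `` {t}"
  moreover have "(t, t) \<in> bcomp_eq C D E \<Omega> \<Psi> x z" by (simp add: bcomp_eq_def)
  ultimately show "(s, t) \<in> bcomp_eq C D E \<Omega> \<Psi> x z" by blast
qed (use eq_trans eq_sym in blast)

text \<open>\<open>set_encode\<close> is injective only on finite sets, so codes of classes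
  determine the classes only because of this.\<close>

lemma class_finite:
  assumes "x \<in> Ob C" "z \<in> Ob E" "s \<in> bcomp_dom D \<Omega> \<Psi> x z"
  shows "finite (bcomp_eq C D E \<Omega> \<Psi> x z `` {s})"
  by (rule finite_subset[OF _ dom_finite[of x z]]) (use eq_dom assms in blast)

lemma cc_eq_iff:
  assumes "u \<in> bob \<Omega> x y" "v \<in> bob \<Psi> y z" "u' \<in> bob \<Omega> x y'" "v' \<in> bob \<Psi> y' z"
  shows "cc x z y u v = cc x z y' u' v' \<longleftrightarrow> (\<langle>y, \<langle>u, v\<rangle>\<rangle>, \<langle>y', \<langle>u', v'\<rangle>\<rangle>) \<in> bcomp_eq C D E \<Omega> \<Psi> x z"
proof -
  have o: "x \<in> Ob C" "z \<in> Ob E" using assms oL oR by auto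
  have "cc x z y u v = cc x z y' u' v' \<longleftrightarrow>
      bcomp_eq C D E \<Omega> \<Psi> x z `` {\<langle>y, \<langle>u, v\<rangle>\<rangle>} = bcomp_eq C D E \<Omega> \<Psi> x z `` {\<langle>y', \<langle>u', v'\<rangle>\<rangle>}"
    unfolding cc_def using class_finite[OF o] assms
    by (intro inj_on_eq_iff[OF inj_on_set_encode]) (auto simp: dom_iff)
  then show ?thesis by (simp add: class_eq_iff)
qed

lemma cc_balance:
  assumes "\<beta> \<in> Ar D" "u \<in> bob \<Omega> x (tgt D \<beta>)" "v \<in> bob \<Psi> (src D \<beta>) z"
  shows "cc x z (src D \<beta>) (bmap \<Omega> (ident C x) \<beta> u) v = cc x z (tgt D \<beta>) u (bmap \<Psi> \<beta> (ident E z) v)"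
proof -
  have o: "x \<in> Ob C" "z \<in> Ob E" using assms oL oR by auto
  have "(\<langle>src D \<beta>, \<langle>bmap \<Omega> (ident C x) \<beta> u, v\<rangle>\<rangle>, \<langle>tgt D \<beta>, \<langle>u, bmap \<Psi> \<beta> (ident E z) v\<rangle>\<rangle>)
      \<in> bcomp_eq C D E \<Omega> \<Psi> x z"
    unfolding bcomp_eq_def using assms by (intro r_into_rtrancl) (auto simp: bcomp_rel_def)
  then show ?thesis using assms o by (subst cc_eq_iff) auto
qed

text \<open>Universal property of the quotient as a transfer of equations: a formula that respects
  each elementary relation is constant along every zigzag of them. It serves both to define maps on
  classes and to prove injectivity by applying an inverse formula.\<close>

lemma cc_lift:
  assumes "cc x z y u v = cc x z y' u' v'"
    and "u \<in> bob \<Omega> x y" "v \<in> bob \<Psi> y z" "u' \<in> bob \<Omega> x y'" "v' \<in> bob \<Psi> y' z"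
    and bal: "\<And>\<beta> u v. \<beta> \<in> Ar D \<Longrightarrow> u \<in> bob \<Omega> x (tgt D \<beta>) \<Longrightarrow> v \<in> bob \<Psi> (src D \<beta>) z \<Longrightarrow>
      \<theta> (src D \<beta>) (bmap \<Omega> (ident C x) \<beta> u) v = \<theta> (tgt D \<beta>) u (bmap \<Psi> \<beta> (ident E z) v)"
  shows "\<theta> y u v = \<theta> y' u' v'"
proof -
  define T where "T t = \<theta> (pi1 t) (pi1 (pi2 t)) (pi2 (pi2 t))" for t
  have r: "(s, t) \<in> bcomp_rel C D E \<Omega> \<Psi> x z \<Longrightarrow> T s = T t" for s t
    using bal by (auto simp: bcomp_rel_def T_def)
  have "(\<langle>y, \<langle>u, v\<rangle>\<rangle>, \<langle>y', \<langle>u', v'\<rangle>\<rangle>) \<in> bcomp_eq C D E \<Omega> \<Psi> x z"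
    using assms(1-5) by (simp add: cc_eq_iff)
  then have "T \<langle>y, \<langle>u, v\<rangle>\<rangle> = T \<langle>y', \<langle>u', v'\<rangle>\<rangle>"
    unfolding bcomp_eq_def
  proof (induction rule: rtrancl_induct)
    case (step s t)
    then show ?case using r[of s t] r[of t s] by auto
  qed simp
  then show ?thesis by (simp add: T_def)
qed

lemma bob_bcomp: "k \<in> bob (bcomp C D E \<Omega> \<Psi>) x z \<longleftrightarrow>
    (\<exists>y u v. u \<in> bob \<Omega> x y \<and> v \<in> bob \<Psi> y z \<and> k = cc x z y u v)"
proof
  assume "k \<in> bob (bcomp C D E \<Omega> \<Psi>) x z"
  then obtain t where t: "t \<in> bcomp_dom D \<Omega> \<Psi> x z" "k = set_encode (bcomp_eq C D E \<Omega> \<Psi> x z `` {t})"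
    by (auto simp: bcomp_def quotient_def)
  then show "\<exists>y u v. u \<in> bob \<Omega> x y \<and> v \<in> bob \<Psi> y z \<and> k = cc x z y u v"
    by (intro exI[of _ "pi1 t"] exI[of _ "pi1 (pi2 t)"] exI[of _ "pi2 (pi2 t)"])
      (auto simp: dom_iff cc_def)
next
  assume "\<exists>y u v. u \<in> bob \<Omega> x y \<and> v \<in> bob \<Psi> y z \<and> k = cc x z y u v"
  then obtain y u v where *: "u \<in> bob \<Omega> x y" "v \<in> bob \<Psi> y z" "k = cc x z y u v" by blast
  then have "\<langle>y, \<langle>u, v\<rangle>\<rangle> \<in> bcomp_dom D \<Omega> \<Psi> x z" by (simp add: dom_iff)
  then show "k \<in> bob (bcomp C D E \<Omega> \<Psi>) x z"
    using * oL oR by (auto simp: bcomp_def cc_def quotient_def)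
qed

lemma cc_bob: "u \<in> bob \<Omega> x y \<Longrightarrow> v \<in> bob \<Psi> y z \<Longrightarrow> cc x z y u v \<in> bob (bcomp C D E \<Omega> \<Psi>) x z"
  by (auto simp: bob_bcomp)

lemma bmap_bcomp:
  assumes "\<alpha> \<in> Ar C" "\<gamma> \<in> Ar E" "u \<in> bob \<Omega> (src C \<alpha>) y" "v \<in> bob \<Psi> y (tgt E \<gamma>)"
  shows "bmap (bcomp C D E \<Omega> \<Psi>) \<alpha> \<gamma> (cc (src C \<alpha>) (tgt E \<gamma>) y u v) =
    cc (tgt C \<alpha>) (src E \<gamma>) y (bmap \<Omega> \<alpha> (ident D y) u) (bmap \<Psi> (ident D y) \<gamma> v)"
proof -
  let ?x = "src C \<alpha>" and ?z = "tgt E \<gamma>" and ?x' = "tgt C \<alpha>" and ?z' = "src E \<gamma>"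
  let ?e = "bcomp_eq C D E \<Omega> \<Psi> ?x ?z" and ?e' = "bcomp_eq C D E \<Omega> \<Psi> ?x' ?z'"
  define \<phi> where "\<phi> t = (let y = pi1 t; u = pi1 (pi2 t); v = pi2 (pi2 t)
      in \<langle>y, \<langle>bmap \<Omega> \<alpha> (ident D y) u, bmap \<Psi> (ident D y) \<gamma> v\<rangle>\<rangle>)" for t
  have o: "y \<in> Ob D" "?x \<in> Ob C" "?z \<in> Ob E" "?x' \<in> Ob C" "?z' \<in> Ob E"
    using assms oL oR by auto
  let ?t = "\<langle>y, \<langle>u, v\<rangle>\<rangle>"
  have fin: "finite (?e `` {?t})" using class_finite[OF o(2,3)] assms by (simp add: dom_iff)
  \<comment> \<open>The action sends an elementary relation to an elementary relation, since the
    actions of \<open>\<alpha>\<close> and \<open>\<gamma>\<close> commute with that of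
    \<open>\<beta>\<close>.\<close>
  have rel: "(\<phi> s, \<phi> t) \<in> bcomp_rel C D E \<Omega> \<Psi> ?x' ?z'" if st: "(s, t) \<in> bcomp_rel C D E \<Omega> \<Psi> ?x ?z" for s t
  proof -
    obtain \<beta> u v where b: "\<beta> \<in> Ar D" "u \<in> bob \<Omega> ?x (tgt D \<beta>)" "v \<in> bob \<Psi> (src D \<beta>) ?z"
      and s: "s = \<langle>src D \<beta>, \<langle>bmap \<Omega> (ident C ?x) \<beta> u, v\<rangle>\<rangle>"
      and t: "t = \<langle>tgt D \<beta>, \<langle>u, bmap \<Psi> \<beta> (ident E ?z) v\<rangle>\<rangle>"
      using st by (auto simp: bcomp_rel_def)
    have "\<phi> s = \<langle>src D \<beta>, \<langle>bmap \<Omega> (ident C ?x') \<beta> (bmap \<Omega> \<alpha> (ident D (tgt D \<beta>)) u),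
        bmap \<Psi> (ident D (src D \<beta>)) \<gamma> v\<rangle>\<rangle>"
      unfolding \<phi>_def s using b assms o by (simp add: Let_def)
    moreover have "\<phi> t = \<langle>tgt D \<beta>, \<langle>bmap \<Omega> \<alpha> (ident D (tgt D \<beta>)) u,
        bmap \<Psi> \<beta> (ident E ?z') (bmap \<Psi> (ident D (src D \<beta>)) \<gamma> v)\<rangle>\<rangle>"
      unfolding \<phi>_def t using b assms o by (simp add: Let_def)
    ultimately show ?thesis unfolding bcomp_rel_def using b assms o by fastforce
  qed
  have eq: "(\<phi> s, \<phi> t) \<in> ?e'" if "(s, t) \<in> ?e" for s t
    using that unfolding bcomp_eq_def
  proof (induction rule: rtrancl_induct)
    case (step t r)
    then have "(\<phi> t, \<phi> r) \<in> bcomp_rel C D E \<Omega> \<Psi> ?x' ?z' \<union> (bcomp_rel C D E \<Omega> \<Psi> ?x' ?z')\<inverse>"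
      using rel by auto
    then show ?case using step.IH by (meson rtrancl.rtrancl_into_rtrancl)
  qed simp
  \<comment> \<open>\<open>bmap\<close> saturates the image of the whole class. By \<open>eq\<close>
    all members have equivalent images, so the result is the class of the image of one
    member.\<close>
  have "?e' `` (\<phi> ` (?e `` {?t})) = ?e' `` {\<phi> ?t}"
  proof
    show "?e' `` (\<phi> ` (?e `` {?t})) \<subseteq> ?e' `` {\<phi> ?t}" using eq eq_trans by blast
    have "?t \<in> ?e `` {?t}" by (auto simp: bcomp_eq_def)
    then show "?e' `` {\<phi> ?t} \<subseteq> ?e' `` (\<phi> ` (?e `` {?t}))" by blast
  qed
  moreover have "cc ?x ?z y u v \<in> set_encode ` (bcomp_dom D \<Omega> \<Psi> ?x ?z // ?e)"
    using cc_bob[OF assms(3,4)] by (simp add: bcomp_def)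
  ultimately show ?thesis
    using assms fin unfolding bcomp_def
    by (subst bmap_norm) (auto simp: cc_def \<phi>_def[symmetric] set_encode_inverse, auto simp: \<phi>_def)
qed

lemma bmap_bcomp':
  assumes "\<alpha> \<in> Ar C" "\<gamma> \<in> Ar E" "u \<in> bob \<Omega> x y" "v \<in> bob \<Psi> y z" "x = src C \<alpha>" "z = tgt E \<gamma>"
  shows "bmap (bcomp C D E \<Omega> \<Psi>) \<alpha> \<gamma> (cc x z y u v) =
    cc (tgt C \<alpha>) (src E \<gamma>) y (bmap \<Omega> \<alpha> (ident D y) u) (bmap \<Psi> (ident D y) \<gamma> v)"
  using bmap_bcomp assms by simp

lemma bcomp_bisets: "bcomp C D E \<Omega> \<Psi> \<in> bisets C E"
proof -
  \<comment> \<open>The record before normalisation gets a name, because \<open>bisetsI\<close>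
    speaks of an arbitrary record inside \<open>norm_biset\<close>.\<close>
  define B where "B = \<lparr>bob = (\<lambda>x z. set_encode ` (bcomp_dom D \<Omega> \<Psi> x z // bcomp_eq C D E \<Omega> \<Psi> x z)),
     bmap = (\<lambda>\<alpha> \<gamma> k. set_encode (bcomp_eq C D E \<Omega> \<Psi> (tgt C \<alpha>) (src E \<gamma>) ``
        ((\<lambda>t. let y = pi1 t; u = pi1 (pi2 t); v = pi2 (pi2 t)
              in \<langle>y, \<langle>bmap \<Omega> \<alpha> (ident D y) u, bmap \<Psi> (ident D y) \<gamma> v\<rangle>\<rangle>) ` set_decode k)))\<rparr>"
  have B: "bcomp C D E \<Omega> \<Psi> = norm_biset C E B" by (simp add: bcomp_def B_def)
  have ob: "k \<in> bob B x z \<longleftrightarrow> (\<exists>y u v. u \<in> bob \<Omega> x y \<and> v \<in> bob \<Psi> y z \<and> k = cc x z y u v)"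
    if "x \<in> Ob C" "z \<in> Ob E" for k x z
    using bob_bcomp[of k x z] that unfolding B by simp
  have bm: "bmap B \<alpha> \<gamma> (cc x z y u v) =
      cc (tgt C \<alpha>) (src E \<gamma>) y (bmap \<Omega> \<alpha> (ident D y) u) (bmap \<Psi> (ident D y) \<gamma> v)"
    if "\<alpha> \<in> Ar C" "\<gamma> \<in> Ar E" "u \<in> bob \<Omega> x y" "v \<in> bob \<Psi> y z" "x = src C \<alpha>" "z = tgt E \<gamma>" for \<alpha> \<gamma> u v x y z
    using bmap_bcomp'[OF that] that ob unfolding B by (subst (asm) bmap_norm) auto
  show ?thesis
    unfolding B
  proof (rule bisetsI)
    fix x y assume "x \<in> Ob C" "y \<in> Ob E"
    show "finite (bob B x y)"
      using dom_finite by (simp add: B_def quotient_def)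
  next
    fix \<alpha> \<beta> u assume a: "\<alpha> \<in> Ar C" "\<beta> \<in> Ar E" "u \<in> bob B (src C \<alpha>) (tgt E \<beta>)"
    then obtain y p q where *: "p \<in> bob \<Omega> (src C \<alpha>) y" "q \<in> bob \<Psi> y (tgt E \<beta>)" "u = cc (src C \<alpha>) (tgt E \<beta>) y p q"
      using ob by auto
    have "bmap B \<alpha> \<beta> u = cc (tgt C \<alpha>) (src E \<beta>) y (bmap \<Omega> \<alpha> (ident D y) p) (bmap \<Psi> (ident D y) \<beta> q)"
      using * a by (simp only: bm)
    moreover have "bmap \<Omega> \<alpha> (ident D y) p \<in> bob \<Omega> (tgt C \<alpha>) y" "bmap \<Psi> (ident D y) \<beta> q \<in> bob \<Psi> y (src E \<beta>)"
      using * a oL(2)[OF *(1)] by auto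
    ultimately show "bmap B \<alpha> \<beta> u \<in> bob B (tgt C \<alpha>) (src E \<beta>)"
      using a by (subst ob) auto
  next
    fix x y u assume a: "x \<in> Ob C" "y \<in> Ob E" "u \<in> bob B x y"
    then obtain d p q where *: "p \<in> bob \<Omega> x d" "q \<in> bob \<Psi> d y" "u = cc x y d p q"
      using ob by auto
    then show "bmap B (ident C x) (ident E y) u = u"
      using a bm[OF _ _ *(1,2), of "ident C x" "ident E y"] by simp
  next
    fix \<alpha> \<alpha>' \<beta> \<beta>' u
    assume a: "\<alpha> \<in> Ar C" "\<alpha>' \<in> Ar C" "\<beta> \<in> Ar E" "\<beta>' \<in> Ar E" "tgt C \<alpha> = src C \<alpha>'"
      "tgt E \<beta>' = src E \<beta>" "u \<in> bob B (src C \<alpha>) (tgt E \<beta>)"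
    then obtain y p q where *: "p \<in> bob \<Omega> (src C \<alpha>) y" "q \<in> bob \<Psi> y (tgt E \<beta>)" "u = cc (src C \<alpha>) (tgt E \<beta>) y p q"
      using ob by auto
    then show "bmap B (cmp C \<alpha>' \<alpha>) (cmp E \<beta> \<beta>') u = bmap B \<alpha>' \<beta>' (bmap B \<alpha> \<beta> u)"
      using a oL(2)[OF *(1)] by (simp add: bm)
  qed auto
qed

text \<open>Reduces an isomorphism out of a composite to a formula \<open>\<theta>\<close> on
  representing pairs. The map \<open>G\<close> on classes picks some representative, and
  \<open>cc_lift\<close> shows that any other gives the same value. In applications
  \<open>inj\<close> usually follows from a normal form of pairs or from a formula for the
  inverse.\<close>

lemma bcomp_iso:
  assumes \<Theta>: "\<Theta> \<in> bisets C E"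
    and cl: "\<And>x z y u v. u \<in> bob \<Omega> x y \<Longrightarrow> v \<in> bob \<Psi> y z \<Longrightarrow> \<theta> x z y u v \<in> bob \<Theta> x z"
    and bal: "\<And>x z \<beta> u v. \<beta> \<in> Ar D \<Longrightarrow> u \<in> bob \<Omega> x (tgt D \<beta>) \<Longrightarrow> v \<in> bob \<Psi> (src D \<beta>) z \<Longrightarrow>
      \<theta> x z (src D \<beta>) (bmap \<Omega> (ident C x) \<beta> u) v = \<theta> x z (tgt D \<beta>) u (bmap \<Psi> \<beta> (ident E z) v)"
    and nat: "\<And>\<alpha> \<gamma> y u v. \<alpha> \<in> Ar C \<Longrightarrow> \<gamma> \<in> Ar E \<Longrightarrow> u \<in> bob \<Omega> (src C \<alpha>) y \<Longrightarrow> v \<in> bob \<Psi> y (tgt E \<gamma>) \<Longrightarrow>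
      \<theta> (tgt C \<alpha>) (src E \<gamma>) y (bmap \<Omega> \<alpha> (ident D y) u) (bmap \<Psi> (ident D y) \<gamma> v) =
        bmap \<Theta> \<alpha> \<gamma> (\<theta> (src C \<alpha>) (tgt E \<gamma>) y u v)"
    and surj: "\<And>x z w. w \<in> bob \<Theta> x z \<Longrightarrow> \<exists>y u v. u \<in> bob \<Omega> x y \<and> v \<in> bob \<Psi> y z \<and> \<theta> x z y u v = w"
    and inj: "\<And>x z y u v y' u' v'. \<lbrakk>u \<in> bob \<Omega> x y; v \<in> bob \<Psi> y z; u' \<in> bob \<Omega> x y'; v' \<in> bob \<Psi> y' z;
      \<theta> x z y u v = \<theta> x z y' u' v'\<rbrakk> \<Longrightarrow> cc x z y u v = cc x z y' u' v'"
  shows "biset_iso C E (bcomp C D E \<Omega> \<Psi>) \<Theta>"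
proof -
  define G where "G x z k = (SOME w. \<exists>y u v. u \<in> bob \<Omega> x y \<and> v \<in> bob \<Psi> y z \<and> k = cc x z y u v \<and> w = \<theta> x z y u v)"
    for x z k
  have G: "G x z (cc x z y u v) = \<theta> x z y u v" if uv: "u \<in> bob \<Omega> x y" "v \<in> bob \<Psi> y z" for x z y u v
  proof -
    have "\<exists>y' u' v'. u' \<in> bob \<Omega> x y' \<and> v' \<in> bob \<Psi> y' z \<and> cc x z y u v = cc x z y' u' v' \<and>
        G x z (cc x z y u v) = \<theta> x z y' u' v'"
      unfolding G_def by (rule someI_ex) (use uv in blast)
    then obtain y' u' v' where *: "u' \<in> bob \<Omega> x y'" "v' \<in> bob \<Psi> y' z" "cc x z y u v = cc x z y' u' v'"
        "G x z (cc x z y u v) = \<theta> x z y' u' v'" by blast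
    have "\<theta> x z y u v = \<theta> x z y' u' v'"
      by (rule cc_lift[OF *(3) uv *(1,2)]) (rule bal)
    then show ?thesis using * by simp
  qed
  show ?thesis
  proof (rule biset_isoI[of _ _ G])
    fix x z assume "x \<in> Ob C" "z \<in> Ob E"
    show "bij_betw (G x z) (bob (bcomp C D E \<Omega> \<Psi>) x z) (bob \<Theta> x z)"
      unfolding bij_betw_def
    proof (intro conjI inj_onI equalityI subsetI)
      fix k k' assume k: "k \<in> bob (bcomp C D E \<Omega> \<Psi>) x z" "k' \<in> bob (bcomp C D E \<Omega> \<Psi>) x z" "G x z k = G x z k'"
      obtain y u v where *: "u \<in> bob \<Omega> x y" "v \<in> bob \<Psi> y z" "k = cc x z y u v"
        using k(1) bob_bcomp by blast
      obtain y' u' v' where w': "u' \<in> bob \<Omega> x y'" "v' \<in> bob \<Psi> y' z" "k' = cc x z y' u' v'"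
        using k(2) bob_bcomp by blast
      show "k = k'"
        unfolding *(3) w'(3) using k(3) by (intro inj * w') (simp add: G * w')
    next
      fix w assume "w \<in> G x z ` bob (bcomp C D E \<Omega> \<Psi>) x z"
      then show "w \<in> bob \<Theta> x z" by (auto simp: bob_bcomp G cl)
    next
      fix w assume "w \<in> bob \<Theta> x z"
      then obtain y u v where "u \<in> bob \<Omega> x y" "v \<in> bob \<Psi> y z" "\<theta> x z y u v = w" using surj by blast
      then show "w \<in> G x z ` bob (bcomp C D E \<Omega> \<Psi>) x z"
        by (intro image_eqI[of _ _ "cc x z y u v"]) (auto simp: G cc_bob)
    qed
  next
    fix \<alpha> \<gamma> k assume a: "\<alpha> \<in> Ar C" "\<gamma> \<in> Ar E" "k \<in> bob (bcomp C D E \<Omega> \<Psi>) (src C \<alpha>) (tgt E \<gamma>)"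
    then obtain y u v where *: "u \<in> bob \<Omega> (src C \<alpha>) y" "v \<in> bob \<Psi> y (tgt E \<gamma>)" "k = cc (src C \<alpha>) (tgt E \<gamma>) y u v"
      using bob_bcomp by auto
    then show "G (tgt C \<alpha>) (src E \<gamma>) (bmap (bcomp C D E \<Omega> \<Psi>) \<alpha> \<gamma> k) = bmap \<Theta> \<alpha> \<gamma> (G (src C \<alpha>) (tgt E \<gamma>) k)"
      using a oL(2)[OF *(1)] by (simp add: bmap_bcomp G nat)
  qed
qed

end

text \<open>The descended function itself, for fixed outer indices. Associativity needs it, because
  there a further element is held fixed as a parameter.\<close>

lemma (in bpair) cc_fun:
  assumes bal: "\<And>\<beta> u v. \<beta> \<in> Ar D \<Longrightarrow> u \<in> bob \<Omega> x (tgt D \<beta>) \<Longrightarrow> v \<in> bob \<Psi> (src D \<beta>) z \<Longrightarrow>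
      \<theta> (src D \<beta>) (bmap \<Omega> (ident C x) \<beta> u) v = \<theta> (tgt D \<beta>) u (bmap \<Psi> \<beta> (ident E z) v)"
  shows "\<exists>g. \<forall>y u v. u \<in> bob \<Omega> x y \<longrightarrow> v \<in> bob \<Psi> y z \<longrightarrow> g (cc x z y u v) = \<theta> y u v"
proof -
  define g where "g k = (SOME w. \<exists>y u v. u \<in> bob \<Omega> x y \<and> v \<in> bob \<Psi> y z \<and> k = cc x z y u v \<and> w = \<theta> y u v)" for k
  have "g (cc x z y u v) = \<theta> y u v" if uv: "u \<in> bob \<Omega> x y" "v \<in> bob \<Psi> y z" for y u v
  proof -
    have "\<exists>y' u' v'. u' \<in> bob \<Omega> x y' \<and> v' \<in> bob \<Psi> y' z \<and> cc x z y u v = cc x z y' u' v' \<and>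
        g (cc x z y u v) = \<theta> y' u' v'"
      unfolding g_def by (rule someI_ex) (use uv in blast)
    then obtain y' u' v' where *: "u' \<in> bob \<Omega> x y'" "v' \<in> bob \<Psi> y' z" "cc x z y u v = cc x z y' u' v'"
        "g (cc x z y u v) = \<theta> y' u' v'" by blast
    have "\<theta> y u v = \<theta> y' u' v'"
      by (rule cc_lift[OF *(3) uv *(1,2)]) (rule bal)
    then show ?thesis using * by simp
  qed
  then show ?thesis by blast
qed

section \<open>Disjoint unions, identity bisets and products\<close>

lemma bsum_bob: "s \<in> bob (bsum C D \<Omega> \<Psi>) x y \<longleftrightarrow> x \<in> Ob C \<and> y \<in> Ob D \<and>
    ((\<exists>u\<in>bob \<Omega> x y. s = sum_encode (Inl u)) \<or> (\<exists>v\<in>bob \<Psi> x y. s = sum_encode (Inr v)))"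
  by (auto simp: bsum_def)

lemma bsum_bmap [simp]:
  "\<lbrakk>\<alpha> \<in> Ar C; \<beta> \<in> Ar D; fincat C; fincat D; u \<in> bob \<Omega> (src C \<alpha>) (tgt D \<beta>)\<rbrakk> \<Longrightarrow>
    bmap (bsum C D \<Omega> \<Psi>) \<alpha> \<beta> (sum_encode (Inl u)) = sum_encode (Inl (bmap \<Omega> \<alpha> \<beta> u))"
  "\<lbrakk>\<alpha> \<in> Ar C; \<beta> \<in> Ar D; fincat C; fincat D; v \<in> bob \<Psi> (src C \<alpha>) (tgt D \<beta>)\<rbrakk> \<Longrightarrow>
    bmap (bsum C D \<Omega> \<Psi>) \<alpha> \<beta> (sum_encode (Inr v)) = sum_encode (Inr (bmap \<Psi> \<alpha> \<beta> v))"
  unfolding bsum_def by (subst bmap_norm; auto)+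

lemma sum_encode_simps [simp]:
  "sum_encode (Inl u) = sum_encode (Inl v) \<longleftrightarrow> u = v"
  "sum_encode (Inr u) = sum_encode (Inr v) \<longleftrightarrow> u = v"
  "sum_encode (Inl u) \<noteq> sum_encode (Inr v)" "sum_encode (Inr u) \<noteq> sum_encode (Inl v)"
  by (simp_all only: sum_encode_eq) simp_all

lemma bsum_bisets:
  assumes "fincat C" "fincat D" "\<Omega> \<in> bisets C D" "\<Psi> \<in> bisets C D"
  shows "bsum C D \<Omega> \<Psi> \<in> bisets C D"
  unfolding bsum_def
  by (rule bisetsI) (use assms in \<open>auto simp: bisetsD(3)[OF assms(3)] bisetsD(3)[OF assms(4)]
    bisetsD(4-6)[OF assms(3)] bisetsD(4-6)[OF assms(4)]\<close>)

lemma idb_bob [simp]: "fincat C \<Longrightarrow>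
    u \<in> bob (idb C) x y \<longleftrightarrow> u \<in> Ar C \<and> src C u = y \<and> tgt C u = x"
  by (auto simp: idb_def Hom_def)

lemma idb_bmap [simp]:
  "\<lbrakk>fincat C; \<alpha> \<in> Ar C; \<beta> \<in> Ar C; u \<in> Ar C; tgt C u = src C \<alpha>; src C u = tgt C \<beta>\<rbrakk> \<Longrightarrow>
    bmap (idb C) \<alpha> \<beta> u = cmp C \<alpha> (cmp C u \<beta>)"
  by (simp add: idb_def Hom_def)

lemma idb_bisets: assumes "fincat C" shows "idb C \<in> bisets C C"
proof -
  have "finite (Hom C y x)" for x y
    by (rule finite_subset[OF _ fincats_finite(2)[OF assms]]) (auto simp: Hom_def)
  then show ?thesis
    unfolding idb_def by (intro bisetsI) (use assms in \<open>auto simp: Hom_def\<close>)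
qed

lemma bprod_bob [simp]: "w \<in> bob (bprod C D C' D' \<Omega> \<Psi>) x y \<longleftrightarrow>
    (pi1 x \<in> Ob C \<and> pi2 x \<in> Ob C') \<and> (pi1 y \<in> Ob D \<and> pi2 y \<in> Ob D') \<and>
    pi1 w \<in> bob \<Omega> (pi1 x) (pi1 y) \<and> pi2 w \<in> bob \<Psi> (pi2 x) (pi2 y)"
  by (simp add: bprod_def prod_encode_image)

lemma bprod_bmap [simp]:
  "\<lbrakk>pi1 \<alpha> \<in> Ar C; pi2 \<alpha> \<in> Ar C'; pi1 \<beta> \<in> Ar D; pi2 \<beta> \<in> Ar D';
    pi1 w \<in> bob \<Omega> (src C (pi1 \<alpha>)) (tgt D (pi1 \<beta>)); pi2 w \<in> bob \<Psi> (src C' (pi2 \<alpha>)) (tgt D' (pi2 \<beta>))\<rbrakk> \<Longrightarrow>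
    bmap (bprod C D C' D' \<Omega> \<Psi>) \<alpha> \<beta> w =
      \<langle>bmap \<Omega> (pi1 \<alpha>) (pi1 \<beta>) (pi1 w), bmap \<Psi> (pi2 \<alpha>) (pi2 \<beta>) (pi2 w)\<rangle>"
  by (simp add: bprod_def prod_encode_image)

lemma bprod_bisets:
  assumes "fincat C" "fincat D" "fincat C'" "fincat D'" and \<Omega>: "\<Omega> \<in> bisets C D" and \<Psi>: "\<Psi> \<in> bisets C' D'"
  shows "bprod C D C' D' \<Omega> \<Psi> \<in> bisets (C \<times>\<^sub>c C') (D \<times>\<^sub>c D')"
  unfolding bprod_def
  by (rule bisetsI)
    (use assms in \<open>auto simp: prod_encode_image bisetsD(3-6)[OF \<Omega>] bisetsD(3-6)[OF \<Psi>]\<close>)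

text \<open>Relabelling: \<open>p\<close> and \<open>q\<close> are the two components of a functor \<open>C \<times> E\<^sup>o\<^sup>p \<rightarrow> C' \<times> E'\<^sup>o\<^sup>p\<close>, applied to objects and to morphisms.\<close>

definition rl :: "fcat \<Rightarrow> fcat \<Rightarrow> (nat \<Rightarrow> nat \<Rightarrow> nat) \<Rightarrow> (nat \<Rightarrow> nat \<Rightarrow> nat) \<Rightarrow> biset \<Rightarrow> biset" where
  "rl C E p q \<Omega> = norm_biset C E
    \<lparr>bob = (\<lambda>x z. bob \<Omega> (p x z) (q x z)), bmap = (\<lambda>\<alpha> \<gamma>. bmap \<Omega> (p \<alpha> \<gamma>) (q \<alpha> \<gamma>))\<rparr>"

lemma rl_bob [simp]: "u \<in> bob (rl C E p q \<Omega>) x z \<longleftrightarrow> x \<in> Ob C \<and> z \<in> Ob E \<and> u \<in> bob \<Omega> (p x z) (q x z)"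
  by (simp add: rl_def)

lemma rl_bmap [simp]: "\<lbrakk>\<alpha> \<in> Ar C; \<gamma> \<in> Ar E; u \<in> bob \<Omega> (p (src C \<alpha>) (tgt E \<gamma>)) (q (src C \<alpha>) (tgt E \<gamma>))\<rbrakk> \<Longrightarrow>
    bmap (rl C E p q \<Omega>) \<alpha> \<gamma> u = bmap \<Omega> (p \<alpha> \<gamma>) (q \<alpha> \<gamma>) u"
  by (simp add: rl_def)

text \<open>Functoriality of the pair \<open>(p, q)\<close>. Each component depends on both
  arguments, so that a factor may cross from the covariant to the contravariant side: duality and
  bending are instances, as is restriction along a functor on either side.\<close>

locale relab =
  fixes C E C' E' :: fcat and p q :: "nat \<Rightarrow> nat \<Rightarrow> nat"
  assumes rcats [simp]: "fincat C" "fincat E" "fincat C'" "fincat E'"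
    and rOb [simp]: "x \<in> Ob C \<Longrightarrow> z \<in> Ob E \<Longrightarrow> p x z \<in> Ob C'" "x \<in> Ob C \<Longrightarrow> z \<in> Ob E \<Longrightarrow> q x z \<in> Ob E'"
    and rAr [simp]: "\<alpha> \<in> Ar C \<Longrightarrow> \<gamma> \<in> Ar E \<Longrightarrow> p \<alpha> \<gamma> \<in> Ar C'" "\<alpha> \<in> Ar C \<Longrightarrow> \<gamma> \<in> Ar E \<Longrightarrow> q \<alpha> \<gamma> \<in> Ar E'"
      "\<alpha> \<in> Ar C \<Longrightarrow> \<gamma> \<in> Ar E \<Longrightarrow> src C' (p \<alpha> \<gamma>) = p (src C \<alpha>) (tgt E \<gamma>)"
      "\<alpha> \<in> Ar C \<Longrightarrow> \<gamma> \<in> Ar E \<Longrightarrow> tgt C' (p \<alpha> \<gamma>) = p (tgt C \<alpha>) (src E \<gamma>)"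
      "\<alpha> \<in> Ar C \<Longrightarrow> \<gamma> \<in> Ar E \<Longrightarrow> tgt E' (q \<alpha> \<gamma>) = q (src C \<alpha>) (tgt E \<gamma>)"
      "\<alpha> \<in> Ar C \<Longrightarrow> \<gamma> \<in> Ar E \<Longrightarrow> src E' (q \<alpha> \<gamma>) = q (tgt C \<alpha>) (src E \<gamma>)"
    and rId [simp]: "x \<in> Ob C \<Longrightarrow> z \<in> Ob E \<Longrightarrow> p (ident C x) (ident E z) = ident C' (p x z)"
      "x \<in> Ob C \<Longrightarrow> z \<in> Ob E \<Longrightarrow> q (ident C x) (ident E z) = ident E' (q x z)"
    and rCmp [simp]: "\<lbrakk>\<alpha> \<in> Ar C; \<alpha>' \<in> Ar C; \<gamma> \<in> Ar E; \<gamma>' \<in> Ar E; tgt C \<alpha> = src C \<alpha>'; tgt E \<gamma>' = src E \<gamma>\<rbrakk> \<Longrightarrow>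
        p (cmp C \<alpha>' \<alpha>) (cmp E \<gamma> \<gamma>') = cmp C' (p \<alpha>' \<gamma>') (p \<alpha> \<gamma>)"
      "\<lbrakk>\<alpha> \<in> Ar C; \<alpha>' \<in> Ar C; \<gamma> \<in> Ar E; \<gamma>' \<in> Ar E; tgt C \<alpha> = src C \<alpha>'; tgt E \<gamma>' = src E \<gamma>\<rbrakk> \<Longrightarrow>
        q (cmp C \<alpha>' \<alpha>) (cmp E \<gamma> \<gamma>') = cmp E' (q \<alpha> \<gamma>) (q \<alpha>' \<gamma>')"
begin

lemma rl_bisets: assumes "\<Omega> \<in> bisets C' E'" shows "rl C E p q \<Omega> \<in> bisets C E"
  unfolding rl_def
  by (rule bisetsI) (auto simp: bisetsD(3-6)[OF assms])

lemma rl_iso: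
  assumes "biset_iso C' E' \<Omega> \<Psi>" "\<Omega> \<in> bisets C' E'" "\<Psi> \<in> bisets C' E'"
  shows "biset_iso C E (rl C E p q \<Omega>) (rl C E p q \<Psi>)"
proof -
  obtain \<theta> \<sigma> where inv: "biset_inv C' E' \<Omega> \<Psi> \<theta> \<sigma>" using biset_iso_inv assms by (metis rcats(3,4))
  show ?thesis
  proof (rule biset_isoI[of _ _ "\<lambda>x z. \<theta> (p x z) (q x z)"])
    show "bij_betw (\<theta> (p x z) (q x z)) (bob (rl C E p q \<Omega>) x z) (bob (rl C E p q \<Psi>) x z)"
      if "x \<in> Ob C" "z \<in> Ob E" for x z
      by (rule bij_betw_byWitness[of _ "\<sigma> (p x z) (q x z)"]) (use that in \<open>auto simp: biset_invD[OF inv]\<close>)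
  qed (auto simp: biset_invD[OF inv])
qed

lemma rl_bsum:
  assumes "\<Omega> \<in> bisets C' E'" "\<Psi> \<in> bisets C' E'"
  shows "rl C E p q (bsum C' E' \<Omega> \<Psi>) = bsum C E (rl C E p q \<Omega>) (rl C E p q \<Psi>)"
  by (rule biset_eqI[of _ C E])
    (use assms in \<open>auto simp: bsum_bob intro!: rl_bisets bsum_bisets\<close>)

end

lemma rl_rl:
  assumes "relab C E C' E' p q" "relab C' E' C'' E'' p' q'" "\<Omega> \<in> bisets C'' E''"
  shows "rl C E p q (rl C' E' p' q' \<Omega>) = rl C E (\<lambda>x z. p' (p x z) (q x z)) (\<lambda>x z. q' (p x z) (q x z)) \<Omega>"
proof -
  interpret A: relab C E C' E' p q by fact
  interpret B: relab C' E' C'' E'' p' q' by fact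
  show ?thesis unfolding rl_def norm_biset_def by (auto simp: fun_eq_iff)
qed

lemma rl_cong:
  assumes "fincat C" "fincat E"
    and "\<And>x z. x \<in> Ob C \<Longrightarrow> z \<in> Ob E \<Longrightarrow> p x z = p' x z \<and> q x z = q' x z"
    and "\<And>x z. x \<in> Ar C \<Longrightarrow> z \<in> Ar E \<Longrightarrow> p x z = p' x z \<and> q x z = q' x z"
  shows "rl C E p q \<Omega> = rl C E p' q' \<Omega>"
  unfolding rl_def norm_biset_def using assms by (auto simp: fun_eq_iff)

lemma rl_id: "\<Omega> \<in> bisets C E \<Longrightarrow> rl C E (\<lambda>x z. x) (\<lambda>x z. z) \<Omega> = \<Omega>"
proof -
  have "\<lparr>bob = bob \<Omega>, bmap = bmap \<Omega>\<rparr> = \<Omega>" by (rule biset.equality) simp_all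
  then show "\<Omega> \<in> bisets C E \<Longrightarrow> rl C E (\<lambda>x z. x) (\<lambda>x z. z) \<Omega> = \<Omega>"
    unfolding rl_def by (simp only: bisetsD(7))
qed

section \<open>Functors and their bisets\<close>

locale functr =
  fixes C D :: fcat and F :: "nat \<Rightarrow> nat"
  assumes fcats [simp]: "fincat C" "fincat D"
    and fOb [simp]: "x \<in> Ob C \<Longrightarrow> F x \<in> Ob D"
    and fAr [simp]: "f \<in> Ar C \<Longrightarrow> F f \<in> Ar D"
    and fsrc [simp]: "f \<in> Ar C \<Longrightarrow> src D (F f) = F (src C f)"
    and ftgt [simp]: "f \<in> Ar C \<Longrightarrow> tgt D (F f) = F (tgt C f)"
    and fident [simp]: "x \<in> Ob C \<Longrightarrow> F (ident C x) = ident D (F x)"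
    and fcmp [simp]: "\<lbrakk>f \<in> Ar C; g \<in> Ar C; tgt C f = src C g\<rbrakk> \<Longrightarrow> F (cmp C g f) = cmp D (F g) (F f)"

lemma relab_right: "functr E D F \<Longrightarrow> fincat C \<Longrightarrow> relab C E C D (\<lambda>x z. x) (\<lambda>x z. F z)"
  unfolding functr_def relab_def by simp

lemma relab_left: "functr C D G \<Longrightarrow> fincat E \<Longrightarrow> relab C E D E (\<lambda>x z. G x) (\<lambda>x z. z)"
  unfolding functr_def relab_def by simp

text \<open>The biset \<open>(x, z) \<mapsto> Hom(F z, x)\<close>. In the convention of
  \<open>bhom\<close> it represents an arrow from \<open>C\<close> to \<open>D\<close>, in the
  direction of \<open>F\<close>.\<close>

definition fb :: "fcat \<Rightarrow> fcat \<Rightarrow> (nat \<Rightarrow> nat) \<Rightarrow> biset" where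
  "fb D C F = rl D C (\<lambda>x z. x) (\<lambda>x z. F z) (idb D)"

lemma fb_bisets: "functr C D F \<Longrightarrow> fb D C F \<in> bisets D C"
  unfolding fb_def
  by (rule relab.rl_bisets[OF relab_right[of C D F D]]) (auto simp: functr_def intro: idb_bisets)

lemma fb_id: "fincat C \<Longrightarrow> fb C C (\<lambda>x. x) = idb C"
  unfolding fb_def by (intro rl_id idb_bisets)

text \<open>Density formula: \<open>[u, v] = [u v, 1]\<close>, so every class has exactly one
  representative with middle object \<open>F z\<close> and an identity as second entry. This works
  for every functor \<open>F\<close>.\<close>

lemma bcomp_fb_right:
  assumes F: "functr E D F" and C: "fincat C" and \<Omega>: "\<Omega> \<in> bisets C D"
  shows "biset_iso C E (bcomp C D E \<Omega> (fb D E F)) (rl C E (\<lambda>x z. x) (\<lambda>x z. F z) \<Omega>)"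
proof -
  interpret F: functr E D F by fact
  note rb = relab.rl_bisets[OF relab_right[OF F C] \<Omega>]
  interpret bpair C D E \<Omega> "fb D E F" by unfold_locales (use C \<Omega> fb_bisets[OF F] in auto)
  have fbob: "u \<in> bob (fb D E F) y z \<longleftrightarrow> u \<in> Ar D \<and> src D u = F z \<and> tgt D u = y \<and> z \<in> Ob E" for u y z
    by (auto simp: fb_def)
  have fmap: "bmap (fb D E F) \<beta> \<gamma> v = cmp D \<beta> (cmp D v (F \<gamma>))"
    if "v \<in> Ar D" "src D v = F (tgt E \<gamma>)" "tgt D v = src D \<beta>" "\<beta> \<in> Ar D" "\<gamma> \<in> Ar E" for v \<beta> \<gamma>
    using that by (simp add: fb_def)
  let ?\<theta> = "\<lambda>x z y u v. bmap \<Omega> (ident C x) v u"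
  have norm: "cc x z y u v = cc x z (F z) (?\<theta> x z y u v) (ident D (F z))"
    if "u \<in> bob \<Omega> x y" "v \<in> bob (fb D E F) y z" for x z y u v
  proof -
    have v: "v \<in> Ar D" "src D v = F z" "tgt D v = y" "z \<in> Ob E" using that(2) by (auto simp: fbob)
    then show ?thesis using cc_balance[of v u x "ident D (F z)" z] that(1) by (simp add: fbob fmap)
  qed
  show ?thesis
  proof (rule bcomp_iso[where \<theta> = ?\<theta>])
    show "\<exists>y u v. u \<in> bob \<Omega> x y \<and> v \<in> bob (fb D E F) y z \<and> ?\<theta> x z y u v = w"
      if "w \<in> bob (rl C E (\<lambda>x z. x) (\<lambda>x z. F z) \<Omega>) x z" for x z w
      using that by (intro exI[of _ "F z"] exI[of _ w] exI[of _ "ident D (F z)"]) (auto simp: fbob)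
    show "cc x z y u v = cc x z y' u' v'"
      if "u \<in> bob \<Omega> x y" "v \<in> bob (fb D E F) y z" "u' \<in> bob \<Omega> x y'" "v' \<in> bob (fb D E F) y' z"
        "?\<theta> x z y u v = ?\<theta> x z y' u' v'" for x z y u v y' u' v'
      using that norm by metis
  qed (use oL \<Omega> in \<open>auto simp: fbob fmap intro!: rb\<close>)
qed

text \<open>On this side the composite is a left Kan extension along \<open>F\<close>. It is a
  relabelling because \<open>F\<close> has the inverse \<open>G\<close>, which moves the first entry
  into the second: \<open>[u, v] = [1, G(u) v]\<close>.\<close>

lemma bcomp_fb_left:
  assumes F: "functr D C F" and G: "functr C D G"
    and GF: "\<And>x. x \<in> Ob D \<Longrightarrow> G (F x) = x" "\<And>x. x \<in> Ar D \<Longrightarrow> G (F x) = x"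
    and FG: "\<And>x. x \<in> Ob C \<Longrightarrow> F (G x) = x" "\<And>x. x \<in> Ar C \<Longrightarrow> F (G x) = x"
    and E: "fincat E" and \<Omega>: "\<Omega> \<in> bisets D E"
  shows "biset_iso C E (bcomp C D E (fb C D F) \<Omega>) (rl C E (\<lambda>x z. G x) (\<lambda>x z. z) \<Omega>)"
proof -
  interpret F: functr D C F by fact
  interpret G: functr C D G by fact
  note rb = relab.rl_bisets[OF relab_left[OF G E] \<Omega>]
  interpret bpair C D E "fb C D F" \<Omega> by unfold_locales (use E \<Omega> fb_bisets[OF F] in auto)
  have fbob: "u \<in> bob (fb C D F) x y \<longleftrightarrow> u \<in> Ar C \<and> src C u = F y \<and> tgt C u = x \<and> y \<in> Ob D" for u x y
    by (auto simp: fb_def)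
  have fmap: "bmap (fb C D F) \<alpha> \<beta> u = cmp C \<alpha> (cmp C u (F \<beta>))"
    if "u \<in> Ar C" "src C u = F (tgt D \<beta>)" "tgt C u = src C \<alpha>" "\<beta> \<in> Ar D" "\<alpha> \<in> Ar C" for u \<alpha> \<beta>
    using that by (simp add: fb_def)
  let ?\<theta> = "\<lambda>x z y u v. bmap \<Omega> (G u) (ident E z) v"
  have norm: "cc x z y u v = cc x z (G x) (ident C x) (?\<theta> x z y u v)"
    if "u \<in> bob (fb C D F) x y" "v \<in> bob \<Omega> y z" for x z y u v
  proof -
    have u: "u \<in> Ar C" "src C u = F y" "tgt C u = x" "y \<in> Ob D" using that(1) by (auto simp: fbob)
    then have "x \<in> Ob C" by auto
    then show ?thesis using cc_balance[of "G u" "ident C x" x v z] u that(2)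
      by (simp add: fbob fmap GF FG)
  qed
  show ?thesis
  proof (rule bcomp_iso[where \<theta> = ?\<theta>])
    show "\<exists>y u v. u \<in> bob (fb C D F) x y \<and> v \<in> bob \<Omega> y z \<and> ?\<theta> x z y u v = w"
      if "w \<in> bob (rl C E (\<lambda>x z. G x) (\<lambda>x z. z) \<Omega>) x z" for x z w
      using that by (intro exI[of _ "G x"] exI[of _ "ident C x"] exI[of _ w]) (auto simp: fbob FG)
    show "cc x z y u v = cc x z y' u' v'"
      if "u \<in> bob (fb C D F) x y" "v \<in> bob \<Omega> y z" "u' \<in> bob (fb C D F) x y'" "v' \<in> bob \<Omega> y' z"
        "?\<theta> x z y u v = ?\<theta> x z y' u' v'" for x z y u v y' u' v'
      using that norm by metis
  qed (use oR \<Omega> in \<open>auto simp: fbob fmap GF FG intro!: rb\<close>)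
qed

text \<open>A class on either side has two layers, and \<open>cc_fun\<close> descends through one of
  them at a time. The function \<open>g\<close>, with the outer element \<open>w\<close> fixed,
  gives the map from left to right; \<open>h\<close>, with \<open>u\<close> fixed, undoes it and
  yields injectivity.\<close>

lemma bcomp_assoc:
  assumes cats: "fincat C" "fincat D" "fincat E" "fincat F"
    and bs: "\<Omega> \<in> bisets C D" "\<Psi> \<in> bisets D E" "\<Theta> \<in> bisets E F"
  shows "biset_iso C F (bcomp C E F (bcomp C D E \<Omega> \<Psi>) \<Theta>) (bcomp C D F \<Omega> (bcomp D E F \<Psi> \<Theta>))"
proof -
  interpret L: bpair C D E \<Omega> \<Psi> by unfold_locales fact+
  let ?X = "bcomp C D E \<Omega> \<Psi>"
  interpret LL: bpair C E F ?X \<Theta> by unfold_locales (use cats bs L.bcomp_bisets in auto)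
  interpret R: bpair D E F \<Psi> \<Theta> by unfold_locales fact+
  let ?Y = "bcomp D E F \<Psi> \<Theta>"
  interpret RR: bpair C D F \<Omega> ?Y by unfold_locales (use cats bs R.bcomp_bisets in auto)
  have ex1: "\<exists>g. \<forall>d u v. u \<in> bob \<Omega> x d \<longrightarrow> v \<in> bob \<Psi> d y \<longrightarrow>
      g (L.cc x y d u v) = RR.cc x z d u (R.cc d z y v w)" if w: "w \<in> bob \<Theta> y z" for x y z w
  proof (rule L.cc_fun)
    fix \<delta> u v assume *: "\<delta> \<in> Ar D" "u \<in> bob \<Omega> x (tgt D \<delta>)" "v \<in> bob \<Psi> (src D \<delta>) y"
    show "RR.cc x z (src D \<delta>) (bmap \<Omega> (ident C x) \<delta> u) (R.cc (src D \<delta>) z y v w) =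
        RR.cc x z (tgt D \<delta>) u (R.cc (tgt D \<delta>) z y (bmap \<Psi> \<delta> (ident E y) v) w)"
      using RR.cc_balance[OF *(1,2) R.cc_bob[OF *(3) w]]
        R.bmap_bcomp'[of \<delta> "ident F z" v "src D \<delta>" y w z] * w R.oR[OF w] by simp
  qed
  define g where "g x y z w = (SOME g. \<forall>d u v. u \<in> bob \<Omega> x d \<longrightarrow> v \<in> bob \<Psi> d y \<longrightarrow>
      g (L.cc x y d u v) = RR.cc x z d u (R.cc d z y v w))" for x y z w
  have g: "g x y z w (L.cc x y d u v) = RR.cc x z d u (R.cc d z y v w)"
    if "u \<in> bob \<Omega> x d" "v \<in> bob \<Psi> d y" "w \<in> bob \<Theta> y z" for x y z w d u v
    using someI_ex[OF ex1[OF that(3), of x]] that unfolding g_def by blast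
  have ex2: "\<exists>h. \<forall>y v w. v \<in> bob \<Psi> d y \<longrightarrow> w \<in> bob \<Theta> y z \<longrightarrow>
      h (R.cc d z y v w) = LL.cc x z y (L.cc x y d u v) w" if u: "u \<in> bob \<Omega> x d" for x d z u
  proof (rule R.cc_fun)
    fix \<epsilon> v w assume *: "\<epsilon> \<in> Ar E" "v \<in> bob \<Psi> d (tgt E \<epsilon>)" "w \<in> bob \<Theta> (src E \<epsilon>) z"
    show "LL.cc x z (src E \<epsilon>) (L.cc x (src E \<epsilon>) d u (bmap \<Psi> (ident D d) \<epsilon> v)) w =
        LL.cc x z (tgt E \<epsilon>) (L.cc x (tgt E \<epsilon>) d u v) (bmap \<Theta> \<epsilon> (ident F z) w)"
      using LL.cc_balance[OF *(1) L.cc_bob[OF u *(2)] *(3)]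
        L.bmap_bcomp'[of "ident C x" \<epsilon> u x d v "tgt E \<epsilon>"] * u L.oL[OF u] by simp
  qed
  define h where "h x d z u = (SOME h. \<forall>y v w. v \<in> bob \<Psi> d y \<longrightarrow> w \<in> bob \<Theta> y z \<longrightarrow>
      h (R.cc d z y v w) = LL.cc x z y (L.cc x y d u v) w)" for x d z u
  have h: "h x d z u (R.cc d z y v w) = LL.cc x z y (L.cc x y d u v) w"
    if "u \<in> bob \<Omega> x d" "v \<in> bob \<Psi> d y" "w \<in> bob \<Theta> y z" for x y z w d u v
    using someI_ex[OF ex2[OF that(1), of z]] that unfolding h_def by blast
  show ?thesis
  proof (rule LL.bcomp_iso[where \<theta> = "\<lambda>x z y k w. g x y z w k"])
    show "bcomp C D F \<Omega> ?Y \<in> bisets C F" by (rule RR.bcomp_bisets)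
    show "g x y z w k \<in> bob (bcomp C D F \<Omega> ?Y) x z" if "k \<in> bob ?X x y" "w \<in> bob \<Theta> y z" for x z y k w
      using that by (auto simp: L.bob_bcomp g intro!: RR.cc_bob R.cc_bob)
  next
    fix x z \<epsilon> k w assume *: "\<epsilon> \<in> Ar E" "k \<in> bob ?X x (tgt E \<epsilon>)" "w \<in> bob \<Theta> (src E \<epsilon>) z"
    then obtain d u v where uv: "u \<in> bob \<Omega> x d" "v \<in> bob \<Psi> d (tgt E \<epsilon>)" "k = L.cc x (tgt E \<epsilon>) d u v"
      using L.bob_bcomp by blast
    show "g x (src E \<epsilon>) z w (bmap ?X (ident C x) \<epsilon> k) = g x (tgt E \<epsilon>) z (bmap \<Theta> \<epsilon> (ident F z) w) k"
      using * uv L.oL[OF uv(1)] R.oR[OF *(3)] R.cc_balance[OF *(1) uv(2) *(3)]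
      by (simp add: L.bmap_bcomp' g)
  next
    fix \<alpha> \<gamma> y k w
    assume *: "\<alpha> \<in> Ar C" "\<gamma> \<in> Ar F" "k \<in> bob ?X (src C \<alpha>) y" "w \<in> bob \<Theta> y (tgt F \<gamma>)"
    then obtain d u v where uv: "u \<in> bob \<Omega> (src C \<alpha>) d" "v \<in> bob \<Psi> d y" "k = L.cc (src C \<alpha>) y d u v"
      using L.bob_bcomp by blast
    show "g (tgt C \<alpha>) y (src F \<gamma>) (bmap \<Theta> (ident E y) \<gamma> w) (bmap ?X \<alpha> (ident E y) k) =
        bmap (bcomp C D F \<Omega> ?Y) \<alpha> \<gamma> (g (src C \<alpha>) y (tgt F \<gamma>) w k)"
      using * uv L.oL[OF uv(1)] R.oR[OF *(4)]
      by (simp add: L.bmap_bcomp' g RR.bmap_bcomp' R.bmap_bcomp' R.cc_bob)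
  next
    fix x z t assume "t \<in> bob (bcomp C D F \<Omega> ?Y) x z"
    then obtain d u l where *: "u \<in> bob \<Omega> x d" "l \<in> bob ?Y d z" "t = RR.cc x z d u l"
      using RR.bob_bcomp by blast
    then obtain y v w where **: "v \<in> bob \<Psi> d y" "w \<in> bob \<Theta> y z" "l = R.cc d z y v w"
      using R.bob_bcomp by blast
    show "\<exists>y k w. k \<in> bob ?X x y \<and> w \<in> bob \<Theta> y z \<and> g x y z w k = t"
      using * ** by (intro exI[of _ y] exI[of _ "L.cc x y d u v"] exI[of _ w]) (simp add: L.cc_bob g)
  next
    fix x z y k w y' k' w'
    assume *: "k \<in> bob ?X x y" "w \<in> bob \<Theta> y z" "k' \<in> bob ?X x y'" "w' \<in> bob \<Theta> y' z"
      "g x y z w k = g x y' z w' k'"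
    obtain d u v where uv: "u \<in> bob \<Omega> x d" "v \<in> bob \<Psi> d y" "k = L.cc x y d u v"
      using * L.bob_bcomp by blast
    obtain d' u' v' where uv': "u' \<in> bob \<Omega> x d'" "v' \<in> bob \<Psi> d' y'" "k' = L.cc x y' d' u' v'"
      using * L.bob_bcomp by blast
    have eq: "RR.cc x z d u (R.cc d z y v w) = RR.cc x z d' u' (R.cc d' z y' v' w')"
      using * uv uv' by (simp add: g)
    \<comment> \<open>\<open>h\<close> respects the elementary relations of the outer layer, so it
      may be applied to both sides of \<open>eq\<close>.\<close>
    have "h x d z u (R.cc d z y v w) = h x d' z u' (R.cc d' z y' v' w')"
    proof (rule RR.cc_lift[OF eq uv(1) R.cc_bob[OF uv(2) *(2)] uv'(1) R.cc_bob[OF uv'(2) *(4)]])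
      fix \<delta> u l assume a: "\<delta> \<in> Ar D" "u \<in> bob \<Omega> x (tgt D \<delta>)" "l \<in> bob ?Y (src D \<delta>) z"
      then obtain y v w where vw: "v \<in> bob \<Psi> (src D \<delta>) y" "w \<in> bob \<Theta> y z" "l = R.cc (src D \<delta>) z y v w"
        using R.bob_bcomp by blast
      show "h x (src D \<delta>) z (bmap \<Omega> (ident C x) \<delta> u) l = h x (tgt D \<delta>) z u (bmap ?Y \<delta> (ident F z) l)"
        using a vw L.oL[OF a(2)] R.oR[OF vw(2)] L.cc_balance[OF a(1,2) vw(1)]
        by (simp add: h R.bmap_bcomp')
    qed
    then show "LL.cc x z y k w = LL.cc x z y' k' w'" using * uv uv' by (simp add: h)
  qed
qed

lemma bcomp_cong:
  assumes cats: "fincat C" "fincat D" "fincat E"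
    and bs: "\<Omega> \<in> bisets C D" "\<Psi> \<in> bisets D E" "\<Omega>' \<in> bisets C D" "\<Psi>' \<in> bisets D E"
    and iso: "biset_iso C D \<Omega> \<Omega>'" "biset_iso D E \<Psi> \<Psi>'"
  shows "biset_iso C E (bcomp C D E \<Omega> \<Psi>) (bcomp C D E \<Omega>' \<Psi>')"
proof -
  interpret A: bpair C D E \<Omega> \<Psi> by unfold_locales fact+
  interpret B: bpair C D E \<Omega>' \<Psi>' by unfold_locales fact+
  obtain f f' where f: "biset_inv C D \<Omega> \<Omega>' f f'" using biset_iso_inv iso(1) cats bs by blast
  obtain g g' where g: "biset_inv D E \<Psi> \<Psi>' g g'" using biset_iso_inv iso(2) cats bs by blast
  note [simp] = biset_invD[OF f] biset_invD[OF g]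
  show ?thesis
  proof (rule A.bcomp_iso[where \<theta> = "\<lambda>x z y u v. B.cc x z y (f x y u) (g y z v)"])
    fix x z w assume "w \<in> bob (bcomp C D E \<Omega>' \<Psi>') x z"
    then obtain y u v where *: "u \<in> bob \<Omega>' x y" "v \<in> bob \<Psi>' y z" "w = B.cc x z y u v"
      using B.bob_bcomp by blast
    then show "\<exists>y u v. u \<in> bob \<Omega> x y \<and> v \<in> bob \<Psi> y z \<and> B.cc x z y (f x y u) (g y z v) = w"
      by (intro exI[of _ y] exI[of _ "f' x y u"] exI[of _ "g' y z v"]) simp
  next
    fix x z y u v y' u' v'
    assume *: "u \<in> bob \<Omega> x y" "v \<in> bob \<Psi> y z" "u' \<in> bob \<Omega> x y'" "v' \<in> bob \<Psi> y' z"
      "B.cc x z y (f x y u) (g y z v) = B.cc x z y' (f x y' u') (g y' z v')"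
    \<comment> \<open>Injectivity: the inverse bijections \<open>f'\<close> and \<open>g'\<close>
      carry the equation back to the first composite.\<close>
    have "A.cc x z y (f' x y (f x y u)) (g' y z (g y z v)) = A.cc x z y' (f' x y' (f x y' u')) (g' y' z (g y' z v'))"
    proof (rule B.cc_lift[OF *(5)])
      fix \<beta> u v assume a: "\<beta> \<in> Ar D" "u \<in> bob \<Omega>' x (tgt D \<beta>)" "v \<in> bob \<Psi>' (src D \<beta>) z"
      show "A.cc x z (src D \<beta>) (f' x (src D \<beta>) (bmap \<Omega>' (ident C x) \<beta> u)) (g' (src D \<beta>) z v) =
          A.cc x z (tgt D \<beta>) (f' x (tgt D \<beta>) u) (g' (tgt D \<beta>) z (bmap \<Psi>' \<beta> (ident E z) v))"
        using a B.oL[OF a(2)] B.oR[OF a(3)] A.cc_balance[of \<beta> "f' x (tgt D \<beta>) u" x "g' (src D \<beta>) z v" z]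
        by simp
    qed (use * in auto)
    then show "A.cc x z y u v = A.cc x z y' u' v'" using * by simp
  next
    fix x z \<beta> u v assume a: "\<beta> \<in> Ar D" "u \<in> bob \<Omega> x (tgt D \<beta>)" "v \<in> bob \<Psi> (src D \<beta>) z"
    show "B.cc x z (src D \<beta>) (f x (src D \<beta>) (bmap \<Omega> (ident C x) \<beta> u)) (g (src D \<beta>) z v) =
        B.cc x z (tgt D \<beta>) (f x (tgt D \<beta>) u) (g (tgt D \<beta>) z (bmap \<Psi> \<beta> (ident E z) v))"
      using a A.oL[OF a(2)] A.oR[OF a(3)] B.cc_balance[of \<beta> "f x (tgt D \<beta>) u" x "g (src D \<beta>) z v" z]
      by simp
  next
    fix \<alpha> \<gamma> y u v assume a: "\<alpha> \<in> Ar C" "\<gamma> \<in> Ar E" "u \<in> bob \<Omega> (src C \<alpha>) y" "v \<in> bob \<Psi> y (tgt E \<gamma>)"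
    then show "B.cc (tgt C \<alpha>) (src E \<gamma>) y (f (tgt C \<alpha>) y (bmap \<Omega> \<alpha> (ident D y) u))
        (g y (src E \<gamma>) (bmap \<Psi> (ident D y) \<gamma> v)) =
      bmap (bcomp C D E \<Omega>' \<Psi>') \<alpha> \<gamma> (B.cc (src C \<alpha>) (tgt E \<gamma>) y (f (src C \<alpha>) y u) (g y (tgt E \<gamma>) v))"
      using A.oL[OF a(3)] by (simp add: B.bmap_bcomp')
  qed (simp_all add: B.bcomp_bisets B.cc_bob)
qed

text \<open>An elementary relation moves a morphism of \<open>D\<close> across the pair but never
  changes the summand, so the tag can be pulled out of the class.\<close>

lemma bcomp_bsum_left:
  assumes cats: "fincat C" "fincat D" "fincat E"
    and bs: "\<Omega> \<in> bisets C D" "\<Omega>' \<in> bisets C D" "\<Psi> \<in> bisets D E"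
  shows "biset_iso C E (bcomp C D E (bsum C D \<Omega> \<Omega>') \<Psi>) (bsum C E (bcomp C D E \<Omega> \<Psi>) (bcomp C D E \<Omega>' \<Psi>))"
proof -
  interpret A: bpair C D E \<Omega> \<Psi> by unfold_locales fact+
  interpret B: bpair C D E \<Omega>' \<Psi> by unfold_locales fact+
  interpret S: bpair C D E "bsum C D \<Omega> \<Omega>'" \<Psi> by unfold_locales (use assms bsum_bisets in auto)
  let ?\<theta> = "\<lambda>x z y s v. case sum_decode s of Inl u \<Rightarrow> sum_encode (Inl (A.cc x z y u v))
    | Inr u \<Rightarrow> sum_encode (Inr (B.cc x z y u v))"
  note bcs = A.bcomp_bisets B.bcomp_bisets
  show ?thesis
  proof (rule S.bcomp_iso[where \<theta> = ?\<theta>])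
    show "bsum C E (bcomp C D E \<Omega> \<Psi>) (bcomp C D E \<Omega>' \<Psi>) \<in> bisets C E" by (intro bsum_bisets cats bcs)
    show "?\<theta> x z y s v \<in> bob (bsum C E (bcomp C D E \<Omega> \<Psi>) (bcomp C D E \<Omega>' \<Psi>)) x z"
      if "s \<in> bob (bsum C D \<Omega> \<Omega>') x y" "v \<in> bob \<Psi> y z" for x z y s v
      using that S.oL[OF that(1)] S.oR[OF that(2)] by (auto simp: bsum_bob A.cc_bob B.cc_bob)
  next
    fix x z \<beta> s v assume a: "\<beta> \<in> Ar D" "s \<in> bob (bsum C D \<Omega> \<Omega>') x (tgt D \<beta>)" "v \<in> bob \<Psi> (src D \<beta>) z"
    then show "?\<theta> x z (src D \<beta>) (bmap (bsum C D \<Omega> \<Omega>') (ident C x) \<beta> s) v =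
        ?\<theta> x z (tgt D \<beta>) s (bmap \<Psi> \<beta> (ident E z) v)"
      using cats by (auto simp: bsum_bob A.cc_balance B.cc_balance)
  next
    fix \<alpha> \<gamma> y s v
    assume a: "\<alpha> \<in> Ar C" "\<gamma> \<in> Ar E" "s \<in> bob (bsum C D \<Omega> \<Omega>') (src C \<alpha>) y" "v \<in> bob \<Psi> y (tgt E \<gamma>)"
    then show "?\<theta> (tgt C \<alpha>) (src E \<gamma>) y (bmap (bsum C D \<Omega> \<Omega>') \<alpha> (ident D y) s) (bmap \<Psi> (ident D y) \<gamma> v) =
        bmap (bsum C E (bcomp C D E \<Omega> \<Psi>) (bcomp C D E \<Omega>' \<Psi>)) \<alpha> \<gamma> (?\<theta> (src C \<alpha>) (tgt E \<gamma>) y s v)"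
      using cats by (auto simp: bsum_bob A.cc_bob B.cc_bob A.bmap_bcomp' B.bmap_bcomp')
  next
    fix x z w assume "w \<in> bob (bsum C E (bcomp C D E \<Omega> \<Psi>) (bcomp C D E \<Omega>' \<Psi>)) x z"
    then consider y u v where "u \<in> bob \<Omega> x y" "v \<in> bob \<Psi> y z" "w = sum_encode (Inl (A.cc x z y u v))"
      | y u v where "u \<in> bob \<Omega>' x y" "v \<in> bob \<Psi> y z" "w = sum_encode (Inr (B.cc x z y u v))"
      by (auto simp: bsum_bob A.bob_bcomp B.bob_bcomp)
    then show "\<exists>y s v. s \<in> bob (bsum C D \<Omega> \<Omega>') x y \<and> v \<in> bob \<Psi> y z \<and> ?\<theta> x z y s v = w"
    proof cases
      case 1
      then show ?thesis using A.oL[OF 1(1)]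
        by (intro exI[of _ y] exI[of _ "sum_encode (Inl u)"] exI[of _ v]) (auto simp: bsum_bob)
    next
      case 2
      then show ?thesis using B.oL[OF 2(1)]
        by (intro exI[of _ y] exI[of _ "sum_encode (Inr u)"] exI[of _ v]) (auto simp: bsum_bob)
    qed
  next
    fix x z y s v y' s' v'
    assume *: "s \<in> bob (bsum C D \<Omega> \<Omega>') x y" "v \<in> bob \<Psi> y z" "s' \<in> bob (bsum C D \<Omega> \<Omega>') x y'" "v' \<in> bob \<Psi> y' z"
      and eq: "?\<theta> x z y s v = ?\<theta> x z y' s' v'"
    have l: "S.cc x z y (sum_encode (Inl u)) v = S.cc x z y' (sum_encode (Inl u')) v'"
      if "A.cc x z y u v = A.cc x z y' u' v'" "u \<in> bob \<Omega> x y" "u' \<in> bob \<Omega> x y'" for u u'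
    proof (rule A.cc_lift[OF that(1,2) *(2) that(3) *(4), where \<theta> = "\<lambda>y u. S.cc x z y (sum_encode (Inl u))"])
      fix \<beta> u v assume a: "\<beta> \<in> Ar D" "u \<in> bob \<Omega> x (tgt D \<beta>)" "v \<in> bob \<Psi> (src D \<beta>) z"
      then show "S.cc x z (src D \<beta>) (sum_encode (Inl (bmap \<Omega> (ident C x) \<beta> u))) v =
          S.cc x z (tgt D \<beta>) (sum_encode (Inl u)) (bmap \<Psi> \<beta> (ident E z) v)"
        using S.cc_balance[of \<beta> "sum_encode (Inl u)" x v z] A.oL[OF a(2)] by (simp add: bsum_bob)
    qed
    have r: "S.cc x z y (sum_encode (Inr u)) v = S.cc x z y' (sum_encode (Inr u')) v'"
      if "B.cc x z y u v = B.cc x z y' u' v'" "u \<in> bob \<Omega>' x y" "u' \<in> bob \<Omega>' x y'" for u u'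
    proof (rule B.cc_lift[OF that(1,2) *(2) that(3) *(4), where \<theta> = "\<lambda>y u. S.cc x z y (sum_encode (Inr u))"])
      fix \<beta> u v assume a: "\<beta> \<in> Ar D" "u \<in> bob \<Omega>' x (tgt D \<beta>)" "v \<in> bob \<Psi> (src D \<beta>) z"
      then show "S.cc x z (src D \<beta>) (sum_encode (Inr (bmap \<Omega>' (ident C x) \<beta> u))) v =
          S.cc x z (tgt D \<beta>) (sum_encode (Inr u)) (bmap \<Psi> \<beta> (ident E z) v)"
        using S.cc_balance[of \<beta> "sum_encode (Inr u)" x v z] B.oL[OF a(2)] by (simp add: bsum_bob)
    qed
    show "S.cc x z y s v = S.cc x z y' s' v'"
      using * eq by (auto simp: bsum_bob l r)
  qed
qed

lemma bcomp_bsum_right: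
  assumes cats: "fincat C" "fincat D" "fincat E"
    and bs: "\<Omega> \<in> bisets C D" "\<Psi> \<in> bisets D E" "\<Psi>' \<in> bisets D E"
  shows "biset_iso C E (bcomp C D E \<Omega> (bsum D E \<Psi> \<Psi>')) (bsum C E (bcomp C D E \<Omega> \<Psi>) (bcomp C D E \<Omega> \<Psi>'))"
proof -
  interpret A: bpair C D E \<Omega> \<Psi> by unfold_locales fact+
  interpret B: bpair C D E \<Omega> \<Psi>' by unfold_locales fact+
  interpret S: bpair C D E \<Omega> "bsum D E \<Psi> \<Psi>'" by unfold_locales (use assms bsum_bisets in auto)
  let ?\<theta> = "\<lambda>x z y u s. case sum_decode s of Inl v \<Rightarrow> sum_encode (Inl (A.cc x z y u v))
    | Inr v \<Rightarrow> sum_encode (Inr (B.cc x z y u v))"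
  note bcs = A.bcomp_bisets B.bcomp_bisets
  show ?thesis
  proof (rule S.bcomp_iso[where \<theta> = ?\<theta>])
    show "bsum C E (bcomp C D E \<Omega> \<Psi>) (bcomp C D E \<Omega> \<Psi>') \<in> bisets C E" by (intro bsum_bisets cats bcs)
    show "?\<theta> x z y u s \<in> bob (bsum C E (bcomp C D E \<Omega> \<Psi>) (bcomp C D E \<Omega> \<Psi>')) x z"
      if "u \<in> bob \<Omega> x y" "s \<in> bob (bsum D E \<Psi> \<Psi>') y z" for x z y s u
      using that S.oL[OF that(1)] S.oR[OF that(2)] by (auto simp: bsum_bob A.cc_bob B.cc_bob)
  next
    fix x z \<beta> u s assume a: "\<beta> \<in> Ar D" "u \<in> bob \<Omega> x (tgt D \<beta>)" "s \<in> bob (bsum D E \<Psi> \<Psi>') (src D \<beta>) z"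
    then show "?\<theta> x z (src D \<beta>) (bmap \<Omega> (ident C x) \<beta> u) s =
        ?\<theta> x z (tgt D \<beta>) u (bmap (bsum D E \<Psi> \<Psi>') \<beta> (ident E z) s)"
      using cats by (auto simp: bsum_bob A.cc_balance B.cc_balance)
  next
    fix \<alpha> \<gamma> y u s
    assume a: "\<alpha> \<in> Ar C" "\<gamma> \<in> Ar E" "u \<in> bob \<Omega> (src C \<alpha>) y" "s \<in> bob (bsum D E \<Psi> \<Psi>') y (tgt E \<gamma>)"
    then show "?\<theta> (tgt C \<alpha>) (src E \<gamma>) y (bmap \<Omega> \<alpha> (ident D y) u) (bmap (bsum D E \<Psi> \<Psi>') (ident D y) \<gamma> s) =
        bmap (bsum C E (bcomp C D E \<Omega> \<Psi>) (bcomp C D E \<Omega> \<Psi>')) \<alpha> \<gamma> (?\<theta> (src C \<alpha>) (tgt E \<gamma>) y u s)"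
      using cats by (auto simp: bsum_bob A.cc_bob B.cc_bob A.bmap_bcomp' B.bmap_bcomp')
  next
    fix x z w assume "w \<in> bob (bsum C E (bcomp C D E \<Omega> \<Psi>) (bcomp C D E \<Omega> \<Psi>')) x z"
    then consider y u v where "u \<in> bob \<Omega> x y" "v \<in> bob \<Psi> y z" "w = sum_encode (Inl (A.cc x z y u v))"
      | y u v where "u \<in> bob \<Omega> x y" "v \<in> bob \<Psi>' y z" "w = sum_encode (Inr (B.cc x z y u v))"
      by (auto simp: bsum_bob A.bob_bcomp B.bob_bcomp)
    then show "\<exists>y u s. u \<in> bob \<Omega> x y \<and> s \<in> bob (bsum D E \<Psi> \<Psi>') y z \<and> ?\<theta> x z y u s = w"
    proof cases
      case 1
      then show ?thesis using A.oR[OF 1(2)]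
        by (intro exI[of _ y] exI[of _ u] exI[of _ "sum_encode (Inl v)"]) (auto simp: bsum_bob)
    next
      case 2
      then show ?thesis using B.oR[OF 2(2)]
        by (intro exI[of _ y] exI[of _ u] exI[of _ "sum_encode (Inr v)"]) (auto simp: bsum_bob)
    qed
  next
    fix x z y u s y' u' s'
    assume *: "u \<in> bob \<Omega> x y" "s \<in> bob (bsum D E \<Psi> \<Psi>') y z" "u' \<in> bob \<Omega> x y'" "s' \<in> bob (bsum D E \<Psi> \<Psi>') y' z"
      and eq: "?\<theta> x z y u s = ?\<theta> x z y' u' s'"
    have l: "S.cc x z y u (sum_encode (Inl v)) = S.cc x z y' u' (sum_encode (Inl v'))"
      if "A.cc x z y u v = A.cc x z y' u' v'" "v \<in> bob \<Psi> y z" "v' \<in> bob \<Psi> y' z" for v v'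
    proof (rule A.cc_lift[OF that(1) *(1) that(2) *(3) that(3), where \<theta> = "\<lambda>y u v. S.cc x z y u (sum_encode (Inl v))"])
      fix \<beta> u v assume a: "\<beta> \<in> Ar D" "u \<in> bob \<Omega> x (tgt D \<beta>)" "v \<in> bob \<Psi> (src D \<beta>) z"
      then show "S.cc x z (src D \<beta>) (bmap \<Omega> (ident C x) \<beta> u) (sum_encode (Inl v)) =
          S.cc x z (tgt D \<beta>) u (sum_encode (Inl (bmap \<Psi> \<beta> (ident E z) v)))"
        using S.cc_balance[of \<beta> u x "sum_encode (Inl v)" z] A.oR[OF a(3)] by (simp add: bsum_bob)
    qed
    have r: "S.cc x z y u (sum_encode (Inr v)) = S.cc x z y' u' (sum_encode (Inr v'))"
      if "B.cc x z y u v = B.cc x z y' u' v'" "v \<in> bob \<Psi>' y z" "v' \<in> bob \<Psi>' y' z" for v v'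
    proof (rule B.cc_lift[OF that(1) *(1) that(2) *(3) that(3), where \<theta> = "\<lambda>y u v. S.cc x z y u (sum_encode (Inr v))"])
      fix \<beta> u v assume a: "\<beta> \<in> Ar D" "u \<in> bob \<Omega> x (tgt D \<beta>)" "v \<in> bob \<Psi>' (src D \<beta>) z"
      then show "S.cc x z (src D \<beta>) (bmap \<Omega> (ident C x) \<beta> u) (sum_encode (Inr v)) =
          S.cc x z (tgt D \<beta>) u (sum_encode (Inr (bmap \<Psi>' \<beta> (ident E z) v)))"
        using S.cc_balance[of \<beta> u x "sum_encode (Inr v)" z] B.oR[OF a(3)] by (simp add: bsum_bob)
    qed
    show "S.cc x z y u s = S.cc x z y' u' s'"
      using * eq by (auto simp: bsum_bob l r)
  qed
qed

section \<open>Products, duals and bending\<close>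

lemma pr_collapse: "\<langle>a, pi2 w\<rangle> = w \<longleftrightarrow> a = pi1 w" "\<langle>pi1 w, b\<rangle> = w \<longleftrightarrow> b = pi2 w"
  by (auto simp: pr_eq_iff)

section \<open>Products of bisets\<close>

lemma bprod_cong:
  assumes cats: "fincat C" "fincat D" "fincat C'" "fincat D'"
    and bs: "\<Omega> \<in> bisets C D" "\<Omega>' \<in> bisets C D" "\<Psi> \<in> bisets C' D'" "\<Psi>' \<in> bisets C' D'"
    and iso: "biset_iso C D \<Omega> \<Omega>'" "biset_iso C' D' \<Psi> \<Psi>'"
  shows "biset_iso (C \<times>\<^sub>c C') (D \<times>\<^sub>c D') (bprod C D C' D' \<Omega> \<Psi>) (bprod C D C' D' \<Omega>' \<Psi>')"
proof -
  obtain f f' where f: "biset_inv C D \<Omega> \<Omega>' f f'" using biset_iso_inv iso(1) cats bs by blast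
  obtain g g' where g: "biset_inv C' D' \<Psi> \<Psi>' g g'" using biset_iso_inv iso(2) cats bs by blast
  note [simp] = biset_invD[OF f] biset_invD[OF g]
  let ?\<theta> = "\<lambda>x y w. \<langle>f (pi1 x) (pi1 y) (pi1 w), g (pi2 x) (pi2 y) (pi2 w)\<rangle>"
  let ?\<sigma> = "\<lambda>x y w. \<langle>f' (pi1 x) (pi1 y) (pi1 w), g' (pi2 x) (pi2 y) (pi2 w)\<rangle>"
  show ?thesis
  proof (rule biset_isoI[of _ _ ?\<theta>])
    show "bij_betw (?\<theta> x y) (bob (bprod C D C' D' \<Omega> \<Psi>) x y) (bob (bprod C D C' D' \<Omega>' \<Psi>') x y)" for x y
      by (rule bij_betw_byWitness[of _ "?\<sigma> x y"]) auto
  qed (use cats in simp)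
qed

lemma bprod_bsum_left:
  assumes cats: "fincat C" "fincat D" "fincat C'" "fincat D'"
    and bs: "\<Omega> \<in> bisets C D" "\<Omega>' \<in> bisets C D" "\<Psi> \<in> bisets C' D'"
  shows "biset_iso (C \<times>\<^sub>c C') (D \<times>\<^sub>c D') (bprod C D C' D' (bsum C D \<Omega> \<Omega>') \<Psi>)
    (bsum (C \<times>\<^sub>c C') (D \<times>\<^sub>c D') (bprod C D C' D' \<Omega> \<Psi>) (bprod C D C' D' \<Omega>' \<Psi>))"
proof -
  let ?\<theta> = "\<lambda>x y w. case sum_decode (pi1 w) of Inl u \<Rightarrow> sum_encode (Inl \<langle>u, pi2 w\<rangle>)
    | Inr u \<Rightarrow> sum_encode (Inr \<langle>u, pi2 w\<rangle>)"
  let ?\<sigma> = "\<lambda>s. case sum_decode s of Inl t \<Rightarrow> \<langle>sum_encode (Inl (pi1 t)), pi2 t\<rangle>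
    | Inr t \<Rightarrow> \<langle>sum_encode (Inr (pi1 t)), pi2 t\<rangle>"
  note [simp] = bisetsD(4)[OF bs(1)] bisetsD(4)[OF bs(2)] bisetsD(4)[OF bs(3)]
  show ?thesis
  proof (rule biset_isoI[of _ _ ?\<theta>])
    show "bij_betw (?\<theta> x y) (bob (bprod C D C' D' (bsum C D \<Omega> \<Omega>') \<Psi>) x y)
      (bob (bsum (C \<times>\<^sub>c C') (D \<times>\<^sub>c D') (bprod C D C' D' \<Omega> \<Psi>) (bprod C D C' D' \<Omega>' \<Psi>)) x y)"
      if "x \<in> Ob (C \<times>\<^sub>c C')" "y \<in> Ob (D \<times>\<^sub>c D')" for x y
      by (rule bij_betw_byWitness[of _ ?\<sigma>]) (use that in \<open>auto simp: bsum_bob pr_collapse\<close>)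
  next
    fix \<alpha> \<beta> w
    assume "\<alpha> \<in> Ar (C \<times>\<^sub>c C')" "\<beta> \<in> Ar (D \<times>\<^sub>c D')"
      "w \<in> bob (bprod C D C' D' (bsum C D \<Omega> \<Omega>') \<Psi>) (src (C \<times>\<^sub>c C') \<alpha>) (tgt (D \<times>\<^sub>c D') \<beta>)"
    then show "?\<theta> (tgt (C \<times>\<^sub>c C') \<alpha>) (src (D \<times>\<^sub>c D') \<beta>) (bmap (bprod C D C' D' (bsum C D \<Omega> \<Omega>') \<Psi>) \<alpha> \<beta> w) =
      bmap (bsum (C \<times>\<^sub>c C') (D \<times>\<^sub>c D') (bprod C D C' D' \<Omega> \<Psi>) (bprod C D C' D' \<Omega>' \<Psi>)) \<alpha> \<beta>
        (?\<theta> (src (C \<times>\<^sub>c C') \<alpha>) (tgt (D \<times>\<^sub>c D') \<beta>) w)"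
      using cats by (auto simp: bsum_bob)
  qed
qed

lemma bprod_bsum_right:
  assumes cats: "fincat C" "fincat D" "fincat C'" "fincat D'"
    and bs: "\<Omega> \<in> bisets C D" "\<Psi> \<in> bisets C' D'" "\<Psi>' \<in> bisets C' D'"
  shows "biset_iso (C \<times>\<^sub>c C') (D \<times>\<^sub>c D') (bprod C D C' D' \<Omega> (bsum C' D' \<Psi> \<Psi>'))
    (bsum (C \<times>\<^sub>c C') (D \<times>\<^sub>c D') (bprod C D C' D' \<Omega> \<Psi>) (bprod C D C' D' \<Omega> \<Psi>'))"
proof -
  let ?\<theta> = "\<lambda>x y w. case sum_decode (pi2 w) of Inl u \<Rightarrow> sum_encode (Inl \<langle>pi1 w, u\<rangle>)
    | Inr u \<Rightarrow> sum_encode (Inr \<langle>pi1 w, u\<rangle>)"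
  let ?\<sigma> = "\<lambda>s. case sum_decode s of Inl t \<Rightarrow> \<langle>pi1 t, sum_encode (Inl (pi2 t))\<rangle>
    | Inr t \<Rightarrow> \<langle>pi1 t, sum_encode (Inr (pi2 t))\<rangle>"
  note [simp] = bisetsD(4)[OF bs(1)] bisetsD(4)[OF bs(2)] bisetsD(4)[OF bs(3)]
  show ?thesis
  proof (rule biset_isoI[of _ _ ?\<theta>])
    show "bij_betw (?\<theta> x y) (bob (bprod C D C' D' \<Omega> (bsum C' D' \<Psi> \<Psi>')) x y)
      (bob (bsum (C \<times>\<^sub>c C') (D \<times>\<^sub>c D') (bprod C D C' D' \<Omega> \<Psi>) (bprod C D C' D' \<Omega> \<Psi>')) x y)"
      if "x \<in> Ob (C \<times>\<^sub>c C')" "y \<in> Ob (D \<times>\<^sub>c D')" for x y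
      by (rule bij_betw_byWitness[of _ ?\<sigma>]) (use that in \<open>auto simp: bsum_bob pr_collapse\<close>)
  next
    fix \<alpha> \<beta> w
    assume "\<alpha> \<in> Ar (C \<times>\<^sub>c C')" "\<beta> \<in> Ar (D \<times>\<^sub>c D')"
      "w \<in> bob (bprod C D C' D' \<Omega> (bsum C' D' \<Psi> \<Psi>')) (src (C \<times>\<^sub>c C') \<alpha>) (tgt (D \<times>\<^sub>c D') \<beta>)"
    then show "?\<theta> (tgt (C \<times>\<^sub>c C') \<alpha>) (src (D \<times>\<^sub>c D') \<beta>) (bmap (bprod C D C' D' \<Omega> (bsum C' D' \<Psi> \<Psi>')) \<alpha> \<beta> w) =
      bmap (bsum (C \<times>\<^sub>c C') (D \<times>\<^sub>c D') (bprod C D C' D' \<Omega> \<Psi>) (bprod C D C' D' \<Omega> \<Psi>')) \<alpha> \<beta>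
        (?\<theta> (src (C \<times>\<^sub>c C') \<alpha>) (tgt (D \<times>\<^sub>c D') \<beta>) w)"
      using cats by (auto simp: bsum_bob)
  qed
qed

lemma bprod_bcomp:
  assumes cats: "fincat C" "fincat D" "fincat E" "fincat C'" "fincat D'" "fincat E'"
    and bs: "\<Omega> \<in> bisets C D" "\<Psi> \<in> bisets D E" "\<Omega>' \<in> bisets C' D'" "\<Psi>' \<in> bisets D' E'"
  shows "biset_iso (C \<times>\<^sub>c C') (E \<times>\<^sub>c E')
    (bcomp (C \<times>\<^sub>c C') (D \<times>\<^sub>c D') (E \<times>\<^sub>c E') (bprod C D C' D' \<Omega> \<Omega>') (bprod D E D' E' \<Psi> \<Psi>'))
    (bprod C E C' E' (bcomp C D E \<Omega> \<Psi>) (bcomp C' D' E' \<Omega>' \<Psi>'))"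
proof -
  interpret A: bpair C D E \<Omega> \<Psi> by unfold_locales fact+
  interpret B: bpair C' D' E' \<Omega>' \<Psi>' by unfold_locales fact+
  interpret P: bpair "C \<times>\<^sub>c C'" "D \<times>\<^sub>c D'" "E \<times>\<^sub>c E'" "bprod C D C' D' \<Omega> \<Omega>'" "bprod D E D' E' \<Psi> \<Psi>'"
    by unfold_locales (use assms bprod_bisets in auto)
  let ?\<theta> = "\<lambda>x z y u v. \<langle>A.cc (pi1 x) (pi1 z) (pi1 y) (pi1 u) (pi1 v), B.cc (pi2 x) (pi2 z) (pi2 y) (pi2 u) (pi2 v)\<rangle>"
  show ?thesis
  proof (rule P.bcomp_iso[where \<theta> = ?\<theta>])
    show "bprod C E C' E' (bcomp C D E \<Omega> \<Psi>) (bcomp C' D' E' \<Omega>' \<Psi>') \<in> bisets (C \<times>\<^sub>c C') (E \<times>\<^sub>c E')"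
      by (intro bprod_bisets cats A.bcomp_bisets B.bcomp_bisets)
    show "?\<theta> x z y u v \<in> bob (bprod C E C' E' (bcomp C D E \<Omega> \<Psi>) (bcomp C' D' E' \<Omega>' \<Psi>')) x z"
      if "u \<in> bob (bprod C D C' D' \<Omega> \<Omega>') x y" "v \<in> bob (bprod D E D' E' \<Psi> \<Psi>') y z" for x z y u v
      using that by (simp add: A.cc_bob B.cc_bob)
  next
    fix x z \<beta> u v assume a: "\<beta> \<in> Ar (D \<times>\<^sub>c D')" "u \<in> bob (bprod C D C' D' \<Omega> \<Omega>') x (tgt (D \<times>\<^sub>c D') \<beta>)"
      "v \<in> bob (bprod D E D' E' \<Psi> \<Psi>') (src (D \<times>\<^sub>c D') \<beta>) z"
    then show "?\<theta> x z (src (D \<times>\<^sub>c D') \<beta>) (bmap (bprod C D C' D' \<Omega> \<Omega>') (ident (C \<times>\<^sub>c C') x) \<beta> u) v =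
        ?\<theta> x z (tgt (D \<times>\<^sub>c D') \<beta>) u (bmap (bprod D E D' E' \<Psi> \<Psi>') \<beta> (ident (E \<times>\<^sub>c E') z) v)"
      by (simp add: A.cc_balance B.cc_balance)
  next
    fix \<alpha> \<gamma> y u v assume a: "\<alpha> \<in> Ar (C \<times>\<^sub>c C')" "\<gamma> \<in> Ar (E \<times>\<^sub>c E')"
      "u \<in> bob (bprod C D C' D' \<Omega> \<Omega>') (src (C \<times>\<^sub>c C') \<alpha>) y"
      "v \<in> bob (bprod D E D' E' \<Psi> \<Psi>') y (tgt (E \<times>\<^sub>c E') \<gamma>)"
    then show "?\<theta> (tgt (C \<times>\<^sub>c C') \<alpha>) (src (E \<times>\<^sub>c E') \<gamma>) y
        (bmap (bprod C D C' D' \<Omega> \<Omega>') \<alpha> (ident (D \<times>\<^sub>c D') y) u)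
        (bmap (bprod D E D' E' \<Psi> \<Psi>') (ident (D \<times>\<^sub>c D') y) \<gamma> v) =
      bmap (bprod C E C' E' (bcomp C D E \<Omega> \<Psi>) (bcomp C' D' E' \<Omega>' \<Psi>')) \<alpha> \<gamma>
        (?\<theta> (src (C \<times>\<^sub>c C') \<alpha>) (tgt (E \<times>\<^sub>c E') \<gamma>) y u v)"
      by (simp add: A.cc_bob B.cc_bob A.bmap_bcomp' B.bmap_bcomp')
  next
    fix x z w assume a: "w \<in> bob (bprod C E C' E' (bcomp C D E \<Omega> \<Psi>) (bcomp C' D' E' \<Omega>' \<Psi>')) x z"
    obtain y u v where 1: "u \<in> bob \<Omega> (pi1 x) y" "v \<in> bob \<Psi> y (pi1 z)" "pi1 w = A.cc (pi1 x) (pi1 z) y u v"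
      using a A.bob_bcomp by auto
    obtain y' u' v' where 2: "u' \<in> bob \<Omega>' (pi2 x) y'" "v' \<in> bob \<Psi>' y' (pi2 z)" "pi2 w = B.cc (pi2 x) (pi2 z) y' u' v'"
      using a B.bob_bcomp by auto
    show "\<exists>y u v. u \<in> bob (bprod C D C' D' \<Omega> \<Omega>') x y \<and> v \<in> bob (bprod D E D' E' \<Psi> \<Psi>') y z \<and> ?\<theta> x z y u v = w"
      using 1 2 a A.oL[OF 1(1)] B.oL[OF 2(1)]
      by (intro exI[of _ "\<langle>y, y'\<rangle>"] exI[of _ "\<langle>u, u'\<rangle>"] exI[of _ "\<langle>v, v'\<rangle>"]) (auto simp: pr_eq_iff)
  next
    fix x z y u v y' u' v'
    assume a: "u \<in> bob (bprod C D C' D' \<Omega> \<Omega>') x y" "v \<in> bob (bprod D E D' E' \<Psi> \<Psi>') y z"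
      "u' \<in> bob (bprod C D C' D' \<Omega> \<Omega>') x y'" "v' \<in> bob (bprod D E D' E' \<Psi> \<Psi>') y' z"
      and eq: "?\<theta> x z y u v = ?\<theta> x z y' u' v'"
    \<comment> \<open>Injectivity changes one coordinate at a time: the first entries move along a
      zigzag in \<open>D\<close> while an identity holds the second ones, and then the roles are
      exchanged.\<close>
    have "P.cc x z \<langle>pi1 y, pi2 y\<rangle> \<langle>pi1 u, pi2 u\<rangle> \<langle>pi1 v, pi2 v\<rangle> = P.cc x z \<langle>pi1 y', pi2 y\<rangle> \<langle>pi1 u', pi2 u\<rangle> \<langle>pi1 v', pi2 v\<rangle>"
    proof (rule A.cc_lift[of "pi1 x" "pi1 z" "pi1 y" "pi1 u" "pi1 v" "pi1 y'" "pi1 u'" "pi1 v'"])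
      fix \<beta> p q assume b: "\<beta> \<in> Ar D" "p \<in> bob \<Omega> (pi1 x) (tgt D \<beta>)" "q \<in> bob \<Psi> (src D \<beta>) (pi1 z)"
      have "pi2 y \<in> Ob D'" using a(1) by simp
      then show "P.cc x z \<langle>src D \<beta>, pi2 y\<rangle> \<langle>bmap \<Omega> (ident C (pi1 x)) \<beta> p, pi2 u\<rangle> \<langle>q, pi2 v\<rangle> =
          P.cc x z \<langle>tgt D \<beta>, pi2 y\<rangle> \<langle>p, pi2 u\<rangle> \<langle>bmap \<Psi> \<beta> (ident E (pi1 z)) q, pi2 v\<rangle>"
        using P.cc_balance[of "\<langle>\<beta>, ident D' (pi2 y)\<rangle>" "\<langle>p, pi2 u\<rangle>" x "\<langle>q, pi2 v\<rangle>" z] a b by simp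
    qed (use a eq in auto)
    also have "\<dots> = P.cc x z \<langle>pi1 y', pi2 y'\<rangle> \<langle>pi1 u', pi2 u'\<rangle> \<langle>pi1 v', pi2 v'\<rangle>"
    proof (rule B.cc_lift[of "pi2 x" "pi2 z" "pi2 y" "pi2 u" "pi2 v" "pi2 y'" "pi2 u'" "pi2 v'"])
      fix \<beta> p q assume b: "\<beta> \<in> Ar D'" "p \<in> bob \<Omega>' (pi2 x) (tgt D' \<beta>)" "q \<in> bob \<Psi>' (src D' \<beta>) (pi2 z)"
      have "pi1 y' \<in> Ob D" using a(3) by simp
      then show "P.cc x z \<langle>pi1 y', src D' \<beta>\<rangle> \<langle>pi1 u', bmap \<Omega>' (ident C' (pi2 x)) \<beta> p\<rangle> \<langle>pi1 v', q\<rangle> =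
          P.cc x z \<langle>pi1 y', tgt D' \<beta>\<rangle> \<langle>pi1 u', p\<rangle> \<langle>pi1 v', bmap \<Psi>' \<beta> (ident E' (pi2 z)) q\<rangle>"
        using P.cc_balance[of "\<langle>ident D (pi1 y'), \<beta>\<rangle>" "\<langle>pi1 u', p\<rangle>" x "\<langle>pi1 v', q\<rangle>" z] a b by simp
    qed (use a eq in auto)
    finally show "P.cc x z y u v = P.cc x z y' u' v'" by simp
  qed
qed

section \<open>Duality and bending\<close>

lemma relab_dual: "fincat C \<Longrightarrow> fincat D \<Longrightarrow> relab (op_cat D) (op_cat C) C D (\<lambda>x z. z) (\<lambda>x z. x)"
  by unfold_locales simp_all

text \<open>Seen as a relabelling, dualisation inherits compatibility with isomorphisms and disjoint
  unions.\<close>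

lemma bdual_rl: assumes "\<Omega> \<in> bisets C D"
  shows "bdual \<Omega> = rl (op_cat D) (op_cat C) (\<lambda>x z. z) (\<lambda>x z. x) \<Omega>"
proof -
  have "bdual (norm_biset C D \<Omega>) = rl (op_cat D) (op_cat C) (\<lambda>x z. z) (\<lambda>x z. x) \<Omega>"
    by (auto simp: bdual_def rl_def norm_biset_def fun_eq_iff)
  then show ?thesis using bisetsD(7)[OF assms] by simp
qed

text \<open>Currying that changes no element: a biset for an arrow from
  \<open>C \<times>\<^sub>c D\<close> to \<open>E\<close> becomes one for an arrow from
  \<open>C\<close> to \<open>op_cat D \<times>\<^sub>c E\<close>.\<close>

definition bend :: "fcat \<Rightarrow> fcat \<Rightarrow> fcat \<Rightarrow> biset \<Rightarrow> biset" where
  "bend C D E = rl (op_cat D \<times>\<^sub>c E) C (\<lambda>x z. pi2 x) (\<lambda>x z. \<langle>z, pi1 x\<rangle>)"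

definition unbend :: "fcat \<Rightarrow> fcat \<Rightarrow> fcat \<Rightarrow> biset \<Rightarrow> biset" where
  "unbend C D E = rl E (C \<times>\<^sub>c D) (\<lambda>x z. \<langle>pi2 z, x\<rangle>) (\<lambda>x z. pi1 z)"

lemma relab_bend: "\<lbrakk>fincat C; fincat D; fincat E\<rbrakk> \<Longrightarrow>
    relab (op_cat D \<times>\<^sub>c E) C E (C \<times>\<^sub>c D) (\<lambda>x z. pi2 x) (\<lambda>x z. \<langle>z, pi1 x\<rangle>)"
  by unfold_locales (simp_all add: pr_eq_iff)

lemma relab_unbend: "\<lbrakk>fincat C; fincat D; fincat E\<rbrakk> \<Longrightarrow>
    relab E (C \<times>\<^sub>c D) (op_cat D \<times>\<^sub>c E) C (\<lambda>x z. \<langle>pi2 z, x\<rangle>) (\<lambda>x z. pi1 z)"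
  by unfold_locales (simp_all add: pr_eq_iff)

lemma bend_bisets: "\<lbrakk>fincat C; fincat D; fincat E; \<Theta> \<in> bisets E (C \<times>\<^sub>c D)\<rbrakk> \<Longrightarrow>
    bend C D E \<Theta> \<in> bisets (op_cat D \<times>\<^sub>c E) C"
  unfolding bend_def by (rule relab.rl_bisets[OF relab_bend])

lemma unbend_bisets: "\<lbrakk>fincat C; fincat D; fincat E; \<Theta> \<in> bisets (op_cat D \<times>\<^sub>c E) C\<rbrakk> \<Longrightarrow>
    unbend C D E \<Theta> \<in> bisets E (C \<times>\<^sub>c D)"
  unfolding unbend_def by (rule relab.rl_bisets[OF relab_unbend])

lemma unbend_bend: "\<lbrakk>fincat C; fincat D; fincat E; \<Theta> \<in> bisets E (C \<times>\<^sub>c D)\<rbrakk> \<Longrightarrow>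
    unbend C D E (bend C D E \<Theta>) = \<Theta>"
  unfolding bend_def unbend_def by (subst rl_rl[OF relab_unbend relab_bend]) (simp_all add: rl_id)

lemma bend_unbend: "\<lbrakk>fincat C; fincat D; fincat E; \<Theta> \<in> bisets (op_cat D \<times>\<^sub>c E) C\<rbrakk> \<Longrightarrow>
    bend C D E (unbend C D E \<Theta>) = \<Theta>"
  unfolding bend_def unbend_def by (subst rl_rl[OF relab_bend relab_unbend]) (simp_all add: rl_id)

text \<open>Naturality of bending in \<open>C\<close>. On the unbent side an element is
  \<open>[t, (v, d)]\<close> with \<open>d\<close> a morphism of \<open>D\<close>; absorbing
  \<open>d\<close> into \<open>t\<close> gives \<open>[t d, (v, 1)]\<close>, which is the form that
  elements of the bent side have.\<close>

lemma bend_source: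
  assumes cats: "fincat C" "fincat C'" "fincat D" "fincat E"
    and \<Theta>: "\<Theta> \<in> bisets E (C \<times>\<^sub>c D)" and f: "f \<in> bisets C C'"
  shows "biset_iso (op_cat D \<times>\<^sub>c E) C' (bcomp (op_cat D \<times>\<^sub>c E) C C' (bend C D E \<Theta>) f)
    (bend C' D E (bcomp E (C \<times>\<^sub>c D) (C' \<times>\<^sub>c D) \<Theta> (bprod C C' D D f (idb D))))"
proof -
  interpret R: bpair "op_cat D \<times>\<^sub>c E" C C' "bend C D E \<Theta>" f
    by unfold_locales (use assms bend_bisets in auto)
  interpret L: bpair E "C \<times>\<^sub>c D" "C' \<times>\<^sub>c D" \<Theta> "bprod C C' D D f (idb D)"
    by unfold_locales (use assms bprod_bisets idb_bisets in auto)
  note cats [simp] and f' [simp] = bisetsD(3-6)[OF f]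
  have bb: "u \<in> bob (bend C D E \<Theta>) x y \<longleftrightarrow> pi1 x \<in> Ob D \<and> pi2 x \<in> Ob E \<and> y \<in> Ob C \<and> u \<in> bob \<Theta> (pi2 x) \<langle>y, pi1 x\<rangle>" for u x y
    by (simp add: bend_def conj_assoc)
  have bm: "bmap (bend C D E \<Theta>) \<alpha> \<gamma> u = bmap \<Theta> (pi2 \<alpha>) \<langle>\<gamma>, pi1 \<alpha>\<rangle> u"
    if "pi1 \<alpha> \<in> Ar D" "pi2 \<alpha> \<in> Ar E" "\<gamma> \<in> Ar C" "u \<in> bob \<Theta> (src E (pi2 \<alpha>)) \<langle>tgt C \<gamma>, tgt D (pi1 \<alpha>)\<rangle>" for \<alpha> \<gamma> u
    using that by (simp add: bend_def)
  let ?\<theta> = "\<lambda>x z y u v. L.cc (pi2 x) \<langle>z, pi1 x\<rangle> \<langle>y, pi1 x\<rangle> u \<langle>v, ident D (pi1 x)\<rangle>"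
  show ?thesis
  proof (rule R.bcomp_iso[where \<theta> = ?\<theta>])
    show "bend C' D E (bcomp E (C \<times>\<^sub>c D) (C' \<times>\<^sub>c D) \<Theta> (bprod C C' D D f (idb D))) \<in> bisets (op_cat D \<times>\<^sub>c E) C'"
      by (intro bend_bisets cats L.bcomp_bisets)
    show "?\<theta> x z y u v \<in> bob (bend C' D E (bcomp E (C \<times>\<^sub>c D) (C' \<times>\<^sub>c D) \<Theta> (bprod C C' D D f (idb D)))) x z"
      if "u \<in> bob (bend C D E \<Theta>) x y" "v \<in> bob f y z" for x z y u v
      using that R.oR[OF that(2)] by (simp add: bb bend_def L.cc_bob)
  next
    fix x z \<beta> u v assume a: "\<beta> \<in> Ar C" "u \<in> bob (bend C D E \<Theta>) x (tgt C \<beta>)" "v \<in> bob f (src C \<beta>) z"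
    then show "?\<theta> x z (src C \<beta>) (bmap (bend C D E \<Theta>) (ident (op_cat D \<times>\<^sub>c E) x) \<beta> u) v =
        ?\<theta> x z (tgt C \<beta>) u (bmap f \<beta> (ident C' z) v)"
      using R.oR[OF a(3)] L.cc_balance[of "\<langle>\<beta>, ident D (pi1 x)\<rangle>" u "pi2 x" "\<langle>v, ident D (pi1 x)\<rangle>" "\<langle>z, pi1 x\<rangle>"]
      by (simp add: bb bm)
  next
    fix \<alpha> \<gamma> y u v assume a: "\<alpha> \<in> Ar (op_cat D \<times>\<^sub>c E)" "\<gamma> \<in> Ar C'"
      "u \<in> bob (bend C D E \<Theta>) (src (op_cat D \<times>\<^sub>c E) \<alpha>) y" "v \<in> bob f y (tgt C' \<gamma>)"
    then show "?\<theta> (tgt (op_cat D \<times>\<^sub>c E) \<alpha>) (src C' \<gamma>) y (bmap (bend C D E \<Theta>) \<alpha> (ident C y) u) (bmap f (ident C y) \<gamma> v) =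
        bmap (bend C' D E (bcomp E (C \<times>\<^sub>c D) (C' \<times>\<^sub>c D) \<Theta> (bprod C C' D D f (idb D)))) \<alpha> \<gamma>
          (?\<theta> (src (op_cat D \<times>\<^sub>c E) \<alpha>) (tgt C' \<gamma>) y u v)"
      using R.oR[OF a(4)]
        L.cc_balance[of "\<langle>ident C y, pi1 \<alpha>\<rangle>" "bmap \<Theta> (pi2 \<alpha>) \<langle>ident C y, ident D (tgt D (pi1 \<alpha>))\<rangle> u" "tgt E (pi2 \<alpha>)"
          "\<langle>bmap f (ident C y) \<gamma> v, ident D (src D (pi1 \<alpha>))\<rangle>" "\<langle>src C' \<gamma>, src D (pi1 \<alpha>)\<rangle>"]
      by (simp add: bb bm bend_def L.cc_bob L.bmap_bcomp')
  next
    fix x z w assume a: "w \<in> bob (bend C' D E (bcomp E (C \<times>\<^sub>c D) (C' \<times>\<^sub>c D) \<Theta> (bprod C C' D D f (idb D)))) x z"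
    then have o: "pi1 x \<in> Ob D" "pi2 x \<in> Ob E" "z \<in> Ob C'" by (auto simp: bend_def)
    obtain y u v where 1: "u \<in> bob \<Theta> (pi2 x) y" "v \<in> bob (bprod C C' D D f (idb D)) y \<langle>z, pi1 x\<rangle>"
      "w = L.cc (pi2 x) \<langle>z, pi1 x\<rangle> y u v"
      using a by (auto simp: bend_def L.bob_bcomp)
    show "\<exists>y u v. u \<in> bob (bend C D E \<Theta>) x y \<and> v \<in> bob f y z \<and> ?\<theta> x z y u v = w"
      using 1 o L.cc_balance[of "\<langle>ident C (pi1 y), pi2 v\<rangle>" u "pi2 x" "\<langle>pi1 v, ident D (pi1 x)\<rangle>" "\<langle>z, pi1 x\<rangle>"]
      by (intro exI[of _ "pi1 y"] exI[of _ "bmap \<Theta> (ident E (pi2 x)) \<langle>ident C (pi1 y), pi2 v\<rangle> u"] exI[of _ "pi1 v"])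
        (simp add: bb)
  next
    fix x z y u v y' u' v'
    assume a: "u \<in> bob (bend C D E \<Theta>) x y" "v \<in> bob f y z" "u' \<in> bob (bend C D E \<Theta>) x y'" "v' \<in> bob f y' z"
      and eq: "?\<theta> x z y u v = ?\<theta> x z y' u' v'"
    have o: "pi1 x \<in> Ob D" "pi2 x \<in> Ob E" "z \<in> Ob C'" using a R.oR[OF a(2)] by (auto simp: bb)
    let ?\<sigma> = "\<lambda>y u v. R.cc x z (pi1 y) (bmap \<Theta> (ident E (pi2 x)) \<langle>ident C (pi1 y), pi2 v\<rangle> u) (pi1 v)"
    have "?\<sigma> \<langle>y, pi1 x\<rangle> u \<langle>v, ident D (pi1 x)\<rangle> = ?\<sigma> \<langle>y', pi1 x\<rangle> u' \<langle>v', ident D (pi1 x)\<rangle>"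
    proof (rule L.cc_lift[OF eq])
      fix \<beta> u v assume b: "\<beta> \<in> Ar (C \<times>\<^sub>c D)" "u \<in> bob \<Theta> (pi2 x) (tgt (C \<times>\<^sub>c D) \<beta>)"
        "v \<in> bob (bprod C C' D D f (idb D)) (src (C \<times>\<^sub>c D) \<beta>) \<langle>z, pi1 x\<rangle>"
      then show "?\<sigma> (src (C \<times>\<^sub>c D) \<beta>) (bmap \<Theta> (ident E (pi2 x)) \<beta> u) v =
          ?\<sigma> (tgt (C \<times>\<^sub>c D) \<beta>) u (bmap (bprod C C' D D f (idb D)) \<beta> (ident (C' \<times>\<^sub>c D) \<langle>z, pi1 x\<rangle>) v)"
        using o R.cc_balance[of "pi1 \<beta>"
          "bmap \<Theta> (ident E (pi2 x)) \<langle>ident C (tgt C (pi1 \<beta>)), cmp D (pi2 \<beta>) (pi2 v)\<rangle> u" x "pi1 v" z]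
        by (simp add: bb bm)
    qed (use a o in \<open>auto simp: bb\<close>)
    then show "R.cc x z y u v = R.cc x z y' u' v'"
      using a L.bL(3)[of u "pi2 x" "\<langle>y, pi1 x\<rangle>"] L.bL(3)[of u' "pi2 x" "\<langle>y', pi1 x\<rangle>"] by (simp add: bb)
  qed
qed

lemma bdual_simps [simp]: "bob (bdual \<Omega>) y x = bob \<Omega> x y" "bmap (bdual \<Omega>) \<beta> \<alpha> = bmap \<Omega> \<alpha> \<beta>"
  by (simp_all add: bdual_def)

lemma bdual_bisets: "\<lbrakk>fincat C; fincat D; \<Omega> \<in> bisets C D\<rbrakk> \<Longrightarrow> bdual \<Omega> \<in> bisets (op_cat D) (op_cat C)"
  using relab.rl_bisets[OF relab_dual] by (simp add: bdual_rl)

text \<open>Naturality of bending in \<open>E\<close>. The factor \<open>idb (op_cat D)\<close>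
  contributes a morphism of \<open>D\<close>, which is absorbed into the element of
  \<open>\<Theta>\<close>.\<close>

lemma bend_target:
  assumes cats: "fincat C" "fincat D" "fincat E" "fincat E'"
    and \<Theta>: "\<Theta> \<in> bisets E (C \<times>\<^sub>c D)" and h: "h \<in> bisets E' E"
  shows "biset_iso (op_cat D \<times>\<^sub>c E') C
    (bcomp (op_cat D \<times>\<^sub>c E') (op_cat D \<times>\<^sub>c E) C (bprod (op_cat D) (op_cat D) E' E (idb (op_cat D)) h) (bend C D E \<Theta>))
    (bend C D E' (bcomp E' E (C \<times>\<^sub>c D) h \<Theta>))"
proof -
  let ?h = "bprod (op_cat D) (op_cat D) E' E (idb (op_cat D)) h"
  interpret L: bpair E' E "C \<times>\<^sub>c D" h \<Theta> by unfold_locales (use assms in auto)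
  interpret R: bpair "op_cat D \<times>\<^sub>c E'" "op_cat D \<times>\<^sub>c E" C ?h "bend C D E \<Theta>"
    by unfold_locales (use assms bprod_bisets idb_bisets bend_bisets in auto)
  note cats [simp]
  have bb: "u \<in> bob (bend C D E \<Theta>) x y \<longleftrightarrow> pi1 x \<in> Ob D \<and> pi2 x \<in> Ob E \<and> y \<in> Ob C \<and> u \<in> bob \<Theta> (pi2 x) \<langle>y, pi1 x\<rangle>" for u x y
    by (simp add: bend_def conj_assoc)
  have bm: "bmap (bend C D E \<Theta>) \<alpha> \<gamma> u = bmap \<Theta> (pi2 \<alpha>) \<langle>\<gamma>, pi1 \<alpha>\<rangle> u"
    if "pi1 \<alpha> \<in> Ar D" "pi2 \<alpha> \<in> Ar E" "\<gamma> \<in> Ar C" "u \<in> bob \<Theta> (src E (pi2 \<alpha>)) \<langle>tgt C \<gamma>, tgt D (pi1 \<alpha>)\<rangle>" for \<alpha> \<gamma> u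
    using that by (simp add: bend_def)
  let ?\<theta> = "\<lambda>x z y u v. L.cc (pi2 x) \<langle>z, pi1 x\<rangle> (pi2 y) (pi2 u) (bmap \<Theta> (ident E (pi2 y)) \<langle>ident C z, pi1 u\<rangle> v)"
  show ?thesis
  proof (rule R.bcomp_iso[where \<theta> = ?\<theta>])
    show "bend C D E' (bcomp E' E (C \<times>\<^sub>c D) h \<Theta>) \<in> bisets (op_cat D \<times>\<^sub>c E') C"
      by (intro bend_bisets cats L.bcomp_bisets)
    show "?\<theta> x z y u v \<in> bob (bend C D E' (bcomp E' E (C \<times>\<^sub>c D) h \<Theta>)) x z"
      if "u \<in> bob ?h x y" "v \<in> bob (bend C D E \<Theta>) y z" for x z y u v
      using that by (simp add: bb bend_def L.cc_bob)
  next
    fix x z \<beta> u v assume a: "\<beta> \<in> Ar (op_cat D \<times>\<^sub>c E)" "u \<in> bob ?h x (tgt (op_cat D \<times>\<^sub>c E) \<beta>)"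
      "v \<in> bob (bend C D E \<Theta>) (src (op_cat D \<times>\<^sub>c E) \<beta>) z"
    then show "?\<theta> x z (src (op_cat D \<times>\<^sub>c E) \<beta>) (bmap ?h (ident (op_cat D \<times>\<^sub>c E') x) \<beta> u) v =
        ?\<theta> x z (tgt (op_cat D \<times>\<^sub>c E) \<beta>) u (bmap (bend C D E \<Theta>) \<beta> (ident C z) v)"
      using L.cc_balance[of "pi2 \<beta>" "pi2 u" "pi2 x"
          "bmap \<Theta> (ident E (src E (pi2 \<beta>))) \<langle>ident C z, cmp D (pi1 \<beta>) (pi1 u)\<rangle> v" "\<langle>z, pi1 x\<rangle>"]
      by (simp add: bb bm)
  next
    fix \<alpha> \<gamma> y u v assume a: "\<alpha> \<in> Ar (op_cat D \<times>\<^sub>c E')" "\<gamma> \<in> Ar C"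
      "u \<in> bob ?h (src (op_cat D \<times>\<^sub>c E') \<alpha>) y" "v \<in> bob (bend C D E \<Theta>) y (tgt C \<gamma>)"
    then show "?\<theta> (tgt (op_cat D \<times>\<^sub>c E') \<alpha>) (src C \<gamma>) y (bmap ?h \<alpha> (ident (op_cat D \<times>\<^sub>c E) y) u)
          (bmap (bend C D E \<Theta>) (ident (op_cat D \<times>\<^sub>c E) y) \<gamma> v) =
        bmap (bend C D E' (bcomp E' E (C \<times>\<^sub>c D) h \<Theta>)) \<alpha> \<gamma> (?\<theta> (src (op_cat D \<times>\<^sub>c E') \<alpha>) (tgt C \<gamma>) y u v)"
      by (simp add: bb bm bend_def L.cc_bob L.bmap_bcomp')
  next
    fix x z w assume a: "w \<in> bob (bend C D E' (bcomp E' E (C \<times>\<^sub>c D) h \<Theta>)) x z"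
    then have o: "pi1 x \<in> Ob D" "pi2 x \<in> Ob E'" "z \<in> Ob C" by (auto simp: bend_def)
    obtain e k t where 1: "k \<in> bob h (pi2 x) e" "t \<in> bob \<Theta> e \<langle>z, pi1 x\<rangle>" "w = L.cc (pi2 x) \<langle>z, pi1 x\<rangle> e k t"
      using a by (auto simp: bend_def L.bob_bcomp)
    show "\<exists>y u v. u \<in> bob ?h x y \<and> v \<in> bob (bend C D E \<Theta>) y z \<and> ?\<theta> x z y u v = w"
      using 1 o L.oL[OF 1(1)] L.bR(3)[OF 1(2)]
      by (intro exI[of _ "\<langle>pi1 x, e\<rangle>"] exI[of _ "\<langle>ident D (pi1 x), k\<rangle>"] exI[of _ t]) (simp add: bb)
  next
    fix x z y u v y' u' v'
    assume a: "u \<in> bob ?h x y" "v \<in> bob (bend C D E \<Theta>) y z" "u' \<in> bob ?h x y'" "v' \<in> bob (bend C D E \<Theta>) y' z"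
      and eq: "?\<theta> x z y u v = ?\<theta> x z y' u' v'"
    have o: "pi1 x \<in> Ob D" "pi2 x \<in> Ob E'" "z \<in> Ob C" using a by (auto simp: bb)
    let ?\<sigma> = "\<lambda>e k t. R.cc x z \<langle>pi1 x, e\<rangle> \<langle>ident D (pi1 x), k\<rangle> t"
    have n: "R.cc x z y u v = ?\<sigma> (pi2 y) (pi2 u) (bmap \<Theta> (ident E (pi2 y)) \<langle>ident C z, pi1 u\<rangle> v)"
      if "u \<in> bob ?h x y" "v \<in> bob (bend C D E \<Theta>) y z" for y u v
      using that o R.cc_balance[of "\<langle>pi1 u, ident E (pi2 y)\<rangle>" "\<langle>ident D (pi1 x), pi2 u\<rangle>" x v z]
      by (simp add: bb bm)
    have "?\<sigma> (pi2 y) (pi2 u) (bmap \<Theta> (ident E (pi2 y)) \<langle>ident C z, pi1 u\<rangle> v) =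
        ?\<sigma> (pi2 y') (pi2 u') (bmap \<Theta> (ident E (pi2 y')) \<langle>ident C z, pi1 u'\<rangle> v')"
    proof (rule L.cc_lift[OF eq])
      fix \<beta> k t assume b: "\<beta> \<in> Ar E" "k \<in> bob h (pi2 x) (tgt E \<beta>)" "t \<in> bob \<Theta> (src E \<beta>) \<langle>z, pi1 x\<rangle>"
      then show "?\<sigma> (src E \<beta>) (bmap h (ident E' (pi2 x)) \<beta> k) t =
          ?\<sigma> (tgt E \<beta>) k (bmap \<Theta> \<beta> (ident (C \<times>\<^sub>c D) \<langle>z, pi1 x\<rangle>) t)"
        using o R.cc_balance[of "\<langle>ident D (pi1 x), \<beta>\<rangle>" "\<langle>ident D (pi1 x), k\<rangle>" x t z] by (simp add: bb bm)
    qed (use a o in \<open>auto simp: bb\<close>)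
    then show "R.cc x z y u v = R.cc x z y' u' v'" using n a by metis
  qed
qed

text \<open>Dinaturality of bending in \<open>D\<close>: acting by \<open>g\<close> before bending
  is acting by its dual afterwards. The morphism of \<open>E\<close> coming from
  \<open>idb E\<close> is absorbed on the way to the unbent side, the morphism of \<open>C\<close>
  coming from \<open>idb C\<close> on the way back.\<close>

lemma bend_dual:
  assumes cats: "fincat C" "fincat D" "fincat D'" "fincat E"
    and \<Theta>: "\<Theta> \<in> bisets E (C \<times>\<^sub>c D')" and g: "g \<in> bisets D' D"
  shows "biset_iso (op_cat D \<times>\<^sub>c E) C
    (bcomp (op_cat D \<times>\<^sub>c E) (op_cat D' \<times>\<^sub>c E) C (bprod (op_cat D) (op_cat D') E E (bdual g) (idb E)) (bend C D' E \<Theta>))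
    (bend C D E (bcomp E (C \<times>\<^sub>c D') (C \<times>\<^sub>c D) \<Theta> (bprod C C D' D (idb C) g)))"
proof -
  let ?h = "bprod (op_cat D) (op_cat D') E E (bdual g) (idb E)" and ?g = "bprod C C D' D (idb C) g"
  interpret L: bpair E "C \<times>\<^sub>c D'" "C \<times>\<^sub>c D" \<Theta> ?g
    by unfold_locales (use assms bprod_bisets idb_bisets in auto)
  interpret R: bpair "op_cat D \<times>\<^sub>c E" "op_cat D' \<times>\<^sub>c E" C ?h "bend C D' E \<Theta>"
    by unfold_locales (use assms bprod_bisets idb_bisets bend_bisets bdual_bisets in auto)
  note cats [simp] and g' [simp] = bisetsD(3-6)[OF g]
  have bb: "u \<in> bob (bend C D' E \<Theta>) x y \<longleftrightarrow> pi1 x \<in> Ob D' \<and> pi2 x \<in> Ob E \<and> y \<in> Ob C \<and> u \<in> bob \<Theta> (pi2 x) \<langle>y, pi1 x\<rangle>" for u x y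
    by (simp add: bend_def conj_assoc)
  have bm: "bmap (bend C D' E \<Theta>) \<alpha> \<gamma> u = bmap \<Theta> (pi2 \<alpha>) \<langle>\<gamma>, pi1 \<alpha>\<rangle> u"
    if "pi1 \<alpha> \<in> Ar D'" "pi2 \<alpha> \<in> Ar E" "\<gamma> \<in> Ar C" "u \<in> bob \<Theta> (src E (pi2 \<alpha>)) \<langle>tgt C \<gamma>, tgt D' (pi1 \<alpha>)\<rangle>" for \<alpha> \<gamma> u
    using that by (simp add: bend_def)
  let ?\<theta> = "\<lambda>x z y u v. L.cc (pi2 x) \<langle>z, pi1 x\<rangle> \<langle>z, pi1 y\<rangle>
    (bmap \<Theta> (pi2 u) \<langle>ident C z, ident D' (pi1 y)\<rangle> v) \<langle>ident C z, pi1 u\<rangle>"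
  show ?thesis
  proof (rule R.bcomp_iso[where \<theta> = ?\<theta>])
    show "bend C D E (bcomp E (C \<times>\<^sub>c D') (C \<times>\<^sub>c D) \<Theta> ?g) \<in> bisets (op_cat D \<times>\<^sub>c E) C"
      by (intro bend_bisets cats L.bcomp_bisets)
    show "?\<theta> x z y u v \<in> bob (bend C D E (bcomp E (C \<times>\<^sub>c D') (C \<times>\<^sub>c D) \<Theta> ?g)) x z"
      if "u \<in> bob ?h x y" "v \<in> bob (bend C D' E \<Theta>) y z" for x z y u v
      using that by (simp add: bb bend_def L.cc_bob)
  next
    fix x z \<beta> u v assume a: "\<beta> \<in> Ar (op_cat D' \<times>\<^sub>c E)" "u \<in> bob ?h x (tgt (op_cat D' \<times>\<^sub>c E) \<beta>)"
      "v \<in> bob (bend C D' E \<Theta>) (src (op_cat D' \<times>\<^sub>c E) \<beta>) z"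
    then show "?\<theta> x z (src (op_cat D' \<times>\<^sub>c E) \<beta>) (bmap ?h (ident (op_cat D \<times>\<^sub>c E) x) \<beta> u) v =
        ?\<theta> x z (tgt (op_cat D' \<times>\<^sub>c E) \<beta>) u (bmap (bend C D' E \<Theta>) \<beta> (ident C z) v)"
      using L.cc_balance[of "\<langle>ident C z, pi1 \<beta>\<rangle>" "bmap \<Theta> (cmp E (pi2 u) (pi2 \<beta>)) \<langle>ident C z, ident D' (tgt D' (pi1 \<beta>))\<rangle> v" "pi2 x"
          "\<langle>ident C z, pi1 u\<rangle>" "\<langle>z, pi1 x\<rangle>"]
      by (simp add: bb bm)
  next
    fix \<alpha> \<gamma> y u v assume a: "\<alpha> \<in> Ar (op_cat D \<times>\<^sub>c E)" "\<gamma> \<in> Ar C"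
      "u \<in> bob ?h (src (op_cat D \<times>\<^sub>c E) \<alpha>) y" "v \<in> bob (bend C D' E \<Theta>) y (tgt C \<gamma>)"
    then show "?\<theta> (tgt (op_cat D \<times>\<^sub>c E) \<alpha>) (src C \<gamma>) y (bmap ?h \<alpha> (ident (op_cat D' \<times>\<^sub>c E) y) u)
          (bmap (bend C D' E \<Theta>) (ident (op_cat D' \<times>\<^sub>c E) y) \<gamma> v) =
        bmap (bend C D E (bcomp E (C \<times>\<^sub>c D') (C \<times>\<^sub>c D) \<Theta> ?g)) \<alpha> \<gamma> (?\<theta> (src (op_cat D \<times>\<^sub>c E) \<alpha>) (tgt C \<gamma>) y u v)"
      using L.cc_balance[of "\<langle>\<gamma>, ident D' (pi1 y)\<rangle>"
          "bmap \<Theta> (cmp E (pi2 \<alpha>) (pi2 u)) \<langle>ident C (tgt C \<gamma>), ident D' (pi1 y)\<rangle> v" "tgt E (pi2 \<alpha>)"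
          "\<langle>ident C (src C \<gamma>), bmap g (ident D' (pi1 y)) (pi1 \<alpha>) (pi1 u)\<rangle>" "\<langle>src C \<gamma>, src D (pi1 \<alpha>)\<rangle>"]
      by (simp add: bb bm bend_def L.cc_bob L.bmap_bcomp')
  next
    fix x z w assume a: "w \<in> bob (bend C D E (bcomp E (C \<times>\<^sub>c D') (C \<times>\<^sub>c D) \<Theta> ?g)) x z"
    then have o: "pi1 x \<in> Ob D" "pi2 x \<in> Ob E" "z \<in> Ob C" by (auto simp: bend_def)
    obtain y t v where 1: "t \<in> bob \<Theta> (pi2 x) y" "v \<in> bob ?g y \<langle>z, pi1 x\<rangle>" "w = L.cc (pi2 x) \<langle>z, pi1 x\<rangle> y t v"
      using a by (auto simp: bend_def L.bob_bcomp)
    show "\<exists>y u v. u \<in> bob ?h x y \<and> v \<in> bob (bend C D' E \<Theta>) y z \<and> ?\<theta> x z y u v = w"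
      using 1 o L.cc_balance[of "\<langle>pi1 v, ident D' (pi2 y)\<rangle>" t "pi2 x" "\<langle>ident C z, pi2 v\<rangle>" "\<langle>z, pi1 x\<rangle>"]
      by (intro exI[of _ "\<langle>pi2 y, pi2 x\<rangle>"] exI[of _ "\<langle>pi2 v, ident E (pi2 x)\<rangle>"]
          exI[of _ "bmap \<Theta> (ident E (pi2 x)) \<langle>pi1 v, ident D' (pi2 y)\<rangle> t"]) (simp add: bb)
  next
    fix x z y u v y' u' v'
    assume a: "u \<in> bob ?h x y" "v \<in> bob (bend C D' E \<Theta>) y z" "u' \<in> bob ?h x y'" "v' \<in> bob (bend C D' E \<Theta>) y' z"
      and eq: "?\<theta> x z y u v = ?\<theta> x z y' u' v'"
    have o: "pi1 x \<in> Ob D" "pi2 x \<in> Ob E" "z \<in> Ob C" using a by (auto simp: bb)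
    let ?\<sigma> = "\<lambda>y t v. R.cc x z \<langle>pi2 y, pi2 x\<rangle> \<langle>pi2 v, ident E (pi2 x)\<rangle>
      (bmap \<Theta> (ident E (pi2 x)) \<langle>pi1 v, ident D' (pi2 y)\<rangle> t)"
    have n: "R.cc x z y u v = ?\<sigma> \<langle>z, pi1 y\<rangle> (bmap \<Theta> (pi2 u) \<langle>ident C z, ident D' (pi1 y)\<rangle> v) \<langle>ident C z, pi1 u\<rangle>"
      if "u \<in> bob ?h x y" "v \<in> bob (bend C D' E \<Theta>) y z" for y u v
      using that o R.cc_balance[of "\<langle>ident D' (pi1 y), pi2 u\<rangle>" "\<langle>pi1 u, ident E (pi2 x)\<rangle>" x v z]
      by (simp add: bb bm)
    have "?\<sigma> \<langle>z, pi1 y\<rangle> (bmap \<Theta> (pi2 u) \<langle>ident C z, ident D' (pi1 y)\<rangle> v) \<langle>ident C z, pi1 u\<rangle> =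
        ?\<sigma> \<langle>z, pi1 y'\<rangle> (bmap \<Theta> (pi2 u') \<langle>ident C z, ident D' (pi1 y')\<rangle> v') \<langle>ident C z, pi1 u'\<rangle>"
    proof (rule L.cc_lift[OF eq])
      fix \<beta> t v assume b: "\<beta> \<in> Ar (C \<times>\<^sub>c D')" "t \<in> bob \<Theta> (pi2 x) (tgt (C \<times>\<^sub>c D') \<beta>)"
        "v \<in> bob ?g (src (C \<times>\<^sub>c D') \<beta>) \<langle>z, pi1 x\<rangle>"
      then show "?\<sigma> (src (C \<times>\<^sub>c D') \<beta>) (bmap \<Theta> (ident E (pi2 x)) \<beta> t) v =
          ?\<sigma> (tgt (C \<times>\<^sub>c D') \<beta>) t (bmap ?g \<beta> (ident (C \<times>\<^sub>c D) \<langle>z, pi1 x\<rangle>) v)"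
        using o R.cc_balance[of "\<langle>pi2 \<beta>, ident E (pi2 x)\<rangle>" "\<langle>pi2 v, ident E (pi2 x)\<rangle>" x
          "bmap \<Theta> (ident E (pi2 x)) \<langle>cmp C (pi1 \<beta>) (pi1 v), ident D' (tgt D' (pi2 \<beta>))\<rangle> t" z]
        by (simp add: bb bm)
    qed (use a o in \<open>auto simp: bb\<close>)
    then show "R.cc x z y u v = R.cc x z y' u' v'" using n a by metis
  qed
qed

text \<open>The functors that permute and rebracket factors. Objects and morphisms of a product are
  coded in the same way, so one function on numbers acts on both; in \<open>unit1\<close> the number
  0 is at once the object and the morphism of \<open>one_cat\<close>. Elements of product bisets are
  coded alike, and the same functions rebracket them.\<close>

definition asc :: "nat \<Rightarrow> nat" where "asc x = \<langle>pi1 (pi1 x), \<langle>pi2 (pi1 x), pi2 x\<rangle>\<rangle>"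
definition asci :: "nat \<Rightarrow> nat" where "asci x = \<langle>\<langle>pi1 x, pi1 (pi2 x)\<rangle>, pi2 (pi2 x)\<rangle>"
definition swp :: "nat \<Rightarrow> nat" where "swp x = \<langle>pi2 x, pi1 x\<rangle>"
definition unit1 :: "nat \<Rightarrow> nat" where "unit1 x = \<langle>0, x\<rangle>"
definition mapp :: "(nat \<Rightarrow> nat) \<Rightarrow> (nat \<Rightarrow> nat) \<Rightarrow> nat \<Rightarrow> nat" where "mapp F G x = \<langle>F (pi1 x), G (pi2 x)\<rangle>"

lemma functr_asc: "\<lbrakk>fincat C; fincat D; fincat E\<rbrakk> \<Longrightarrow>
    functr ((C \<times>\<^sub>c D) \<times>\<^sub>c E) (C \<times>\<^sub>c D \<times>\<^sub>c E) asc"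
  by unfold_locales (auto simp: asc_def)

lemma functr_asci: "\<lbrakk>fincat C; fincat D; fincat E\<rbrakk> \<Longrightarrow>
    functr (C \<times>\<^sub>c D \<times>\<^sub>c E) ((C \<times>\<^sub>c D) \<times>\<^sub>c E) asci"
  by unfold_locales (auto simp: asci_def)

lemma functr_swp: "fincat C \<Longrightarrow> fincat D \<Longrightarrow> functr (C \<times>\<^sub>c D) (D \<times>\<^sub>c C) swp"
  by unfold_locales (auto simp: swp_def)

lemma functr_unit1: "fincat C \<Longrightarrow> functr C (one_cat \<times>\<^sub>c C) unit1"
  by unfold_locales (auto simp: unit1_def)

lemma functr_pi2: "fincat C \<Longrightarrow> functr (one_cat \<times>\<^sub>c C) C pi2"
  by unfold_locales auto

lemma functr_mapp: "functr C D F \<Longrightarrow> functr C' D' G \<Longrightarrow> functr (C \<times>\<^sub>c C') (D \<times>\<^sub>c D') (mapp F G)"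
  unfolding functr_def by (auto simp: mapp_def)

lemma functr_id: "fincat C \<Longrightarrow> functr C C (\<lambda>x. x)"
  by unfold_locales auto

lemma functr_comp: "functr C D F \<Longrightarrow> functr D E G \<Longrightarrow> functr C E (\<lambda>x. G (F x))"
  unfolding functr_def by auto

lemma asc_asci [simp]: "asc (asci x) = x" "asci (asc x) = x" "swp (swp x) = x"
  by (simp_all add: asc_def asci_def swp_def)

lemma fb_comp:
  assumes F: "functr C D F" and G: "functr D E G"
  shows "biset_iso E C (bcomp E D C (fb E D G) (fb D C F)) (fb E C (\<lambda>x. G (F x)))"
proof -
  have c: "fincat C" "fincat D" "fincat E" using F G by (auto simp: functr_def)
  have "rl E C (\<lambda>x z. x) (\<lambda>x z. F z) (fb E D G) = fb E C (\<lambda>x. G (F x))"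
    unfolding fb_def
    by (rule rl_rl[OF relab_right[OF F] relab_right[OF G]]) (use c idb_bisets in auto)
  then show ?thesis using bcomp_fb_right[OF F c(3) fb_bisets[OF G]] by simp
qed

lemma fb_cong:
  assumes "fincat C" "fincat D" "\<And>x. x \<in> Ob C \<Longrightarrow> F x = G x" "\<And>x. x \<in> Ar C \<Longrightarrow> F x = G x"
  shows "fb D C F = fb D C G"
  unfolding fb_def by (rule rl_cong) (use assms in auto)

lemma bprod_fb:
  assumes F: "functr C D F" and G: "functr C' D' G"
  shows "bprod D C D' C' (fb D C F) (fb D' C' G) = fb (D \<times>\<^sub>c D') (C \<times>\<^sub>c C') (mapp F G)"
proof -
  interpret F: functr C D F by fact
  interpret G: functr C' D' G by fact
  show ?thesis
  proof (rule biset_eqI)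
    show "bprod D C D' C' (fb D C F) (fb D' C' G) \<in> bisets (D \<times>\<^sub>c D') (C \<times>\<^sub>c C')"
      by (intro bprod_bisets fb_bisets F G) auto
    show "fb (D \<times>\<^sub>c D') (C \<times>\<^sub>c C') (mapp F G) \<in> bisets (D \<times>\<^sub>c D') (C \<times>\<^sub>c C')"
      by (intro fb_bisets functr_mapp F G)
    show "bob (bprod D C D' C' (fb D C F) (fb D' C' G)) x y = bob (fb (D \<times>\<^sub>c D') (C \<times>\<^sub>c C') (mapp F G)) x y" for x y
      by (auto simp: fb_def mapp_def pr_eq_iff)
  qed (auto simp: fb_def mapp_def pr_eq_iff)
qed

text \<open>The two relabellings are what \<open>bcomp_fb_left\<close> and
  \<open>bcomp_fb_right\<close> make of the composites of the products with the biset of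
  \<open>asci\<close>. The bijection between them rebrackets elements.\<close>

lemma asci_natural:
  assumes cats: "fincat A" "fincat A'" "fincat B" "fincat B'" "fincat C" "fincat C'"
    and bs: "f \<in> bisets A' A" "g \<in> bisets B' B" "h \<in> bisets C' C"
  shows "biset_iso ((A' \<times>\<^sub>c B') \<times>\<^sub>c C') (A \<times>\<^sub>c B \<times>\<^sub>c C)
    (rl ((A' \<times>\<^sub>c B') \<times>\<^sub>c C') (A \<times>\<^sub>c B \<times>\<^sub>c C) (\<lambda>x z. asc x) (\<lambda>x z. z)
      (bprod A' A (B' \<times>\<^sub>c C') (B \<times>\<^sub>c C) f (bprod B' B C' C g h)))
    (rl ((A' \<times>\<^sub>c B') \<times>\<^sub>c C') (A \<times>\<^sub>c B \<times>\<^sub>c C) (\<lambda>x z. x) (\<lambda>x z. asci z)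
      (bprod (A' \<times>\<^sub>c B') (A \<times>\<^sub>c B) C' C (bprod A' A B' B f g) h))"
    (is "biset_iso ?X ?Y ?P ?Q")
proof (rule biset_isoI[of _ _ "\<lambda>x z. asci"])
  show "bij_betw asci (bob ?P x y) (bob ?Q x y)" for x y
    by (rule bij_betw_byWitness[of _ asc]) (auto simp: asc_def asci_def)
qed (use cats in \<open>auto simp: asc_def asci_def\<close>)

lemma swp_natural:
  assumes cats: "fincat A" "fincat A'" "fincat B" "fincat B'"
    and bs: "f \<in> bisets A' A" "g \<in> bisets B' B"
  shows "biset_iso (B' \<times>\<^sub>c A') (A \<times>\<^sub>c B)
    (rl (B' \<times>\<^sub>c A') (A \<times>\<^sub>c B) (\<lambda>x z. swp x) (\<lambda>x z. z) (bprod A' A B' B f g))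
    (rl (B' \<times>\<^sub>c A') (A \<times>\<^sub>c B) (\<lambda>x z. x) (\<lambda>x z. swp z) (bprod B' B A' A g f))"
    (is "biset_iso ?X ?Y ?P ?Q")
proof (rule biset_isoI[of _ _ "\<lambda>x z. swp"])
  show "bij_betw swp (bob ?P x y) (bob ?Q x y)" for x y
    by (rule bij_betw_byWitness[of _ swp]) (auto simp: swp_def)
qed (use cats in \<open>auto simp: swp_def\<close>)

lemma unit1_natural:
  assumes cats: "fincat D" "fincat D'" and h: "h \<in> bisets D' D"
  shows "biset_iso (one_cat \<times>\<^sub>c D') D (rl (one_cat \<times>\<^sub>c D') D (\<lambda>x z. pi2 x) (\<lambda>x z. z) h)
    (rl (one_cat \<times>\<^sub>c D') D (\<lambda>x z. x) (\<lambda>x z. unit1 z) (bprod one_cat one_cat D' D (idb one_cat) h))"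
    (is "biset_iso ?X ?Y ?P ?Q")
proof (rule biset_isoI[of _ _ "\<lambda>x z. unit1"])
  show "bij_betw unit1 (bob ?P x y) (bob ?Q x y)" for x y
    by (rule bij_betw_byWitness[of _ pi2]) (use bisetsD(1,2)[OF h] in \<open>auto simp: unit1_def pr_collapse\<close>)
qed (use cats in \<open>auto simp: unit1_def\<close>)

section \<open>The category of bisets\<close>

lemma bilin_map_simps:
  assumes "module R A" "module R B" "module R D" and h: "bilin_map R A B D h"
  shows "x \<in> carrier A \<Longrightarrow> y \<in> carrier B \<Longrightarrow> h x y \<in> carrier D"
    and "\<lbrakk>x \<in> carrier A; x' \<in> carrier A; y \<in> carrier B\<rbrakk> \<Longrightarrow> h (x \<oplus>\<^bsub>A\<^esub> x') y = h x y \<oplus>\<^bsub>D\<^esub> h x' y"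
    and "\<lbrakk>x \<in> carrier A; y \<in> carrier B; y' \<in> carrier B\<rbrakk> \<Longrightarrow> h x (y \<oplus>\<^bsub>B\<^esub> y') = h x y \<oplus>\<^bsub>D\<^esub> h x y'"
    and "\<lbrakk>r \<in> carrier R; x \<in> carrier A; y \<in> carrier B\<rbrakk> \<Longrightarrow> h (r \<odot>\<^bsub>A\<^esub> x) y = r \<odot>\<^bsub>D\<^esub> h x y"
    and "\<lbrakk>r \<in> carrier R; x \<in> carrier A; y \<in> carrier B\<rbrakk> \<Longrightarrow> h x (r \<odot>\<^bsub>B\<^esub> y) = r \<odot>\<^bsub>D\<^esub> h x y"
    and "y \<in> carrier B \<Longrightarrow> h \<zero>\<^bsub>A\<^esub> y = \<zero>\<^bsub>D\<^esub>"
    and "x \<in> carrier A \<Longrightarrow> h x \<zero>\<^bsub>B\<^esub> = \<zero>\<^bsub>D\<^esub>"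
  using lin_map_zero[OF assms(1,3) bilin_mapD(2)[OF h]] lin_map_zero[OF assms(2,3) bilin_mapD(1)[OF h]]
    bilin_mapD[OF h] by (auto simp: lin_map_def Pi_iff)

lemma lin_map_simps:
  assumes "module R A" "module R B" and h: "lin_map R A B h"
  shows "x \<in> carrier A \<Longrightarrow> h x \<in> carrier B"
    and "x \<in> carrier A \<Longrightarrow> y \<in> carrier A \<Longrightarrow> h (x \<oplus>\<^bsub>A\<^esub> y) = h x \<oplus>\<^bsub>B\<^esub> h y"
    and "r \<in> carrier R \<Longrightarrow> x \<in> carrier A \<Longrightarrow> h (r \<odot>\<^bsub>A\<^esub> x) = r \<odot>\<^bsub>B\<^esub> h x"
    and "h \<zero>\<^bsub>A\<^esub> = \<zero>\<^bsub>B\<^esub>"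
  using lin_map_zero[OF assms] h by (auto simp: lin_map_def)

lemma module_simps:
  assumes "module R M"
  shows "\<zero>\<^bsub>M\<^esub> \<in> carrier M"
    and "x \<in> carrier M \<Longrightarrow> y \<in> carrier M \<Longrightarrow> x \<oplus>\<^bsub>M\<^esub> y \<in> carrier M"
    and "r \<in> carrier R \<Longrightarrow> x \<in> carrier M \<Longrightarrow> r \<odot>\<^bsub>M\<^esub> x \<in> carrier M"
proof -
  interpret module R M by fact
  show "\<zero>\<^bsub>M\<^esub> \<in> carrier M" "x \<in> carrier M \<Longrightarrow> y \<in> carrier M \<Longrightarrow> x \<oplus>\<^bsub>M\<^esub> y \<in> carrier M"
    "r \<in> carrier R \<Longrightarrow> x \<in> carrier M \<Longrightarrow> r \<odot>\<^bsub>M\<^esub> x \<in> carrier M" by auto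
qed

context coefficients
begin

abbreviation "bh C D \<equiv> carrier (bhom R C D)"

abbreviation bfunctor :: "('r, 'm) bfun \<Rightarrow> bool" where "bfunctor \<equiv> biset_functor R"

lemma brels_closed: assumes "fincat C" "fincat D"
  shows "brels R C D \<subseteq> carrier (free_mod R (bisets D C))"
proof -
  interpret F: module R "free_mod R (bisets D C)" by (rule free_mod_module)
  have "(\<lambda>x. f x \<ominus> g x) \<in> carrier (free_mod R (bisets D C))"
    if "f \<in> carrier (free_mod R (bisets D C))" "g \<in> carrier (free_mod R (bisets D C))" for f g
    using F.minus_closed[OF that] free_mod_diff[OF that] by simp
  moreover have "(\<lambda>x. f x \<oplus> g x) \<in> carrier (free_mod R (bisets D C))"
    if "f \<in> carrier (free_mod R (bisets D C))" "g \<in> carrier (free_mod R (bisets D C))" for f g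
    using F.a_closed[OF that] by simp
  ultimately show ?thesis using assms by (auto simp: brels_def bsum_bisets)
qed

context
  fixes C D assumes cats [simp]: "fincat C" "fincat D"
begin

lemma bhom_module: "module R (bhom R C D)"
  unfolding bhom_def by (rule pres_module[OF brels_closed]) auto

lemma bcls_closed: "\<Omega> \<in> bisets D C \<Longrightarrow> bcls R C D \<Omega> \<in> bh C D"
  unfolding bhom_def bcls_def by (rule pgen_closed[OF brels_closed]) auto

lemma bcls_iso: assumes "\<Omega> \<in> bisets D C" "\<Psi> \<in> bisets D C" "biset_iso D C \<Omega> \<Psi>"
  shows "bcls R C D \<Omega> = bcls R C D \<Psi>"
  unfolding bcls_def pgen_pcls
  by (rule pcls_eq[OF brels_closed]) (use assms in \<open>auto simp: brels_def\<close>)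

lemma bcls_bsum: assumes "\<Omega> \<in> bisets D C" "\<Psi> \<in> bisets D C"
  shows "bcls R C D (bsum D C \<Omega> \<Psi>) = bcls R C D \<Omega> \<oplus>\<^bsub>bhom R C D\<^esub> bcls R C D \<Psi>"
proof -
  interpret F: module R "free_mod R (bisets D C)" by (rule free_mod_module)
  let ?b = "basis_elt R \<Omega> \<oplus>\<^bsub>free_mod R (bisets D C)\<^esub> basis_elt R \<Psi>"
  have b: "?b \<in> carrier (free_mod R (bisets D C))" using assms by blast
  have "pcls (bisets D C) (brels R C D) (basis_elt R (bsum D C \<Omega> \<Psi>)) = pcls (bisets D C) (brels R C D) ?b"
    by (rule pcls_eq[OF brels_closed]) (use assms b bsum_bisets in \<open>auto simp: brels_def\<close>)
  also have "\<dots> = pcls (bisets D C) (brels R C D) (basis_elt R \<Omega>) \<oplus>\<^bsub>bhom R C D\<^esub> pcls (bisets D C) (brels R C D) (basis_elt R \<Psi>)"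
    unfolding bhom_def using assms by (intro lin_map_add[OF pcls_lin[OF brels_closed]]) auto
  finally show ?thesis by (simp add: bcls_def pgen_pcls)
qed

lemma bhom_induct [consumes 1, case_names zero add gen]:
  assumes "k \<in> bh C D"
    and "P \<zero>\<^bsub>bhom R C D\<^esub>"
    and "\<And>k l. \<lbrakk>k \<in> bh C D; l \<in> bh C D; P k; P l\<rbrakk> \<Longrightarrow> P (k \<oplus>\<^bsub>bhom R C D\<^esub> l)"
    and "\<And>r \<Omega>. r \<in> carrier R \<Longrightarrow> \<Omega> \<in> bisets D C \<Longrightarrow> P (r \<odot>\<^bsub>bhom R C D\<^esub> bcls R C D \<Omega>)"
  shows "P k"
  using assms unfolding bhom_def bcls_def by (rule pres_induct[OF brels_closed[OF cats]]) auto

text \<open>Universal property of the Grothendieck group with coefficients: the hypotheses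
  \<open>iso\<close> and \<open>sum\<close> kill the two families of relators in
  \<open>brels\<close>.\<close>

lemma bhom_lift:
  fixes M :: "('r, 'a) module"
  assumes M: "module R M" and h: "\<And>\<Omega>. \<Omega> \<in> bisets D C \<Longrightarrow> h \<Omega> \<in> carrier M"
    and iso: "\<And>\<Omega> \<Psi>. \<Omega> \<in> bisets D C \<Longrightarrow> \<Psi> \<in> bisets D C \<Longrightarrow> biset_iso D C \<Omega> \<Psi> \<Longrightarrow> h \<Omega> = h \<Psi>"
    and sum: "\<And>\<Omega> \<Psi>. \<Omega> \<in> bisets D C \<Longrightarrow> \<Psi> \<in> bisets D C \<Longrightarrow> h (bsum D C \<Omega> \<Psi>) = h \<Omega> \<oplus>\<^bsub>M\<^esub> h \<Psi>"
  shows "lin_map R (bhom R C D) M (plift R M h)"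
    and "\<Omega> \<in> bisets D C \<Longrightarrow> plift R M h (bcls R C D \<Omega>) = h \<Omega>"
proof -
  interpret M: module R M by fact
  interpret F: module R "free_mod R (bisets D C)" by (rule free_mod_module)
  have h': "h \<in> bisets D C \<rightarrow> carrier M" using h by auto
  note le = lin_ext[OF M h']
  have d: "lin_ext M h (\<lambda>x. f x \<ominus> g x) = lin_ext M h f \<ominus>\<^bsub>M\<^esub> lin_ext M h g"
    if "f \<in> carrier (free_mod R (bisets D C))" "g \<in> carrier (free_mod R (bisets D C))" for f g
    using lin_map_minus[OF free_mod_module M le(1) that] free_mod_diff[OF that] by simp
  have a: "lin_ext M h (\<lambda>x. f x \<oplus> g x) = lin_ext M h f \<oplus>\<^bsub>M\<^esub> lin_ext M h g"
    if "f \<in> carrier (free_mod R (bisets D C))" "g \<in> carrier (free_mod R (bisets D C))" for f g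
    using lin_map_add[OF le(1) that] by simp
  have c: "(\<lambda>x. f x \<oplus> g x) \<in> carrier (free_mod R (bisets D C))"
    if "f \<in> carrier (free_mod R (bisets D C))" "g \<in> carrier (free_mod R (bisets D C))" for f g
    using F.a_closed[OF that] by simp
  have rel: "lin_ext M h s = \<zero>\<^bsub>M\<^esub>" if "s \<in> brels R C D" for s
  proof -
    consider \<Omega> \<Psi> where "\<Omega> \<in> bisets D C" "\<Psi> \<in> bisets D C" "biset_iso D C \<Omega> \<Psi>" "s = (\<lambda>x. basis_elt R \<Omega> x \<ominus> basis_elt R \<Psi> x)"
      | \<Omega> \<Psi> where "\<Omega> \<in> bisets D C" "\<Psi> \<in> bisets D C"
        "s = (\<lambda>x. basis_elt R (bsum D C \<Omega> \<Psi>) x \<ominus> (basis_elt R \<Omega> x \<oplus> basis_elt R \<Psi> x))"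
      using \<open>s \<in> brels R C D\<close> by (auto simp: brels_def)
    then show ?thesis
    proof cases
      case 1
      then have "lin_ext M h s = h \<Omega> \<ominus>\<^bsub>M\<^esub> h \<Psi>" by (simp add: d le(2))
      then show ?thesis using 1 h[of \<Psi>] iso[of \<Omega> \<Psi>] by (simp add: a_minus_def M.r_neg)
    next
      case 2
      then have "lin_ext M h s = h (bsum D C \<Omega> \<Psi>) \<ominus>\<^bsub>M\<^esub> (h \<Omega> \<oplus>\<^bsub>M\<^esub> h \<Psi>)"
        using bsum_bisets[OF cats(2,1) 2(1,2)] by (simp add: d a c le(2))
      then show ?thesis using 2 h[of \<Psi>] h[of \<Omega>] sum[of \<Omega> \<Psi>] by (simp add: a_minus_def M.r_neg)
    qed
  qed
  show "lin_map R (bhom R C D) M (plift R M h)" "\<Omega> \<in> bisets D C \<Longrightarrow> plift R M h (bcls R C D \<Omega>) = h \<Omega>"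
    unfolding bhom_def bcls_def using plift[OF brels_closed[OF cats] M h' rel] by auto
qed

lemma bhom_ext:
  assumes "module R M" "lin_map R (bhom R C D) M h" "lin_map R (bhom R C D) M h'"
    and "\<And>\<Omega>. \<Omega> \<in> bisets D C \<Longrightarrow> h (bcls R C D \<Omega>) = h' (bcls R C D \<Omega>)" and "k \<in> bh C D"
  shows "h k = h' k"
  using pres_ext[OF brels_closed[OF cats] assms(1)] assms(2-) unfolding bhom_def bcls_def by blast

end

lemmas bhom_induct' = bhom_induct [consumes 3, case_names zero add gen]

lemmas bhom_simps [simp] = module_simps[OF bhom_module] bcls_closed

text \<open>Two-variable form of \<open>bhom_lift\<close>, in the nested shape in which
  \<open>bcmp\<close> and \<open>mprod\<close> are defined. The inner lift is linear in
  \<open>f\<close> for each biset \<open>\<Omega>\<close>, and \<open>bhom_ext\<close> shows that it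
  respects the relations in \<open>\<Omega>\<close>. Linearity in \<open>f\<close> of the outer lift
  is then proved by induction on \<open>g\<close>.\<close>

lemma bhom_bilift:
  fixes M :: "('r, 'a) module"
  assumes cats: "fincat C" "fincat D" "fincat C'" "fincat D'"
    and M: "module R M" and h: "\<And>\<Omega> \<Psi>. \<Omega> \<in> bisets D C \<Longrightarrow> \<Psi> \<in> bisets D' C' \<Longrightarrow> h \<Omega> \<Psi> \<in> carrier M"
    and iso: "\<And>\<Omega> \<Omega>' \<Psi> \<Psi>'. \<Omega> \<in> bisets D C \<Longrightarrow> \<Omega>' \<in> bisets D C \<Longrightarrow> \<Psi> \<in> bisets D' C' \<Longrightarrow> \<Psi>' \<in> bisets D' C' \<Longrightarrow>
      biset_iso D C \<Omega> \<Omega>' \<Longrightarrow> biset_iso D' C' \<Psi> \<Psi>' \<Longrightarrow> h \<Omega> \<Psi> = h \<Omega>' \<Psi>'"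
    and sum1: "\<And>\<Omega> \<Omega>' \<Psi>. \<Omega> \<in> bisets D C \<Longrightarrow> \<Omega>' \<in> bisets D C \<Longrightarrow> \<Psi> \<in> bisets D' C' \<Longrightarrow>
      h (bsum D C \<Omega> \<Omega>') \<Psi> = h \<Omega> \<Psi> \<oplus>\<^bsub>M\<^esub> h \<Omega>' \<Psi>"
    and sum2: "\<And>\<Omega> \<Psi> \<Psi>'. \<Omega> \<in> bisets D C \<Longrightarrow> \<Psi> \<in> bisets D' C' \<Longrightarrow> \<Psi>' \<in> bisets D' C' \<Longrightarrow>
      h \<Omega> (bsum D' C' \<Psi> \<Psi>') = h \<Omega> \<Psi> \<oplus>\<^bsub>M\<^esub> h \<Omega> \<Psi>'"
  shows "bilin_map R (bhom R C D) (bhom R C' D') M (\<lambda>g f. plift R M (\<lambda>\<Omega>. plift R M (h \<Omega>) f) g)"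
    and "\<Omega> \<in> bisets D C \<Longrightarrow> \<Psi> \<in> bisets D' C' \<Longrightarrow>
      plift R M (\<lambda>\<Omega>. plift R M (h \<Omega>) (bcls R C' D' \<Psi>)) (bcls R C D \<Omega>) = h \<Omega> \<Psi>"
proof -
  interpret M: module R M by fact
  note [simp] = cats
  have in2: "lin_map R (bhom R C' D') M (plift R M (h \<Omega>))"
    "\<And>\<Psi>. \<Psi> \<in> bisets D' C' \<Longrightarrow> plift R M (h \<Omega>) (bcls R C' D' \<Psi>) = h \<Omega> \<Psi>" if "\<Omega> \<in> bisets D C" for \<Omega>
  proof -
    have i: "h \<Omega> \<Psi> = h \<Omega> \<Psi>'" if "\<Psi> \<in> bisets D' C'" "\<Psi>' \<in> bisets D' C'" "biset_iso D' C' \<Psi> \<Psi>'" for \<Psi> \<Psi>'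
      by (rule iso[OF \<open>\<Omega> \<in> bisets D C\<close> \<open>\<Omega> \<in> bisets D C\<close> that(1,2) biset_iso_refl that(3)])
    note l = bhom_lift[OF cats(3,4) M h[OF that] i sum2[OF that]]
    show "lin_map R (bhom R C' D') M (plift R M (h \<Omega>))" by (rule l(1))
    show "plift R M (h \<Omega>) (bcls R C' D' \<Psi>) = h \<Omega> \<Psi>" if "\<Psi> \<in> bisets D' C'" for \<Psi>
      by (rule l(2)) (assumption | rule that)+
  qed
  have out: "lin_map R (bhom R C D) M (plift R M (\<lambda>\<Omega>. plift R M (h \<Omega>) f))"
    "\<And>\<Omega>. \<Omega> \<in> bisets D C \<Longrightarrow> plift R M (\<lambda>\<Omega>. plift R M (h \<Omega>) f) (bcls R C D \<Omega>) = plift R M (h \<Omega>) f"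
    if f: "f \<in> bh C' D'" for f
  proof -
    have 1: "plift R M (h \<Omega>) f \<in> carrier M" if "\<Omega> \<in> bisets D C" for \<Omega>
      using lin_map_closed[OF in2(1)[OF that] f] .
    have 2: "plift R M (h \<Omega>) f = plift R M (h \<Omega>') f"
      if "\<Omega> \<in> bisets D C" "\<Omega>' \<in> bisets D C" "biset_iso D C \<Omega> \<Omega>'" for \<Omega> \<Omega>'
    proof (rule bhom_ext[OF cats(3,4) M in2(1)[OF that(1)] in2(1)[OF that(2)] _ f])
      fix \<Psi> assume \<Psi>: "\<Psi> \<in> bisets D' C'"
      show "plift R M (h \<Omega>) (bcls R C' D' \<Psi>) = plift R M (h \<Omega>') (bcls R C' D' \<Psi>)"
        unfolding in2(2)[OF that(1) \<Psi>] in2(2)[OF that(2) \<Psi>]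
        by (rule iso[OF that(1,2) \<Psi> \<Psi> that(3) biset_iso_refl])
    qed
    have 3: "plift R M (h (bsum D C \<Omega> \<Omega>')) f = plift R M (h \<Omega>) f \<oplus>\<^bsub>M\<^esub> plift R M (h \<Omega>') f"
      if "\<Omega> \<in> bisets D C" "\<Omega>' \<in> bisets D C" for \<Omega> \<Omega>'
    proof (rule bhom_ext[OF cats(3,4) M in2(1) _ _ f])
      show "bsum D C \<Omega> \<Omega>' \<in> bisets D C" using that by (simp add: bsum_bisets)
      show "lin_map R (bhom R C' D') M (\<lambda>f. plift R M (h \<Omega>) f \<oplus>\<^bsub>M\<^esub> plift R M (h \<Omega>') f)"
        using in2(1)[OF that(1)] in2(1)[OF that(2)] unfolding lin_map_def
        by (auto simp: Pi_iff M.a_ac M.smult_r_distr)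
    qed (use that sum1 in \<open>simp add: in2(2) bsum_bisets\<close>)
    show "lin_map R (bhom R C D) M (plift R M (\<lambda>\<Omega>. plift R M (h \<Omega>) f))"
      "\<And>\<Omega>. \<Omega> \<in> bisets D C \<Longrightarrow> plift R M (\<lambda>\<Omega>. plift R M (h \<Omega>) f) (bcls R C D \<Omega>) = plift R M (h \<Omega>) f"
      using bhom_lift[OF cats(1,2) M 1 2 3] by auto
  qed
  show "\<Omega> \<in> bisets D C \<Longrightarrow> \<Psi> \<in> bisets D' C' \<Longrightarrow>
      plift R M (\<lambda>\<Omega>. plift R M (h \<Omega>) (bcls R C' D' \<Psi>)) (bcls R C D \<Omega>) = h \<Omega> \<Psi>"
    using out(2) in2(2) by simp
  let ?F = "\<lambda>g f. plift R M (\<lambda>\<Omega>. plift R M (h \<Omega>) f) g"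
  note ol [simp] = lin_map_simps[OF bhom_module M out(1)]
  have add: "?F g (f \<oplus>\<^bsub>bhom R C' D'\<^esub> f') = ?F g f \<oplus>\<^bsub>M\<^esub> ?F g f'"
    if g: "g \<in> bh C D" and f: "f \<in> bh C' D'" "f' \<in> bh C' D'" for g f f'
    using cats(1,2) g
  proof (induction rule: bhom_induct')
    case (add k l)
    then show ?case using f by (simp add: M.a_ac)
  next
    case (gen r \<Omega>)
    then show ?case using f lin_map_closed[OF in2(1)[OF gen(2)]]
      by (simp add: out(2) lin_map_add[OF in2(1)] M.smult_r_distr)
  qed (use f in simp)
  have sm: "?F g (r \<odot>\<^bsub>bhom R C' D'\<^esub> f) = r \<odot>\<^bsub>M\<^esub> ?F g f"
    if g: "g \<in> bh C D" and f: "f \<in> bh C' D'" "r \<in> carrier R" for g f r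
    using cats(1,2) g
  proof (induction rule: bhom_induct')
    case (add k l)
    then show ?case using f by (simp add: M.smult_r_distr)
  next
    case (gen s \<Omega>)
    then show ?case using f lin_map_closed[OF in2(1)[OF gen(2)]]
      by (simp add: out(2) lin_map_smult[OF in2(1)] M.smult_assoc1[symmetric] m_comm)
  qed (use f in simp)
  show "bilin_map R (bhom R C D) (bhom R C' D') M ?F"
    by (rule bilin_mapI) (use add sm in auto)
qed

section \<open>Linear extension of the operations on bisets\<close>

lemma bcomp_closed [simp]: "\<lbrakk>fincat C; fincat D; fincat E; \<Omega> \<in> bisets C D; \<Psi> \<in> bisets D E\<rbrakk> \<Longrightarrow>
    bcomp C D E \<Omega> \<Psi> \<in> bisets C E"
  by (rule bpair.bcomp_bisets) unfold_locales

declare bprod_bisets [simp] bsum_bisets [simp] idb_bisets [simp] bend_bisets [simp] unbend_bisets [simp] bdual_bisets [simp]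

lemma bcmp:
  assumes cats: "fincat C" "fincat D" "fincat E"
  shows "bilin_map R (bhom R D E) (bhom R C D) (bhom R C E) (bcmp R C D E)"
    and "\<Omega> \<in> bisets E D \<Longrightarrow> \<Psi> \<in> bisets D C \<Longrightarrow>
      bcmp R C D E (bcls R D E \<Omega>) (bcls R C D \<Psi>) = bcls R C E (bcomp E D C \<Omega> \<Psi>)"
proof -
  note [simp] = cats
  let ?h = "\<lambda>\<Omega> \<Psi>. bcls R C E (bcomp E D C \<Omega> \<Psi>)"
  have e: "bcmp R C D E = (\<lambda>g f. plift R (bhom R C E) (\<lambda>\<Omega>. plift R (bhom R C E) (?h \<Omega>) f) g)"
    by (intro ext) (simp add: bcmp_def)
  have *: "?h \<Omega> \<Psi> = ?h \<Omega>' \<Psi>'" if "\<Omega> \<in> bisets E D" "\<Omega>' \<in> bisets E D" "\<Psi> \<in> bisets D C" "\<Psi>' \<in> bisets D C"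
    "biset_iso E D \<Omega> \<Omega>'" "biset_iso D C \<Psi> \<Psi>'" for \<Omega> \<Omega>' \<Psi> \<Psi>'
    using that by (intro bcls_iso bcomp_cong) auto
  have s1: "?h (bsum E D \<Omega> \<Omega>') \<Psi> = ?h \<Omega> \<Psi> \<oplus>\<^bsub>bhom R C E\<^esub> ?h \<Omega>' \<Psi>"
    if "\<Omega> \<in> bisets E D" "\<Omega>' \<in> bisets E D" "\<Psi> \<in> bisets D C" for \<Omega> \<Omega>' \<Psi>
    using that bcls_iso[OF _ _ _ _ bcomp_bsum_left[OF cats(3,2,1) that]] by (simp add: bcls_bsum)
  have s2: "?h \<Omega> (bsum D C \<Psi> \<Psi>') = ?h \<Omega> \<Psi> \<oplus>\<^bsub>bhom R C E\<^esub> ?h \<Omega> \<Psi>'"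
    if "\<Omega> \<in> bisets E D" "\<Psi> \<in> bisets D C" "\<Psi>' \<in> bisets D C" for \<Omega> \<Psi> \<Psi>'
    using that bcls_iso[OF _ _ _ _ bcomp_bsum_right[OF cats(3,2,1) that]] by (simp add: bcls_bsum)
  note b = bhom_bilift[of D E C D "bhom R C E" ?h, OF cats(2,3,1,2) bhom_module[OF cats(1,3)] _ * s1 s2]
  show "bilin_map R (bhom R D E) (bhom R C D) (bhom R C E) (bcmp R C D E)"
    unfolding e by (rule b(1)) simp_all
  show "\<Omega> \<in> bisets E D \<Longrightarrow> \<Psi> \<in> bisets D C \<Longrightarrow>
      bcmp R C D E (bcls R D E \<Omega>) (bcls R C D \<Psi>) = ?h \<Omega> \<Psi>"
    unfolding e by (rule b(2)) simp_all
qed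

lemma mprod:
  assumes cats: "fincat C" "fincat D" "fincat C'" "fincat D'"
  shows "bilin_map R (bhom R C D) (bhom R C' D') (bhom R (C \<times>\<^sub>c C') (D \<times>\<^sub>c D')) (mprod R C D C' D')"
    and "\<Omega> \<in> bisets D C \<Longrightarrow> \<Psi> \<in> bisets D' C' \<Longrightarrow>
      mprod R C D C' D' (bcls R C D \<Omega>) (bcls R C' D' \<Psi>) = bcls R (C \<times>\<^sub>c C') (D \<times>\<^sub>c D') (bprod D C D' C' \<Omega> \<Psi>)"
proof -
  note [simp] = cats
  let ?M = "bhom R (C \<times>\<^sub>c C') (D \<times>\<^sub>c D')"
  let ?h = "\<lambda>\<Omega> \<Psi>. bcls R (C \<times>\<^sub>c C') (D \<times>\<^sub>c D') (bprod D C D' C' \<Omega> \<Psi>)"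
  have e: "mprod R C D C' D' = (\<lambda>g f. plift R ?M (\<lambda>\<Omega>. plift R ?M (?h \<Omega>) f) g)"
    by (intro ext) (simp add: mprod_def)
  have *: "?h \<Omega> \<Psi> = ?h \<Omega>' \<Psi>'" if "\<Omega> \<in> bisets D C" "\<Omega>' \<in> bisets D C" "\<Psi> \<in> bisets D' C'" "\<Psi>' \<in> bisets D' C'"
    "biset_iso D C \<Omega> \<Omega>'" "biset_iso D' C' \<Psi> \<Psi>'" for \<Omega> \<Omega>' \<Psi> \<Psi>'
    using that by (intro bcls_iso bprod_cong) auto
  have s1: "?h (bsum D C \<Omega> \<Omega>') \<Psi> = ?h \<Omega> \<Psi> \<oplus>\<^bsub>?M\<^esub> ?h \<Omega>' \<Psi>"
    if "\<Omega> \<in> bisets D C" "\<Omega>' \<in> bisets D C" "\<Psi> \<in> bisets D' C'" for \<Omega> \<Omega>' \<Psi>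
    using that bcls_iso[OF _ _ _ _ bprod_bsum_left[OF cats(2,1,4,3) that]] by (simp add: bcls_bsum)
  have s2: "?h \<Omega> (bsum D' C' \<Psi> \<Psi>') = ?h \<Omega> \<Psi> \<oplus>\<^bsub>?M\<^esub> ?h \<Omega> \<Psi>'"
    if "\<Omega> \<in> bisets D C" "\<Psi> \<in> bisets D' C'" "\<Psi>' \<in> bisets D' C'" for \<Omega> \<Psi> \<Psi>'
    using that bcls_iso[OF _ _ _ _ bprod_bsum_right[OF cats(2,1,4,3) that]] by (simp add: bcls_bsum)
  have M: "module R ?M" by (rule bhom_module) simp_all
  note b = bhom_bilift[of C D C' D' ?M ?h, OF cats M _ * s1 s2]
  show "bilin_map R (bhom R C D) (bhom R C' D') ?M (mprod R C D C' D')"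
    unfolding e by (rule b(1)) simp_all
  show "\<Omega> \<in> bisets D C \<Longrightarrow> \<Psi> \<in> bisets D' C' \<Longrightarrow> mprod R C D C' D' (bcls R C D \<Omega>) (bcls R C' D' \<Psi>) = ?h \<Omega> \<Psi>"
    unfolding e by (rule b(2)) simp_all
qed

lemma bhom_rl:
  assumes r: "relab D' C' D C p q"
  defines "L \<equiv> plift R (bhom R C' D') (\<lambda>\<Omega>. bcls R C' D' (rl D' C' p q \<Omega>))"
  shows "lin_map R (bhom R C D) (bhom R C' D') L"
    and "\<Omega> \<in> bisets D C \<Longrightarrow> L (bcls R C D \<Omega>) = bcls R C' D' (rl D' C' p q \<Omega>)"
proof -
  have [simp]: "fincat C" "fincat D" "fincat C'" "fincat D'" using r by (simp_all add: relab_def)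
  have M: "module R (bhom R C' D')" by (rule bhom_module) simp_all
  have 1: "bcls R C' D' (rl D' C' p q \<Omega>) \<in> bh C' D'" if "\<Omega> \<in> bisets D C" for \<Omega>
    using relab.rl_bisets[OF r that] by simp
  have 2: "bcls R C' D' (rl D' C' p q \<Omega>) = bcls R C' D' (rl D' C' p q \<Psi>)"
    if "\<Omega> \<in> bisets D C" "\<Psi> \<in> bisets D C" "biset_iso D C \<Omega> \<Psi>" for \<Omega> \<Psi>
    using that relab.rl_bisets[OF r] relab.rl_iso[OF r] by (intro bcls_iso) auto
  have 3: "bcls R C' D' (rl D' C' p q (bsum D C \<Omega> \<Psi>)) =
      bcls R C' D' (rl D' C' p q \<Omega>) \<oplus>\<^bsub>bhom R C' D'\<^esub> bcls R C' D' (rl D' C' p q \<Psi>)"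
    if "\<Omega> \<in> bisets D C" "\<Psi> \<in> bisets D C" for \<Omega> \<Psi>
    using that relab.rl_bisets[OF r] relab.rl_bsum[OF r] by (simp add: bcls_bsum)
  show "lin_map R (bhom R C D) (bhom R C' D') L"
    "\<Omega> \<in> bisets D C \<Longrightarrow> L (bcls R C D \<Omega>) = bcls R C' D' (rl D' C' p q \<Omega>)"
    unfolding L_def using bhom_lift[of C D "bhom R C' D'", OF _ _ M 1 2 3] by auto
qed

lemma mdual:
  assumes cats: "fincat C" "fincat D"
  shows "lin_map R (bhom R C D) (bhom R (op_cat D) (op_cat C)) (mdual R C D)"
    and "\<Omega> \<in> bisets D C \<Longrightarrow> mdual R C D (bcls R C D \<Omega>) = bcls R (op_cat D) (op_cat C) (bdual \<Omega>)"
proof -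
  note [simp] = cats
  have M: "module R (bhom R (op_cat D) (op_cat C))" by (rule bhom_module) simp_all
  let ?h = "\<lambda>\<Omega>. bcls R (op_cat D) (op_cat C) (bdual \<Omega>)"
  have r: "relab (op_cat C) (op_cat D) D C (\<lambda>x z. z) (\<lambda>x z. x)" by (rule relab_dual) simp_all
  have 2: "?h \<Omega> = ?h \<Psi>" if "\<Omega> \<in> bisets D C" "\<Psi> \<in> bisets D C" "biset_iso D C \<Omega> \<Psi>" for \<Omega> \<Psi>
    using that relab.rl_iso[OF r that(3,1,2)] relab.rl_bisets[OF r] by (intro bcls_iso) (auto simp: bdual_rl)
  have 3: "?h (bsum D C \<Omega> \<Psi>) = ?h \<Omega> \<oplus>\<^bsub>bhom R (op_cat D) (op_cat C)\<^esub> ?h \<Psi>"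
    if "\<Omega> \<in> bisets D C" "\<Psi> \<in> bisets D C" for \<Omega> \<Psi>
    using that relab.rl_bsum[OF r that] bdual_bisets[OF cats(2,1) that(1)] bdual_bisets[OF cats(2,1) that(2)]
    by (simp add: bdual_rl[of _ D C] bcls_bsum)
  have e: "mdual R C D = plift R (bhom R (op_cat D) (op_cat C)) ?h" by (intro ext) (simp add: mdual_def)
  show "lin_map R (bhom R C D) (bhom R (op_cat D) (op_cat C)) (mdual R C D)"
    "\<Omega> \<in> bisets D C \<Longrightarrow> mdual R C D (bcls R C D \<Omega>) = ?h \<Omega>"
    unfolding e using bhom_lift[OF cats M _ 2 3] by auto
qed

lemmas bcmp_simps [simp] = bilin_map_simps[OF bhom_module bhom_module bhom_module bcmp(1)] bcmp(2)
lemmas mprod_simps [simp] = bilin_map_simps[OF bhom_module bhom_module bhom_module mprod(1)] mprod(2)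
lemmas mdual_simps [simp] = lin_map_simps[OF bhom_module bhom_module mdual(1)] mdual(2)

definition mbend :: "fcat \<Rightarrow> fcat \<Rightarrow> fcat \<Rightarrow> 'r bmor \<Rightarrow> 'r bmor" where
  "mbend C D E = plift R (bhom R C (op_cat D \<times>\<^sub>c E)) (\<lambda>\<Omega>. bcls R C (op_cat D \<times>\<^sub>c E) (bend C D E \<Omega>))"

definition munbend :: "fcat \<Rightarrow> fcat \<Rightarrow> fcat \<Rightarrow> 'r bmor \<Rightarrow> 'r bmor" where
  "munbend C D E = plift R (bhom R (C \<times>\<^sub>c D) E) (\<lambda>\<Omega>. bcls R (C \<times>\<^sub>c D) E (unbend C D E \<Omega>))"

lemma mbend:
  assumes "fincat C" "fincat D" "fincat E"
  shows "lin_map R (bhom R (C \<times>\<^sub>c D) E) (bhom R C (op_cat D \<times>\<^sub>c E)) (mbend C D E)"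
    and "\<Omega> \<in> bisets E (C \<times>\<^sub>c D) \<Longrightarrow> mbend C D E (bcls R (C \<times>\<^sub>c D) E \<Omega>) = bcls R C (op_cat D \<times>\<^sub>c E) (bend C D E \<Omega>)"
  unfolding mbend_def bend_def using bhom_rl[OF relab_bend[OF assms]] by auto

lemma munbend:
  assumes "fincat C" "fincat D" "fincat E"
  shows "lin_map R (bhom R C (op_cat D \<times>\<^sub>c E)) (bhom R (C \<times>\<^sub>c D) E) (munbend C D E)"
    and "\<Omega> \<in> bisets (op_cat D \<times>\<^sub>c E) C \<Longrightarrow> munbend C D E (bcls R C (op_cat D \<times>\<^sub>c E) \<Omega>) = bcls R (C \<times>\<^sub>c D) E (unbend C D E \<Omega>)"
  unfolding munbend_def unbend_def using bhom_rl[OF relab_unbend[OF assms]] by auto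

lemmas mbend_simps [simp] = lin_map_simps[OF bhom_module bhom_module mbend(1)] mbend(2)
lemmas munbend_simps [simp] = lin_map_simps[OF bhom_module bhom_module munbend(1)] munbend(2)

text \<open>The arrow of the biset category defined by a functor. It is covariant in
  \<open>F\<close> and turns products of functors into products of arrows, so identities between
  permutations of factors become identities between arrows.\<close>

definition J :: "fcat \<Rightarrow> fcat \<Rightarrow> (nat \<Rightarrow> nat) \<Rightarrow> 'r bmor" where
  "J C D F = bcls R C D (fb D C F)"

lemma J_closed [simp]: "functr C D F \<Longrightarrow> J C D F \<in> bh C D"
  unfolding J_def by (rule bcls_closed) (auto simp: functr_def fb_bisets)

lemma bident_J: "fincat C \<Longrightarrow> bident R C = J C C (\<lambda>x. x)"
  by (simp add: bident_def J_def fb_id)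

lemma bident_closed [simp]: "fincat C \<Longrightarrow> bident R C \<in> bh C C"
  by (simp add: bident_def)

lemma J_comp: assumes F: "functr C D F" and G: "functr D E G"
  shows "bcmp R C D E (J D E G) (J C D F) = J C E (\<lambda>x. G (F x))"
proof -
  have [simp]: "fincat C" "fincat D" "fincat E" using F G by (simp_all add: functr_def)
  show ?thesis unfolding J_def
    using fb_bisets[OF F] fb_bisets[OF G] fb_bisets[OF functr_comp[OF F G]] fb_comp[OF F G]
    by (simp add: bcls_iso)
qed

lemma J_cong: "\<lbrakk>fincat C; fincat D; (\<And>x. x \<in> Ob C \<Longrightarrow> F x = G x); (\<And>x. x \<in> Ar C \<Longrightarrow> F x = G x)\<rbrakk> \<Longrightarrow>
    J C D F = J C D G"
  unfolding J_def by (rule arg_cong, rule fb_cong)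

lemma mprod_J: assumes F: "functr C D F" and G: "functr C' D' G"
  shows "mprod R C D C' D' (J C D F) (J C' D' G) = J (C \<times>\<^sub>c C') (D \<times>\<^sub>c D') (mapp F G)"
proof -
  have [simp]: "fincat C" "fincat D" "fincat C'" "fincat D'" using F G by (simp_all add: functr_def)
  show ?thesis unfolding J_def using fb_bisets[OF F] fb_bisets[OF G] by (simp add: bprod_fb[OF F G])
qed

lemma mapp_id [simp]: "mapp (\<lambda>x. x) (\<lambda>x. x) = (\<lambda>x. x)"
  by (simp add: mapp_def fun_eq_iff)

lemma mprod_bident: "fincat C \<Longrightarrow> fincat D \<Longrightarrow> mprod R C C D D (bident R C) (bident R D) = bident R (C \<times>\<^sub>c D)"
  by (simp add: bident_J mprod_J[OF functr_id functr_id])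

text \<open>The identity biset is the biset of the identity functor, so the unit laws are instances
  of the two composition rules for bisets of functors.\<close>

lemma bcmp_ident [simp]:
  assumes [simp]: "fincat C" "fincat D" and f: "f \<in> bh C D"
  shows "bcmp R C D D (bident R D) f = f" "bcmp R C C D f (bident R C) = f"
proof -
  have l: "bcls R C D (bcomp D D C (idb D) \<Omega>) = bcls R C D \<Omega>" if "\<Omega> \<in> bisets D C" for \<Omega>
    using that bcomp_fb_left[of D D "\<lambda>x. x" "\<lambda>x. x" C \<Omega>] by (intro bcls_iso) (auto simp: fb_id rl_id functr_id)
  have r: "bcls R C D (bcomp D C C \<Omega> (idb C)) = bcls R C D \<Omega>" if "\<Omega> \<in> bisets D C" for \<Omega>
    using that bcomp_fb_right[of C C "\<lambda>x. x" D \<Omega>] by (intro bcls_iso) (auto simp: fb_id rl_id functr_id)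
  show "bcmp R C D D (bident R D) f = f" "bcmp R C C D f (bident R C) = f"
    using assms(1,2) f by (induction rule: bhom_induct') (simp_all add: l r bident_def)
qed

lemma bcmp_assoc:
  assumes [simp]: "fincat A" "fincat B" "fincat C" "fincat D"
    and f: "f \<in> bh A B" and g: "g \<in> bh B C" and h: "h \<in> bh C D"
  shows "bcmp R A C D h (bcmp R A B C g f) = bcmp R A B D (bcmp R B C D h g) f"
proof -
  have 1: "bcls R A D (bcomp D C A \<Theta> (bcomp C B A \<Psi> \<Omega>)) = bcls R A D (bcomp D B A (bcomp D C B \<Theta> \<Psi>) \<Omega>)"
    if "\<Omega> \<in> bisets B A" "\<Psi> \<in> bisets C B" "\<Theta> \<in> bisets D C" for \<Omega> \<Psi> \<Theta>
    using that bcls_iso[OF _ _ _ _ bcomp_assoc[of D C B A \<Theta> \<Psi> \<Omega>]] by simp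
  have 2: "bcmp R A C D h (bcmp R A B C (bcls R B C \<Psi>) (bcls R A B \<Omega>)) = bcmp R A B D (bcmp R B C D h (bcls R B C \<Psi>)) (bcls R A B \<Omega>)"
    if "\<Omega> \<in> bisets B A" "\<Psi> \<in> bisets C B" for \<Omega> \<Psi>
    using assms(3,4) h by (induction rule: bhom_induct') (use that in \<open>simp_all add: 1\<close>)
  have 3: "bcmp R A C D h (bcmp R A B C g (bcls R A B \<Omega>)) = bcmp R A B D (bcmp R B C D h g) (bcls R A B \<Omega>)"
    if "\<Omega> \<in> bisets B A" for \<Omega>
    \<comment> \<open>Rule 8 of \<open>bcmp_simps\<close> and of \<open>mprod_simps\<close> merges
      classes into the class of one biset. It is switched off here so that terms keep the shape in
      which the preceding fact is stated.\<close>
    using assms(2,3) g by (induction rule: bhom_induct') (use that h in \<open>simp_all add: 2 del: bcmp_simps(8) mprod_simps(8)\<close>)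
  show ?thesis
    using assms(1,2) f by (induction rule: bhom_induct') (use g h in \<open>simp_all add: 3 del: bcmp_simps(8) mprod_simps(8)\<close>)
qed

lemma mprod_bcmp:
  assumes [simp]: "fincat C" "fincat D" "fincat E" "fincat C'" "fincat D'" "fincat E'"
    and f: "f \<in> bh C D" and g: "g \<in> bh D E" and f': "f' \<in> bh C' D'" and g': "g' \<in> bh D' E'"
  shows "bcmp R (C \<times>\<^sub>c C') (D \<times>\<^sub>c D') (E \<times>\<^sub>c E') (mprod R D E D' E' g g') (mprod R C D C' D' f f') =
    mprod R C E C' E' (bcmp R C D E g f) (bcmp R C' D' E' g' f')"
proof -
  let ?B = "bcmp R (C \<times>\<^sub>c C') (D \<times>\<^sub>c D') (E \<times>\<^sub>c E')"
  have 1: "bcls R (C \<times>\<^sub>c C') (E \<times>\<^sub>c E') (bcomp (E \<times>\<^sub>c E') (D \<times>\<^sub>c D') (C \<times>\<^sub>c C') (bprod E D E' D' \<Omega> \<Omega>') (bprod D C D' C' \<Psi> \<Psi>')) =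
    bcls R (C \<times>\<^sub>c C') (E \<times>\<^sub>c E') (bprod E C E' C' (bcomp E D C \<Omega> \<Psi>) (bcomp E' D' C' \<Omega>' \<Psi>'))"
    if "\<Omega> \<in> bisets E D" "\<Psi> \<in> bisets D C" "\<Omega>' \<in> bisets E' D'" "\<Psi>' \<in> bisets D' C'" for \<Omega> \<Omega>' \<Psi> \<Psi>'
    using that bcls_iso[OF _ _ _ _ bprod_bcomp[of E D C E' D' C' \<Omega> \<Psi> \<Omega>' \<Psi>']] by simp
  have 2: "?B (mprod R D E D' E' g (bcls R D' E' \<Omega>')) (mprod R C D C' D' (bcls R C D \<Psi>) (bcls R C' D' \<Psi>')) =
    mprod R C E C' E' (bcmp R C D E g (bcls R C D \<Psi>)) (bcmp R C' D' E' (bcls R D' E' \<Omega>') (bcls R C' D' \<Psi>'))"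
    if "\<Psi> \<in> bisets D C" "\<Omega>' \<in> bisets E' D'" "\<Psi>' \<in> bisets D' C'" for \<Omega>' \<Psi> \<Psi>'
    using assms(2,3) g by (induction rule: bhom_induct') (use that in \<open>simp_all add: 1\<close>)
  have 3: "?B (mprod R D E D' E' g g') (mprod R C D C' D' (bcls R C D \<Psi>) (bcls R C' D' \<Psi>')) =
    mprod R C E C' E' (bcmp R C D E g (bcls R C D \<Psi>)) (bcmp R C' D' E' g' (bcls R C' D' \<Psi>'))"
    if "\<Psi> \<in> bisets D C" "\<Psi>' \<in> bisets D' C'" for \<Psi> \<Psi>'
    using assms(5,6) g' by (induction rule: bhom_induct') (use that g in \<open>simp_all add: 2 del: bcmp_simps(8) mprod_simps(8)\<close>)
  have 4: "?B (mprod R D E D' E' g g') (mprod R C D C' D' f (bcls R C' D' \<Psi>')) =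
    mprod R C E C' E' (bcmp R C D E g f) (bcmp R C' D' E' g' (bcls R C' D' \<Psi>'))"
    if "\<Psi>' \<in> bisets D' C'" for \<Psi>'
    using assms(1,2) f by (induction rule: bhom_induct') (use that g g' in \<open>simp_all add: 3 del: bcmp_simps(8) mprod_simps(8)\<close>)
  show ?thesis
    using assms(4,5) f' by (induction rule: bhom_induct') (use f g g' in \<open>simp_all add: 4 del: bcmp_simps(8) mprod_simps(8)\<close>)
qed

lemma mbend_source:
  assumes [simp]: "fincat C" "fincat C'" "fincat D" "fincat E"
    and t: "t \<in> bh (C \<times>\<^sub>c D) E" and f: "f \<in> bh C' C"
  shows "mbend C' D E (bcmp R (C' \<times>\<^sub>c D) (C \<times>\<^sub>c D) E t (mprod R C' C D D f (bident R D))) =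
    bcmp R C' C (op_cat D \<times>\<^sub>c E) (mbend C D E t) f"
proof -
  have 2: "mbend C' D E (bcmp R (C' \<times>\<^sub>c D) (C \<times>\<^sub>c D) E (bcls R (C \<times>\<^sub>c D) E \<Theta>) (mprod R C' C D D f (bident R D))) =
    bcmp R C' C (op_cat D \<times>\<^sub>c E) (mbend C D E (bcls R (C \<times>\<^sub>c D) E \<Theta>)) f" if "\<Theta> \<in> bisets E (C \<times>\<^sub>c D)" for \<Theta>
    using assms(2,1) f
  proof (induction rule: bhom_induct')
    case (gen r \<Omega>)
    then show ?case using that bcls_iso[OF _ _ _ _ bend_source[of C C' D E \<Theta> \<Omega>]] by (simp add: bident_def)
  qed (use that in simp_all)
  have c: "C \<times>\<^sub>c D \<in> fincats" by simp
  show ?thesis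
    using c assms(4) t by (induction rule: bhom_induct') (use f in \<open>simp_all add: 2\<close>)
qed

lemma mbend_target:
  assumes [simp]: "fincat C" "fincat D" "fincat E" "fincat E'"
    and t: "t \<in> bh (C \<times>\<^sub>c D) E" and h: "h \<in> bh E E'"
  shows "mbend C D E' (bcmp R (C \<times>\<^sub>c D) E E' h t) =
    bcmp R C (op_cat D \<times>\<^sub>c E) (op_cat D \<times>\<^sub>c E') (mprod R (op_cat D) (op_cat D) E E' (bident R (op_cat D)) h) (mbend C D E t)"
proof -
  have 2: "mbend C D E' (bcmp R (C \<times>\<^sub>c D) E E' h (bcls R (C \<times>\<^sub>c D) E \<Theta>)) =
    bcmp R C (op_cat D \<times>\<^sub>c E) (op_cat D \<times>\<^sub>c E') (mprod R (op_cat D) (op_cat D) E E' (bident R (op_cat D)) h)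
      (mbend C D E (bcls R (C \<times>\<^sub>c D) E \<Theta>))" if "\<Theta> \<in> bisets E (C \<times>\<^sub>c D)" for \<Theta>
    using assms(3,4) h
  proof (induction rule: bhom_induct')
    case (gen r \<Omega>)
    then show ?case using that bcls_iso[OF _ _ _ _ bend_target[of C D E E' \<Theta> \<Omega>]] by (simp add: bident_def)
  qed (use that in simp_all)
  have c: "C \<times>\<^sub>c D \<in> fincats" by simp
  show ?thesis
    using c assms(3) t by (induction rule: bhom_induct') (use h in \<open>simp_all add: 2\<close>)
qed

lemma mbend_dual:
  assumes [simp]: "fincat C" "fincat D" "fincat D'" "fincat E"
    and t: "t \<in> bh (C \<times>\<^sub>c D') E" and g: "g \<in> bh D D'"
  shows "mbend C D E (bcmp R (C \<times>\<^sub>c D) (C \<times>\<^sub>c D') E t (mprod R C C D D' (bident R C) g)) =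
    bcmp R C (op_cat D' \<times>\<^sub>c E) (op_cat D \<times>\<^sub>c E) (mprod R (op_cat D') (op_cat D) E E (mdual R D D' g) (bident R E)) (mbend C D' E t)"
proof -
  have 2: "mbend C D E (bcmp R (C \<times>\<^sub>c D) (C \<times>\<^sub>c D') E (bcls R (C \<times>\<^sub>c D') E \<Theta>) (mprod R C C D D' (bident R C) g)) =
    bcmp R C (op_cat D' \<times>\<^sub>c E) (op_cat D \<times>\<^sub>c E) (mprod R (op_cat D') (op_cat D) E E (mdual R D D' g) (bident R E))
      (mbend C D' E (bcls R (C \<times>\<^sub>c D') E \<Theta>))" if "\<Theta> \<in> bisets E (C \<times>\<^sub>c D')" for \<Theta>
    using assms(2,3) g
  proof (induction rule: bhom_induct')
    case (gen r \<Omega>)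
    then show ?case using that bcls_iso[OF _ _ _ _ bend_dual[of C D D' E \<Theta> \<Omega>]] by (simp add: bident_def)
  qed (use that in simp_all)
  have c: "C \<times>\<^sub>c D' \<in> fincats" by simp
  show ?thesis
    using c assms(4) t by (induction rule: bhom_induct') (use g in \<open>simp_all add: 2\<close>)
qed

lemma munbend_mbend [simp]:
  assumes [simp]: "fincat C" "fincat D" "fincat E"
  shows "t \<in> bh (C \<times>\<^sub>c D) E \<Longrightarrow> munbend C D E (mbend C D E t) = t"
    and "t \<in> bh C (op_cat D \<times>\<^sub>c E) \<Longrightarrow> mbend C D E (munbend C D E t) = t"
proof -
  have c: "C \<times>\<^sub>c D \<in> fincats" "op_cat D \<times>\<^sub>c E \<in> fincats" by simp_all
  show "t \<in> bh (C \<times>\<^sub>c D) E \<Longrightarrow> munbend C D E (mbend C D E t) = t"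
    using c(1) assms(3) by (induction rule: bhom_induct') (simp_all add: unbend_bend)
  show "t \<in> bh C (op_cat D \<times>\<^sub>c E) \<Longrightarrow> mbend C D E (munbend C D E t) = t"
    using assms(1) c(2) by (induction rule: bhom_induct') (simp_all add: bend_unbend)
qed

text \<open>For classes of bisets both sides are relabellings: the left one because
  \<open>asci\<close> has the inverse \<open>asc\<close>, the right one as for any functor.
  Linearity then extends the identity one variable at a time.\<close>

lemma J_asci_natural:
  assumes [simp]: "fincat A" "fincat A'" "fincat B" "fincat B'" "fincat C" "fincat C'"
    and f: "f \<in> bh A A'" and g: "g \<in> bh B B'" and h: "h \<in> bh C C'"
  shows "bcmp R (A \<times>\<^sub>c B \<times>\<^sub>c C) (A' \<times>\<^sub>c B' \<times>\<^sub>c C') ((A' \<times>\<^sub>c B') \<times>\<^sub>c C')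
      (J (A' \<times>\<^sub>c B' \<times>\<^sub>c C') ((A' \<times>\<^sub>c B') \<times>\<^sub>c C') asci) (mprod R A A' (B \<times>\<^sub>c C) (B' \<times>\<^sub>c C') f (mprod R B B' C C' g h)) =
    bcmp R (A \<times>\<^sub>c B \<times>\<^sub>c C) ((A \<times>\<^sub>c B) \<times>\<^sub>c C) ((A' \<times>\<^sub>c B') \<times>\<^sub>c C')
      (mprod R (A \<times>\<^sub>c B) (A' \<times>\<^sub>c B') C C' (mprod R A A' B B' f g) h) (J (A \<times>\<^sub>c B \<times>\<^sub>c C) ((A \<times>\<^sub>c B) \<times>\<^sub>c C) asci)"
    (is "?L f g h = ?R f g h")
proof -
  note fs = functr_asci[of A' B' C'] functr_asc[of A' B' C'] functr_asci[of A B C]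
  have J': "J (A' \<times>\<^sub>c B' \<times>\<^sub>c C') ((A' \<times>\<^sub>c B') \<times>\<^sub>c C') asci \<in> bh (A' \<times>\<^sub>c B' \<times>\<^sub>c C') ((A' \<times>\<^sub>c B') \<times>\<^sub>c C')"
    "J (A \<times>\<^sub>c B \<times>\<^sub>c C) ((A \<times>\<^sub>c B) \<times>\<^sub>c C) asci \<in> bh (A \<times>\<^sub>c B \<times>\<^sub>c C) ((A \<times>\<^sub>c B) \<times>\<^sub>c C)"
    using fs by simp_all
  have 1: "?L (bcls R A A' \<Omega>) (bcls R B B' \<Psi>) (bcls R C C' \<Theta>) = ?R (bcls R A A' \<Omega>) (bcls R B B' \<Psi>) (bcls R C C' \<Theta>)"
    if bs: "\<Omega> \<in> bisets A' A" "\<Psi> \<in> bisets B' B" "\<Theta> \<in> bisets C' C" for \<Omega> \<Psi> \<Theta>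
  proof -
    let ?w = "bprod A' A (B' \<times>\<^sub>c C') (B \<times>\<^sub>c C) \<Omega> (bprod B' B C' C \<Psi> \<Theta>)"
    let ?w' = "bprod (A' \<times>\<^sub>c B') (A \<times>\<^sub>c B) C' C (bprod A' A B' B \<Omega> \<Psi>) \<Theta>"
    let ?P = "rl ((A' \<times>\<^sub>c B') \<times>\<^sub>c C') (A \<times>\<^sub>c B \<times>\<^sub>c C) (\<lambda>x z. asc x) (\<lambda>x z. z) ?w"
    let ?Q = "rl ((A' \<times>\<^sub>c B') \<times>\<^sub>c C') (A \<times>\<^sub>c B \<times>\<^sub>c C) (\<lambda>x z. x) (\<lambda>x z. asci z) ?w'"
    have P: "?P \<in> bisets ((A' \<times>\<^sub>c B') \<times>\<^sub>c C') (A \<times>\<^sub>c B \<times>\<^sub>c C)"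
      by (rule relab.rl_bisets[OF relab_left[OF fs(2)]]) (use bs in simp_all)
    have Q: "?Q \<in> bisets ((A' \<times>\<^sub>c B') \<times>\<^sub>c C') (A \<times>\<^sub>c B \<times>\<^sub>c C)"
      by (rule relab.rl_bisets[OF relab_right[OF fs(3)]]) (use bs in simp_all)
    have "?L (bcls R A A' \<Omega>) (bcls R B B' \<Psi>) (bcls R C C' \<Theta>) = bcls R (A \<times>\<^sub>c B \<times>\<^sub>c C) ((A' \<times>\<^sub>c B') \<times>\<^sub>c C') ?P"
      unfolding J_def using bs fs P fb_bisets[OF fs(1)]
      by (simp, intro bcls_iso bcomp_fb_left[OF fs(1,2)]) simp_all
    also have "\<dots> = bcls R (A \<times>\<^sub>c B \<times>\<^sub>c C) ((A' \<times>\<^sub>c B') \<times>\<^sub>c C') ?Q"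
      by (intro bcls_iso asci_natural P Q bs) simp_all
    also have "\<dots> = ?R (bcls R A A' \<Omega>) (bcls R B B' \<Psi>) (bcls R C C' \<Theta>)"
      unfolding J_def using bs fs Q fb_bisets[OF fs(3)]
      by (simp, intro bcls_iso[symmetric] bcomp_fb_right[OF fs(3)]) simp_all
    finally show ?thesis .
  qed
  have 2: "?L f (bcls R B B' \<Psi>) (bcls R C C' \<Theta>) = ?R f (bcls R B B' \<Psi>) (bcls R C C' \<Theta>)"
    if "\<Psi> \<in> bisets B' B" "\<Theta> \<in> bisets C' C" for \<Psi> \<Theta>
    using assms(1,2) f by (induction rule: bhom_induct') (use that J' 1 in \<open>simp_all del: mprod_simps(8) bcmp_simps(8)\<close>)
  have 3: "?L f g (bcls R C C' \<Theta>) = ?R f g (bcls R C C' \<Theta>)" if "\<Theta> \<in> bisets C' C" for \<Theta>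
    using assms(3,4) g by (induction rule: bhom_induct') (use that J' f 2 in \<open>simp_all del: mprod_simps(8) bcmp_simps(8)\<close>)
  show ?thesis
    using assms(5,6) h by (induction rule: bhom_induct') (use J' f g 3 in \<open>simp_all del: mprod_simps(8) bcmp_simps(8)\<close>)
qed

lemma J_swp_natural:
  assumes [simp]: "fincat A" "fincat A'" "fincat B" "fincat B'"
    and f: "f \<in> bh A A'" and g: "g \<in> bh B B'"
  shows "bcmp R (A \<times>\<^sub>c B) (A' \<times>\<^sub>c B') (B' \<times>\<^sub>c A') (J (A' \<times>\<^sub>c B') (B' \<times>\<^sub>c A') swp) (mprod R A A' B B' f g) =
    bcmp R (A \<times>\<^sub>c B) (B \<times>\<^sub>c A) (B' \<times>\<^sub>c A') (mprod R B B' A A' g f) (J (A \<times>\<^sub>c B) (B \<times>\<^sub>c A) swp)"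
    (is "?L f g = ?R f g")
proof -
  note fs = functr_swp[of A' B'] functr_swp[of B' A'] functr_swp[of A B]
  have J': "J (A' \<times>\<^sub>c B') (B' \<times>\<^sub>c A') swp \<in> bh (A' \<times>\<^sub>c B') (B' \<times>\<^sub>c A')"
    "J (A \<times>\<^sub>c B) (B \<times>\<^sub>c A) swp \<in> bh (A \<times>\<^sub>c B) (B \<times>\<^sub>c A)"
    using fs by simp_all
  have 1: "?L (bcls R A A' \<Omega>) (bcls R B B' \<Psi>) = ?R (bcls R A A' \<Omega>) (bcls R B B' \<Psi>)"
    if bs: "\<Omega> \<in> bisets A' A" "\<Psi> \<in> bisets B' B" for \<Omega> \<Psi>
  proof -
    let ?P = "rl (B' \<times>\<^sub>c A') (A \<times>\<^sub>c B) (\<lambda>x z. swp x) (\<lambda>x z. z) (bprod A' A B' B \<Omega> \<Psi>)"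
    let ?Q = "rl (B' \<times>\<^sub>c A') (A \<times>\<^sub>c B) (\<lambda>x z. x) (\<lambda>x z. swp z) (bprod B' B A' A \<Psi> \<Omega>)"
    have P: "?P \<in> bisets (B' \<times>\<^sub>c A') (A \<times>\<^sub>c B)"
      by (rule relab.rl_bisets[OF relab_left[OF fs(2)]]) (use bs in simp_all)
    have Q: "?Q \<in> bisets (B' \<times>\<^sub>c A') (A \<times>\<^sub>c B)"
      by (rule relab.rl_bisets[OF relab_right[OF fs(3)]]) (use bs in simp_all)
    have "?L (bcls R A A' \<Omega>) (bcls R B B' \<Psi>) = bcls R (A \<times>\<^sub>c B) (B' \<times>\<^sub>c A') ?P"
      unfolding J_def using bs fs P fb_bisets[OF fs(1)]
      by (simp, intro bcls_iso bcomp_fb_left[OF fs(1,2)]) simp_all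
    also have "\<dots> = bcls R (A \<times>\<^sub>c B) (B' \<times>\<^sub>c A') ?Q"
      by (intro bcls_iso swp_natural P Q bs) simp_all
    also have "\<dots> = ?R (bcls R A A' \<Omega>) (bcls R B B' \<Psi>)"
      unfolding J_def using bs fs Q fb_bisets[OF fs(3)]
      by (simp, intro bcls_iso[symmetric] bcomp_fb_right[OF fs(3)]) simp_all
    finally show ?thesis .
  qed
  have 2: "?L f (bcls R B B' \<Psi>) = ?R f (bcls R B B' \<Psi>)" if "\<Psi> \<in> bisets B' B" for \<Psi>
    using assms(1,2) f by (induction rule: bhom_induct') (use that J' 1 in \<open>simp_all del: mprod_simps(8) bcmp_simps(8)\<close>)
  show ?thesis
    using assms(3,4) g by (induction rule: bhom_induct') (use J' f 2 in \<open>simp_all del: mprod_simps(8) bcmp_simps(8)\<close>)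
qed

lemma J_unit1_natural:
  assumes [simp]: "fincat D" "fincat D'" and h: "h \<in> bh D D'"
  shows "bcmp R D D' (one_cat \<times>\<^sub>c D') (J D' (one_cat \<times>\<^sub>c D') unit1) h =
    bcmp R D (one_cat \<times>\<^sub>c D) (one_cat \<times>\<^sub>c D') (mprod R one_cat one_cat D D' (bident R one_cat) h) (J D (one_cat \<times>\<^sub>c D) unit1)"
    (is "?L h = ?R h")
proof -
  note fs = functr_unit1[of D'] functr_pi2[of D'] functr_unit1[of D]
  have J': "J D' (one_cat \<times>\<^sub>c D') unit1 \<in> bh D' (one_cat \<times>\<^sub>c D')" "J D (one_cat \<times>\<^sub>c D) unit1 \<in> bh D (one_cat \<times>\<^sub>c D)"
    using fs by simp_all
  have 1: "?L (bcls R D D' \<Omega>) = ?R (bcls R D D' \<Omega>)" if bs: "\<Omega> \<in> bisets D' D" for \<Omega>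
  proof -
    let ?P = "rl (one_cat \<times>\<^sub>c D') D (\<lambda>x z. pi2 x) (\<lambda>x z. z) \<Omega>"
    let ?Q = "rl (one_cat \<times>\<^sub>c D') D (\<lambda>x z. x) (\<lambda>x z. unit1 z) (bprod one_cat one_cat D' D (idb one_cat) \<Omega>)"
    have P: "?P \<in> bisets (one_cat \<times>\<^sub>c D') D"
      by (rule relab.rl_bisets[OF relab_left[OF fs(2)]]) (use bs in simp_all)
    have Q: "?Q \<in> bisets (one_cat \<times>\<^sub>c D') D"
      by (rule relab.rl_bisets[OF relab_right[OF fs(3)]]) (use bs in simp_all)
    have "?L (bcls R D D' \<Omega>) = bcls R D (one_cat \<times>\<^sub>c D') ?P"
      unfolding J_def using bs fs P fb_bisets[OF fs(1)]
      by (simp, intro bcls_iso bcomp_fb_left[OF fs(1,2)]) (auto simp: unit1_def pr_collapse)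
    also have "\<dots> = bcls R D (one_cat \<times>\<^sub>c D') ?Q"
      by (intro bcls_iso unit1_natural P Q bs) simp_all
    also have "\<dots> = ?R (bcls R D D' \<Omega>)"
      unfolding J_def using bs fs Q fb_bisets[OF fs(3)]
      by (simp add: bident_def, intro bcls_iso[symmetric] bcomp_fb_right[OF fs(3)]) simp_all
    finally show ?thesis .
  qed
  show ?thesis
    using assms(1,2) h by (induction rule: bhom_induct') (use J' 1 in \<open>simp_all del: mprod_simps(8) bcmp_simps(8)\<close>)
qed

end

section \<open>Biset functors and natural bilinear families\<close>

context coefficients
begin

lemma bf_module: "bfunctor M \<Longrightarrow> fincat C \<Longrightarrow> module R (vob M C)"
  by (simp add: biset_functor_def)

lemma bf_bilin: "\<lbrakk>bfunctor M; fincat C; fincat D\<rbrakk> \<Longrightarrow> bilin_map R (bhom R C D) (vob M C) (vob M D) (vmap M C D)"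
  by (simp add: biset_functor_def)

lemma bf_simps:
  assumes "bfunctor M"
  shows "fincat C \<Longrightarrow> module R (vob M C)"
    and "fincat C \<Longrightarrow> \<zero>\<^bsub>vob M C\<^esub> \<in> el M C"
    and "\<lbrakk>fincat C; x \<in> el M C; y \<in> el M C\<rbrakk> \<Longrightarrow> x \<oplus>\<^bsub>vob M C\<^esub> y \<in> el M C"
    and "\<lbrakk>fincat C; r \<in> carrier R; x \<in> el M C\<rbrakk> \<Longrightarrow> r \<odot>\<^bsub>vob M C\<^esub> x \<in> el M C"
    and "\<lbrakk>fincat C; fincat D; f \<in> bh C D; x \<in> el M C\<rbrakk> \<Longrightarrow> vmap M C D f x \<in> el M D"
    and "\<lbrakk>fincat C; fincat D; f \<in> bh C D; f' \<in> bh C D; x \<in> el M C\<rbrakk> \<Longrightarrow>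
      vmap M C D (f \<oplus>\<^bsub>bhom R C D\<^esub> f') x = vmap M C D f x \<oplus>\<^bsub>vob M D\<^esub> vmap M C D f' x"
    and "\<lbrakk>fincat C; fincat D; f \<in> bh C D; x \<in> el M C; x' \<in> el M C\<rbrakk> \<Longrightarrow>
      vmap M C D f (x \<oplus>\<^bsub>vob M C\<^esub> x') = vmap M C D f x \<oplus>\<^bsub>vob M D\<^esub> vmap M C D f x'"
    and "\<lbrakk>fincat C; fincat D; r \<in> carrier R; f \<in> bh C D; x \<in> el M C\<rbrakk> \<Longrightarrow>
      vmap M C D (r \<odot>\<^bsub>bhom R C D\<^esub> f) x = r \<odot>\<^bsub>vob M D\<^esub> vmap M C D f x"
    and "\<lbrakk>fincat C; fincat D; r \<in> carrier R; f \<in> bh C D; x \<in> el M C\<rbrakk> \<Longrightarrow>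
      vmap M C D f (r \<odot>\<^bsub>vob M C\<^esub> x) = r \<odot>\<^bsub>vob M D\<^esub> vmap M C D f x"
    and "\<lbrakk>fincat C; fincat D; x \<in> el M C\<rbrakk> \<Longrightarrow> vmap M C D \<zero>\<^bsub>bhom R C D\<^esub> x = \<zero>\<^bsub>vob M D\<^esub>"
    and "\<lbrakk>fincat C; fincat D; f \<in> bh C D\<rbrakk> \<Longrightarrow> vmap M C D f \<zero>\<^bsub>vob M C\<^esub> = \<zero>\<^bsub>vob M D\<^esub>"
    and "fincat C \<Longrightarrow> x \<in> el M C \<Longrightarrow> vmap M C C (bident R C) x = x"
    and "\<lbrakk>fincat C; fincat D; fincat E; f \<in> bh C D; g \<in> bh D E; x \<in> el M C\<rbrakk> \<Longrightarrow>
      vmap M D E g (vmap M C D f x) = vmap M C E (bcmp R C D E g f) x"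
  using bf_module[OF assms] module_simps[OF bf_module[OF assms]]
    bilin_map_simps[OF bhom_module bf_module[OF assms] bf_module[OF assms] bf_bilin[OF assms]] assms[unfolded biset_functor_def]
  by auto

lemma biset_functorI:
  assumes "\<And>C. fincat C \<Longrightarrow> module R (vob M C)"
    and "\<And>C D. fincat C \<Longrightarrow> fincat D \<Longrightarrow> bilin_map R (bhom R C D) (vob M C) (vob M D) (vmap M C D)"
    and "\<And>C x. fincat C \<Longrightarrow> x \<in> el M C \<Longrightarrow> vmap M C C (bident R C) x = x"
    and "\<And>C D E f g x. \<lbrakk>fincat C; fincat D; fincat E; f \<in> bh C D; g \<in> bh D E;
      x \<in> el M C\<rbrakk> \<Longrightarrow> vmap M C E (bcmp R C D E g f) x = vmap M D E g (vmap M C D f x)"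
  shows "bfunctor M"
  using assms by (simp add: biset_functor_def)

lemma nt_simps:
  assumes M: "bfunctor M" and N: "bfunctor N" and \<eta>: "\<eta> \<in> nat_trans R M N"
  shows "fincat C \<Longrightarrow> x \<in> el M C \<Longrightarrow> \<eta> C x \<in> el N C"
    and "\<lbrakk>fincat C; x \<in> el M C; y \<in> el M C\<rbrakk> \<Longrightarrow> \<eta> C (x \<oplus>\<^bsub>vob M C\<^esub> y) = \<eta> C x \<oplus>\<^bsub>vob N C\<^esub> \<eta> C y"
    and "\<lbrakk>fincat C; r \<in> carrier R; x \<in> el M C\<rbrakk> \<Longrightarrow> \<eta> C (r \<odot>\<^bsub>vob M C\<^esub> x) = r \<odot>\<^bsub>vob N C\<^esub> \<eta> C x"
    and "fincat C \<Longrightarrow> \<eta> C \<zero>\<^bsub>vob M C\<^esub> = \<zero>\<^bsub>vob N C\<^esub>"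
    and "\<lbrakk>fincat C; fincat D; f \<in> bh C D; x \<in> el M C\<rbrakk> \<Longrightarrow>
      \<eta> D (vmap M C D f x) = vmap N C D f (\<eta> C x)"
proof -
  have l: "fincat C \<Longrightarrow> lin_map R (vob M C) (vob N C) (\<eta> C)" for C using \<eta> by (simp add: nat_trans_def)
  note ls = lin_map_simps[OF bf_simps(1)[OF M] bf_simps(1)[OF N] l]
  show "fincat C \<Longrightarrow> x \<in> el M C \<Longrightarrow> \<eta> C x \<in> el N C"
    "\<lbrakk>fincat C; x \<in> el M C; y \<in> el M C\<rbrakk> \<Longrightarrow> \<eta> C (x \<oplus>\<^bsub>vob M C\<^esub> y) = \<eta> C x \<oplus>\<^bsub>vob N C\<^esub> \<eta> C y"
    "\<lbrakk>fincat C; r \<in> carrier R; x \<in> el M C\<rbrakk> \<Longrightarrow> \<eta> C (r \<odot>\<^bsub>vob M C\<^esub> x) = r \<odot>\<^bsub>vob N C\<^esub> \<eta> C x"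
    "fincat C \<Longrightarrow> \<eta> C \<zero>\<^bsub>vob M C\<^esub> = \<zero>\<^bsub>vob N C\<^esub>"
    by (simp_all add: ls)
  show "\<lbrakk>fincat C; fincat D; f \<in> bh C D; x \<in> el M C\<rbrakk> \<Longrightarrow>
      \<eta> D (vmap M C D f x) = vmap N C D f (\<eta> C x)"
    using \<eta> by (simp add: nat_trans_def)
qed

lemma nt_lin: "\<eta> \<in> nat_trans R M N \<Longrightarrow> fincat C \<Longrightarrow> lin_map R (vob M C) (vob N C) (\<eta> C)"
  by (simp add: nat_trans_def)

text \<open>Puts a family of maps into the extensional form that \<open>nat_trans\<close> demands,
  so that transformations with equal values are equal.\<close>

definition ntr :: "('r, 'm) bfun \<Rightarrow> (fcat \<Rightarrow> 'm \<Rightarrow> 'n) \<Rightarrow> fcat \<Rightarrow> 'm \<Rightarrow> 'n" where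
  "ntr M h = (\<lambda>C\<in>fincats. \<lambda>x\<in>el M C. h C x)"

lemma ntr_apply [simp]: "fincat C \<Longrightarrow> x \<in> el M C \<Longrightarrow> ntr M h C x = h C x"
  by (simp add: ntr_def)

lemma ntr_nat_trans:
  assumes M: "bfunctor M"
    and l: "\<And>C. fincat C \<Longrightarrow> lin_map R (vob M C) (vob N C) (h C)"
    and n: "\<And>C D f x. \<lbrakk>fincat C; fincat D; f \<in> bh C D; x \<in> el M C\<rbrakk> \<Longrightarrow>
      h D (vmap M C D f x) = vmap N C D f (h C x)"
  shows "ntr M h \<in> nat_trans R M N"
proof -
  note [simp] = bf_simps[OF M]
  have "lin_map R (vob M C) (vob N C) (ntr M h C)" if "fincat C" for C
    using lin_map_cong[of R "vob M C" "ntr M h C" "h C" "vob N C"] l[OF that] that by simp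
  then show ?thesis using n unfolding nat_trans_def by (auto simp: ntr_def)
qed

lemma nat_trans_ext:
  assumes "\<eta> \<in> nat_trans R M N" "\<theta> \<in> nat_trans R M N"
    and "\<And>C x. fincat C \<Longrightarrow> x \<in> el M C \<Longrightarrow> \<eta> C x = \<theta> C x"
  shows "\<eta> = \<theta>"
proof
  fix C
  show "\<eta> C = \<theta> C"
  proof (cases "fincat C")
    case True
    then have "\<eta> C \<in> extensional (el M C)" "\<theta> C \<in> extensional (el M C)"
      using assms(1,2) by (auto simp: nat_trans_def)
    then show ?thesis using assms(3)[OF True] by (rule extensionalityI)
  next
    case False
    then show ?thesis using assms(1,2) by (auto simp: nat_trans_def extensional_def)
  qed
qed

lemma ntr_ext: "\<eta> \<in> nat_trans R M N \<Longrightarrow> ntr M \<eta> = \<eta>"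
  unfolding ntr_def nat_trans_def by (auto simp: fun_eq_iff restrict_def extensional_def)

lemma nat_trans_comp:
  assumes M: "bfunctor M" and N: "bfunctor N" and P: "bfunctor P"
    and \<eta>: "\<eta> \<in> nat_trans R M N" and \<theta>: "\<theta> \<in> nat_trans R N P"
  shows "ntr M (\<lambda>C x. \<theta> C (\<eta> C x)) \<in> nat_trans R M P"
proof (rule ntr_nat_trans[OF M])
  show "lin_map R (vob M C) (vob P C) (\<lambda>x. \<theta> C (\<eta> C x))" if "fincat C" for C
    by (rule lin_map_comp[OF nt_lin[OF \<eta> that] nt_lin[OF \<theta> that]])
qed (simp add: nt_simps[OF M N \<eta>] nt_simps[OF N P \<theta>])

text \<open>The subfunctor generated by \<open>G\<close>. Scalars are covered by \<open>act\<close>,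
  because multiplication by \<open>r\<close> is the action of the arrow \<open>r\<close> times the
  identity.\<close>

inductive gspan :: "('r, 'm) bfun \<Rightarrow> (fcat \<Rightarrow> 'm set) \<Rightarrow> fcat \<Rightarrow> 'm \<Rightarrow> bool" for M G where
  zero: "fincat C \<Longrightarrow> gspan M G C \<zero>\<^bsub>vob M C\<^esub>"
| add: "\<lbrakk>fincat C; gspan M G C x; gspan M G C y\<rbrakk> \<Longrightarrow> gspan M G C (x \<oplus>\<^bsub>vob M C\<^esub> y)"
| act: "\<lbrakk>fincat C; fincat D; x \<in> G D; x \<in> el M D; f \<in> bh D C\<rbrakk> \<Longrightarrow> gspan M G C (vmap M D C f x)"

definition generates :: "('r, 'm) bfun \<Rightarrow> (fcat \<Rightarrow> 'm set) \<Rightarrow> bool" where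
  "generates M G \<longleftrightarrow> (\<forall>C\<in>fincats. \<forall>x\<in>el M C. gspan M G C x)"

lemma gspan_closed:
  assumes M: "bfunctor M"
  shows "gspan M G C x \<Longrightarrow> fincat C \<and> x \<in> el M C"
  by (induction rule: gspan.induct) (simp_all add: bf_simps[OF M])

lemma gspan_vmap:
  assumes M: "bfunctor M"
  shows "\<lbrakk>gspan M G C x; fincat D; f \<in> bh C D\<rbrakk> \<Longrightarrow> gspan M G D (vmap M C D f x)"
  by (induction rule: gspan.induct)
    (simp_all add: bf_simps[OF M] gspan_closed[OF M] gspan.intros)

lemma gspan_smult:
  assumes M: "bfunctor M"
  shows "gspan M G C x \<Longrightarrow> r \<in> carrier R \<Longrightarrow> gspan M G C (r \<odot>\<^bsub>vob M C\<^esub> x)"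
proof -
  assume x: "gspan M G C x" and r: "r \<in> carrier R"
  then have c: "fincat C" "x \<in> el M C" using gspan_closed[OF M] by auto
  have "r \<odot>\<^bsub>vob M C\<^esub> x = vmap M C C (r \<odot>\<^bsub>bhom R C C\<^esub> bident R C) x"
    using c r by (simp add: bf_simps[OF M])
  then show ?thesis using gspan_vmap[OF M x, of C "r \<odot>\<^bsub>bhom R C C\<^esub> bident R C"] c r by simp
qed

lemma generates_all: assumes M: "bfunctor M" shows "generates M (\<lambda>C. el M C)"
  unfolding generates_def
proof (intro ballI)
  fix C x assume "fincat C" "x \<in> el M C"
  then show "gspan M (\<lambda>C. el M C) C x"
    using gspan.act[of C C x "\<lambda>C. el M C" M "bident R C"] by (simp add: bf_simps[OF M])
qed

lemma generates_induct [consumes 3, case_names zero add act]: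
  assumes "generates M G" "fincat C" "x \<in> el M C"
    and "P \<zero>\<^bsub>vob M C\<^esub>"
    and add: "\<And>x y. \<lbrakk>x \<in> el M C; y \<in> el M C; P x; P y\<rbrakk> \<Longrightarrow> P (x \<oplus>\<^bsub>vob M C\<^esub> y)"
    and "\<And>D x f. \<lbrakk>fincat D; x \<in> G D; x \<in> el M D; f \<in> bh D C\<rbrakk> \<Longrightarrow> P (vmap M D C f x)"
    and M: "bfunctor M"
  shows "P x"
proof -
  have "gspan M G C x" using assms(1-3) by (simp add: generates_def)
  then show ?thesis using assms(4-6)
    by (induction rule: gspan.induct) (auto dest: gspan_closed[OF M])
qed

text \<open>The basic equality test: linearity and naturality carry an equation from the generators
  to all elements.\<close>

lemma generates_ext:
  assumes M: "bfunctor M" and N: "bfunctor N" and G: "generates M G"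
    and \<eta>: "\<eta> \<in> nat_trans R M N" and \<theta>: "\<theta> \<in> nat_trans R M N"
    and eq: "\<And>C x. \<lbrakk>fincat C; x \<in> G C; x \<in> el M C\<rbrakk> \<Longrightarrow> \<eta> C x = \<theta> C x"
  shows "\<eta> = \<theta>"
proof (rule nat_trans_ext[OF \<eta> \<theta>])
  fix C x assume C: "fincat C" "x \<in> el M C"
  show "\<eta> C x = \<theta> C x"
    using G C
  proof (induction rule: generates_induct)
    case (act D x f)
    then show ?case using C by (simp add: nt_simps[OF M N \<eta>] nt_simps[OF M N \<theta>] eq)
  qed (use C M in \<open>simp_all add: nt_simps[OF M N \<eta>] nt_simps[OF M N \<theta>]\<close>)
qed

text \<open>Families of this kind are what Day convolution along the product of categories
  classifies: natural in each variable separately and bilinear, with the value over the product of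
  the two categories.\<close>

definition bifam :: "('r, 'a) bfun \<Rightarrow> ('r, 'b) bfun \<Rightarrow> ('r, 'c) bfun \<Rightarrow> (fcat \<Rightarrow> fcat \<Rightarrow> 'a \<Rightarrow> 'b \<Rightarrow> 'c) \<Rightarrow> bool" where
  "bifam L M N \<beta> \<longleftrightarrow>
    (\<forall>C\<in>fincats. \<forall>D\<in>fincats. bilin_map R (vob L C) (vob M D) (vob N (C \<times>\<^sub>c D)) (\<beta> C D)) \<and>
    (\<forall>C\<in>fincats. \<forall>C'\<in>fincats. \<forall>D\<in>fincats. \<forall>D'\<in>fincats. \<forall>f\<in>bh C C'. \<forall>g\<in>bh D D'. \<forall>x\<in>el L C. \<forall>y\<in>el M D.
      \<beta> C' D' (vmap L C C' f x) (vmap M D D' g y) =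
        vmap N (C \<times>\<^sub>c D) (C' \<times>\<^sub>c D') (mprod R C C' D D' f g) (\<beta> C D x y))"

lemma bifamI:
  assumes "\<And>C D. fincat C \<Longrightarrow> fincat D \<Longrightarrow> bilin_map R (vob L C) (vob M D) (vob N (C \<times>\<^sub>c D)) (\<beta> C D)"
    and "\<And>C C' D D' f g x y. \<lbrakk>fincat C; fincat C'; fincat D; fincat D'; f \<in> bh C C';
      g \<in> bh D D'; x \<in> el L C; y \<in> el M D\<rbrakk> \<Longrightarrow>
      \<beta> C' D' (vmap L C C' f x) (vmap M D D' g y) =
        vmap N (C \<times>\<^sub>c D) (C' \<times>\<^sub>c D') (mprod R C C' D D' f g) (\<beta> C D x y)"
  shows "bifam L M N \<beta>"
  using assms by (simp add: bifam_def)

lemma bifam_bilin: "\<lbrakk>bifam L M N \<beta>; fincat C; fincat D\<rbrakk> \<Longrightarrow>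
    bilin_map R (vob L C) (vob M D) (vob N (C \<times>\<^sub>c D)) (\<beta> C D)"
  by (simp add: bifam_def)

lemma bifam_simps:
  assumes L: "bfunctor L" and M: "bfunctor M" and N: "bfunctor N" and \<beta>: "bifam L M N \<beta>"
    and c: "fincat C" "fincat D"
  shows "x \<in> el L C \<Longrightarrow> y \<in> el M D \<Longrightarrow> \<beta> C D x y \<in> el N (C \<times>\<^sub>c D)"
    and "\<lbrakk>x \<in> el L C; x' \<in> el L C; y \<in> el M D\<rbrakk> \<Longrightarrow>
      \<beta> C D (x \<oplus>\<^bsub>vob L C\<^esub> x') y = \<beta> C D x y \<oplus>\<^bsub>vob N (C \<times>\<^sub>c D)\<^esub> \<beta> C D x' y"
    and "\<lbrakk>x \<in> el L C; y \<in> el M D; y' \<in> el M D\<rbrakk> \<Longrightarrow>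
      \<beta> C D x (y \<oplus>\<^bsub>vob M D\<^esub> y') = \<beta> C D x y \<oplus>\<^bsub>vob N (C \<times>\<^sub>c D)\<^esub> \<beta> C D x y'"
    and "\<lbrakk>r \<in> carrier R; x \<in> el L C; y \<in> el M D\<rbrakk> \<Longrightarrow>
      \<beta> C D (r \<odot>\<^bsub>vob L C\<^esub> x) y = r \<odot>\<^bsub>vob N (C \<times>\<^sub>c D)\<^esub> \<beta> C D x y"
    and "\<lbrakk>r \<in> carrier R; x \<in> el L C; y \<in> el M D\<rbrakk> \<Longrightarrow>
      \<beta> C D x (r \<odot>\<^bsub>vob M D\<^esub> y) = r \<odot>\<^bsub>vob N (C \<times>\<^sub>c D)\<^esub> \<beta> C D x y"
    and "y \<in> el M D \<Longrightarrow> \<beta> C D \<zero>\<^bsub>vob L C\<^esub> y = \<zero>\<^bsub>vob N (C \<times>\<^sub>c D)\<^esub>"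
    and "x \<in> el L C \<Longrightarrow> \<beta> C D x \<zero>\<^bsub>vob M D\<^esub> = \<zero>\<^bsub>vob N (C \<times>\<^sub>c D)\<^esub>"
  by (rule bilin_map_simps[OF bf_module[OF L c(1)] bf_module[OF M c(2)] bf_module[OF N prod_cat_fincats[OF c]] bifam_bilin[OF \<beta> c]];
      assumption)+

lemma bifam_nat:
  assumes "bifam L M N \<beta>"
  shows "\<lbrakk>fincat C; fincat C'; fincat D; fincat D'; f \<in> bh C C';
      g \<in> bh D D'; x \<in> el L C; y \<in> el M D\<rbrakk> \<Longrightarrow>
      \<beta> C' D' (vmap L C C' f x) (vmap M D D' g y) =
        vmap N (C \<times>\<^sub>c D) (C' \<times>\<^sub>c D') (mprod R C C' D D' f g) (\<beta> C D x y)"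
  using assms by (simp add: bifam_def)

lemma bifam_nat_left:
  assumes "bifam L M N \<beta>" and M: "bfunctor M"
  shows "\<lbrakk>fincat C; fincat C'; fincat D; f \<in> bh C C'; x \<in> el L C; y \<in> el M D\<rbrakk> \<Longrightarrow>
      \<beta> C' D (vmap L C C' f x) y = vmap N (C \<times>\<^sub>c D) (C' \<times>\<^sub>c D) (mprod R C C' D D f (bident R D)) (\<beta> C D x y)"
  using bifam_nat[OF assms(1), of C C' D D f "bident R D" x y] by (simp add: bf_simps[OF M])

lemma bifam_nat_right:
  assumes "bifam L M N \<beta>" and L: "bfunctor L"
  shows "\<lbrakk>fincat C; fincat D; fincat D'; g \<in> bh D D'; x \<in> el L C; y \<in> el M D\<rbrakk> \<Longrightarrow>
      \<beta> C D' x (vmap M D D' g y) = vmap N (C \<times>\<^sub>c D) (C \<times>\<^sub>c D') (mprod R C C D D' (bident R C) g) (\<beta> C D x y)"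
  using bifam_nat[OF assms(1), of C C D D' "bident R C" g x y] by (simp add: bf_simps[OF L])

text \<open>The mate of an identity under bending, hence the unit of the adjunction between
  \<open>C \<mapsto> C \<times>\<^sub>c D\<close> and
  \<open>E \<mapsto> op_cat D \<times>\<^sub>c E\<close>; \<open>ev\<close> is the counit. The extra
  factor \<open>C\<close> is built in, instead of being attached to a coevaluation out of
  \<open>one_cat\<close>, so that no unit or associativity arrows intervene.\<close>

definition coev :: "fcat \<Rightarrow> fcat \<Rightarrow> 'r bmor" where
  "coev C D = mbend C D (C \<times>\<^sub>c D) (bident R (C \<times>\<^sub>c D))"

definition ev :: "fcat \<Rightarrow> fcat \<Rightarrow> 'r bmor" where
  "ev D E = munbend (op_cat D \<times>\<^sub>c E) D E (bident R (op_cat D \<times>\<^sub>c E))"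

lemma coev_closed [simp]: "fincat C \<Longrightarrow> fincat D \<Longrightarrow> coev C D \<in> bh C (op_cat D \<times>\<^sub>c C \<times>\<^sub>c D)"
  by (simp add: coev_def)

lemma ev_closed [simp]: "fincat D \<Longrightarrow> fincat E \<Longrightarrow> ev D E \<in> bh ((op_cat D \<times>\<^sub>c E) \<times>\<^sub>c D) E"
  by (simp add: ev_def)

lemma mbend_ev [simp]: "fincat D \<Longrightarrow> fincat E \<Longrightarrow> mbend (op_cat D \<times>\<^sub>c E) D E (ev D E) = bident R (op_cat D \<times>\<^sub>c E)"
  by (simp add: ev_def)

lemma mbend_inj:
  assumes "fincat C" "fincat D" "fincat E" "f \<in> bh (C \<times>\<^sub>c D) E" "g \<in> bh (C \<times>\<^sub>c D) E"
    "mbend C D E f = mbend C D E g"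
  shows "f = g"
  using assms munbend_mbend(1) by metis

text \<open>Both sides are the bent form of the product of \<open>f\<close> and \<open>g\<close>.
  The left side uses naturality of bending in the target, the right side naturality in the source
  and dinaturality in the dualised factor.\<close>

lemma coev_natural:
  assumes [simp]: "fincat C" "fincat C'" "fincat D" "fincat D'" "f \<in> bh C C'" "g \<in> bh D D'"
  shows "bcmp R C (op_cat D \<times>\<^sub>c C \<times>\<^sub>c D) (op_cat D \<times>\<^sub>c C' \<times>\<^sub>c D')
      (mprod R (op_cat D) (op_cat D) (C \<times>\<^sub>c D) (C' \<times>\<^sub>c D') (bident R (op_cat D)) (mprod R C C' D D' f g)) (coev C D) =
    bcmp R C (op_cat D' \<times>\<^sub>c C' \<times>\<^sub>c D') (op_cat D \<times>\<^sub>c C' \<times>\<^sub>c D')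
      (mprod R (op_cat D') (op_cat D) (C' \<times>\<^sub>c D') (C' \<times>\<^sub>c D') (mdual R D D' g) (bident R (C' \<times>\<^sub>c D')))
      (bcmp R C C' (op_cat D' \<times>\<^sub>c C' \<times>\<^sub>c D') (coev C' D') f)"
proof -
  have "bcmp R C C' (op_cat D' \<times>\<^sub>c C' \<times>\<^sub>c D') (coev C' D') f = mbend C D' (C' \<times>\<^sub>c D') (mprod R C C' D' D' f (bident R D'))"
    unfolding coev_def by (subst mbend_source[symmetric]) simp_all
  then show ?thesis
    unfolding coev_def by (simp add: mbend_target[symmetric] mbend_dual[symmetric] mprod_bcmp)
qed

text \<open>Bending is injective, and both sides bend to the action of the dual of \<open>f\<close>
  on the factor \<open>op_cat D'\<close>.\<close>

lemma ev_dinatural: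
  assumes [simp]: "fincat D" "fincat D'" "fincat E" "f \<in> bh D D'"
  shows "bcmp R ((op_cat D' \<times>\<^sub>c E) \<times>\<^sub>c D) ((op_cat D \<times>\<^sub>c E) \<times>\<^sub>c D) E (ev D E)
      (mprod R (op_cat D' \<times>\<^sub>c E) (op_cat D \<times>\<^sub>c E) D D (mprod R (op_cat D') (op_cat D) E E (mdual R D D' f) (bident R E)) (bident R D)) =
    bcmp R ((op_cat D' \<times>\<^sub>c E) \<times>\<^sub>c D) ((op_cat D' \<times>\<^sub>c E) \<times>\<^sub>c D') E (ev D' E)
      (mprod R (op_cat D' \<times>\<^sub>c E) (op_cat D' \<times>\<^sub>c E) D D' (bident R (op_cat D' \<times>\<^sub>c E)) f)"
  by (rule mbend_inj[of "op_cat D' \<times>\<^sub>c E" D E]) (simp_all add: mbend_source mbend_dual)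

lemma ev_natural:
  assumes [simp]: "fincat D" "fincat E" "fincat E'" "g \<in> bh E E'"
  shows "bcmp R ((op_cat D \<times>\<^sub>c E) \<times>\<^sub>c D) E E' g (ev D E) =
    bcmp R ((op_cat D \<times>\<^sub>c E) \<times>\<^sub>c D) ((op_cat D \<times>\<^sub>c E') \<times>\<^sub>c D) E' (ev D E')
      (mprod R (op_cat D \<times>\<^sub>c E) (op_cat D \<times>\<^sub>c E') D D (mprod R (op_cat D) (op_cat D) E E' (bident R (op_cat D)) g) (bident R D))"
  by (rule mbend_inj[of "op_cat D \<times>\<^sub>c E" D E'])
    (simp_all add: mbend_source mbend_target[of "op_cat D \<times>\<^sub>c E" D E E'])

text \<open>One of the two triangle identities, the other being \<open>coev_ev\<close>. This one
  makes the map induced by a bilinear family take the prescribed values; the other shows that the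
  universal elements generate.\<close>

lemma ev_coev:
  assumes [simp]: "fincat C" "fincat D"
  shows "bcmp R (C \<times>\<^sub>c D) ((op_cat D \<times>\<^sub>c C \<times>\<^sub>c D) \<times>\<^sub>c D) (C \<times>\<^sub>c D) (ev D (C \<times>\<^sub>c D))
      (mprod R C (op_cat D \<times>\<^sub>c C \<times>\<^sub>c D) D D (coev C D) (bident R D)) = bident R (C \<times>\<^sub>c D)"
  by (rule mbend_inj[of C D "C \<times>\<^sub>c D"]) (simp_all add: mbend_source coev_def)

lemma coev_ev:
  assumes [simp]: "fincat D" "fincat E"
  shows "bcmp R (op_cat D \<times>\<^sub>c E) (op_cat D \<times>\<^sub>c (op_cat D \<times>\<^sub>c E) \<times>\<^sub>c D) (op_cat D \<times>\<^sub>c E)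
      (mprod R (op_cat D) (op_cat D) ((op_cat D \<times>\<^sub>c E) \<times>\<^sub>c D) E (bident R (op_cat D)) (ev D E)) (coev (op_cat D \<times>\<^sub>c E) D) =
    bident R (op_cat D \<times>\<^sub>c E)"
  unfolding coev_def by (simp add: mbend_target[symmetric])

section \<open>The tensor product by generators and relations\<close>

lemma dual_yd_simps [simp]:
  "vob (dual_fun R (yd R C L)) D = vob L (op_cat D \<times>\<^sub>c C)"
  "vmap (dual_fun R (yd R C L)) D E f =
    vmap L (op_cat E \<times>\<^sub>c C) (op_cat D \<times>\<^sub>c C) (mprod R (op_cat E) (op_cat D) C C (mdual R D E f) (bident R C))"
  by (simp_all add: dual_fun_def yd_def)

lemma tens_rels_mem:
  assumes "fincat D"
  shows "\<lbrakk>a \<in> el L D; a' \<in> el L D; b \<in> el M D\<rbrakk> \<Longrightarrow>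
      (\<lambda>t. basis_elt R (D, a \<oplus>\<^bsub>vob L D\<^esub> a', b) t \<ominus> (basis_elt R (D, a, b) t \<oplus> basis_elt R (D, a', b) t)) \<in> tens_rels R L M"
    and "\<lbrakk>a \<in> el L D; b \<in> el M D; b' \<in> el M D\<rbrakk> \<Longrightarrow>
      (\<lambda>t. basis_elt R (D, a, b \<oplus>\<^bsub>vob M D\<^esub> b') t \<ominus> (basis_elt R (D, a, b) t \<oplus> basis_elt R (D, a, b') t)) \<in> tens_rels R L M"
    and "\<lbrakk>r \<in> carrier R; a \<in> el L D; b \<in> el M D\<rbrakk> \<Longrightarrow>
      (\<lambda>t. basis_elt R (D, r \<odot>\<^bsub>vob L D\<^esub> a, b) t \<ominus> r \<otimes> basis_elt R (D, a, b) t) \<in> tens_rels R L M"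
    and "\<lbrakk>r \<in> carrier R; a \<in> el L D; b \<in> el M D\<rbrakk> \<Longrightarrow>
      (\<lambda>t. basis_elt R (D, a, r \<odot>\<^bsub>vob M D\<^esub> b) t \<ominus> r \<otimes> basis_elt R (D, a, b) t) \<in> tens_rels R L M"
    and "\<lbrakk>fincat E; \<Omega> \<in> bisets E D; a \<in> el L E; b \<in> el M D\<rbrakk> \<Longrightarrow>
      (\<lambda>t. basis_elt R (D, vmap L D E (bcls R D E \<Omega>) a, b) t \<ominus> basis_elt R (E, a, vmap M D E (bcls R D E \<Omega>) b) t) \<in> tens_rels R L M"
  unfolding tens_rels_def
      apply (rule UnI1, rule UnI1, rule UnI1, rule UnI1, rule CollectI, intro exI conjI, rule refl)
         apply (use assms in simp_all)[4]
     apply (rule UnI1, rule UnI1, rule UnI1, rule UnI2, rule CollectI, intro exI conjI, rule refl)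
        apply (use assms in simp_all)[4]
    apply (rule UnI1, rule UnI1, rule UnI2, rule CollectI, intro exI conjI, rule refl)
       apply (use assms in simp_all)[4]
   apply (rule UnI1, rule UnI2, rule CollectI, intro exI conjI, rule refl)
      apply (use assms in simp_all)[4]
  apply (rule UnI2, rule CollectI, intro exI conjI, rule refl)
      apply (use assms in simp_all)[5]
  done

text \<open>The elementary tensor in the summand at \<open>D\<close> of the value at
  \<open>C\<close>; its first factor lives over \<open>op_cat D \<times>\<^sub>c C\<close>, its
  second over \<open>D\<close>.\<close>

definition te :: "('r, 'a) bfun \<Rightarrow> ('r, 'b) bfun \<Rightarrow> fcat \<Rightarrow> fcat \<Rightarrow> 'a \<Rightarrow> 'b \<Rightarrow> (fcat \<times> 'a \<times> 'b \<Rightarrow> 'r) set" where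
  "te L M C D a b = tens_elt R (dual_fun R (yd R C L)) M D a b"

text \<open>All relators in \<open>tens_rels\<close> have one of three shapes: additivity,
  homogeneity, equality of two generators. Membership in the free module, the value of a linear
  extension and the resulting equation between classes are settled once for each shape.\<close>

lemma basis_forms:
  assumes "x \<in> X" "y \<in> X" "z \<in> X" "r \<in> carrier R"
  shows "(\<lambda>t. basis_elt R x t \<ominus> (basis_elt R y t \<oplus> basis_elt R z t)) \<in> carrier (free_mod R X)"
    and "(\<lambda>t. basis_elt R x t \<ominus> r \<otimes> basis_elt R y t) \<in> carrier (free_mod R X)"
    and "(\<lambda>t. basis_elt R x t \<ominus> basis_elt R y t) \<in> carrier (free_mod R X)"
    and "(\<lambda>t. basis_elt R y t \<oplus> basis_elt R z t) \<in> carrier (free_mod R X)"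
    and "(\<lambda>t. r \<otimes> basis_elt R y t) \<in> carrier (free_mod R X)"
proof -
  interpret F: module R "free_mod R X" by (rule free_mod_module)
  have b: "basis_elt R x \<in> carrier (free_mod R X)" "basis_elt R y \<in> carrier (free_mod R X)"
    "basis_elt R z \<in> carrier (free_mod R X)" using assms by auto
  show s: "(\<lambda>t. basis_elt R y t \<oplus> basis_elt R z t) \<in> carrier (free_mod R X)"
    using F.a_closed[OF b(2,3)] by simp
  show m: "(\<lambda>t. r \<otimes> basis_elt R y t) \<in> carrier (free_mod R X)"
    using F.smult_closed[OF assms(4) b(2)] by simp
  show "(\<lambda>t. basis_elt R x t \<ominus> (basis_elt R y t \<oplus> basis_elt R z t)) \<in> carrier (free_mod R X)"
    "(\<lambda>t. basis_elt R x t \<ominus> r \<otimes> basis_elt R y t) \<in> carrier (free_mod R X)"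
    "(\<lambda>t. basis_elt R x t \<ominus> basis_elt R y t) \<in> carrier (free_mod R X)"
    using F.minus_closed[OF b(1) s] F.minus_closed[OF b(1) m] F.minus_closed[OF b(1,2)]
    by (simp_all add: free_mod_diff b s m)
qed

lemma basis_forms2:
  assumes "x \<in> X" "y \<in> X"
  shows "r \<in> carrier R \<Longrightarrow> (\<lambda>t. basis_elt R x t \<ominus> r \<otimes> basis_elt R y t) \<in> carrier (free_mod R X)"
    and "(\<lambda>t. basis_elt R x t \<ominus> basis_elt R y t) \<in> carrier (free_mod R X)"
  using basis_forms(2)[of x X y y r] basis_forms(3)[of x X y y \<one>] assms by auto

lemma lin_ext_forms:
  fixes M :: "('r, 'a) module"
  assumes "x \<in> X" "y \<in> X" "z \<in> X" "r \<in> carrier R" and M: "module R M" and h: "h \<in> X \<rightarrow> carrier M"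
  shows "lin_ext M h (\<lambda>t. basis_elt R x t \<ominus> (basis_elt R y t \<oplus> basis_elt R z t)) = h x \<ominus>\<^bsub>M\<^esub> (h y \<oplus>\<^bsub>M\<^esub> h z)"
    and "lin_ext M h (\<lambda>t. basis_elt R x t \<ominus> r \<otimes> basis_elt R y t) = h x \<ominus>\<^bsub>M\<^esub> r \<odot>\<^bsub>M\<^esub> h y"
    and "lin_ext M h (\<lambda>t. basis_elt R x t \<ominus> basis_elt R y t) = h x \<ominus>\<^bsub>M\<^esub> h y"
proof -
  note f = basis_forms[OF assms(1-4)] and l = lin_ext[OF M h]
  have b: "basis_elt R x \<in> carrier (free_mod R X)" "basis_elt R y \<in> carrier (free_mod R X)"
    "basis_elt R z \<in> carrier (free_mod R X)" using assms by auto
  have s: "lin_ext M h (\<lambda>t. basis_elt R y t \<oplus> basis_elt R z t) = h y \<oplus>\<^bsub>M\<^esub> h z"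
    using lin_map_add[OF l(1) b(2,3)] assms by (simp add: l(2))
  have m: "lin_ext M h (\<lambda>t. r \<otimes> basis_elt R y t) = r \<odot>\<^bsub>M\<^esub> h y"
    using lin_map_smult[OF l(1) assms(4) b(2)] assms by (simp add: l(2))
  note d = lin_map_minus[OF free_mod_module M l(1) b(1)]
  show "lin_ext M h (\<lambda>t. basis_elt R x t \<ominus> (basis_elt R y t \<oplus> basis_elt R z t)) = h x \<ominus>\<^bsub>M\<^esub> (h y \<oplus>\<^bsub>M\<^esub> h z)"
    "lin_ext M h (\<lambda>t. basis_elt R x t \<ominus> r \<otimes> basis_elt R y t) = h x \<ominus>\<^bsub>M\<^esub> r \<odot>\<^bsub>M\<^esub> h y"
    "lin_ext M h (\<lambda>t. basis_elt R x t \<ominus> basis_elt R y t) = h x \<ominus>\<^bsub>M\<^esub> h y"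
    using d[OF f(4)] d[OF f(5)] d[OF b(2)] assms s m l(2) by (simp_all add: free_mod_diff b f)
qed

lemma pres_forms:
  assumes S: "S \<subseteq> carrier (free_mod R X)" and "x \<in> X" "y \<in> X" "z \<in> X" "r \<in> carrier R"
  shows "(\<lambda>t. basis_elt R x t \<ominus> (basis_elt R y t \<oplus> basis_elt R z t)) \<in> S \<Longrightarrow>
      pgen R X S x = pgen R X S y \<oplus>\<^bsub>pres R X S\<^esub> pgen R X S z"
    and "(\<lambda>t. basis_elt R x t \<ominus> r \<otimes> basis_elt R y t) \<in> S \<Longrightarrow> pgen R X S x = r \<odot>\<^bsub>pres R X S\<^esub> pgen R X S y"
    and "(\<lambda>t. basis_elt R x t \<ominus> basis_elt R y t) \<in> S \<Longrightarrow> pgen R X S x = pgen R X S y"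
proof -
  note f = basis_forms[OF assms(2-5)]
  have b: "basis_elt R x \<in> carrier (free_mod R X)" "basis_elt R y \<in> carrier (free_mod R X)"
    "basis_elt R z \<in> carrier (free_mod R X)" using assms by auto
  have s: "pcls X S (\<lambda>t. basis_elt R y t \<oplus> basis_elt R z t) = pgen R X S y \<oplus>\<^bsub>pres R X S\<^esub> pgen R X S z"
    using lin_map_add[OF pcls_lin[OF S] b(2,3)] by (simp add: pgen_pcls)
  have m: "pcls X S (\<lambda>t. r \<otimes> basis_elt R y t) = r \<odot>\<^bsub>pres R X S\<^esub> pgen R X S y"
    using lin_map_smult[OF pcls_lin[OF S] assms(5) b(2)] by (simp add: pgen_pcls)
  show "(\<lambda>t. basis_elt R x t \<ominus> (basis_elt R y t \<oplus> basis_elt R z t)) \<in> S \<Longrightarrow>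
      pgen R X S x = pgen R X S y \<oplus>\<^bsub>pres R X S\<^esub> pgen R X S z"
    using pcls_eq[OF S b(1) f(4)] s by (simp add: pgen_pcls)
  show "(\<lambda>t. basis_elt R x t \<ominus> r \<otimes> basis_elt R y t) \<in> S \<Longrightarrow> pgen R X S x = r \<odot>\<^bsub>pres R X S\<^esub> pgen R X S y"
    using pcls_eq[OF S b(1) f(5)] m by (simp add: pgen_pcls)
  show "(\<lambda>t. basis_elt R x t \<ominus> basis_elt R y t) \<in> S \<Longrightarrow> pgen R X S x = pgen R X S y"
    using pcls_eq[OF S b(1,2)] by (simp add: pgen_pcls)
qed

context
  fixes L :: "('r, 'a) bfun" and M :: "('r, 'b) bfun"
  assumes L: "bfunctor L" and M: "bfunctor M"
begin

lemmas [simp] = bf_simps[OF L] bf_simps[OF M]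

lemma tens_rels_closed:
  assumes "fincat C"
  shows "tens_rels R (dual_fun R (yd R C L)) M \<subseteq> carrier (free_mod R (tens_gens (dual_fun R (yd R C L)) M))"
  using assms unfolding tens_rels_def
  by (auto intro!: basis_forms(1)[OF _ _ _ one_closed] basis_forms2 simp: tens_gens_def)

lemma vob_raw_tens: "vob (raw_tens R L M) C =
    pres R (tens_gens (dual_fun R (yd R C L)) M) (tens_rels R (dual_fun R (yd R C L)) M)"
  by (simp add: raw_tens_def tens_B_def)

lemma rt_module: "fincat C \<Longrightarrow> module R (vob (raw_tens R L M) C)"
  unfolding vob_raw_tens by (rule pres_module[OF tens_rels_closed])

lemmas rt_simps [simp] = module_simps[OF rt_module]

context
  fixes C D assumes cats [simp]: "fincat C" "fincat D"
begin

lemma te_closed [simp]: "a \<in> el L (op_cat D \<times>\<^sub>c C) \<Longrightarrow> b \<in> el M D \<Longrightarrow>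
    te L M C D a b \<in> el (raw_tens R L M) C"
  unfolding vob_raw_tens te_def tens_elt_def by (rule pgen_closed[OF tens_rels_closed]) (auto simp: tens_gens_def)

lemma te_bilin: "bilin_map R (vob L (op_cat D \<times>\<^sub>c C)) (vob M D) (vob (raw_tens R L M) C) (te L M C D)"
proof -
  let ?L = "dual_fun R (yd R C L)"
  note pf = pres_forms[OF tens_rels_closed[OF cats(1)]]
  have g: "a \<in> el L (op_cat D \<times>\<^sub>c C) \<Longrightarrow> b \<in> el M D \<Longrightarrow> (D, a, b) \<in> tens_gens ?L M" for a b
    by (simp add: tens_gens_def)
  show ?thesis
  proof (rule bilin_mapI)
    fix x x' y assume a: "x \<in> el L (op_cat D \<times>\<^sub>c C)" "x' \<in> el L (op_cat D \<times>\<^sub>c C)" "y \<in> el M D"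
    show "te L M C D (x \<oplus>\<^bsub>vob L (op_cat D \<times>\<^sub>c C)\<^esub> x') y = te L M C D x y \<oplus>\<^bsub>vob (raw_tens R L M) C\<^esub> te L M C D x' y"
      unfolding vob_raw_tens te_def tens_elt_def
    proof (rule pf(1)[OF g g g one_closed])
      show "(\<lambda>t. basis_elt R (D, x \<oplus>\<^bsub>vob L (op_cat D \<times>\<^sub>c C)\<^esub> x', y) t \<ominus> (basis_elt R (D, x, y) t \<oplus> basis_elt R (D, x', y) t))
          \<in> tens_rels R ?L M"
        using tens_rels_mem(1)[of D x ?L x' y M] a by simp
    qed (use a in simp_all)
  next
    fix x y y' assume a: "x \<in> el L (op_cat D \<times>\<^sub>c C)" "y \<in> el M D" "y' \<in> el M D"
    show "te L M C D x (y \<oplus>\<^bsub>vob M D\<^esub> y') = te L M C D x y \<oplus>\<^bsub>vob (raw_tens R L M) C\<^esub> te L M C D x y'"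
      unfolding vob_raw_tens te_def tens_elt_def
    proof (rule pf(1)[OF g g g one_closed])
      show "(\<lambda>t. basis_elt R (D, x, y \<oplus>\<^bsub>vob M D\<^esub> y') t \<ominus> (basis_elt R (D, x, y) t \<oplus> basis_elt R (D, x, y') t))
          \<in> tens_rels R ?L M"
        using tens_rels_mem(2)[of D x ?L y M y'] a by simp
    qed (use a in simp_all)
  next
    fix r x y assume a: "r \<in> carrier R" "x \<in> el L (op_cat D \<times>\<^sub>c C)" "y \<in> el M D"
    show "te L M C D (r \<odot>\<^bsub>vob L (op_cat D \<times>\<^sub>c C)\<^esub> x) y = r \<odot>\<^bsub>vob (raw_tens R L M) C\<^esub> te L M C D x y"
      unfolding vob_raw_tens te_def tens_elt_def
    proof (rule pf(2)[OF g g g a(1)])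
      show "(\<lambda>t. basis_elt R (D, r \<odot>\<^bsub>vob L (op_cat D \<times>\<^sub>c C)\<^esub> x, y) t \<ominus> r \<otimes> basis_elt R (D, x, y) t) \<in> tens_rels R ?L M"
        using tens_rels_mem(3)[of D r x ?L y M] a by simp
    qed (use a in simp_all)
    show "te L M C D x (r \<odot>\<^bsub>vob M D\<^esub> y) = r \<odot>\<^bsub>vob (raw_tens R L M) C\<^esub> te L M C D x y"
      unfolding vob_raw_tens te_def tens_elt_def
    proof (rule pf(2)[OF g g g a(1)])
      show "(\<lambda>t. basis_elt R (D, x, r \<odot>\<^bsub>vob M D\<^esub> y) t \<ominus> r \<otimes> basis_elt R (D, x, y) t) \<in> tens_rels R ?L M"
        using tens_rels_mem(4)[of D r x ?L y M] a by simp
    qed (use a in simp_all)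
  qed simp
qed

end

lemmas te_simps [simp] = bilin_map_simps[OF bf_simps(1)[OF L prod_cat_fincats[OF op_cat_fincats]] bf_simps(1)[OF M] rt_module te_bilin]

text \<open>The relators impose balancing only for classes of bisets; linearity of both sides in
  \<open>f\<close> extends it to all arrows.\<close>

lemma te_slide:
  assumes [simp]: "fincat C" "fincat D" "fincat E"
    and f: "f \<in> bh D E" and a [simp]: "a \<in> el L (op_cat E \<times>\<^sub>c C)" and b [simp]: "b \<in> el M D"
  shows "te L M C D (vmap L (op_cat E \<times>\<^sub>c C) (op_cat D \<times>\<^sub>c C) (mprod R (op_cat E) (op_cat D) C C (mdual R D E f) (bident R C)) a) b =
    te L M C E a (vmap M D E f b)"
  using assms(2,3) f
proof (induction rule: bhom_induct')
  case (gen r \<Omega>)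
  let ?L = "dual_fun R (yd R C L)"
  have "te L M C D (vmap ?L D E (bcls R D E \<Omega>) a) b = te L M C E a (vmap M D E (bcls R D E \<Omega>) b)"
    unfolding te_def tens_elt_def
  proof (rule pres_forms(3)[OF tens_rels_closed, where r = \<one> and z = "(E, a, vmap M D E (bcls R D E \<Omega>) b)"])
    show "(\<lambda>t. basis_elt R (D, vmap ?L D E (bcls R D E \<Omega>) a, b) t \<ominus> basis_elt R (E, a, vmap M D E (bcls R D E \<Omega>) b) t)
        \<in> tens_rels R ?L M"
      using tens_rels_mem(5)[of D E \<Omega> a ?L b M] gen by simp
  qed (use gen in \<open>auto simp: tens_gens_def\<close>)
  then show ?case using gen by simp
qed simp_all

text \<open>A scalar multiple of an elementary tensor is again elementary, with the scalar absorbed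
  into \<open>a\<close>. So elementary tensors generate additively.\<close>

lemma rt_induct [consumes 2, case_names zero add te]:
  assumes C: "fincat C" and k: "k \<in> el (raw_tens R L M) C"
    and z: "P \<zero>\<^bsub>vob (raw_tens R L M) C\<^esub>"
    and a: "\<And>k l. \<lbrakk>k \<in> el (raw_tens R L M) C; l \<in> el (raw_tens R L M) C; P k; P l\<rbrakk> \<Longrightarrow>
      P (k \<oplus>\<^bsub>vob (raw_tens R L M) C\<^esub> l)"
    and t: "\<And>D a b. \<lbrakk>fincat D; a \<in> el L (op_cat D \<times>\<^sub>c C); b \<in> el M D\<rbrakk> \<Longrightarrow> P (te L M C D a b)"
  shows "P k"
proof (rule pres_induct[OF tens_rels_closed[OF C] k[unfolded vob_raw_tens]])
  let ?L = "dual_fun R (yd R C L)"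
  fix r x assume r: "r \<in> carrier R" and "x \<in> tens_gens ?L M"
  then obtain D a b where x: "x = (D, a, b)" "fincat D" "a \<in> el L (op_cat D \<times>\<^sub>c C)" "b \<in> el M D"
    by (auto simp: tens_gens_def)
  have "P (te L M C D (r \<odot>\<^bsub>vob L (op_cat D \<times>\<^sub>c C)\<^esub> a) b)" using x r C by (intro t) simp_all
  moreover have "te L M C D (r \<odot>\<^bsub>vob L (op_cat D \<times>\<^sub>c C)\<^esub> a) b = r \<odot>\<^bsub>vob (raw_tens R L M) C\<^esub> te L M C D a b"
    using x r C by simp
  ultimately show "P (r \<odot>\<^bsub>pres R (tens_gens ?L M) (tens_rels R ?L M)\<^esub> pgen R (tens_gens ?L M) (tens_rels R ?L M) x)"
    using x by (simp add: te_def tens_elt_def vob_raw_tens)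
qed (use z a in \<open>simp_all add: vob_raw_tens\<close>)

text \<open>Universal property of the value at a fixed \<open>C\<close>: bilinearity kills the first
  four families of relators and \<open>sl\<close> the fifth.\<close>

lemma rt_lift:
  fixes N :: "('r, 'c) module"
  assumes C [simp]: "fincat C" and N: "module R N"
    and bil: "\<And>D. fincat D \<Longrightarrow> bilin_map R (vob L (op_cat D \<times>\<^sub>c C)) (vob M D) N (h D)"
    and sl: "\<And>D E f a b. \<lbrakk>fincat D; fincat E; f \<in> bh D E; a \<in> el L (op_cat E \<times>\<^sub>c C); b \<in> el M D\<rbrakk> \<Longrightarrow>
      h D (vmap L (op_cat E \<times>\<^sub>c C) (op_cat D \<times>\<^sub>c C) (mprod R (op_cat E) (op_cat D) C C (mdual R D E f) (bident R C)) a) b =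
        h E a (vmap M D E f b)"
  shows "lin_map R (vob (raw_tens R L M) C) N (plift R N (\<lambda>(D, a, b). h D a b))"
    and "\<lbrakk>fincat D; a \<in> el L (op_cat D \<times>\<^sub>c C); b \<in> el M D\<rbrakk> \<Longrightarrow>
      plift R N (\<lambda>(D, a, b). h D a b) (te L M C D a b) = h D a b"
proof -
  interpret N: module R N by fact
  let ?L = "dual_fun R (yd R C L)" and ?h = "\<lambda>(D, a, b). h D a b"
  have lm: "module R (vob L (op_cat D \<times>\<^sub>c C))" if "fincat D" for D using that by simp
  note hs = bilin_map_simps[OF lm bf_simps(1)[OF M] N bil]
  have h: "?h \<in> tens_gens ?L M \<rightarrow> carrier N" by (auto simp: tens_gens_def hs(1))
  note le = lin_ext_forms[OF _ _ _ _ N h]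
  have cancel: "x \<in> carrier N \<Longrightarrow> x \<ominus>\<^bsub>N\<^esub> x = \<zero>\<^bsub>N\<^esub>" for x by (simp add: a_minus_def N.r_neg)
  have rel: "lin_ext N ?h s = \<zero>\<^bsub>N\<^esub>" if s: "s \<in> tens_rels R ?L M" for s
    using s unfolding tens_rels_def
  proof (elim UnE CollectE exE conjE)
    fix D a a' b assume "s = (\<lambda>t. basis_elt R (D, a \<oplus>\<^bsub>vob ?L D\<^esub> a', b) t \<ominus> (basis_elt R (D, a, b) t \<oplus> basis_elt R (D, a', b) t))"
      "fincat D" "a \<in> el ?L D" "a' \<in> el ?L D" "b \<in> el M D"
    then show ?thesis by (simp add: le(1)[OF _ _ _ one_closed] tens_gens_def hs cancel)
  next
    fix D a b b' assume "s = (\<lambda>t. basis_elt R (D, a, b \<oplus>\<^bsub>vob M D\<^esub> b') t \<ominus> (basis_elt R (D, a, b) t \<oplus> basis_elt R (D, a, b') t))"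
      "fincat D" "a \<in> el ?L D" "b \<in> el M D" "b' \<in> el M D"
    then show ?thesis by (simp add: le(1)[OF _ _ _ one_closed] tens_gens_def hs cancel)
  next
    fix D r a b assume "s = (\<lambda>t. basis_elt R (D, r \<odot>\<^bsub>vob ?L D\<^esub> a, b) t \<ominus> r \<otimes> basis_elt R (D, a, b) t)"
      "fincat D" "r \<in> carrier R" "a \<in> el ?L D" "b \<in> el M D"
    then show ?thesis using le(2)[of "(D, r \<odot>\<^bsub>vob ?L D\<^esub> a, b)" "(D, a, b)" "(D, a, b)" r]
      by (simp add: tens_gens_def hs cancel)
  next
    fix D r a b assume "s = (\<lambda>t. basis_elt R (D, a, r \<odot>\<^bsub>vob M D\<^esub> b) t \<ominus> r \<otimes> basis_elt R (D, a, b) t)"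
      "fincat D" "r \<in> carrier R" "a \<in> el ?L D" "b \<in> el M D"
    then show ?thesis using le(2)[of "(D, a, r \<odot>\<^bsub>vob M D\<^esub> b)" "(D, a, b)" "(D, a, b)" r]
      by (simp add: tens_gens_def hs cancel)
  next
    fix D E \<Omega> a b assume *: "s = (\<lambda>t. basis_elt R (D, vmap ?L D E (bcls R D E \<Omega>) a, b) t \<ominus> basis_elt R (E, a, vmap M D E (bcls R D E \<Omega>) b) t)"
      "fincat D" "fincat E" "\<Omega> \<in> bisets E D" "a \<in> el ?L E" "b \<in> el M D"
    then have "h D (vmap ?L D E (bcls R D E \<Omega>) a) b = h E a (vmap M D E (bcls R D E \<Omega>) b)"
      using sl[of D E "bcls R D E \<Omega>" a b] by simp
    moreover have "lin_ext N ?h s = h D (vmap ?L D E (bcls R D E \<Omega>) a) b \<ominus>\<^bsub>N\<^esub> h E a (vmap M D E (bcls R D E \<Omega>) b)"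
      using * le(3)[of "(D, vmap ?L D E (bcls R D E \<Omega>) a, b)" "(E, a, vmap M D E (bcls R D E \<Omega>) b)" "(D, vmap ?L D E (bcls R D E \<Omega>) a, b)" \<one>]
      by (simp add: tens_gens_def)
    ultimately show ?thesis using * by (simp add: cancel hs(1))
  qed
  note pl = plift[OF tens_rels_closed[OF C] N h rel]
  show "lin_map R (vob (raw_tens R L M) C) N (plift R N ?h)"
    unfolding vob_raw_tens by (rule pl(1)) simp
  show "\<lbrakk>fincat D; a \<in> el L (op_cat D \<times>\<^sub>c C); b \<in> el M D\<rbrakk> \<Longrightarrow>
      plift R N ?h (te L M C D a b) = h D a b"
    unfolding te_def tens_elt_def using pl(2)[of "(D, a, b)"] by (simp add: tens_gens_def)
qed

end

declare mprod_bident [simp] mprod_bcmp [simp] bf_simps [simp] rt_simps [simp] te_closed [simp] te_simps [simp]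

lemmas rt_induct' = rt_induct [consumes 4, case_names zero add te]

section \<open>The universal bilinear family\<close>

text \<open>The universal element \<open>x \<otimes> y \<in> (L \<otimes> M)(C \<times> D)\<close>: the generator at \<open>D\<close> of the tensor product over \<open>\<bbbB>\<close> needs a first factor
  in \<open>L(D\<^sup>o\<^sup>p \<times> C \<times> D)\<close>, which \<^const>\<open>coev\<close> supplies.\<close>

definition ru :: "('r, 'a) bfun \<Rightarrow> ('r, 'b) bfun \<Rightarrow> fcat \<Rightarrow> fcat \<Rightarrow> 'a \<Rightarrow> 'b \<Rightarrow> (fcat \<times> 'a \<times> 'b \<Rightarrow> 'r) set" where
  "ru L M C D x y = te L M (C \<times>\<^sub>c D) D (vmap L C (op_cat D \<times>\<^sub>c C \<times>\<^sub>c D) (coev C D) x) y"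

text \<open>The parameter \<open>U\<close> lets this serve the universal family both before and
  after transport into \<open>'m\<close>. The parameters \<open>G\<close> and \<open>H\<close>
  restrict the two factors to generators, for instance to the single generator of the unit.\<close>

definition ten_gens :: "('r, 'a) bfun \<Rightarrow> ('r, 'b) bfun \<Rightarrow> (fcat \<Rightarrow> fcat \<Rightarrow> 'a \<Rightarrow> 'b \<Rightarrow> 'c) \<Rightarrow>
    (fcat \<Rightarrow> 'a set) \<Rightarrow> (fcat \<Rightarrow> 'b set) \<Rightarrow> fcat \<Rightarrow> 'c set" where
  "ten_gens L M U G H E = {U C D x y | C D x y. C \<in> fincats \<and> fincat D \<and> E = C \<times>\<^sub>c D \<and>
     x \<in> G C \<and> x \<in> el L C \<and> y \<in> H D \<and> y \<in> el M D}"

lemma ten_gensI: "\<lbrakk>fincat C; fincat D; x \<in> G C; x \<in> el L C; y \<in> H D; y \<in> el M D\<rbrakk> \<Longrightarrow>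
    U C D x y \<in> ten_gens L M U G H (C \<times>\<^sub>c D)"
  unfolding ten_gens_def by blast

context
  fixes L :: "('r, 'a) bfun" and M :: "('r, 'b) bfun"
  assumes L [simp]: "bfunctor L" and M [simp]: "bfunctor M"
begin

lemma rt_ext:
  assumes [simp]: "fincat C" and N: "module R N"
    and h: "lin_map R (vob (raw_tens R L M) C) N h" and h': "lin_map R (vob (raw_tens R L M) C) N h'"
    and eq: "\<And>D a b. \<lbrakk>fincat D; a \<in> el L (op_cat D \<times>\<^sub>c C); b \<in> el M D\<rbrakk> \<Longrightarrow>
      h (te L M C D a b) = h' (te L M C D a b)"
    and k: "k \<in> el (raw_tens R L M) C"
  shows "h k = h' k"
  using L M assms(1) k
proof (induction rule: rt_induct')
  case zero
  then show ?case using lin_map_zero[OF rt_module[OF L M assms(1)] N] h h' by metis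
next
  case (add k l)
  then show ?case by (simp add: lin_map_add[OF h] lin_map_add[OF h'])
qed (use eq in simp)

lemma rt_vmap:
  assumes [simp]: "fincat C" "fincat C'" "f \<in> bh C C'"
  shows "lin_map R (vob (raw_tens R L M) C) (vob (raw_tens R L M) C') (vmap (raw_tens R L M) C C' f)"
    and "\<lbrakk>fincat D; a \<in> el L (op_cat D \<times>\<^sub>c C); b \<in> el M D\<rbrakk> \<Longrightarrow>
      vmap (raw_tens R L M) C C' f (te L M C D a b) =
        te L M C' D (vmap L (op_cat D \<times>\<^sub>c C) (op_cat D \<times>\<^sub>c C') (mprod R (op_cat D) (op_cat D) C C' (bident R (op_cat D)) f) a) b"
proof -
  let ?h = "\<lambda>D a b. te L M C' D (vmap L (op_cat D \<times>\<^sub>c C) (op_cat D \<times>\<^sub>c C') (mprod R (op_cat D) (op_cat D) C C' (bident R (op_cat D)) f) a) b"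
  have e: "vmap (raw_tens R L M) C C' f = plift R (vob (raw_tens R L M) C') (\<lambda>(D, a, b). ?h D a b)"
    by (simp add: raw_tens_def te_def yd_map_def)
  have b: "bilin_map R (vob L (op_cat D \<times>\<^sub>c C)) (vob M D) (vob (raw_tens R L M) C') (?h D)" if "fincat D" for D
    by (rule bilin_mapI) (use that in simp_all)
  have s: "?h D (vmap L (op_cat E \<times>\<^sub>c C) (op_cat D \<times>\<^sub>c C) (mprod R (op_cat E) (op_cat D) C C (mdual R D E g) (bident R C)) a) b =
      ?h E a (vmap M D E g b)"
    if [simp]: "fincat D" "fincat E" "g \<in> bh D E" "a \<in> el L (op_cat E \<times>\<^sub>c C)" "b \<in> el M D" for D E g a b
    by (subst te_slide[symmetric]) simp_all
  note r = rt_lift[OF L M assms(1) rt_module[OF L M assms(2)] b s]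
  show "lin_map R (vob (raw_tens R L M) C) (vob (raw_tens R L M) C') (vmap (raw_tens R L M) C C' f)"
    unfolding e by (rule r(1))
  show "\<lbrakk>fincat D; a \<in> el L (op_cat D \<times>\<^sub>c C); b \<in> el M D\<rbrakk> \<Longrightarrow>
      vmap (raw_tens R L M) C C' f (te L M C D a b) = ?h D a b"
    unfolding e by (rule r(2))
qed

lemma raw_tens_functor: "bfunctor (raw_tens R L M)"
proof (rule biset_functorI)
  fix C D assume c [simp]: "fincat C" "fincat D"
  note v [simp] = lin_map_simps[OF rt_module[OF L M c(1)] rt_module[OF L M c(2)] rt_vmap(1)[OF c]]
  interpret T: module R "vob (raw_tens R L M) D" by (rule rt_module[OF L M c(2)])
  show "bilin_map R (bhom R C D) (vob (raw_tens R L M) C) (vob (raw_tens R L M) D) (vmap (raw_tens R L M) C D)"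
  proof (rule bilin_mapI)
    fix f g k assume f: "f \<in> bh C D" "g \<in> bh C D" and k: "k \<in> el (raw_tens R L M) C"
    show "vmap (raw_tens R L M) C D (f \<oplus>\<^bsub>bhom R C D\<^esub> g) k =
        vmap (raw_tens R L M) C D f k \<oplus>\<^bsub>vob (raw_tens R L M) D\<^esub> vmap (raw_tens R L M) C D g k"
      using L M c(1) k by (induction rule: rt_induct') (use f in \<open>simp_all add: rt_vmap(2) T.a_ac\<close>)
  next
    fix r f k assume f: "r \<in> carrier R" "f \<in> bh C D" and k: "k \<in> el (raw_tens R L M) C"
    show "vmap (raw_tens R L M) C D (r \<odot>\<^bsub>bhom R C D\<^esub> f) k = r \<odot>\<^bsub>vob (raw_tens R L M) D\<^esub> vmap (raw_tens R L M) C D f k"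
      using L M c(1) k by (induction rule: rt_induct') (use f in \<open>simp_all add: rt_vmap(2) T.smult_r_distr\<close>)
  qed simp_all
next
  fix C x assume c [simp]: "fincat C" and x: "x \<in> el (raw_tens R L M) C"
  note v [simp] = lin_map_simps[OF rt_module[OF L M c] rt_module[OF L M c] rt_vmap(1)[OF c c]]
  show "vmap (raw_tens R L M) C C (bident R C) x = x"
    using L M c x by (induction rule: rt_induct') (simp_all add: rt_vmap(2))
next
  fix C D E f g x
  assume c [simp]: "fincat C" "fincat D" "fincat E" "f \<in> bh C D" "g \<in> bh D E"
    and x: "x \<in> el (raw_tens R L M) C"
  note [simp] = lin_map_simps[OF rt_module[OF L M c(1)] rt_module[OF L M c(2)] rt_vmap(1)[OF c(1,2)]]
    lin_map_simps[OF rt_module[OF L M c(2)] rt_module[OF L M c(3)] rt_vmap(1)[OF c(2,3)]]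
    lin_map_simps[OF rt_module[OF L M c(1)] rt_module[OF L M c(3)] rt_vmap(1)[OF c(1,3)]]
  show "vmap (raw_tens R L M) C E (bcmp R C D E g f) x = vmap (raw_tens R L M) D E g (vmap (raw_tens R L M) C D f x)"
    using L M c(1) x by (induction rule: rt_induct') (simp_all add: rt_vmap(2))
qed (rule rt_module[OF L M])

text \<open>The action of \<open>g\<close> on \<open>y\<close> slides across the tensor and becomes
  the action of its dual on the first factor. There \<open>coev_natural\<close> converts it,
  together with \<open>f\<close>, into the action on the product.\<close>

lemma bifam_ru: "bifam L M (raw_tens R L M) (ru L M)"
proof (rule bifamI)
  fix C D assume "fincat C" "fincat D"
  then show "bilin_map R (vob L C) (vob M D) (vob (raw_tens R L M) (C \<times>\<^sub>c D)) (ru L M C D)"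
    by (intro bilin_mapI) (simp_all add: ru_def)
next
  fix C C' D D' f g x y
  assume [simp]: "fincat C" "fincat C'" "fincat D" "fincat D'" "f \<in> bh C C'" "g \<in> bh D D'"
    "x \<in> el L C" "y \<in> el M D"
  show "ru L M C' D' (vmap L C C' f x) (vmap M D D' g y) =
    vmap (raw_tens R L M) (C \<times>\<^sub>c D) (C' \<times>\<^sub>c D') (mprod R C C' D D' f g) (ru L M C D x y)"
    unfolding ru_def by (subst te_slide[symmetric]) (simp_all add: rt_vmap(2) coev_natural)
qed

text \<open>Every elementary tensor is the image of a universal one under the counit, by the
  triangle identity \<open>coev_ev\<close>. This is why the universal elements generate.\<close>

lemma te_ru:
  assumes [simp]: "fincat C" "fincat D" "a \<in> el L (op_cat D \<times>\<^sub>c C)" "b \<in> el M D"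
  shows "te L M C D a b = vmap (raw_tens R L M) ((op_cat D \<times>\<^sub>c C) \<times>\<^sub>c D) C (ev D C) (ru L M (op_cat D \<times>\<^sub>c C) D a b)"
  unfolding ru_def by (simp add: rt_vmap(2) coev_ev)

lemma ru_generates: "generates (raw_tens R L M) (ten_gens L M (ru L M) (\<lambda>C. el L C) (\<lambda>D. el M D))"
  (is "generates ?T ?G")
  unfolding generates_def
proof (intro ballI)
  fix C k assume C [simp]: "fincat C" and k: "k \<in> el ?T C"
  show "gspan ?T ?G C k"
    using L M C k
  proof (induction rule: rt_induct')
    case (te D a b)
    then have "gspan ?T ?G C (vmap ?T ((op_cat D \<times>\<^sub>c C) \<times>\<^sub>c D) C (ev D C) (ru L M (op_cat D \<times>\<^sub>c C) D a b))"
      by (intro gspan.act) (auto intro!: ten_gensI simp: bifam_simps(1)[OF L M raw_tens_functor bifam_ru])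
    then show ?case using te by (simp add: te_ru)
  qed (auto intro: gspan.intros)
qed

text \<open>By \<open>te_ru\<close> the value at an elementary tensor is forced: it is
  \<open>ev\<close> applied to the value of \<open>\<beta>\<close>. This formula is balanced by
  dinaturality of \<open>ev\<close> and natural by \<open>ev_natural\<close>, and
  \<open>ev_coev\<close> returns the prescribed values on universal elements.\<close>

lemma rt_univ:
  assumes N [simp]: "bfunctor N" and \<beta>: "bifam L M N \<beta>"
  shows "\<exists>\<eta>\<in>nat_trans R (raw_tens R L M) N. \<forall>C\<in>fincats. \<forall>D\<in>fincats. \<forall>x\<in>el L C. \<forall>y\<in>el M D.
    \<eta> (C \<times>\<^sub>c D) (ru L M C D x y) = \<beta> C D x y"
proof -
  note [simp] = bifam_simps[OF L M N \<beta>]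
  let ?h = "\<lambda>E D a b. vmap N ((op_cat D \<times>\<^sub>c E) \<times>\<^sub>c D) E (ev D E) (\<beta> (op_cat D \<times>\<^sub>c E) D a b)"
  let ?\<eta> = "\<lambda>E. plift R (vob N E) (\<lambda>(D, a, b). ?h E D a b)"
  have b: "bilin_map R (vob L (op_cat D \<times>\<^sub>c E)) (vob M D) (vob N E) (?h E D)" if "fincat D" "fincat E" for D E
    by (rule bilin_mapI) (use that in simp_all)
  have s: "?h E D (vmap L (op_cat D' \<times>\<^sub>c E) (op_cat D \<times>\<^sub>c E) (mprod R (op_cat D') (op_cat D) E E (mdual R D D' g) (bident R E)) a) b =
      ?h E D' a (vmap M D D' g b)"
    if [simp]: "fincat E" "fincat D" "fincat D'" "g \<in> bh D D'" "a \<in> el L (op_cat D' \<times>\<^sub>c E)" "b \<in> el M D" for E D D' g a b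
    by (simp add: bifam_nat_left[OF \<beta> M] bifam_nat_right[OF \<beta> L] ev_dinatural)
  note r = rt_lift[OF L M _ bf_simps(1)[OF N] b s]
  have lin: "lin_map R (vob (raw_tens R L M) E) (vob N E) (?\<eta> E)" if "fincat E" for E
    using that by (intro r(1))
  have te: "?\<eta> E (te L M E D a b) = ?h E D a b"
    if "fincat E" "fincat D" "a \<in> el L (op_cat D \<times>\<^sub>c E)" "b \<in> el M D" for E D a b
    using that by (intro r(2))
  show ?thesis
  proof (intro bexI ballI)
    show "ntr (raw_tens R L M) ?\<eta> \<in> nat_trans R (raw_tens R L M) N"
    proof (rule ntr_nat_trans[OF raw_tens_functor lin])
      fix E E' f k assume c [simp]: "fincat E" "fincat E'" "f \<in> bh E E'" and k: "k \<in> el (raw_tens R L M) E"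
      show "?\<eta> E' (vmap (raw_tens R L M) E E' f k) = vmap N E E' f (?\<eta> E k)"
      proof (rule rt_ext[OF c(1) bf_simps(1)[OF N c(2)] _ _ _ k])
        show "lin_map R (vob (raw_tens R L M) E) (vob N E') (\<lambda>k. ?\<eta> E' (vmap (raw_tens R L M) E E' f k))"
          by (rule lin_map_comp[OF rt_vmap(1)[OF c] lin[OF c(2)]])
        have "lin_map R (vob N E) (vob N E') (vmap N E E' f)" by (rule lin_mapI) simp_all
        then show "lin_map R (vob (raw_tens R L M) E) (vob N E') (\<lambda>k. vmap N E E' f (?\<eta> E k))"
          by (rule lin_map_comp[OF lin[OF c(1)]])
      qed (simp add: rt_vmap(2) te bifam_nat_left[OF \<beta> M] ev_natural)
    qed
    fix C D x y assume [simp]: "fincat C" "fincat D" "x \<in> el L C" "y \<in> el M D"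
    have "ru L M C D x y \<in> el (raw_tens R L M) (C \<times>\<^sub>c D)"
      by (simp add: ru_def)
    then show "ntr (raw_tens R L M) ?\<eta> (C \<times>\<^sub>c D) (ru L M C D x y) = \<beta> C D x y"
      by (simp add: ru_def te bifam_nat_left[OF \<beta> M] ev_coev)
  qed
qed

end

text \<open>The map is defined on elementary tensors; naturality of \<open>\<phi>\<close> moves it
  past the \<open>coev\<close> inside a universal element.\<close>

lemma raw_tens_map:
  assumes L [simp]: "bfunctor L" and M [simp]: "bfunctor M"
    and L' [simp]: "bfunctor L'" and M' [simp]: "bfunctor M'"
    and \<phi>: "\<phi> \<in> nat_trans R L L'" and \<psi>: "\<psi> \<in> nat_trans R M M'"
  shows "raw_tens_map R L L' M M' \<phi> \<psi> \<in> nat_trans R (raw_tens R L M) (raw_tens R L' M')"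
    and "\<lbrakk>fincat C; fincat D; x \<in> el L C; y \<in> el M D\<rbrakk> \<Longrightarrow>
      raw_tens_map R L L' M M' \<phi> \<psi> (C \<times>\<^sub>c D) (ru L M C D x y) = ru L' M' C D (\<phi> C x) (\<psi> D y)"
proof -
  let ?T = "raw_tens R L M" and ?T' = "raw_tens R L' M'"
  note T [simp] = raw_tens_functor[OF L M] and T' [simp] = raw_tens_functor[OF L' M']
  note [simp] = nt_simps[OF L L' \<phi>] nt_simps[OF M M' \<psi>]
  let ?h = "\<lambda>E D a b. te L' M' E D (\<phi> (op_cat D \<times>\<^sub>c E) a) (\<psi> D b)"
  let ?\<eta> = "\<lambda>E. plift R (vob ?T' E) (\<lambda>(D, a, b). ?h E D a b)"
  have e: "raw_tens_map R L L' M M' \<phi> \<psi> = ntr ?T ?\<eta>"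
    by (simp add: raw_tens_map_def ntr_def te_def cong: restrict_cong)
  have b: "bilin_map R (vob L (op_cat D \<times>\<^sub>c E)) (vob M D) (vob ?T' E) (?h E D)" if "fincat D" "fincat E" for D E
    by (rule bilin_mapI) (use that in simp_all)
  have s: "?h E D (vmap L (op_cat D' \<times>\<^sub>c E) (op_cat D \<times>\<^sub>c E) (mprod R (op_cat D') (op_cat D) E E (mdual R D D' g) (bident R E)) a) b =
      ?h E D' a (vmap M D D' g b)"
    if [simp]: "fincat E" "fincat D" "fincat D'" "g \<in> bh D D'" "a \<in> el L (op_cat D' \<times>\<^sub>c E)" "b \<in> el M D" for E D D' g a b
    by (simp add: te_slide)
  note r = rt_lift[OF L M _ bf_simps(1)[OF T'] b s]
  have lin: "lin_map R (vob ?T E) (vob ?T' E) (?\<eta> E)" if "fincat E" for E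
    using that by (intro r(1))
  have te: "?\<eta> E (te L M E D a b) = ?h E D a b"
    if "fincat E" "fincat D" "a \<in> el L (op_cat D \<times>\<^sub>c E)" "b \<in> el M D" for E D a b
    using that by (intro r(2))
  show "raw_tens_map R L L' M M' \<phi> \<psi> \<in> nat_trans R ?T ?T'"
    unfolding e
  proof (rule ntr_nat_trans[OF T lin])
    fix E E' f k assume c [simp]: "fincat E" "fincat E'" "f \<in> bh E E'" and k: "k \<in> el ?T E"
    show "?\<eta> E' (vmap ?T E E' f k) = vmap ?T' E E' f (?\<eta> E k)"
    proof (rule rt_ext[OF L M c(1) bf_simps(1)[OF T' c(2)] _ _ _ k])
      show "lin_map R (vob ?T E) (vob ?T' E') (\<lambda>k. ?\<eta> E' (vmap ?T E E' f k))"
        by (rule lin_map_comp[OF rt_vmap(1)[OF L M c] lin[OF c(2)]])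
      show "lin_map R (vob ?T E) (vob ?T' E') (\<lambda>k. vmap ?T' E E' f (?\<eta> E k))"
        by (rule lin_map_comp[OF lin[OF c(1)] rt_vmap(1)[OF L' M' c]])
    qed (simp add: rt_vmap(2) te)
  qed
  show "\<lbrakk>fincat C; fincat D; x \<in> el L C; y \<in> el M D\<rbrakk> \<Longrightarrow>
      raw_tens_map R L L' M M' \<phi> \<psi> (C \<times>\<^sub>c D) (ru L M C D x y) = ru L' M' C D (\<phi> C x) (\<psi> D y)"
    unfolding e by (simp add: ru_def te)
qed

section \<open>Transport of biset functors into the universe\<close>

definition mv :: "('r, 'a) bfun \<Rightarrow> fcat \<Rightarrow> 'a \<Rightarrow> 'b" where
  "mv M C = emb (el M C)"

context
  fixes M :: "('r, 'a) bfun"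
  assumes M [simp]: "bfunctor M"
    and small: "\<forall>C\<in>fincats. \<exists>e :: 'a \<Rightarrow> 'b. inj_on e (el M C)"
begin

abbreviation (input) "MM \<equiv> (move_fun M :: ('r, 'b) bfun)"

lemma mv_inj: "fincat C \<Longrightarrow> inj_on (mv M C :: 'a \<Rightarrow> 'b) (el M C)"
proof -
  assume "fincat C"
  then have "\<exists>e :: 'a \<Rightarrow> 'b. inj_on e (el M C)" by (rule bspec[OF small])
  then show ?thesis unfolding mv_def emb_def by (rule someI_ex)
qed

lemma unemb_mv: "fincat C \<Longrightarrow> x \<in> el M C \<Longrightarrow> unemb (el M C) (mv M C x :: 'b) = x"
  unfolding unemb_def mv_def using mv_inj[unfolded mv_def] by (rule inv_into_f_f)

lemma move_simps:
  assumes [simp]: "fincat C"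
  shows "el MM C = mv M C ` el M C"
    and "\<zero>\<^bsub>vob MM C\<^esub> = mv M C \<zero>\<^bsub>vob M C\<^esub>"
    and "x \<in> el M C \<Longrightarrow> y \<in> el M C \<Longrightarrow> mv M C x \<oplus>\<^bsub>vob MM C\<^esub> mv M C y = mv M C (x \<oplus>\<^bsub>vob M C\<^esub> y)"
    and "x \<in> el M C \<Longrightarrow> r \<odot>\<^bsub>vob MM C\<^esub> mv M C x = mv M C (r \<odot>\<^bsub>vob M C\<^esub> x)"
    and "x \<in> el M C \<Longrightarrow> vmap MM C D f (mv M C x) = mv M D (vmap M C D f x)"
  using unemb_mv by (simp_all add: move_fun_def move_mod_def Let_def mv_def)

lemma mv_lin: "fincat C \<Longrightarrow> lin_map R (vob M C) (vob MM C) (mv M C)"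
  by (rule lin_mapI) (simp_all add: move_simps)

lemma move_functor: "bfunctor MM"
proof -
  have m: "module R (vob MM C)" if [simp]: "fincat C" for C
  proof -
    interpret V: module R "vob M C" by simp
    show ?thesis
      by (rule modI) (auto simp: move_simps V.a_ac V.smult_l_distr V.smult_r_distr V.smult_assoc1)
  qed
  show ?thesis
  proof (rule biset_functorI[OF m])
    fix C D assume "fincat C" "fincat D"
    then show "bilin_map R (bhom R C D) (vob MM C) (vob MM D) (vmap MM C D)"
      by (intro bilin_mapI) (auto simp: move_simps)
  qed (auto simp: move_simps)
qed

lemma mv_nat: "ntr M (mv M :: fcat \<Rightarrow> 'a \<Rightarrow> 'b) \<in> nat_trans R M MM"
  by (rule ntr_nat_trans[OF M mv_lin]) (simp_all add: move_simps)

text \<open>\<open>mv\<close> is a pointwise bijection with inverse \<open>unemb\<close>. The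
  extension property hides the chosen injections from everything that follows.\<close>

lemma move_lift:
  assumes N [simp]: "bfunctor N" and \<eta>: "\<eta> \<in> nat_trans R M N"
  shows "\<exists>\<theta>\<in>nat_trans R MM N. \<forall>C\<in>fincats. \<forall>x\<in>el M C. \<theta> C (mv M C x) = \<eta> C x"
proof (intro bexI ballI)
  note [simp] = nt_simps[OF M N \<eta>] and MM' [simp] = move_functor
  let ?\<theta> = "\<lambda>C x. \<eta> C (unemb (el M C) x)"
  show "ntr MM ?\<theta> \<in> nat_trans R MM N"
  proof (rule ntr_nat_trans[OF MM'])
    fix C assume "fincat C"
    then show "lin_map R (vob MM C) (vob N C) (?\<theta> C)"
      by (intro lin_mapI) (auto simp: move_simps unemb_mv)
  qed (auto simp: move_simps unemb_mv)
  show "ntr MM ?\<theta> C (mv M C x) = \<eta> C x" if "fincat C" "x \<in> el M C" for C x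
    using that by (simp add: move_simps unemb_mv)
qed

lemma move_bifam:
  assumes K: "bfunctor K" and L: "bfunctor L" and \<beta>: "bifam K L M \<beta>"
  shows "bifam K L MM (\<lambda>C D x y. mv M (C \<times>\<^sub>c D) (\<beta> C D x y))"
proof (rule bifamI)
  note [simp] = bifam_simps[OF K L M \<beta>]
  show "bilin_map R (vob K C) (vob L D) (vob MM (C \<times>\<^sub>c D)) (\<lambda>x y. mv M (C \<times>\<^sub>c D) (\<beta> C D x y))"
    if "fincat C" "fincat D" for C D
    by (rule bilin_mapI) (use that K L in \<open>auto simp: move_simps\<close>)
qed (simp add: bifam_nat[OF \<beta>] move_simps bifam_simps[OF K L M \<beta>])

lemma move_generates:
  assumes G: "generates M G"
  shows "generates MM (\<lambda>C. mv M C ` (G C \<inter> el M C))"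
  unfolding generates_def
proof (intro ballI)
  fix C y assume C [simp]: "fincat C" and y: "y \<in> el MM C"
  then obtain x where x: "x \<in> el M C" "y = mv M C x" by (auto simp: move_simps)
  show "gspan MM (\<lambda>C. mv M C ` (G C \<inter> el M C)) C y"
    unfolding x(2) using G C x(1)
  proof (induction rule: generates_induct)
    case zero
    then show ?case using gspan.zero[OF C, of MM] by (simp add: move_simps)
  next
    case (add x y)
    then show ?case using gspan.add[OF C add.IH] by (simp add: move_simps)
  next
    case (act D x f)
    then have "gspan MM (\<lambda>C. mv M C ` (G C \<inter> el M C)) C (vmap MM D C f (mv M D x))"
      by (intro gspan.act) (auto simp: move_simps)
    then show ?case using act by (simp add: move_simps)
  qed simp
qed

end

lemma move_nat:
  fixes M N :: "('r, 'a) bfun"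
  assumes M: "bfunctor M" and N: "bfunctor N"
    and sM: "\<forall>C\<in>fincats. \<exists>e :: 'a \<Rightarrow> 'b. inj_on e (el M C)"
    and sN: "\<forall>C\<in>fincats. \<exists>e :: 'a \<Rightarrow> 'b. inj_on e (el N C)"
    and \<eta>: "\<eta> \<in> nat_trans R M N"
  shows "(move_nat M N \<eta> :: fcat \<Rightarrow> 'b \<Rightarrow> 'b) \<in> nat_trans R (move_fun M) (move_fun N)"
    and "fincat C \<Longrightarrow> x \<in> el M C \<Longrightarrow> move_nat M N \<eta> C (mv M C x :: 'b) = mv N C (\<eta> C x)"
proof -
  note ms = move_simps[OF M sM] and ns = move_simps[OF N sN] and u = unemb_mv[OF M sM]
  note [simp] = nt_simps[OF M N \<eta>] M N
  let ?h = "\<lambda>C (x :: 'b). mv N C (\<eta> C (unemb (el M C) x)) :: 'b"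
  have e: "(move_nat M N \<eta> :: fcat \<Rightarrow> 'b \<Rightarrow> 'b) = ntr (move_fun M) ?h"
    by (auto simp: move_nat_def ntr_def ms fun_eq_iff mv_def restrict_def)
  show "(move_nat M N \<eta> :: fcat \<Rightarrow> 'b \<Rightarrow> 'b) \<in> nat_trans R (move_fun M) (move_fun N)"
    unfolding e
  proof (rule ntr_nat_trans[OF move_functor[OF M sM]])
    fix C assume "fincat C"
    then show "lin_map R (vob (move_fun M) C) (vob (move_fun N) C) (?h C)"
      by (intro lin_mapI) (auto simp: ms ns u)
  qed (auto simp: ms ns u)
  show "fincat C \<Longrightarrow> x \<in> el M C \<Longrightarrow> move_nat M N \<eta> C (mv M C x :: 'b) = mv N C (\<eta> C x)"
    unfolding e by (simp add: ms u)
qed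

end

section \<open>Universes\<close>

text \<open>Infinity of \<open>'m\<close> makes smallness stable under countable unions, products
  and finite subsets. The embedding of \<open>R\<close> then makes a module presented on a small set
  of generators small.\<close>

locale universe = coefficients R for R :: "'r ring" (structure) +
  fixes U :: "'m itself"
  assumes infinite_U: "infinite (UNIV :: 'm set)"
    and small_R: "\<exists>e :: 'r \<Rightarrow> 'm. inj_on e (carrier R)"
begin

definition small :: "'a set \<Rightarrow> bool" where
  "small A \<longleftrightarrow> (\<exists>e :: 'a \<Rightarrow> 'm. inj_on e A)"

lemma small_iff: "small A \<longleftrightarrow> (card_of A, card_of (UNIV :: 'm set)) \<in> ordLeq"
  by (simp add: small_def card_of_ordLeq[symmetric])

lemma small_mono: "small B \<Longrightarrow> A \<subseteq> B \<Longrightarrow> small A"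
  unfolding small_def using inj_on_subset by blast

lemma small_inj: "inj_on f A \<Longrightarrow> small (f ` A) \<Longrightarrow> small A"
  unfolding small_def using comp_inj_on by blast

lemma small_image: "small A \<Longrightarrow> small (f ` A)"
  unfolding small_iff using card_of_image ordLeq_transitive by blast

lemma small_nat: "small (A :: nat set)"
  by (rule small_mono[of UNIV]) (use infinite_U in \<open>auto simp: small_iff infinite_iff_card_of_nat\<close>)

lemma small_UN: "small I \<Longrightarrow> (\<And>i. i \<in> I \<Longrightarrow> small (A i)) \<Longrightarrow> small (\<Union>i\<in>I. A i)"
  unfolding small_iff by (rule card_of_UNION_ordLeq_infinite[OF infinite_U]) auto

lemma small_Sigma: "small I \<Longrightarrow> (\<And>i. i \<in> I \<Longrightarrow> small (A i)) \<Longrightarrow> small (SIGMA i:I. A i)"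
  unfolding small_iff by (rule card_of_Sigma_ordLeq_infinite[OF infinite_U]) auto

lemma small_Times: "small A \<Longrightarrow> small B \<Longrightarrow> small (A \<times> B)"
  by (rule small_Sigma)

lemma small_single: "small {x}"
  by (simp add: small_def)

text \<open>Subsets with \<open>n\<close> elements are small by induction on \<open>n\<close>, each
  step inserting one element; all finite subsets form a countable union of these families.\<close>

lemma small_Fpow: assumes A: "small A" shows "small {B. B \<subseteq> A \<and> finite B}"
proof -
  have n: "small {B. B \<subseteq> A \<and> finite B \<and> card B = n}" for n
  proof (induction n)
    case 0
    have "{B. B \<subseteq> A \<and> finite B \<and> card B = 0} \<subseteq> {{}}" by auto
    then show ?case by (rule small_mono[OF small_single])
  next
    case (Suc n)
    have "{B. B \<subseteq> A \<and> finite B \<and> card B = Suc n} \<subseteq> (\<lambda>(a, B). insert a B) ` (A \<times> {B. B \<subseteq> A \<and> finite B \<and> card B = n})"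
    proof
      fix B assume "B \<in> {B. B \<subseteq> A \<and> finite B \<and> card B = Suc n}"
      then have B: "B \<subseteq> A" "finite B" "card B = Suc n" by auto
      then obtain b where b: "b \<in> B" by fastforce
      then have "B = (\<lambda>(a, B). insert a B) (b, B - {b})" "(b, B - {b}) \<in> A \<times> {B. B \<subseteq> A \<and> finite B \<and> card B = n}"
        using B by auto
      then show "B \<in> (\<lambda>(a, B). insert a B) ` (A \<times> {B. B \<subseteq> A \<and> finite B \<and> card B = n})" by blast
    qed
    then show ?case by (rule small_mono[OF small_image[OF small_Times[OF A Suc]]])
  qed
  have "{B. B \<subseteq> A \<and> finite B} = (\<Union>n\<in>UNIV. {B. B \<subseteq> A \<and> finite B \<and> card B = n})" by auto
  moreover have "small (\<Union>n\<in>UNIV. {B. B \<subseteq> A \<and> finite B \<and> card B = n})"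
    by (rule small_UN[OF small_nat n])
  ultimately show ?thesis by simp
qed

text \<open>A normal category is determined by its finite sets of objects and morphisms and by the
  finite graphs of its structure maps. Normality makes this encoding injective.\<close>

lemma small_fincats: "small fincats"
proof -
  let ?g = "\<lambda>f A. (\<lambda>x. (x, f x)) ` A :: (nat \<times> nat) set"
  define F where "F C = (Ob C, Ar C, ?g (src C) (Ar C), ?g (tgt C) (Ar C), ?g (ident C) (Ob C),
    (\<lambda>(g, f). (g, f, cmp C g f)) ` (Ar C \<times> Ar C))" for C :: fcat
  have gr: "f x = f' x" if "?g f A = ?g f' A" "x \<in> A" for f f' A x
    using that by (auto simp: set_eq_iff image_iff)
  have "inj_on F fincats"
  proof (rule inj_onI)
    fix C D assume C: "fincat C" "fincat D" and eq: "F C = F D"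
    have o: "Ob C = Ob D" "Ar C = Ar D" using eq by (simp_all add: F_def)
    have s: "src C f = src D f" "tgt C f = tgt D f" if "f \<in> Ar C" for f
      using eq that gr[of "src C" "Ar C" "src D" f] gr[of "tgt C" "Ar C" "tgt D" f] o by (simp_all add: F_def)
    have i: "ident C x = ident D x" if "x \<in> Ob C" for x
      using eq that gr[of "ident C" "Ob C" "ident D" x] o by (simp add: F_def)
    have c: "cmp C g f = cmp D g f" if "g \<in> Ar C" "f \<in> Ar C" for f g
    proof -
      have e: "(\<lambda>(g, f). (g, f, cmp C g f)) ` (Ar C \<times> Ar C) = (\<lambda>(g, f). (g, f, cmp D g f)) ` (Ar D \<times> Ar D)"
        using eq unfolding F_def prod.inject by (elim conjE)
      have "(g, f, cmp C g f) \<in> (\<lambda>(g, f). (g, f, cmp C g f)) ` (Ar C \<times> Ar C)" using that by auto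
      then show ?thesis unfolding e by auto
    qed
    have "norm_cat C = norm_cat D"
    proof -
      have r: "restrict (src C) (Ar C) = restrict (src D) (Ar D)" "restrict (tgt C) (Ar C) = restrict (tgt D) (Ar D)"
        "restrict (ident C) (Ob C) = restrict (ident D) (Ob D)"
        unfolding o[symmetric] by (intro restrict_ext s i; assumption)+
      have "(\<lambda>g f. if g \<in> Ar C \<and> f \<in> Ar C \<and> tgt C f = src C g then cmp C g f else undefined) =
          (\<lambda>g f. if g \<in> Ar D \<and> f \<in> Ar D \<and> tgt D f = src D g then cmp D g f else undefined)"
        by (intro HOL.ext if_cong) (auto simp: o[symmetric] s[symmetric] c[symmetric])
      note q = this
      show ?thesis unfolding norm_cat_def cat.ext_inject by (intro conjI q r o refl)
    qed
    moreover have "norm_cat C = C" "norm_cat D = D" using C unfolding fincats_def by blast+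
    ultimately show "C = D" by metis
  qed
  moreover have "small (F ` fincats)"
  proof (rule small_mono)
    let ?f = "\<lambda>A. {B. B \<subseteq> A \<and> finite B}"
    show "F ` fincats \<subseteq> ?f UNIV \<times> ?f UNIV \<times> ?f (UNIV \<times> UNIV) \<times> ?f (UNIV \<times> UNIV) \<times> ?f (UNIV \<times> UNIV) \<times> ?f (UNIV \<times> UNIV \<times> UNIV)"
      unfolding F_def using fincats_finite by auto
    show "small (?f (UNIV :: nat set) \<times> ?f (UNIV :: nat set) \<times> ?f ((UNIV :: nat set) \<times> (UNIV :: nat set)) \<times>
        ?f ((UNIV :: nat set) \<times> (UNIV :: nat set)) \<times> ?f ((UNIV :: nat set) \<times> (UNIV :: nat set)) \<times>
        ?f ((UNIV :: nat set) \<times> (UNIV :: nat set) \<times> (UNIV :: nat set)))"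
      by (intro small_Times small_Fpow small_nat)
  qed
  ultimately show ?thesis by (rule small_inj)
qed

lemma small_bisets: assumes "fincat C" "fincat D" shows "small (bisets C D)"
proof -
  define E where "E \<Omega> = (SIGMA \<alpha>:Ar C. SIGMA \<beta>:Ar D. bob \<Omega> (src C \<alpha>) (tgt D \<beta>))" for \<Omega> :: biset
  define F where "F \<Omega> = ((SIGMA x:Ob C. SIGMA y:Ob D. bob \<Omega> x y),
    (\<lambda>(\<alpha>, \<beta>, u). (\<alpha>, \<beta>, u, bmap \<Omega> \<alpha> \<beta> u)) ` E \<Omega>)" for \<Omega> :: biset
  have "inj_on F (bisets C D)"
  proof (rule inj_onI)
    fix \<Omega> \<Psi> assume bs: "\<Omega> \<in> bisets C D" "\<Psi> \<in> bisets C D" and eq: "F \<Omega> = F \<Psi>"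
    have b: "bob \<Omega> x y = bob \<Psi> x y" if "x \<in> Ob C" "y \<in> Ob D" for x y
      using eq that unfolding F_def by (auto simp: set_eq_iff)
    show "\<Omega> = \<Psi>"
    proof (rule biset_eqI[OF bs b])
      fix \<alpha> \<beta> u assume a: "\<alpha> \<in> Ar C" "\<beta> \<in> Ar D" "u \<in> bob \<Omega> (src C \<alpha>) (tgt D \<beta>)"
      then have m: "(\<alpha>, \<beta>, u, bmap \<Omega> \<alpha> \<beta> u) \<in> (\<lambda>(\<alpha>, \<beta>, u). (\<alpha>, \<beta>, u, bmap \<Omega> \<alpha> \<beta> u)) ` E \<Omega>"
        by (auto simp: E_def image_iff)
      have e: "(\<lambda>(\<alpha>, \<beta>, u). (\<alpha>, \<beta>, u, bmap \<Omega> \<alpha> \<beta> u)) ` E \<Omega> = (\<lambda>(\<alpha>, \<beta>, u). (\<alpha>, \<beta>, u, bmap \<Psi> \<alpha> \<beta> u)) ` E \<Psi>"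
        using eq by (simp only: F_def prod.inject)
      show "bmap \<Omega> \<alpha> \<beta> u = bmap \<Psi> \<alpha> \<beta> u" using m unfolding e by auto
    qed
  qed
  moreover have "small (F ` bisets C D)"
  proof (rule small_mono)
    let ?f = "\<lambda>A. {B. B \<subseteq> A \<and> finite B}"
    have "finite (E \<Omega>)" if "\<Omega> \<in> bisets C D" for \<Omega>
      unfolding E_def using bisetsD(3)[OF that] assms fincats_finite by (intro finite_SigmaI) auto
    moreover have "finite (SIGMA x:Ob C. SIGMA y:Ob D. bob \<Omega> x y)" if "\<Omega> \<in> bisets C D" for \<Omega>
      using bisetsD(3)[OF that] assms fincats_finite by (intro finite_SigmaI) auto
    ultimately show "F ` bisets C D \<subseteq> ?f (UNIV \<times> UNIV \<times> UNIV) \<times> ?f (UNIV \<times> UNIV \<times> UNIV \<times> UNIV)"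
      by (auto simp: F_def)
    show "small (?f ((UNIV :: nat set) \<times> (UNIV :: nat set) \<times> (UNIV :: nat set)) \<times>
        ?f ((UNIV :: nat set) \<times> (UNIV :: nat set) \<times> (UNIV :: nat set) \<times> (UNIV :: nat set)))"
      by (intro small_Times small_Fpow small_nat)
  qed
  ultimately show ?thesis by (rule small_inj)
qed

lemma small_carrier_R: "small (carrier R)"
  unfolding small_def by (rule small_R)

text \<open>A function is recovered from the finite part of its graph where it leaves the default
  \<open>z\<close>. Letting the values range over a dependent family \<open>Y\<close> covers direct
  sums of representables as well as free modules.\<close>

lemma small_finsupp:
  assumes X: "small X" and Y: "\<And>x. x \<in> X \<Longrightarrow> small (Y x)"
    and F: "\<And>f x. f \<in> F \<Longrightarrow> x \<in> X \<Longrightarrow> f x \<in> Y x" "\<And>f. f \<in> F \<Longrightarrow> finite {x \<in> X. f x \<noteq> z x}"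
    and out: "\<And>f g x. \<lbrakk>f \<in> F; g \<in> F; x \<notin> X\<rbrakk> \<Longrightarrow> f x = g x"
  shows "small F"
proof -
  define G where "G f = (\<lambda>x. (x, f x)) ` {x \<in> X. f x \<noteq> z x}" for f
  have "inj_on G F"
  proof (intro inj_onI ext)
    fix f g x assume fg: "f \<in> F" "g \<in> F" and eq: "G f = G g"
    show "f x = g x"
    proof (cases "x \<in> X")
      case True
      have "(x, y) \<in> G f \<longleftrightarrow> y = f x \<and> f x \<noteq> z x" "(x, y) \<in> G g \<longleftrightarrow> y = g x \<and> g x \<noteq> z x" for y
        using True by (auto simp: G_def)
      then show ?thesis using eq by metis
    next
      case False
      then show ?thesis using out fg by blast
    qed
  qed
  have "G ` F \<subseteq> {B. B \<subseteq> Sigma X Y \<and> finite B}"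
    using F by (auto simp: G_def)
  moreover have "small {B. B \<subseteq> Sigma X Y \<and> finite B}" by (intro small_Fpow small_Sigma X Y)
  ultimately have "small (G ` F)" using small_mono by blast
  with \<open>inj_on G F\<close> show ?thesis by (rule small_inj)
qed

lemma small_pres:
  assumes X: "small X" and S: "S \<subseteq> carrier (free_mod R X)"
  shows "small (carrier (pres R X S))"
proof -
  have "small (carrier (free_mod R X))"
  proof (rule small_finsupp[OF X, of "\<lambda>_. carrier R" _ "\<lambda>_. \<zero>"])
    fix f assume f: "f \<in> carrier (free_mod R X)"
    show "finite {x \<in> X. f x \<noteq> \<zero>}"
      by (rule finite_subset[of _ "{x. f x \<noteq> \<zero>}"]) (use f in \<open>auto simp: free_mod_carrier\<close>)
    show "f x \<in> carrier R" for x using f by (simp add: free_mod_carrier)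
    fix g x assume g: "g \<in> carrier (free_mod R X)" and x: "x \<notin> X"
    have "f x = \<zero>" "g x = \<zero>" using f g x by (auto simp: free_mod_carrier)
    then show "f x = g x" by simp
  qed (rule small_carrier_R)
  then show ?thesis unfolding pres_carrier[OF S] by (rule small_image)
qed

lemma small_bhom: "fincat C \<Longrightarrow> fincat D \<Longrightarrow> small (bh C D)"
  unfolding bhom_def by (rule small_pres[OF small_bisets brels_closed])

lemma small_type: "small (A :: 'm set)"
  unfolding small_def by (intro exI[of _ id]) simp

lemma small_raw_tens:
  fixes L M :: "('r, 'm) bfun"
  assumes "bfunctor L" "bfunctor M" "fincat C"
  shows "small (el (raw_tens R L M) C)"
  unfolding vob_raw_tens[OF assms(1,2)]
  by (rule small_pres[OF _ tens_rels_closed[OF assms]])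
    (auto simp: tens_gens_def intro!: small_Sigma small_fincats small_Times small_type)

end

context coefficients
begin

section \<open>Representable functors and the category of biset functors\<close>

lemma generates_trans:
  assumes M: "bfunctor M" and G: "generates M G"
    and H: "\<And>C x. \<lbrakk>fincat C; x \<in> G C; x \<in> el M C\<rbrakk> \<Longrightarrow> gspan M H C x"
  shows "generates M H"
  unfolding generates_def
proof (intro ballI)
  fix C x assume C: "fincat C" and x: "x \<in> el M C"
  from G C x show "gspan M H C x"
    by (induction rule: generates_induct) (auto intro: gspan.zero gspan.add gspan_vmap M H C)
qed

definition rep :: "fcat \<Rightarrow> ('r, 'r bmor) bfun" where
  "rep K = \<lparr>vob = bhom R K, vmap = (\<lambda>C D f. bcmp R K C D f)\<rparr>"

lemma rep_simps [simp]: "vob (rep K) = bhom R K" "vmap (rep K) C D = bcmp R K C D"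
  by (simp_all add: rep_def)

lemma rep_functor [simp]: "fincat K \<Longrightarrow> bfunctor (rep K)"
  by (rule biset_functorI) (simp_all add: bhom_module bcmp bcmp_assoc)

text \<open>Yoneda: every arrow out of \<open>K\<close> is the result of acting by itself on the
  identity.\<close>

lemma rep_generates: assumes [simp]: "fincat K"
  shows "generates (rep K) (\<lambda>C. if C = K then {bident R K} else {})"
  unfolding generates_def
proof (intro ballI)
  fix C f assume "fincat C" "f \<in> el (rep K) C"
  then show "gspan (rep K) (\<lambda>C. if C = K then {bident R K} else {}) C f"
    using gspan.act[of C K "bident R K" "\<lambda>C. if C = K then {bident R K} else {}" "rep K" f] by simp
qed

lemma yd_simps [simp]:
  "vob (yd R K M) C = vob M (C \<times>\<^sub>c K)"
  "vmap (yd R K M) C D f = vmap M (C \<times>\<^sub>c K) (D \<times>\<^sub>c K) (mprod R C D K K f (bident R K))"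
  by (simp_all add: yd_def)

lemma yd_functor [simp]: "fincat K \<Longrightarrow> bfunctor M \<Longrightarrow> bfunctor (yd R K M)"
  by (rule biset_functorI) (auto intro!: bilin_mapI)

text \<open>The argument \<open>N\<close> is the middle object; it lets the simplifier prove that composites are natural.\<close>

definition ncomp :: "('r, 'a) bfun \<Rightarrow> ('r, 'b) bfun \<Rightarrow> (fcat \<Rightarrow> 'b \<Rightarrow> 'c) \<Rightarrow> (fcat \<Rightarrow> 'a \<Rightarrow> 'b) \<Rightarrow> fcat \<Rightarrow> 'a \<Rightarrow> 'c" where
  "ncomp M N \<theta> \<eta> = ntr M (\<lambda>C x. \<theta> C (\<eta> C x))"

definition nid :: "('r, 'a) bfun \<Rightarrow> fcat \<Rightarrow> 'a \<Rightarrow> 'a" where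
  "nid M = ntr M (\<lambda>C x. x)"

lemma ncomp_apply [simp]: "fincat C \<Longrightarrow> x \<in> el M C \<Longrightarrow> ncomp M N \<theta> \<eta> C x = \<theta> C (\<eta> C x)"
  by (simp add: ncomp_def)

lemma nid_apply [simp]: "fincat C \<Longrightarrow> x \<in> el M C \<Longrightarrow> nid M C x = x"
  by (simp add: nid_def)

lemma ncomp_nat [simp]: "\<lbrakk>bfunctor M; bfunctor N; bfunctor P;
    \<eta> \<in> nat_trans R M N; \<theta> \<in> nat_trans R N P\<rbrakk> \<Longrightarrow> ncomp M N \<theta> \<eta> \<in> nat_trans R M P"
  unfolding ncomp_def by (rule nat_trans_comp)

lemma nid_nat [simp]: "bfunctor M \<Longrightarrow> nid M \<in> nat_trans R M M"
  unfolding nid_def by (rule ntr_nat_trans) (simp_all add: lin_map_def)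

lemma Hom_bfun: "h \<in> Hom (bfun_cat R) M N \<longleftrightarrow>
    bfunctor M \<and> bfunctor N \<and> (\<exists>\<eta>\<in>nat_trans R M N. h = (M, N, \<eta>))"
  by (auto simp: Hom_def bfun_cat_def)

lemma bfun_cat_simps [simp]:
  "M \<in> Ob (bfun_cat R) \<longleftrightarrow> bfunctor M"
  "(M, N, \<eta>) \<in> Ar (bfun_cat R) \<longleftrightarrow> bfunctor M \<and> bfunctor N \<and> \<eta> \<in> nat_trans R M N"
  "src (bfun_cat R) (M, N, \<eta>) = M" "tgt (bfun_cat R) (M, N, \<eta>) = N"
  "ident (bfun_cat R) M = (M, M, nid M)"
  "cmp (bfun_cat R) (M', N', \<theta>) (M, N, \<eta>) = (M, N', ncomp M M' \<theta> \<eta>)"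
  by (simp_all add: bfun_cat_def ncomp_def nid_def ntr_def compose_def restrict_def fun_eq_iff)

lemma nt_closed: "\<lbrakk>bfunctor M; bfunctor N; \<eta> \<in> nat_trans R M N;
    C \<in> fincats; x \<in> el M C\<rbrakk> \<Longrightarrow> \<eta> C x \<in> el N C"
  by (rule nt_simps)

lemma bfun_cat_Ar: "f \<in> Ar (bfun_cat R) \<longleftrightarrow> (\<exists>M N \<eta>. f = (M, N, \<eta>) \<and> bfunctor M \<and> bfunctor N \<and> \<eta> \<in> nat_trans R M N)"
  by (auto simp: bfun_cat_def)

lemma ncomp_nid:
  assumes "bfunctor M" "bfunctor N" "\<eta> \<in> nat_trans R M N"
  shows "ncomp M N (nid N) \<eta> = \<eta>" and "ncomp M M \<eta> (nid M) = \<eta>"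
  by (rule nat_trans_ext[OF _ assms(3)]; simp add: assms nt_closed[OF assms])+

lemma ncomp_assoc:
  assumes "bfunctor M" "bfunctor N" "\<eta> \<in> nat_trans R M N"
  shows "ncomp M N (ncomp N P \<kappa> \<theta>) \<eta> = ncomp M P \<kappa> (ncomp M N \<theta> \<eta>)"
  by (simp add: ncomp_def[of M] ntr_def restrict_def fun_eq_iff nt_closed[OF assms])

lemma category_bfun: "category (bfun_cat R)"
  by (rule categoryI) (auto simp: bfun_cat_Ar ncomp_nid ncomp_assoc)

end

context universe
begin

section \<open>The tensor product in the universe and its universal property\<close>

definition tu :: "('r, 'm) bfun \<Rightarrow> ('r, 'm) bfun \<Rightarrow> fcat \<Rightarrow> fcat \<Rightarrow> 'm \<Rightarrow> 'm \<Rightarrow> 'm" where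
  "tu L M = (\<lambda>C D x y. mv (raw_tens R L M) (C \<times>\<^sub>c D) (ru L M C D x y))"

lemma raw_tens_small: "bfunctor L \<Longrightarrow> bfunctor M \<Longrightarrow>
    \<forall>C\<in>fincats. \<exists>e :: _ \<Rightarrow> 'm. inj_on e (el (raw_tens R L M) C)" for L M :: "('r, 'm) bfun"
  using small_raw_tens unfolding small_def by blast

lemma rep_small: "fincat K \<Longrightarrow> \<forall>C\<in>fincats. \<exists>e :: _ \<Rightarrow> 'm. inj_on e (el (rep K) C)"
  using small_bhom unfolding small_def by simp

lemma tens_functor [simp]: "bfunctor L \<Longrightarrow> bfunctor M \<Longrightarrow> bfunctor (tens R L M)" for L M :: "('r, 'm) bfun"
  unfolding tens_def by (rule move_functor[OF raw_tens_functor raw_tens_small])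

lemma bifam_tu: "bfunctor L \<Longrightarrow> bfunctor M \<Longrightarrow> bifam L M (tens R L M) (tu L M)"
  unfolding tens_def tu_def by (rule move_bifam[OF raw_tens_functor raw_tens_small _ _ bifam_ru])

lemmas tu_simps [simp] = bifam_simps[OF _ _ tens_functor bifam_tu]
lemmas tu_nat = bifam_nat[OF bifam_tu] and tu_left = bifam_nat_left[OF bifam_tu] and tu_right = bifam_nat_right[OF bifam_tu]

lemma tens_univ:
  assumes L: "bfunctor L" and M: "bfunctor M" and N: "bfunctor N" and \<beta>: "bifam L M N \<beta>"
  shows "\<exists>\<theta>\<in>nat_trans R (tens R L M) N. \<forall>C\<in>fincats. \<forall>D\<in>fincats. \<forall>x\<in>el L C. \<forall>y\<in>el M D.
    \<theta> (C \<times>\<^sub>c D) (tu L M C D x y) = \<beta> C D x y"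
proof -
  obtain \<eta> where \<eta>: "\<eta> \<in> nat_trans R (raw_tens R L M) N"
    "\<And>C D x y. \<lbrakk>fincat C; fincat D; x \<in> el L C; y \<in> el M D\<rbrakk> \<Longrightarrow>
      \<eta> (C \<times>\<^sub>c D) (ru L M C D x y) = \<beta> C D x y"
    using rt_univ[OF L M N \<beta>] by blast
  obtain \<theta> where "\<theta> \<in> nat_trans R (tens R L M) N" and
    "\<forall>C\<in>fincats. \<forall>x\<in>el (raw_tens R L M) C. \<theta> C (mv (raw_tens R L M) C x) = \<eta> C x"
    using move_lift[OF raw_tens_functor[OF L M] raw_tens_small[OF L M] N \<eta>(1)] unfolding tens_def by blast
  then show ?thesis
    using \<eta>(2) by (intro bexI[of _ \<theta>]) (auto simp: tu_def bifam_simps[OF L M raw_tens_functor bifam_ru] L M)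
qed

definition tlift :: "('r, 'm) bfun \<Rightarrow> ('r, 'm) bfun \<Rightarrow> ('r, 'n) bfun \<Rightarrow> (fcat \<Rightarrow> fcat \<Rightarrow> 'm \<Rightarrow> 'm \<Rightarrow> 'n) \<Rightarrow> fcat \<Rightarrow> 'm \<Rightarrow> 'n" where
  "tlift L M N \<beta> = (SOME \<theta>. \<theta> \<in> nat_trans R (tens R L M) N \<and> (\<forall>C\<in>fincats. \<forall>D\<in>fincats. \<forall>x\<in>el L C. \<forall>y\<in>el M D.
    \<theta> (C \<times>\<^sub>c D) (tu L M C D x y) = \<beta> C D x y))"

lemma tlift:
  assumes "bfunctor L" "bfunctor M" "bfunctor N" "bifam L M N \<beta>"
  shows "tlift L M N \<beta> \<in> nat_trans R (tens R L M) N"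
    and "\<lbrakk>fincat C; fincat D; x \<in> el L C; y \<in> el M D\<rbrakk> \<Longrightarrow>
      tlift L M N \<beta> (C \<times>\<^sub>c D) (tu L M C D x y) = \<beta> C D x y"
  using someI_ex[OF tens_univ[OF assms, unfolded Bex_def], folded tlift_def] by blast+

text \<open>Universal elements with arbitrary entries generate. By naturality of \<open>tu\<close>
  in each variable, first \<open>y\<close> and then \<open>x\<close> is reduced to the given
  generators.\<close>

lemma tens_generates:
  assumes L [simp]: "bfunctor L" and M [simp]: "bfunctor M" and G: "generates L G" and H: "generates M H"
  shows "generates (tens R L M) (ten_gens L M (tu L M) G H)"
proof (rule generates_trans[OF tens_functor[OF L M]])
  show "generates (tens R L M) (\<lambda>C. mv (raw_tens R L M) C `
      (ten_gens L M (ru L M) (\<lambda>C. el L C) (\<lambda>D. el M D) C \<inter> el (raw_tens R L M) C))"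
    unfolding tens_def
    by (rule move_generates[OF raw_tens_functor[OF L M] raw_tens_small[OF L M] ru_generates[OF L M]])
  fix E and t :: 'm assume "t \<in> mv (raw_tens R L M) E `
      (ten_gens L M (ru L M) (\<lambda>C. el L C) (\<lambda>D. el M D) E \<inter> el (raw_tens R L M) E)"
  then obtain C D x y where c [simp]: "fincat C" "fincat D" and E: "E = C \<times>\<^sub>c D"
    and x: "x \<in> el L C" and y: "y \<in> el M D" and t: "t = tu L M C D x y"
    by (auto simp: ten_gens_def tu_def)
  let ?G = "ten_gens L M (tu L M) G H"
  have g: "gspan (tens R L M) ?G (C \<times>\<^sub>c D') (tu L M C D' x y)"
    if x: "x \<in> G C" "x \<in> el L C" "y \<in> H D'" "y \<in> el M D'" "fincat C" "fincat D'" for C D' x y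
    using gspan.act[of "C \<times>\<^sub>c D'" "C \<times>\<^sub>c D'" "tu L M C D' x y" ?G "tens R L M" "bident R (C \<times>\<^sub>c D')"] that
    by (simp add: ten_gensI)
  have y': "gspan (tens R L M) ?G (C \<times>\<^sub>c D) (tu L M C D x y)" if x: "x \<in> G C" "x \<in> el L C" and [simp]: "fincat C" for C x
    using H c(2) y
  proof (induction rule: generates_induct)
    case (act D' y f)
    then show ?case using x gspan_vmap[OF tens_functor[OF L M] g[OF x act(2,3) _ act(1)]] by (simp add: tu_right)
  qed (use x in \<open>auto intro: gspan.zero gspan.add\<close>)
  show "gspan (tens R L M) ?G E t" unfolding E t using G c(1) x
  proof (induction rule: generates_induct)
    case (act C' x f)
    then show ?case using y gspan_vmap[OF tens_functor[OF L M] y'[OF act(2,3,1)]] by (simp add: tu_left)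
  qed (use y in \<open>auto intro: gspan.zero gspan.add\<close>)
qed

lemma tens_map:
  assumes L: "bfunctor L" and M: "bfunctor M" and L': "bfunctor L'" and M': "bfunctor M'"
    and \<phi>: "\<phi> \<in> nat_trans R L L'" and \<psi>: "\<psi> \<in> nat_trans R M M'"
  shows "tens_map R L L' M M' \<phi> \<psi> \<in> nat_trans R (tens R L M) (tens R L' M')"
    and "\<lbrakk>fincat C; fincat D; x \<in> el L C; y \<in> el M D\<rbrakk> \<Longrightarrow>
      tens_map R L L' M M' \<phi> \<psi> (C \<times>\<^sub>c D) (tu L M C D x y) = tu L' M' C D (\<phi> C x) (\<psi> D y)"
  unfolding tens_def tens_map_def tu_def
  by (rule move_nat[OF raw_tens_functor raw_tens_functor raw_tens_small raw_tens_small raw_tens_map(1)];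
      fact L M L' M' \<phi> \<psi>)
    (simp add: move_nat[OF raw_tens_functor raw_tens_functor raw_tens_small raw_tens_small raw_tens_map(1)]
      raw_tens_map(2) L M L' M' \<phi> \<psi> bifam_simps[OF L M raw_tens_functor bifam_ru])

text \<open>The equality test for maps out of a tensor product. Restricting each factor to
  generators is what allows the unit to be tested at \<open>iota\<close> alone and an iterated
  tensor product at its elementary tensors.\<close>

lemma tens_ext:
  assumes "bfunctor L" "bfunctor M" "bfunctor N" "generates L G" "generates M H"
    and "\<eta> \<in> nat_trans R (tens R L M) N" "\<theta> \<in> nat_trans R (tens R L M) N"
    and "\<And>C D x y. \<lbrakk>fincat C; fincat D; x \<in> G C; x \<in> el L C; y \<in> H D; y \<in> el M D\<rbrakk> \<Longrightarrow>
      \<eta> (C \<times>\<^sub>c D) (tu L M C D x y) = \<theta> (C \<times>\<^sub>c D) (tu L M C D x y)"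
  shows "\<eta> = \<theta>"
  by (rule generates_ext[OF tens_functor[OF assms(1,2)] assms(3) tens_generates[OF assms(1,2,4,5)] assms(6,7)])
    (auto simp: ten_gens_def intro: assms(8))

text \<open>Natural trilinear families over
  \<open>(C \<times>\<^sub>c D) \<times>\<^sub>c E\<close>. They are stated as bilinear families in
  the first two variables with values in a Yoneda-Dress shift, linear and natural in the third, so
  that the universal property can be applied twice.\<close>

definition trifam :: "('r, 'm) bfun \<Rightarrow> ('r, 'm) bfun \<Rightarrow> ('r, 'm) bfun \<Rightarrow> ('r, 'n) bfun \<Rightarrow>
    (fcat \<Rightarrow> fcat \<Rightarrow> fcat \<Rightarrow> 'm \<Rightarrow> 'm \<Rightarrow> 'm \<Rightarrow> 'n) \<Rightarrow> bool" where
  "trifam K L M N \<gamma> \<longleftrightarrow>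
    (\<forall>E\<in>fincats. \<forall>m\<in>el M E. bifam K L (yd R E N) (\<lambda>C D k l. \<gamma> C D E k l m)) \<and>
    (\<forall>C\<in>fincats. \<forall>D\<in>fincats. \<forall>E\<in>fincats. \<forall>k\<in>el K C. \<forall>l\<in>el L D.
      lin_map R (vob M E) (vob N ((C \<times>\<^sub>c D) \<times>\<^sub>c E)) (\<gamma> C D E k l)) \<and>
    (\<forall>C\<in>fincats. \<forall>D\<in>fincats. \<forall>E\<in>fincats. \<forall>E'\<in>fincats. \<forall>g\<in>bh E E'. \<forall>k\<in>el K C. \<forall>l\<in>el L D. \<forall>m\<in>el M E.
      \<gamma> C D E' k l (vmap M E E' g m) =
        vmap N ((C \<times>\<^sub>c D) \<times>\<^sub>c E) ((C \<times>\<^sub>c D) \<times>\<^sub>c E') (mprod R (C \<times>\<^sub>c D) (C \<times>\<^sub>c D) E E' (bident R (C \<times>\<^sub>c D)) g) (\<gamma> C D E k l m))"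

definition tlift3 :: "('r, 'm) bfun \<Rightarrow> ('r, 'm) bfun \<Rightarrow> ('r, 'm) bfun \<Rightarrow> ('r, 'n) bfun \<Rightarrow>
    (fcat \<Rightarrow> fcat \<Rightarrow> fcat \<Rightarrow> 'm \<Rightarrow> 'm \<Rightarrow> 'm \<Rightarrow> 'n) \<Rightarrow> fcat \<Rightarrow> 'm \<Rightarrow> 'n" where
  "tlift3 K L M N \<gamma> = tlift (tens R K L) M N (\<lambda>A E t m. tlift K L (yd R E N) (\<lambda>C D k l. \<gamma> C D E k l m) A t)"

text \<open>For fixed \<open>m\<close> the universal property of \<open>tens R K L\<close> gives a
  map \<open>\<theta> E m\<close> into the shift of \<open>N\<close> by \<open>E\<close>. Letting
  \<open>m\<close> vary makes this a bilinear family on \<open>tens R K L\<close> and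
  \<open>M\<close>, to which the universal property applies again.\<close>

lemma tlift3:
  assumes K [simp]: "bfunctor K" and L [simp]: "bfunctor L" and M [simp]: "bfunctor M" and N [simp]: "bfunctor N"
    and \<gamma>: "trifam K L M N \<gamma>"
  shows "tlift3 K L M N \<gamma> \<in> nat_trans R (tens R (tens R K L) M) N" (is ?A)
    and "\<lbrakk>fincat C; fincat D; fincat E; k \<in> el K C; l \<in> el L D; m \<in> el M E\<rbrakk> \<Longrightarrow>
      tlift3 K L M N \<gamma> ((C \<times>\<^sub>c D) \<times>\<^sub>c E) (tu (tens R K L) M (C \<times>\<^sub>c D) E (tu K L C D k l) m) = \<gamma> C D E k l m"
proof -
  define \<theta> where "\<theta> E m = tlift K L (yd R E N) (\<lambda>C D k l. \<gamma> C D E k l m)" for E m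
  have b: "fincat E \<Longrightarrow> m \<in> el M E \<Longrightarrow> bifam K L (yd R E N) (\<lambda>C D k l. \<gamma> C D E k l m)"
    and l: "\<lbrakk>fincat C; fincat D; fincat E; k \<in> el K C; l \<in> el L D\<rbrakk> \<Longrightarrow>
      lin_map R (vob M E) (vob N ((C \<times>\<^sub>c D) \<times>\<^sub>c E)) (\<gamma> C D E k l)" for C D E k l m
    using \<gamma> by (simp_all add: trifam_def)
  note n = \<gamma>[unfolded trifam_def, THEN conjunct2, THEN conjunct2, rule_format]
  note \<theta> = tlift(1)[OF K L yd_functor[OF _ N] b, folded \<theta>_def] and \<theta>g = tlift(2)[OF K L yd_functor[OF _ N] b, folded \<theta>_def]
  let ?T = "tens R K L"
  note [simp] = nt_simps[OF tens_functor[OF K L] yd_functor[OF _ N] \<theta>, simplified] \<theta>g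
  note gen = tens_generates[OF K L generates_all[OF K] generates_all[OF L]]
  note ls [simp] = lin_map_simps[OF _ _ l]
  \<comment> \<open>\<open>\<theta> E m\<close> is chosen separately for each \<open>m\<close>, so
    its linearity in \<open>m\<close> has to be derived. It is checked on the generators of
    \<open>tens R K L\<close>, where the values are prescribed.\<close>
  have add: "\<theta> E (m \<oplus>\<^bsub>vob M E\<^esub> m') A t = \<theta> E m A t \<oplus>\<^bsub>vob N (A \<times>\<^sub>c E)\<^esub> \<theta> E m' A t"
    if E [simp]: "fincat E" "m \<in> el M E" "m' \<in> el M E"
      and t: "fincat A" "t \<in> el ?T A" for E m m' A t
    using gen t
  proof (induction rule: generates_induct)
    case zero
    interpret module R "vob N (A \<times>\<^sub>c E)" using t by simp
    show ?case using t by simp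
  next
    case (add x y)
    interpret module R "vob N (A \<times>\<^sub>c E)" using t by simp
    show ?case using add t by (simp add: a_ac)
  next
    case (act D x f)
    then show ?case using t by (auto simp: ten_gens_def)
  qed simp
  have smult: "\<theta> E (r \<odot>\<^bsub>vob M E\<^esub> m) A t = r \<odot>\<^bsub>vob N (A \<times>\<^sub>c E)\<^esub> \<theta> E m A t"
    if [simp]: "fincat E" "m \<in> el M E" "r \<in> carrier R"
      and t: "fincat A" "t \<in> el ?T A" for E m r A t
    using gen t
  proof (induction rule: generates_induct)
    case zero
    interpret module R "vob N (A \<times>\<^sub>c E)" using t by simp
    show ?case using t by simp
  next
    case (add x y)
    interpret module R "vob N (A \<times>\<^sub>c E)" using t by simp
    show ?case using add t by (simp add: smult_r_distr)
  next
    case (act D x f)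
    then show ?case using t by (auto simp: ten_gens_def)
  qed simp
  have nat: "\<theta> E' (vmap M E E' g m) A t = vmap N (A \<times>\<^sub>c E) (A \<times>\<^sub>c E') (mprod R A A E E' (bident R A) g) (\<theta> E m A t)"
    if [simp]: "fincat E" "fincat E'" "g \<in> bh E E'" "m \<in> el M E"
      and t: "fincat A" "t \<in> el ?T A" for E E' g m A t
    using gen t
    by (induction rule: generates_induct) (use t in \<open>auto simp: ten_gens_def n\<close>)
  have "bifam ?T M N (\<lambda>A E t m. \<theta> E m A t)"
  proof (rule bifamI)
    fix A E assume "fincat A" "fincat E"
    then show "bilin_map R (vob ?T A) (vob M E) (vob N (A \<times>\<^sub>c E)) (\<lambda>t m. \<theta> E m A t)"
      by (intro bilin_mapI) (simp_all add: add smult)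
  qed (simp add: nat)
  note u = tlift[OF tens_functor[OF K L] M N this, folded tlift3_def[of K L M N \<gamma>, folded \<theta>_def]]
  show ?A by (rule u(1))
  show "\<lbrakk>fincat C; fincat D; fincat E; k \<in> el K C; l \<in> el L D; m \<in> el M E\<rbrakk> \<Longrightarrow>
      tlift3 K L M N \<gamma> ((C \<times>\<^sub>c D) \<times>\<^sub>c E) (tu (tens R K L) M (C \<times>\<^sub>c D) E (tu K L C D k l) m) = \<gamma> C D E k l m"
    by (simp add: u(2))
qed

lemmas functr_simps = functr_def mapp_def swp_def asci_def unit1_def

lemma mprod_J_left: "functr C D F \<Longrightarrow> fincat E \<Longrightarrow>
    mprod R E E C D (bident R E) (J C D F) = J (E \<times>\<^sub>c C) (E \<times>\<^sub>c D) (mapp (\<lambda>x. x) F)"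
  by (simp add: bident_J mprod_J functr_id)

lemma mprod_J_right: "functr C D F \<Longrightarrow> fincat E \<Longrightarrow>
    mprod R C D E E (J C D F) (bident R E) = J (C \<times>\<^sub>c E) (D \<times>\<^sub>c E) (mapp F (\<lambda>x. x))"
  by (simp add: bident_J mprod_J functr_id)

lemma J_ident: "fincat C \<Longrightarrow> (\<And>x. F x = x) \<Longrightarrow> J C C F = bident R C"
  by (simp add: bident_J J_cong[of C C F "\<lambda>x. x"])

lemmas J_simps = functr_asci functr_swp functr_unit1 functr_pi2 mprod_J_left mprod_J_right J_comp mprod_J

text \<open>The swapped tensor lies over \<open>D \<times>\<^sub>c C\<close>; the arrow of
  \<open>swp\<close> brings it back over \<open>C \<times>\<^sub>c D\<close>, as a bilinear family
  demands.\<close>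

definition sig :: "('r, 'm) bfun \<Rightarrow> ('r, 'm) bfun \<Rightarrow> fcat \<Rightarrow> 'm \<Rightarrow> 'm" where
  "sig L M = tlift L M (tens R M L)
    (\<lambda>C D x y. vmap (tens R M L) (D \<times>\<^sub>c C) (C \<times>\<^sub>c D) (J (D \<times>\<^sub>c C) (C \<times>\<^sub>c D) swp) (tu M L D C y x))"

lemma sig:
  assumes L [simp]: "bfunctor L" and M [simp]: "bfunctor M"
  shows "sig L M \<in> nat_trans R (tens R L M) (tens R M L)"
    and "\<lbrakk>fincat C; fincat D; x \<in> el L C; y \<in> el M D\<rbrakk> \<Longrightarrow> sig L M (C \<times>\<^sub>c D) (tu L M C D x y) =
      vmap (tens R M L) (D \<times>\<^sub>c C) (C \<times>\<^sub>c D) (J (D \<times>\<^sub>c C) (C \<times>\<^sub>c D) swp) (tu M L D C y x)"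
  unfolding sig_def
  by (rule tlift[OF L M tens_functor[OF M L] bifamI];
      simp add: bilin_mapI functr_swp tu_nat J_swp_natural)+

text \<open>The prescribed value of the associator on a threefold elementary tensor. The rebracketed
  tensor lies over \<open>C \<times>\<^sub>c D \<times>\<^sub>c E\<close>, so the arrow of
  \<open>asci\<close> carries it over
  \<open>(C \<times>\<^sub>c D) \<times>\<^sub>c E\<close>.\<close>

abbreviation (input) "aval K L M C D E k l m \<equiv>
  vmap (tens R K (tens R L M)) (C \<times>\<^sub>c D \<times>\<^sub>c E) ((C \<times>\<^sub>c D) \<times>\<^sub>c E) (J (C \<times>\<^sub>c D \<times>\<^sub>c E) ((C \<times>\<^sub>c D) \<times>\<^sub>c E) asci)
    (tu K (tens R L M) C (D \<times>\<^sub>c E) k (tu L M D E l m))"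

definition asso :: "('r, 'm) bfun \<Rightarrow> ('r, 'm) bfun \<Rightarrow> ('r, 'm) bfun \<Rightarrow> fcat \<Rightarrow> 'm \<Rightarrow> 'm" where
  "asso K L M = tlift3 K L M (tens R K (tens R L M)) (aval K L M)"

lemma asso:
  assumes K [simp]: "bfunctor K" and L [simp]: "bfunctor L" and M [simp]: "bfunctor M"
  shows "asso K L M \<in> nat_trans R (tens R (tens R K L) M) (tens R K (tens R L M))" (is ?A)
    and "\<lbrakk>fincat C; fincat D; fincat E; k \<in> el K C; l \<in> el L D; m \<in> el M E\<rbrakk> \<Longrightarrow>
      asso K L M ((C \<times>\<^sub>c D) \<times>\<^sub>c E) (tu (tens R K L) M (C \<times>\<^sub>c D) E (tu K L C D k l) m) = aval K L M C D E k l m"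
proof -
  note [simp] = functr_asci
  have nat: "aval K L M C' D' E' (vmap K C C' f k) (vmap L D D' g l) (vmap M E E' h m) =
      vmap (tens R K (tens R L M)) ((C \<times>\<^sub>c D) \<times>\<^sub>c E) ((C' \<times>\<^sub>c D') \<times>\<^sub>c E')
        (mprod R (C \<times>\<^sub>c D) (C' \<times>\<^sub>c D') E E' (mprod R C C' D D' f g) h) (aval K L M C D E k l m)"
    if [simp]: "fincat C" "fincat C'" "fincat D" "fincat D'" "fincat E" "fincat E'"
      "f \<in> bh C C'" "g \<in> bh D D'" "h \<in> bh E E'" "k \<in> el K C" "l \<in> el L D" "m \<in> el M E"
    for C C' D D' E E' f g h k l m
    by (simp add: tu_nat J_asci_natural)
  note tlift3[of K L M "tens R K (tens R L M)" "aval K L M", folded asso_def]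
  moreover have "trifam K L M (tens R K (tens R L M)) (aval K L M)"
    unfolding trifam_def
  proof (intro conjI ballI)
    show "bifam K L (yd R E (tens R K (tens R L M))) (\<lambda>C D k l. aval K L M C D E k l m)"
      if m: "fincat E" "m \<in> el M E" for E m
    proof (rule bifamI)
      fix C C' D D' f g k l assume "fincat C" "fincat C'" "fincat D" "fincat D'" "f \<in> bh C C'" "g \<in> bh D D'"
        "k \<in> el K C" "l \<in> el L D"
      then show "aval K L M C' D' E (vmap K C C' f k) (vmap L D D' g l) m =
          vmap (yd R E (tens R K (tens R L M))) (C \<times>\<^sub>c D) (C' \<times>\<^sub>c D') (mprod R C C' D D' f g) (aval K L M C D E k l m)"
        using nat[of C C' D D' E E f g "bident R E" k l m] m by simp
    qed (use m in \<open>simp add: bilin_mapI\<close>)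
    show "lin_map R (vob M E) (vob (tens R K (tens R L M)) ((C \<times>\<^sub>c D) \<times>\<^sub>c E)) (\<lambda>m. aval K L M C D E k l m)"
      if "fincat C" "fincat D" "fincat E" "k \<in> el K C" "l \<in> el L D" for C D E k l
      using that by (simp add: lin_mapI)
    show "aval K L M C D E' k l (vmap M E E' g m) = vmap (tens R K (tens R L M)) ((C \<times>\<^sub>c D) \<times>\<^sub>c E) ((C \<times>\<^sub>c D) \<times>\<^sub>c E')
        (mprod R (C \<times>\<^sub>c D) (C \<times>\<^sub>c D) E E' (bident R (C \<times>\<^sub>c D)) g) (aval K L M C D E k l m)"
      if "fincat C" "fincat D" "fincat E" "fincat E'" "g \<in> bh E E'" "k \<in> el K C" "l \<in> el L D"
        "m \<in> el M E" for C D E E' g k l m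
      using nat[of C C D D E E' "bident R C" "bident R D" g k l m] that by simp
  qed
  ultimately show ?A
    and "\<lbrakk>fincat C; fincat D; fincat E; k \<in> el K C; l \<in> el L D; m \<in> el M E\<rbrakk> \<Longrightarrow>
      asso K L M ((C \<times>\<^sub>c D) \<times>\<^sub>c E) (tu (tens R K L) M (C \<times>\<^sub>c D) E (tu K L C D k l) m) = aval K L M C D E k l m"
    by simp_all
qed

lemmas asso_simps [simp] = nt_simps(1,5)[OF _ _ asso(1)] nt_simps(1,5)[OF _ _ sig(1)] nt_simps(1,5)[OF _ _ tens_map(1)]
declare asso [simp] sig [simp] tens_map [simp]

text \<open>Built from symmetries and one associator of reversed order: \<open>K(LM)\<close> goes to
  \<open>(LM)K\<close>, \<open>(ML)K\<close>, \<open>M(LK)\<close>, \<open>(LK)M\<close> and finally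
  \<open>(KL)M\<close>. In this way trilinear families are set up for a single bracketing
  only.\<close>

definition asso_inv :: "('r, 'm) bfun \<Rightarrow> ('r, 'm) bfun \<Rightarrow> ('r, 'm) bfun \<Rightarrow> fcat \<Rightarrow> 'm \<Rightarrow> 'm" where
  "asso_inv K L M =
    ncomp (tens R K (tens R L M)) (tens R (tens R L K) M) (tens_map R (tens R L K) (tens R K L) M M (sig L K) (nid M))
      (ncomp (tens R K (tens R L M)) (tens R M (tens R L K)) (sig M (tens R L K))
        (ncomp (tens R K (tens R L M)) (tens R (tens R M L) K) (asso M L K)
          (ncomp (tens R K (tens R L M)) (tens R (tens R L M) K) (tens_map R (tens R L M) (tens R M L) K K (sig L M) (nid K))
            (sig K (tens R L M)))))"

lemma asso_inv:
  assumes [simp]: "bfunctor K" "bfunctor L" "bfunctor M"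
  shows "asso_inv K L M \<in> nat_trans R (tens R K (tens R L M)) (tens R (tens R K L) M)"
    and "\<lbrakk>fincat C; fincat D; fincat E; k \<in> el K C; l \<in> el L D; m \<in> el M E\<rbrakk> \<Longrightarrow>
      asso_inv K L M (C \<times>\<^sub>c D \<times>\<^sub>c E) (tu K (tens R L M) C (D \<times>\<^sub>c E) k (tu L M D E l m)) =
        vmap (tens R (tens R K L) M) ((C \<times>\<^sub>c D) \<times>\<^sub>c E) (C \<times>\<^sub>c D \<times>\<^sub>c E)
          (J ((C \<times>\<^sub>c D) \<times>\<^sub>c E) (C \<times>\<^sub>c D \<times>\<^sub>c E) asc) (tu (tens R K L) M (C \<times>\<^sub>c D) E (tu K L C D k l) m)"
proof -
  show "asso_inv K L M \<in> nat_trans R (tens R K (tens R L M)) (tens R (tens R K L) M)"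
    unfolding asso_inv_def by simp
  show "\<lbrakk>fincat C; fincat D; fincat E; k \<in> el K C; l \<in> el L D; m \<in> el M E\<rbrakk> \<Longrightarrow>
      asso_inv K L M (C \<times>\<^sub>c D \<times>\<^sub>c E) (tu K (tens R L M) C (D \<times>\<^sub>c E) k (tu L M D E l m)) =
        vmap (tens R (tens R K L) M) ((C \<times>\<^sub>c D) \<times>\<^sub>c E) (C \<times>\<^sub>c D \<times>\<^sub>c E)
          (J ((C \<times>\<^sub>c D) \<times>\<^sub>c E) (C \<times>\<^sub>c D \<times>\<^sub>c E) asc) (tu (tens R K L) M (C \<times>\<^sub>c D) E (tu K L C D k l) m)"
    unfolding asso_inv_def by (simp add: J_simps tu_left functr_simps asc_def[abs_def])
qed

declare asso_inv [simp]
lemmas asso_inv_simps [simp] = nt_simps(1,5)[OF _ _ asso_inv(1)]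

section \<open>The unit and the unitors\<close>

lemma raw_burnside_rep: "raw_burnside R = rep one_cat"
  by (simp add: raw_burnside_def rep_def)

text \<open>The Yoneda element of the unit, seen in \<open>'m\<close>; maps out of the unit are
  determined by their value here.\<close>

definition iota :: 'm where
  "iota = mv (rep one_cat) one_cat (bident R one_cat)"

lemma burnside_functor [simp]: "bfunctor (burnside R :: ('r, 'm) bfun)"
  unfolding burnside_def raw_burnside_rep by (rule move_functor[OF rep_functor rep_small]) simp_all

lemma iota_closed [simp]: "iota \<in> el (burnside R) one_cat"
  unfolding burnside_def raw_burnside_rep iota_def
  by (simp add: move_simps(1)[OF rep_functor rep_small])

abbreviation "iota_gen \<equiv> (\<lambda>C. if C = one_cat then {iota} else {})"

lemma burnside_generates: "generates (burnside R) iota_gen"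
proof -
  have "(\<lambda>C. mv (rep one_cat) C ` ((if C = one_cat then {bident R one_cat} else {}) \<inter> el (rep one_cat) C)) = iota_gen"
    by (auto simp: iota_def fun_eq_iff)
  then show ?thesis
    using move_generates[OF rep_functor rep_small rep_generates, OF one_cat_fincats one_cat_fincats one_cat_fincats]
    unfolding burnside_def raw_burnside_rep by metis
qed

text \<open>\<open>mprod_bcmp\<close> under a further composite with \<open>h\<close>, the shape
  that arises when composites are nested to the right.\<close>

lemma mprod_bcmp_assoc:
  assumes [simp]: "fincat C" "fincat D" "fincat E" "fincat C'" "fincat D'" "fincat E'" "fincat A"
    and f: "f \<in> bh C D" and g: "g \<in> bh D E" and f': "f' \<in> bh C' D'" and g': "g' \<in> bh D' E'" and h: "h \<in> bh A (C \<times>\<^sub>c C')"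
  shows "bcmp R A (D \<times>\<^sub>c D') (E \<times>\<^sub>c E') (mprod R D E D' E' g g') (bcmp R A (C \<times>\<^sub>c C') (D \<times>\<^sub>c D') (mprod R C D C' D' f f') h) =
    bcmp R A (C \<times>\<^sub>c C') (E \<times>\<^sub>c E') (mprod R C E C' E' (bcmp R C D E g f) (bcmp R C' D' E' g' f')) h"
  using assms by (simp add: bcmp_assoc)

text \<open>The arrows of \<open>unit1\<close> and \<open>pi2\<close> are mutually inverse, so
  naturality of one gives naturality of the other by conjugation.\<close>

lemma J_pi2_natural:
  assumes [simp]: "fincat D" "fincat D'" and h [simp]: "h \<in> bh D D'"
  shows "bcmp R (one_cat \<times>\<^sub>c D) (one_cat \<times>\<^sub>c D') D' (J (one_cat \<times>\<^sub>c D') D' pi2) (mprod R one_cat one_cat D D' (bident R one_cat) h) =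
    bcmp R (one_cat \<times>\<^sub>c D) D D' h (J (one_cat \<times>\<^sub>c D) D pi2)" (is "bcmp R ?P ?P' D' ?q ?m = _")
proof -
  note [simp] = functr_unit1 functr_pi2
  have u: "bcmp R ?P D ?P (J D ?P unit1) (J ?P D pi2) = bident R ?P"
  proof -
    have "bcmp R ?P D ?P (J D ?P unit1) (J ?P D pi2) = J ?P ?P (\<lambda>x. unit1 (pi2 x))" by (simp add: J_comp)
    also have "\<dots> = J ?P ?P (\<lambda>x. x)" by (rule J_cong) (auto simp: unit1_def pr_collapse)
    finally show ?thesis by (simp add: bident_J)
  qed
  have "bcmp R ?P ?P' D' ?q ?m = bcmp R ?P ?P' D' ?q (bcmp R ?P ?P ?P' ?m (bcmp R ?P D ?P (J D ?P unit1) (J ?P D pi2)))"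
    by (simp add: u)
  also have "\<dots> = bcmp R ?P ?P' D' ?q (bcmp R ?P D ?P' (bcmp R D D' ?P' (J D' ?P' unit1) h) (J ?P D pi2))"
    by (simp add: J_unit1_natural[OF assms] bcmp_assoc[of _ ?P] bcmp_assoc[of ?P D ?P ?P'] del: mprod_bcmp)
  also have "\<dots> = bcmp R ?P D D' (bcmp R D D' D' (bcmp R D' ?P' D' ?q (J D' ?P' unit1)) h) (J ?P D pi2)"
    by (simp add: bcmp_assoc)
  also have "bcmp R D' ?P' D' ?q (J D' ?P' unit1) = bident R D'"
    by (simp add: J_comp J_ident unit1_def)
  finally show ?thesis by simp
qed

text \<open>Prescribed only at \<open>iota\<close>. This determines it, because \<open>iota\<close>
  generates the unit; a formula for general elements would involve the chosen injection of the unit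
  into \<open>'m\<close>.\<close>

definition lun :: "('r, 'm) bfun \<Rightarrow> fcat \<Rightarrow> 'm \<Rightarrow> 'm" where
  "lun M = (SOME \<eta>. \<eta> \<in> nat_trans R (tens R (burnside R) M) M \<and>
    (\<forall>D\<in>fincats. \<forall>y\<in>el M D. \<eta> (one_cat \<times>\<^sub>c D) (tu (burnside R) M one_cat D iota y) =
      vmap M D (one_cat \<times>\<^sub>c D) (J D (one_cat \<times>\<^sub>c D) unit1) y))"

lemma lun:
  assumes M [simp]: "bfunctor M"
  shows "lun M \<in> nat_trans R (tens R (burnside R) M) M" (is ?A)
    and "fincat D \<Longrightarrow> y \<in> el M D \<Longrightarrow> lun M (one_cat \<times>\<^sub>c D) (tu (burnside R) M one_cat D iota y) =
      vmap M D (one_cat \<times>\<^sub>c D) (J D (one_cat \<times>\<^sub>c D) unit1) y"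
proof -
  note [simp] = functr_unit1
  \<comment> \<open>\<open>\<theta>\<close> undoes the transport and identifies the unit with the
    representable functor of \<open>one_cat\<close>.\<close>
  obtain \<theta> where \<theta>: "\<theta> \<in> nat_trans R (burnside R :: ('r, 'm) bfun) (rep one_cat)"
    and \<theta>m: "\<And>C x. fincat C \<Longrightarrow> x \<in> bh one_cat C \<Longrightarrow> \<theta> C (mv (rep one_cat) C x) = x"
    using move_lift[OF rep_functor rep_small rep_functor nid_nat[OF rep_functor]] unfolding burnside_def raw_burnside_rep
    by (metis nid_apply one_cat_fincats rep_simps(1))
  note [simp] = nt_simps[OF burnside_functor rep_functor[OF one_cat_fincats] \<theta>, simplified]
  \<comment> \<open>An element \<open>b\<close> of the unit at \<open>C\<close> corresponds to an
    arrow from \<open>one_cat\<close> to \<open>C\<close>. After \<open>y\<close> has been moved to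
    \<open>one_cat \<times>\<^sub>c D\<close>, the product of this arrow with the identity of
    \<open>D\<close> acts on it.\<close>
  let ?\<beta> = "\<lambda>C D b y. vmap M (one_cat \<times>\<^sub>c D) (C \<times>\<^sub>c D) (mprod R one_cat C D D (\<theta> C b) (bident R D))
    (vmap M D (one_cat \<times>\<^sub>c D) (J D (one_cat \<times>\<^sub>c D) unit1) y)"
  have "bifam (burnside R) M M ?\<beta>"
  proof (rule bifamI)
    fix C D assume "fincat C" "fincat D"
    then show "bilin_map R (vob (burnside R) C) (vob M D) (vob M (C \<times>\<^sub>c D)) (?\<beta> C D)"
      by (intro bilin_mapI) simp_all
  qed (simp add: bcmp_assoc[symmetric] J_unit1_natural mprod_bcmp_assoc)
  from tens_univ[OF burnside_functor M M this] obtain \<eta> where \<eta>: "\<eta> \<in> nat_trans R (tens R (burnside R) M) M"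
    "\<And>D y. fincat D \<Longrightarrow> y \<in> el M D \<Longrightarrow> \<eta> (one_cat \<times>\<^sub>c D) (tu (burnside R) M one_cat D iota y) = ?\<beta> one_cat D iota y"
    using iota_closed one_cat_fincats by meson
  have "\<theta> one_cat iota = bident R one_cat" unfolding iota_def by (simp add: \<theta>m)
  then have "\<exists>\<eta>. \<eta> \<in> nat_trans R (tens R (burnside R) M) M \<and>
    (\<forall>D\<in>fincats. \<forall>y\<in>el M D. \<eta> (one_cat \<times>\<^sub>c D) (tu (burnside R) M one_cat D iota y) =
      vmap M D (one_cat \<times>\<^sub>c D) (J D (one_cat \<times>\<^sub>c D) unit1) y)"
    using \<eta> by (intro exI[of _ \<eta>]) simp
  from someI_ex[OF this] show ?A
    and "fincat D \<Longrightarrow> y \<in> el M D \<Longrightarrow> lun M (one_cat \<times>\<^sub>c D) (tu (burnside R) M one_cat D iota y) =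
      vmap M D (one_cat \<times>\<^sub>c D) (J D (one_cat \<times>\<^sub>c D) unit1) y"
    unfolding lun_def[symmetric] by blast+
qed

definition lun_inv :: "('r, 'm) bfun \<Rightarrow> fcat \<Rightarrow> 'm \<Rightarrow> 'm" where
  "lun_inv M = ntr M (\<lambda>D y. vmap (tens R (burnside R) M) (one_cat \<times>\<^sub>c D) D (J (one_cat \<times>\<^sub>c D) D pi2)
     (tu (burnside R) M one_cat D iota y))"

lemma lun_inv: "bfunctor M \<Longrightarrow> lun_inv M \<in> nat_trans R M (tens R (burnside R) M)"
  unfolding lun_inv_def
  by (rule ntr_nat_trans) (simp_all add: lin_mapI functr_pi2 tu_right J_pi2_natural)

declare lun [simp] lun_inv [simp]
lemmas lun_simps [simp] = nt_simps(1,5)[OF _ _ lun(1)] nt_simps(1,5)[OF _ _ lun_inv]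

text \<open>Obtained from the left unitor through the symmetry, which also supplies the inverse:
  \<open>lun_inv\<close> followed by \<open>sig\<close>.\<close>

definition run :: "('r, 'm) bfun \<Rightarrow> fcat \<Rightarrow> 'm \<Rightarrow> 'm" where
  "run M = ncomp (tens R M (burnside R)) (tens R (burnside R) M) (lun M) (sig M (burnside R))"

lemma run [simp]: "bfunctor M \<Longrightarrow> run M \<in> nat_trans R (tens R M (burnside R)) M"
  unfolding run_def by simp

lemma tens_ext3:
  assumes "bfunctor K" "bfunctor L" "bfunctor M" "bfunctor N"
    "generates K F" "generates L G" "generates M H"
    and "\<eta> \<in> nat_trans R (tens R (tens R K L) M) N" "\<theta> \<in> nat_trans R (tens R (tens R K L) M) N"
    and "\<And>C D E k l m. \<lbrakk>fincat C; fincat D; fincat E; k \<in> F C; k \<in> el K C;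
      l \<in> G D; l \<in> el L D; m \<in> H E; m \<in> el M E\<rbrakk> \<Longrightarrow>
      \<eta> ((C \<times>\<^sub>c D) \<times>\<^sub>c E) (tu (tens R K L) M (C \<times>\<^sub>c D) E (tu K L C D k l) m) =
      \<theta> ((C \<times>\<^sub>c D) \<times>\<^sub>c E) (tu (tens R K L) M (C \<times>\<^sub>c D) E (tu K L C D k l) m)"
  shows "\<eta> = \<theta>"
  by (rule tens_ext[OF tens_functor[OF assms(1,2)] assms(3,4) tens_generates[OF assms(1,2,5,6)] assms(7-9)])
    (auto simp: ten_gens_def assms)

end

section \<open>Coherence\<close>

context coefficients
begin

section \<open>Modules of natural transformations\<close>

lemma ntr_cong: "(\<And>C x. fincat C \<Longrightarrow> x \<in> el M C \<Longrightarrow> h C x = h' C x) \<Longrightarrow> ntr M h = ntr M h'"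
  by (auto simp: ntr_def fun_eq_iff restrict_def)

lemma nat_mod_simps [simp]:
  "carrier (nat_mod R M N) = nat_trans R M N"
  "\<zero>\<^bsub>nat_mod R M N\<^esub> = ntr M (\<lambda>C x. \<zero>\<^bsub>vob N C\<^esub>)"
  "\<eta> \<oplus>\<^bsub>nat_mod R M N\<^esub> \<theta> = ntr M (\<lambda>C x. \<eta> C x \<oplus>\<^bsub>vob N C\<^esub> \<theta> C x)"
  "r \<odot>\<^bsub>nat_mod R M N\<^esub> \<eta> = ntr M (\<lambda>C x. r \<odot>\<^bsub>vob N C\<^esub> \<eta> C x)"
  by (simp_all add: nat_mod_def ntr_def)

context
  fixes M :: "('r, 'a) bfun" and N :: "('r, 'b) bfun"
  assumes M [simp]: "bfunctor M" and N [simp]: "bfunctor N"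
begin

lemma ntr_zero_nat: "ntr M (\<lambda>C x. \<zero>\<^bsub>vob N C\<^esub>) \<in> nat_trans R M N"
  by (rule ntr_nat_trans) (simp_all add: lin_map_const_zero)

lemma ntr_add_nat:
  assumes a: "\<eta> \<in> nat_trans R M N" and b: "\<theta> \<in> nat_trans R M N"
  shows "ntr M (\<lambda>C x. \<eta> C x \<oplus>\<^bsub>vob N C\<^esub> \<theta> C x) \<in> nat_trans R M N"
proof (rule ntr_nat_trans)
  note [simp] = nt_simps[OF M N a] nt_simps[OF M N b]
  fix C assume [simp]: "fincat C"
  interpret module R "vob N C" by simp
  show "lin_map R (vob M C) (vob N C) (\<lambda>x. \<eta> C x \<oplus>\<^bsub>vob N C\<^esub> \<theta> C x)"
    by (rule lin_mapI) (simp_all add: a_ac smult_r_distr)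
qed (simp_all add: nt_simps[OF M N a] nt_simps[OF M N b])

lemma ntr_smult_nat:
  assumes r: "r \<in> carrier R" and a: "\<eta> \<in> nat_trans R M N"
  shows "ntr M (\<lambda>C x. r \<odot>\<^bsub>vob N C\<^esub> \<eta> C x) \<in> nat_trans R M N"
proof (rule ntr_nat_trans)
  note [simp] = nt_simps[OF M N a] r
  fix C assume [simp]: "fincat C"
  interpret module R "vob N C" by simp
  show "lin_map R (vob M C) (vob N C) (\<lambda>x. r \<odot>\<^bsub>vob N C\<^esub> \<eta> C x)"
    by (rule lin_mapI) (simp_all add: smult_r_distr smult_assoc1[symmetric] m_comm)
qed (simp_all add: nt_simps[OF M N a] r)

lemmas nat_mod_nat [simp] = ntr_zero_nat ntr_add_nat ntr_smult_nat

lemma nat_mod_module: "module R (nat_mod R M N)"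
proof (rule modI)
  note c = nt_closed[OF M N]
  fix \<eta> \<theta> \<zeta> r s assume e: "\<eta> \<in> carrier (nat_mod R M N)" 
  then have e': "\<eta> \<in> nat_trans R M N" by simp
  have m: "module R (vob N C)" if "fincat C" for C using that by simp
  note mods = abelian_monoid.a_assoc[OF abelian_group.axioms(1)] 
  show "\<zero>\<^bsub>nat_mod R M N\<^esub> \<oplus>\<^bsub>nat_mod R M N\<^esub> \<eta> = \<eta>"
    by (rule nat_trans_ext[OF _ e'], use e' in simp)
      (simp add: c[OF e'] abelian_monoid.l_zero[OF abelian_group.axioms(1)[OF module.axioms(2)[OF m]]])
  {
    assume t: "\<theta> \<in> carrier (nat_mod R M N)"
    then have t': "\<theta> \<in> nat_trans R M N" by simp
    show "\<eta> \<oplus>\<^bsub>nat_mod R M N\<^esub> \<theta> = \<theta> \<oplus>\<^bsub>nat_mod R M N\<^esub> \<eta>"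
      by simp (rule ntr_cong, simp add: c[OF e'] c[OF t'] abelian_monoid.a_comm[OF abelian_group.axioms(1)[OF module.axioms(2)[OF m]]])
    show "r \<in> carrier R \<Longrightarrow> r \<odot>\<^bsub>nat_mod R M N\<^esub> (\<eta> \<oplus>\<^bsub>nat_mod R M N\<^esub> \<theta>) =
        r \<odot>\<^bsub>nat_mod R M N\<^esub> \<eta> \<oplus>\<^bsub>nat_mod R M N\<^esub> r \<odot>\<^bsub>nat_mod R M N\<^esub> \<theta>"
      by simp (rule ntr_cong, simp add: c[OF e'] c[OF t'] module.smult_r_distr[OF m])
    assume "\<zeta> \<in> carrier (nat_mod R M N)"
    then have z': "\<zeta> \<in> nat_trans R M N" by simp
    show "\<eta> \<oplus>\<^bsub>nat_mod R M N\<^esub> \<theta> \<oplus>\<^bsub>nat_mod R M N\<^esub> \<zeta> = \<eta> \<oplus>\<^bsub>nat_mod R M N\<^esub> (\<theta> \<oplus>\<^bsub>nat_mod R M N\<^esub> \<zeta>)"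
      by simp (rule ntr_cong, simp add: c[OF e'] c[OF t'] c[OF z'] abelian_monoid.a_assoc[OF abelian_group.axioms(1)[OF module.axioms(2)[OF m]]])
  }
  assume r: "r \<in> carrier R" "s \<in> carrier R"
  show "(r \<oplus> s) \<odot>\<^bsub>nat_mod R M N\<^esub> \<eta> = r \<odot>\<^bsub>nat_mod R M N\<^esub> \<eta> \<oplus>\<^bsub>nat_mod R M N\<^esub> s \<odot>\<^bsub>nat_mod R M N\<^esub> \<eta>"
    by simp (rule ntr_cong, simp add: c[OF e'] r module.smult_l_distr[OF m])
  show "(r \<otimes> s) \<odot>\<^bsub>nat_mod R M N\<^esub> \<eta> = r \<odot>\<^bsub>nat_mod R M N\<^esub> (s \<odot>\<^bsub>nat_mod R M N\<^esub> \<eta>)"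
    by simp (rule ntr_cong, simp add: c[OF e'] r module.smult_assoc1[OF m])
next
  fix \<eta> assume e: "\<eta> \<in> carrier (nat_mod R M N)"
  have m: "module R (vob N C)" if "fincat C" for C using that by simp
  show "\<one> \<odot>\<^bsub>nat_mod R M N\<^esub> \<eta> = \<eta>"
    using e by (intro nat_trans_ext[of _ M N]) (simp_all add: nt_closed[OF M N] module.smult_one[OF m])
  show "\<zero> \<odot>\<^bsub>nat_mod R M N\<^esub> \<eta> = \<zero>\<^bsub>nat_mod R M N\<^esub>"
    using e by simp (rule ntr_cong, simp add: nt_closed[OF M N] module.smult_l_null[OF m])
qed simp_all

end

end

context universe
begin

section \<open>Coherence laws\<close>

lemmas tens_eqI = tens_ext[OF _ _ _ generates_all generates_all]
lemmas tens3_eqI = tens_ext3[OF _ _ _ _ generates_all generates_all generates_all]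

lemma tens_map_nid:
  fixes L M :: "('r, 'm) bfun"
  assumes [simp]: "bfunctor L" "bfunctor M"
  shows "tens_map R L L M M (nid L) (nid M) = nid (tens R L M)"
  by (rule tens_eqI[of L M "tens R L M"]) simp_all

lemma tens_map_ncomp:
  fixes L L' L'' M M' M'' :: "('r, 'm) bfun"
  assumes [simp]: "bfunctor L" "bfunctor L'" "bfunctor L''" "bfunctor M" "bfunctor M'" "bfunctor M''"
    and f: "\<phi> \<in> nat_trans R L L'" "\<phi>' \<in> nat_trans R L' L''" "\<psi> \<in> nat_trans R M M'" "\<psi>' \<in> nat_trans R M' M''"
  shows "tens_map R L L'' M M'' (ncomp L L' \<phi>' \<phi>) (ncomp M M' \<psi>' \<psi>) =
    ncomp (tens R L M) (tens R L' M') (tens_map R L' L'' M' M'' \<phi>' \<psi>') (tens_map R L L' M M' \<phi> \<psi>)"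
proof -
  note [simp] = f nt_simps(1)[OF _ _ f(1)] nt_simps(1)[OF _ _ f(3)]
  show ?thesis by (rule tens_eqI[of L M "tens R L'' M''"]) simp_all
qed

lemma sig_natural:
  assumes [simp]: "bfunctor L" "bfunctor L'" "bfunctor M" "bfunctor M'"
    and f: "\<phi> \<in> nat_trans R L L'" "\<psi> \<in> nat_trans R M M'"
  shows "ncomp (tens R L M) (tens R L' M') (sig L' M') (tens_map R L L' M M' \<phi> \<psi>) =
    ncomp (tens R L M) (tens R M L) (tens_map R M M' L L' \<psi> \<phi>) (sig L M)"
proof -
  note [simp] = f nt_simps(1)[OF _ _ f(1)] nt_simps(1)[OF _ _ f(2)] functr_swp
  show ?thesis by (rule tens_eqI[of L M "tens R M' L'"]) simp_all
qed

lemma sig_sig: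
  assumes [simp]: "bfunctor L" "bfunctor M"
  shows "ncomp (tens R L M) (tens R M L) (sig M L) (sig L M) = nid (tens R L M)"
  by (rule tens_eqI[of L M "tens R L M"]) (simp_all add: J_simps J_ident)

lemma asso_natural:
  assumes [simp]: "bfunctor K" "bfunctor K'" "bfunctor L" "bfunctor L'" "bfunctor M" "bfunctor M'"
    and f: "\<kappa> \<in> nat_trans R K K'" "\<phi> \<in> nat_trans R L L'" "\<psi> \<in> nat_trans R M M'"
  shows "ncomp (tens R (tens R K L) M) (tens R (tens R K' L') M') (asso K' L' M')
      (tens_map R (tens R K L) (tens R K' L') M M' (tens_map R K K' L L' \<kappa> \<phi>) \<psi>) =
    ncomp (tens R (tens R K L) M) (tens R K (tens R L M))
      (tens_map R K K' (tens R L M) (tens R L' M') \<kappa> (tens_map R L L' M M' \<phi> \<psi>)) (asso K L M)"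
proof -
  note [simp] = f nt_simps(1)[OF _ _ f(1)] nt_simps(1)[OF _ _ f(2)] nt_simps(1)[OF _ _ f(3)] functr_asci
  show ?thesis by (rule tens3_eqI[of K L M "tens R K' (tens R L' M')"]) simp_all
qed

lemma asso_inv_left:
  assumes [simp]: "bfunctor K" "bfunctor L" "bfunctor M"
  shows "ncomp (tens R (tens R K L) M) (tens R K (tens R L M)) (asso_inv K L M) (asso K L M) = nid (tens R (tens R K L) M)"
  by (rule tens3_eqI[of K L M "tens R (tens R K L) M"]) (simp_all add: J_simps functr_asc J_ident)

lemma asso_inv_right:
  assumes [simp]: "bfunctor K" "bfunctor L" "bfunctor M"
  shows "ncomp (tens R K (tens R L M)) (tens R (tens R K L) M) (asso K L M) (asso_inv K L M) = nid (tens R K (tens R L M))"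
  by (rule tens_ext[OF _ _ _ generates_all tens_generates[OF _ _ generates_all generates_all], of K L M "tens R K (tens R L M)"])
    (auto simp: ten_gens_def J_simps functr_asc J_ident)

lemma lun_natural:
  assumes [simp]: "bfunctor M" "bfunctor M'" and f: "\<phi> \<in> nat_trans R M M'"
  shows "ncomp (tens R (burnside R) M) (tens R (burnside R) M') (lun M') (tens_map R (burnside R) (burnside R) M M' (nid (burnside R)) \<phi>) =
    ncomp (tens R (burnside R) M) M \<phi> (lun M)"
proof -
  note [simp] = f nt_simps(1,5)[OF _ _ f(1)] functr_unit1
  show ?thesis
    by (rule tens_ext[OF _ _ _ burnside_generates generates_all, of M M']) (auto split: if_splits)
qed

lemma lun_inv_left:
  assumes [simp]: "bfunctor M"
  shows "ncomp (tens R (burnside R) M) M (lun_inv M) (lun M) = nid (tens R (burnside R) M)"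
proof (rule tens_ext[OF _ _ _ burnside_generates generates_all, of M "tens R (burnside R) M"])
  have *: "J (one_cat \<times>\<^sub>c D) (one_cat \<times>\<^sub>c D) (\<lambda>x. \<langle>0, pi2 x\<rangle>) = bident R (one_cat \<times>\<^sub>c D)" if "fincat D" for D
    unfolding bident_J[OF prod_cat_fincats[OF one_cat_fincats that]]
    by (rule J_cong) (use that in \<open>auto simp: pr_collapse\<close>)
  fix C D x y assume "fincat C" "fincat D" "x \<in> iota_gen C" "y \<in> el M D"
  moreover from this have "C = one_cat" "x = iota" by (auto split: if_splits)
  ultimately show "ncomp (tens R (burnside R) M) M (lun_inv M) (lun M) (C \<times>\<^sub>c D) (tu (burnside R) M C D x y) =
      nid (tens R (burnside R) M) (C \<times>\<^sub>c D) (tu (burnside R) M C D x y)"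
    by (simp add: lun_inv_def tu_right J_simps functr_simps *)
qed simp_all

lemma lun_inv_right:
  assumes [simp]: "bfunctor M"
  shows "ncomp M (tens R (burnside R) M) (lun M) (lun_inv M) = nid M"
proof (rule nat_trans_ext[of _ M M])
  fix C x assume "fincat C" "x \<in> el M C"
  then show "ncomp M (tens R (burnside R) M) (lun M) (lun_inv M) C x = nid M C x"
    by (simp add: lun_inv_def J_simps J_ident unit1_def functr_simps)
qed simp_all

text \<open>Here \<open>tens_generates\<close> is fed into the first slot of the threefold test, so
  that only fourfold elementary tensors remain. On these, both sides are actions of rebracketing
  arrows that come from the same functor.\<close>

lemma pentagon_asso:
  assumes [simp]: "bfunctor H" "bfunctor K" "bfunctor L" "bfunctor M"
  shows "ncomp (tens R (tens R (tens R H K) L) M) (tens R H (tens R (tens R K L) M))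
      (tens_map R H H (tens R (tens R K L) M) (tens R K (tens R L M)) (nid H) (asso K L M))
      (ncomp (tens R (tens R (tens R H K) L) M) (tens R (tens R H (tens R K L)) M) (asso H (tens R K L) M)
        (tens_map R (tens R (tens R H K) L) (tens R H (tens R K L)) M M (asso H K L) (nid M))) =
    ncomp (tens R (tens R (tens R H K) L) M) (tens R (tens R H K) (tens R L M)) (asso H K (tens R L M)) (asso (tens R H K) L M)"
  by (rule tens_ext3[OF _ _ _ _ tens_generates[OF _ _ generates_all generates_all] generates_all generates_all, of H K L M "tens R H (tens R K (tens R L M))"])
    (auto simp: ten_gens_def tu_left tu_right J_simps functr_simps)

text \<open>In the middle factor only \<open>iota\<close> has to be tested, which is exactly where
  the left unitor is prescribed.\<close>

lemma triangle_asso: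
  assumes [simp]: "bfunctor L" "bfunctor M"
  shows "ncomp (tens R (tens R L (burnside R)) M) (tens R L (tens R (burnside R) M))
      (tens_map R L L (tens R (burnside R) M) M (nid L) (lun M)) (asso L (burnside R) M) =
    tens_map R (tens R L (burnside R)) L M M (run L) (nid M)"
  by (rule tens_ext3[OF _ _ _ _ generates_all burnside_generates generates_all, of L M "tens R L M"])
    (auto simp: run_def tu_left tu_right J_simps functr_simps split: if_splits)

lemma hexagon_asso:
  assumes [simp]: "bfunctor K" "bfunctor L" "bfunctor M"
  shows "ncomp (tens R (tens R K L) M) (tens R (tens R L M) K) (asso L M K)
      (ncomp (tens R (tens R K L) M) (tens R K (tens R L M)) (sig K (tens R L M)) (asso K L M)) =
    ncomp (tens R (tens R K L) M) (tens R L (tens R K M)) (tens_map R L L (tens R K M) (tens R M K) (nid L) (sig K M))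
      (ncomp (tens R (tens R K L) M) (tens R (tens R L K) M) (asso L K M) (tens_map R (tens R K L) (tens R L K) M M (sig K L) (nid M)))"
  by (rule tens3_eqI[of K L M "tens R L (tens R M K)"]) (simp_all add: tu_left tu_right J_simps functr_simps)

lemma run_natural:
  assumes [simp]: "bfunctor M" "bfunctor M'" and f: "\<phi> \<in> nat_trans R M M'"
  shows "ncomp (tens R M (burnside R)) (tens R M' (burnside R)) (run M') (tens_map R M M' (burnside R) (burnside R) \<phi> (nid (burnside R))) =
    ncomp (tens R M (burnside R)) M \<phi> (run M)"
proof -
  note [simp] = f nt_simps(1,5)[OF _ _ f(1)] functr_unit1 functr_swp
  show ?thesis
    by (rule tens_ext[OF _ _ _ generates_all burnside_generates, of M M']) (auto simp: run_def split: if_splits)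
qed

lemma tens_arr_simp [simp]: "tens_arr R (L, L', \<phi>) (M, M', \<psi>) = (tens R L M, tens R L' M', tens_map R L L' M M' \<phi> \<psi>)"
  by (simp add: tens_arr_def)

lemma iso_arrow_bfun:
  assumes "bfunctor M" "bfunctor N" "\<eta> \<in> nat_trans R M N" "\<theta> \<in> nat_trans R N M"
    and "ncomp M N \<theta> \<eta> = nid M" "ncomp N M \<eta> \<theta> = nid N"
  shows "iso_arrow (bfun_cat R) (M, N, \<eta>)"
  unfolding iso_arrow_def using assms by (auto simp: Hom_bfun intro!: bexI[of _ "(N, M, \<theta>)"])

theorem symmetric_monoidal_bfun:
  "symmetric_monoidal (bfun_cat R :: (('r, 'm) bfun, ('r, 'm) bfun_arr) cat) (tens R) (tens_arr R) (burnside R)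
    (\<lambda>K L M. (tens R (tens R K L) M, tens R K (tens R L M), asso K L M))
    (\<lambda>M. (tens R (burnside R) M, M, lun M)) (\<lambda>M. (tens R M (burnside R), M, run M))
    (\<lambda>L M. (tens R L M, tens R M L, sig L M))"
proof (intro symmetric_monoidal.intro category_bfun symmetric_monoidal_axioms.intro)
  fix M :: "('r, 'm) bfun" assume M: "M \<in> Ob (bfun_cat R)"
  then have [simp]: "bfunctor M" by simp
  show "iso_arrow (bfun_cat R) (tens R M (burnside R), M, run M)"
  proof (rule iso_arrow_bfun)
    let ?B = "burnside R :: ('r, 'm) bfun" and ?i = "ncomp M (tens R (burnside R) M) (sig (burnside R) M) (lun_inv M)"
    show "?i \<in> nat_trans R M (tens R M ?B)" by simp
    have "ncomp (tens R M ?B) M ?i (run M) = ncomp (tens R M ?B) (tens R ?B M) (sig ?B M)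
        (ncomp (tens R M ?B) (tens R ?B M) (ncomp (tens R ?B M) M (lun_inv M) (lun M)) (sig M ?B))"
      by (simp add: run_def ncomp_assoc)
    then show "ncomp (tens R M ?B) M ?i (run M) = nid (tens R M ?B)"
      by (simp add: lun_inv_left ncomp_nid sig_sig)
    have "ncomp M (tens R M ?B) (run M) ?i = ncomp M (tens R ?B M) (lun M)
        (ncomp M (tens R ?B M) (ncomp (tens R ?B M) (tens R M ?B) (sig M ?B) (sig ?B M)) (lun_inv M))"
      by (simp add: run_def ncomp_assoc)
    then show "ncomp M (tens R M ?B) (run M) ?i = nid M"
      by (simp add: sig_sig ncomp_nid lun_inv_right)
  qed simp_all
qed (auto simp: Hom_bfun tens_map_nid tens_map_ncomp asso_natural lun_natural run_natural sig_natural pentagon_asso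
  triangle_asso hexagon_asso sig_sig intro!: iso_arrow_bfun intro: asso_inv(1) asso_inv_left asso_inv_right lun_inv lun_inv_left lun_inv_right)

theorem bilin_tens_map:
  fixes L L' M M' :: "('r, 'm) bfun"
  assumes [simp]: "bfunctor L" "bfunctor L'" "bfunctor M" "bfunctor M'"
  shows "bilin_map R (nat_mod R L L') (nat_mod R M M') (nat_mod R (tens R L M) (tens R L' M')) (tens_map R L L' M M')"
proof -
  note [simp] = nt_simps(1)[OF assms(1,2)] nt_simps(1)[OF assms(3,4)] tens_map[OF assms(1,3,2,4)]
  show ?thesis
    by (rule bilin_mapI; (simp; fail)?; rule tens_eqI[of L M "tens R L' M'"])
      simp_all
qed

end

context coefficients
begin

section \<open>Projective biset functors\<close>

definition nsurj :: "('r, 'a) bfun \<Rightarrow> ('r, 'b) bfun \<Rightarrow> (fcat \<Rightarrow> 'a \<Rightarrow> 'b) \<Rightarrow> bool" where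
  "nsurj M N e \<longleftrightarrow> e \<in> nat_trans R M N \<and> (\<forall>C\<in>fincats. \<forall>y\<in>el N C. \<exists>x\<in>el M C. e C x = y)"

text \<open>Pointwise linear surjections whose kernels are stable under the action carry the functor
  structure over to their targets.\<close>

lemma quotient_functor:
  fixes N :: "('r, 'a) bfun" and A :: "fcat \<Rightarrow> ('r, 'b) module"
  assumes N [simp]: "bfunctor N" and A [simp]: "\<And>C. fincat C \<Longrightarrow> module R (A C)"
    and lin: "\<And>C. fincat C \<Longrightarrow> lin_map R (vob N C) (A C) (q C)"
    and im: "\<And>C. fincat C \<Longrightarrow> carrier (A C) = q C ` el N C"
    and ker: "\<And>C D f x. \<lbrakk>fincat C; fincat D; f \<in> bh C D; x \<in> el N C;
      q C x = \<zero>\<^bsub>A C\<^esub>\<rbrakk> \<Longrightarrow> q D (vmap N C D f x) = \<zero>\<^bsub>A D\<^esub>"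
  shows "\<exists>Q. bfunctor Q \<and> vob Q = A \<and> ntr N q \<in> nat_trans R N Q"
proof -
  \<comment> \<open>\<open>inv_into\<close> picks a preimage. Fact \<open>v\<close> shows that the
    choice does not matter: two preimages differ by an element of the kernel, which
    \<open>ker\<close> keeps in the kernel.\<close>
  let ?Q = "\<lparr>vob = A, vmap = (\<lambda>C D f k. q D (vmap N C D f (inv_into (el N C) (q C) k)))\<rparr>"
  note ls [simp] = lin_map_simps[OF _ _ lin]
  have v: "vmap ?Q C D f (q C x) = q D (vmap N C D f x)"
    if [simp]: "fincat C" "fincat D" "f \<in> bh C D" "x \<in> el N C" for C D f x
  proof -
    let ?y = "inv_into (el N C) (q C) (q C x)"
    have y [simp]: "?y \<in> el N C" and e: "q C ?y = q C x"
      by (auto intro!: inv_into_into f_inv_into_f)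
    interpret NC: module R "vob N C" by simp
    interpret ND: module R "vob N D" by simp
    interpret AC: module R "A C" by simp
    interpret AD: module R "A D" by simp
    have m: "module R (vob N C)" "module R (vob N D)" "module R (A C)" "module R (A D)" by simp_all
    have l: "lin_map R (vob N C) (vob N D) (vmap N C D f)" by (rule lin_mapI) simp_all
    have "q C (?y \<ominus>\<^bsub>vob N C\<^esub> x) = \<zero>\<^bsub>A C\<^esub>"
      using lin_map_minus[OF m(1,3) lin y] e by (simp add: a_minus_def AC.r_neg)
    then have "q D (vmap N C D f (?y \<ominus>\<^bsub>vob N C\<^esub> x)) = \<zero>\<^bsub>A D\<^esub>" by (intro ker) simp_all
    then have "q D (vmap N C D f ?y) \<ominus>\<^bsub>A D\<^esub> q D (vmap N C D f x) = \<zero>\<^bsub>A D\<^esub>"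
      by (simp add: lin_map_minus[OF m(1,2) l] lin_map_minus[OF m(2,4) lin])
    then have "q D (vmap N C D f ?y) = \<ominus>\<^bsub>A D\<^esub> (\<ominus>\<^bsub>A D\<^esub> q D (vmap N C D f x))"
      unfolding a_minus_def by (intro AD.minus_equality[symmetric]) simp_all
    then show ?thesis by simp
  qed
  have Q: "bfunctor ?Q"
  proof (rule biset_functorI)
    show "bilin_map R (bhom R C D) (vob ?Q C) (vob ?Q D) (vmap ?Q C D)" if c [simp]: "fincat C" "fincat D" for C D
    proof (rule bilin_mapI)
      fix f k l assume "f \<in> bh C D" "k \<in> el ?Q C" "l \<in> el ?Q C"
      then obtain x y where [simp]: "k = q C x" "l = q C y" "x \<in> el N C" "y \<in> el N C" "f \<in> bh C D"
        by (auto simp: im)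
      have "vmap ?Q C D f (q C (x \<oplus>\<^bsub>vob N C\<^esub> y)) = q D (vmap N C D f (x \<oplus>\<^bsub>vob N C\<^esub> y))" by (rule v) simp_all
      then show "vmap ?Q C D f (k \<oplus>\<^bsub>vob ?Q C\<^esub> l) = vmap ?Q C D f k \<oplus>\<^bsub>vob ?Q D\<^esub> vmap ?Q C D f l"
        by (simp add: v del: bfun.simps(2))
    next
      fix r f k assume "f \<in> bh C D" "k \<in> el ?Q C" "r \<in> carrier R"
      then obtain x where [simp]: "k = q C x" "x \<in> el N C" "f \<in> bh C D" "r \<in> carrier R"
        by (auto simp: im)
      have "vmap ?Q C D f (q C (r \<odot>\<^bsub>vob N C\<^esub> x)) = q D (vmap N C D f (r \<odot>\<^bsub>vob N C\<^esub> x))" by (rule v) simp_all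
      then show "vmap ?Q C D f (r \<odot>\<^bsub>vob ?Q C\<^esub> k) = r \<odot>\<^bsub>vob ?Q D\<^esub> vmap ?Q C D f k"
        by (simp add: v del: bfun.simps(2))
    qed (auto simp: im v simp del: bfun.simps(2))
  qed (auto simp: im v simp del: bfun.simps(2))
  have "ntr N q \<in> nat_trans R N ?Q"
    by (rule ntr_nat_trans) (simp_all add: v lin del: bfun.simps(2))
  with Q show ?thesis by (intro exI[of _ ?Q]) simp
qed

text \<open>Cokernel argument: the projection of \<open>N\<close> onto its quotient by the image of
  \<open>e\<close> and the zero map agree after \<open>e\<close>, hence agree, so the image is
  everything. The quotient consists of sets and must first be moved back into the type of
  \<open>N\<close> to be an object of the category.\<close>

lemma epi_nsurj:
  fixes M N :: "('r, 'a) bfun"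
  assumes epi: "epi (bfun_cat R) (M, N, e)"
  shows "nsurj M N e"
proof -
  have M [simp]: "bfunctor M" and N [simp]: "bfunctor N" and e: "e \<in> nat_trans R M N"
    using epi by (auto simp: epi_def)
  note [simp] = nt_simps[OF M N e]
  let ?I = "\<lambda>C. e C ` el M C"
  let ?q = "\<lambda>C x. ?I C +>\<^bsub>vob N C\<^esub> x"
  have I: "submodule (?I C) R (vob N C)" if "fincat C" for C
    by (rule image_submodule[OF _ _ nt_lin[OF e that]]) (simp_all add: that)
  note qm = quot_mod[OF bf_simps(1)[OF N] I]
  have k: "?q C x = \<zero>\<^bsub>quot_mod (vob N C) (?I C)\<^esub> \<longleftrightarrow> x \<in> ?I C" if "fincat C" "x \<in> el N C" for C x
    using qm(4)[OF that(1,1) that(2)] by simp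
  have "\<exists>Q. bfunctor Q \<and> vob Q = (\<lambda>C. quot_mod (vob N C) (?I C)) \<and> ntr N ?q \<in> nat_trans R N Q"
  proof (rule quotient_functor[OF N])
    fix C D f x assume c: "fincat C" "fincat D" "f \<in> bh C D" "x \<in> el N C"
      and z: "?q C x = \<zero>\<^bsub>quot_mod (vob N C) (?I C)\<^esub>"
    have "x \<in> ?I C" using k[OF c(1,4)] z by blast
    then obtain y where "y \<in> el M C" "x = e C y" by blast
    then have "vmap N C D f x = e D (vmap M C D f y)" "vmap M C D f y \<in> el M D" using c by simp_all
    then have "vmap N C D f x \<in> ?I D" by blast
    then show "?q D (vmap N C D f x) = \<zero>\<^bsub>quot_mod (vob N D) (?I D)\<^esub>" by (rule iffD2[OF k, rotated 2]) (use c in simp_all)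
  qed (rule qm(1) qm(2) qm(3); assumption)+
  then obtain Q where Q [simp]: "bfunctor Q" and vQ: "\<And>C. vob Q C = quot_mod (vob N C) (?I C)"
    and q: "ntr N ?q \<in> nat_trans R N Q" by auto
  \<comment> \<open>Choosing a representative of each coset embeds the quotient into the original
    type, so no cardinality assumption enters.\<close>
  have s: "\<forall>C\<in>fincats. \<exists>j :: 'a set \<Rightarrow> 'a. inj_on j (el Q C)"
  proof
    fix C assume C: "fincat C"
    have "el Q C = ?q C ` el N C" unfolding vQ by (rule qm(3)[OF C C])
    then show "\<exists>j :: 'a set \<Rightarrow> 'a. inj_on j (el Q C)"
      by (intro exI[of _ "inv_into (el N C) (?q C)"]) (simp add: inj_on_inv_into)
  qed
  note mv = mv_nat[OF Q s] and mf [simp] = move_functor[OF Q s]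
  let ?Q = "move_fun Q :: ('r, 'a) bfun"
  let ?p = "ncomp N Q (ntr Q (mv Q)) (ntr N ?q)" and ?z = "ntr N (\<lambda>C x. \<zero>\<^bsub>vob ?Q C\<^esub>)"
  note nq = nt_simps[OF N Q q] and nm = nt_simps[OF Q mf mv]
  have p: "?p \<in> nat_trans R N ?Q" by (rule ncomp_nat[OF N Q mf q mv])
  have z: "?z \<in> nat_trans R N ?Q" by simp
  have "ncomp M N ?p e = ncomp M N ?z e"
  proof (rule nat_trans_ext[OF ncomp_nat[OF M N mf e p] ncomp_nat[OF M N mf e z]])
    fix C x assume c [simp]: "fincat C" "x \<in> el M C"
    have "ntr N ?q C (e C x) = \<zero>\<^bsub>vob Q C\<^esub>" using k[of C "e C x"] by (simp add: vQ)
    then show "ncomp M N ?p e C x = ncomp M N ?z e C x"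
      using nm(4)[OF c(1)] by simp
  qed
  then have "cmp (bfun_cat R) (N, ?Q, ?p) (M, N, e) = cmp (bfun_cat R) (N, ?Q, ?z) (M, N, e)" by simp
  moreover have "(N, ?Q, ?p) \<in> Hom (bfun_cat R) N ?Q" "(N, ?Q, ?z) \<in> Hom (bfun_cat R) N ?Q"
    using p z by (simp_all add: Hom_bfun)
  ultimately have "(N, ?Q, ?p) = (N, ?Q, ?z)"
    using epi unfolding epi_def bfun_cat_simps(4) by blast
  then have pz: "?p = ?z" by (simp only: prod.inject)
  show ?thesis unfolding nsurj_def
  proof (intro conjI e ballI)
    fix C y assume c [simp]: "fincat C" "y \<in> el N C"
    have "?p C y = ?z C y" using pz by simp
    then have "ntr Q (mv Q) C (ntr N ?q C y) = ntr Q (mv Q :: fcat \<Rightarrow> 'a set \<Rightarrow> 'a) C \<zero>\<^bsub>vob Q C\<^esub>"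
      using nm(4)[OF c(1)] by simp
    then have "ntr N ?q C y = \<zero>\<^bsub>vob Q C\<^esub>"
      using inj_onD[OF mv_inj[OF Q s c(1)]] nq(1)[OF c] by simp
    then show "\<exists>x\<in>el M C. e C x = y" using k[of C y] by (auto simp: vQ)
  qed
qed

lemma nsurj_epi:
  fixes M N :: "('r, 'a) bfun"
  assumes M: "bfunctor M" and N: "bfunctor N" and e: "nsurj M N e"
  shows "epi (bfun_cat R) (M, N, e)"
  unfolding epi_def
proof (intro conjI allI ballI impI)
  have n: "e \<in> nat_trans R M N" using e by (simp add: nsurj_def)
  then show "(M, N, e) \<in> Ar (bfun_cat R)" using M N by simp
  fix Z f g assume f: "f \<in> Hom (bfun_cat R) (tgt (bfun_cat R) (M, N, e)) Z" and g: "g \<in> Hom (bfun_cat R) (tgt (bfun_cat R) (M, N, e)) Z"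
    and eq: "cmp (bfun_cat R) f (M, N, e) = cmp (bfun_cat R) g (M, N, e)"
  obtain \<phi> \<psi> where [simp]: "f = (N, Z, \<phi>)" "g = (N, Z, \<psi>)" and n': "\<phi> \<in> nat_trans R N Z" "\<psi> \<in> nat_trans R N Z"
    using f g by (auto simp: Hom_bfun)
  have "\<phi> = \<psi>"
  proof (rule nat_trans_ext[OF n'])
    fix C y assume C: "fincat C" and "y \<in> el N C"
    then obtain x where "x \<in> el M C" "e C x = y" using e by (auto simp: nsurj_def)
    moreover have "ncomp M N \<phi> e C x = ncomp M N \<psi> e C x" using eq by simp
    ultimately show "\<phi> C y = \<psi> C y" using C by simp
  qed
  then show "f = g" by simp
qed

text \<open>Lifting against one given map. The types of \<open>P\<close>, \<open>X\<close> and
  \<open>Y\<close> are independent, whereas \<open>projective\<close> confines all three functors to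
  the same type.\<close>

definition lifts :: "('r, 'p) bfun \<Rightarrow> ('r, 'a) bfun \<Rightarrow> ('r, 'b) bfun \<Rightarrow> (fcat \<Rightarrow> 'a \<Rightarrow> 'b) \<Rightarrow> bool" where
  "lifts P X Y e \<longleftrightarrow> (\<forall>f\<in>nat_trans R P Y. \<exists>g\<in>nat_trans R P X. ncomp P X e g = f)"

lemma projective_lifts:
  fixes P X Y :: "('r, 'a) bfun"
  assumes P: "projective (bfun_cat R) P" and X: "bfunctor X" "bfunctor Y" and e: "nsurj X Y e"
  shows "lifts P X Y e"
  unfolding lifts_def
proof
  fix f assume f: "f \<in> nat_trans R P Y"
  have "bfunctor P" using P by (simp add: projective_def)
  then have "(X, Y, e) \<in> Hom (bfun_cat R) X Y" "(P, Y, f) \<in> Hom (bfun_cat R) P Y"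
    using X e f by (auto simp: Hom_bfun nsurj_def)
  then obtain g where "g \<in> Hom (bfun_cat R) P X" "cmp (bfun_cat R) (X, Y, e) g = (P, Y, f)"
    using P nsurj_epi[OF X e] unfolding projective_def by blast
  then show "\<exists>g\<in>nat_trans R P X. ncomp P X e g = f" by (auto simp: Hom_bfun)
qed

lemma lifts_projective:
  fixes P :: "('r, 'a) bfun"
  assumes P: "bfunctor P" and l: "\<And>(X :: ('r, 'a) bfun) (Y :: ('r, 'a) bfun) e. bfunctor X \<Longrightarrow> bfunctor Y \<Longrightarrow> nsurj X Y e \<Longrightarrow> lifts P X Y e"
  shows "projective (bfun_cat R) P"
  unfolding projective_def
proof (intro conjI allI ballI impI)
  fix X Y e f assume "e \<in> Hom (bfun_cat R) X Y" "f \<in> Hom (bfun_cat R) P Y" and epi: "epi (bfun_cat R) e"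
  then obtain \<eta> \<phi> where [simp]: "e = (X, Y, \<eta>)" "f = (P, Y, \<phi>)" and *: "bfunctor X" "bfunctor Y" "\<phi> \<in> nat_trans R P Y"
    by (auto simp: Hom_bfun)
  have "nsurj X Y \<eta>" by (rule epi_nsurj) (use epi in simp)
  then obtain g where "g \<in> nat_trans R P X" "ncomp P X \<eta> g = \<phi>" using l[of X Y \<eta>] * unfolding lifts_def by blast
  then show "\<exists>g\<in>Hom (bfun_cat R) P X. cmp (bfun_cat R) e g = f"
    using P * by (intro bexI[of _ "(P, X, g)"]) (auto simp: Hom_bfun)
qed (use P in simp)

text \<open>The direct sum of the representable functors \<open>rep (c i)\<close>, as finitely
  supported families that are \<open>undefined\<close> off \<open>S\<close>.\<close>

definition free_fun :: "'i set \<Rightarrow> ('i \<Rightarrow> fcat) \<Rightarrow> ('r, 'i \<Rightarrow> 'r bmor) bfun" where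
  "free_fun S c = \<lparr>vob = (\<lambda>D. \<lparr>carrier = {f \<in> extensional S. (\<forall>i\<in>S. f i \<in> bh (c i) D) \<and> finite {i \<in> S. f i \<noteq> \<zero>\<^bsub>bhom R (c i) D\<^esub>}},
      mult = undefined, one = undefined, zero = (\<lambda>i\<in>S. \<zero>\<^bsub>bhom R (c i) D\<^esub>),
      add = (\<lambda>f g. \<lambda>i\<in>S. f i \<oplus>\<^bsub>bhom R (c i) D\<^esub> g i), smult = (\<lambda>r f. \<lambda>i\<in>S. r \<odot>\<^bsub>bhom R (c i) D\<^esub> f i)\<rparr>),
    vmap = (\<lambda>D E h f. \<lambda>i\<in>S. bcmp R (c i) D E h (f i))\<rparr>"

lemma free_fun_simps [simp]:
  "f \<in> el (free_fun S c) D \<longleftrightarrow>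
    f \<in> extensional S \<and> (\<forall>i\<in>S. f i \<in> bh (c i) D) \<and> finite {i \<in> S. f i \<noteq> \<zero>\<^bsub>bhom R (c i) D\<^esub>}"
  "\<zero>\<^bsub>vob (free_fun S c) D\<^esub> = (\<lambda>i\<in>S. \<zero>\<^bsub>bhom R (c i) D\<^esub>)"
  "f \<oplus>\<^bsub>vob (free_fun S c) D\<^esub> g = (\<lambda>i\<in>S. f i \<oplus>\<^bsub>bhom R (c i) D\<^esub> g i)"
  "r \<odot>\<^bsub>vob (free_fun S c) D\<^esub> f = (\<lambda>i\<in>S. r \<odot>\<^bsub>bhom R (c i) D\<^esub> f i)"
  "vmap (free_fun S c) D E h f = (\<lambda>i\<in>S. bcmp R (c i) D E h (f i))"
  by (simp_all add: free_fun_def)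

context
  fixes S :: "'i set" and c :: "'i \<Rightarrow> fcat"
  assumes c [simp]: "\<And>i. i \<in> S \<Longrightarrow> c i \<in> fincats"
begin

abbreviation "FF \<equiv> free_fun S c"
abbreviation "supp D f \<equiv> {i \<in> S. f i \<noteq> \<zero>\<^bsub>bhom R (c i) D\<^esub>}"

lemma bh_mod: "i \<in> S \<Longrightarrow> fincat D \<Longrightarrow> module R (bhom R (c i) D)"
  by (simp add: bhom_module)

lemma bh_l_zero [simp]: "\<lbrakk>i \<in> S; fincat D; f \<in> bh (c i) D\<rbrakk> \<Longrightarrow> \<zero>\<^bsub>bhom R (c i) D\<^esub> \<oplus>\<^bsub>bhom R (c i) D\<^esub> f = f"
  by (rule abelian_monoid.l_zero[OF abelian_group.axioms(1)[OF module.axioms(2)[OF bh_mod]]])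

lemma bh_smult_zero [simp]: "\<lbrakk>i \<in> S; fincat D; r \<in> carrier R\<rbrakk> \<Longrightarrow> r \<odot>\<^bsub>bhom R (c i) D\<^esub> \<zero>\<^bsub>bhom R (c i) D\<^esub> = \<zero>\<^bsub>bhom R (c i) D\<^esub>"
  by (rule module.smult_r_null[OF bh_mod])

lemma supp_closed:
  assumes D: "fincat D" and f: "f \<in> el FF D"
  shows "g \<in> el FF D \<Longrightarrow> f \<oplus>\<^bsub>vob FF D\<^esub> g \<in> el FF D"
    and "r \<in> carrier R \<Longrightarrow> r \<odot>\<^bsub>vob FF D\<^esub> f \<in> el FF D"
    and "fincat E \<Longrightarrow> h \<in> bh D E \<Longrightarrow> vmap FF D E h f \<in> el FF E"
proof -
  have fin: "finite A" if "A \<subseteq> supp D f" for A using finite_subset[OF that] f by simp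
  show "r \<in> carrier R \<Longrightarrow> r \<odot>\<^bsub>vob FF D\<^esub> f \<in> el FF D"
    using D f by (auto intro!: fin)
  show "fincat E \<Longrightarrow> h \<in> bh D E \<Longrightarrow> vmap FF D E h f \<in> el FF E"
    using D f by (auto intro!: fin)
  assume g: "g \<in> el FF D"
  then have "finite (supp D f \<union> supp D g)" using f by simp
  then show "f \<oplus>\<^bsub>vob FF D\<^esub> g \<in> el FF D"
    using D f g by (auto intro: finite_subset[of _ "supp D f \<union> supp D g"])
qed

lemma free_fun_module: assumes D: "fincat D" shows "module R (vob FF D)"
proof (rule modI)
  note m = bh_mod[OF _ D]
  note am = abelian_group.axioms(1)[OF module.axioms(2)[OF m]]
  show "\<zero>\<^bsub>vob FF D\<^esub> \<in> el FF D" using D by simp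
  fix x y z r s assume x: "x \<in> el FF D"
  show "\<zero>\<^bsub>vob FF D\<^esub> \<oplus>\<^bsub>vob FF D\<^esub> x = x" "\<one> \<odot>\<^bsub>vob FF D\<^esub> x = x"
    "\<zero> \<odot>\<^bsub>vob FF D\<^esub> x = \<zero>\<^bsub>vob FF D\<^esub>"
    using x D by (auto intro!: extensionalityI[of _ S] restrict_ext simp: module.smult_one[OF m] module.smult_l_null[OF m])
  show "r \<in> carrier R \<Longrightarrow> s \<in> carrier R \<Longrightarrow> (r \<oplus> s) \<odot>\<^bsub>vob FF D\<^esub> x = r \<odot>\<^bsub>vob FF D\<^esub> x \<oplus>\<^bsub>vob FF D\<^esub> s \<odot>\<^bsub>vob FF D\<^esub> x"
    "r \<in> carrier R \<Longrightarrow> s \<in> carrier R \<Longrightarrow> (r \<otimes> s) \<odot>\<^bsub>vob FF D\<^esub> x = r \<odot>\<^bsub>vob FF D\<^esub> (s \<odot>\<^bsub>vob FF D\<^esub> x)"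
    using x D by (auto intro!: restrict_ext simp: module.smult_l_distr[OF m] module.smult_assoc1[OF m])
  assume y: "y \<in> el FF D"
  show "x \<oplus>\<^bsub>vob FF D\<^esub> y = y \<oplus>\<^bsub>vob FF D\<^esub> x"
    "r \<in> carrier R \<Longrightarrow> r \<odot>\<^bsub>vob FF D\<^esub> (x \<oplus>\<^bsub>vob FF D\<^esub> y) = r \<odot>\<^bsub>vob FF D\<^esub> x \<oplus>\<^bsub>vob FF D\<^esub> r \<odot>\<^bsub>vob FF D\<^esub> y"
    using x y D by (auto intro!: restrict_ext simp: module.smult_r_distr[OF m] abelian_monoid.a_comm[OF am])
  assume z: "z \<in> el FF D"
  show "x \<oplus>\<^bsub>vob FF D\<^esub> y \<oplus>\<^bsub>vob FF D\<^esub> z = x \<oplus>\<^bsub>vob FF D\<^esub> (y \<oplus>\<^bsub>vob FF D\<^esub> z)"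
    using x y z D by (auto intro!: restrict_ext simp: abelian_monoid.a_assoc[OF am])
qed (use supp_closed[OF D] in blast)+

lemma free_functor: "bfunctor FF"
proof (rule biset_functorI[OF free_fun_module])
  fix C D assume D: "fincat C" "fincat D"
  show "bilin_map R (bhom R C D) (vob FF C) (vob FF D) (vmap FF C D)"
    by (rule bilin_mapI, rule supp_closed(3)[OF D(1) _ D(2)]) (use D in \<open>auto intro!: restrict_ext\<close>)
qed (auto intro!: extensionalityI[of _ S] restrict_ext simp: bcmp_assoc)

definition free_gen :: "'i \<Rightarrow> 'i \<Rightarrow> 'r bmor" where
  "free_gen i = (\<lambda>j\<in>S. if j = i then bident R (c i) else \<zero>\<^bsub>bhom R (c j) (c i)\<^esub>)"

lemma free_gen_closed: "i \<in> S \<Longrightarrow> free_gen i \<in> el FF (c i)"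
  by (auto simp: free_gen_def intro: finite_subset[of _ "{i}"])

text \<open>The Yoneda lemma in each summand: this is the map that sends the generator
  \<open>free_gen i\<close> to \<open>z i\<close>.\<close>

definition free_lift :: "('r, 'a) bfun \<Rightarrow> ('i \<Rightarrow> 'a) \<Rightarrow> fcat \<Rightarrow> ('i \<Rightarrow> 'r bmor) \<Rightarrow> 'a" where
  "free_lift X z = ntr FF (\<lambda>D f. finsum (vob X D) (\<lambda>i. vmap X (c i) D (f i) (z i)) (supp D f))"

context
  fixes X :: "('r, 'a) bfun" and z
  assumes X [simp]: "bfunctor X" and z [simp]: "\<And>i. i \<in> S \<Longrightarrow> z i \<in> el X (c i)"
begin

lemma free_lift_superset:
  assumes D [simp]: "fincat D" and f: "f \<in> el FF D" and A: "finite A" "supp D f \<subseteq> A" "A \<subseteq> S"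
  shows "free_lift X z D f = finsum (vob X D) (\<lambda>i. vmap X (c i) D (f i) (z i)) A"
proof -
  interpret M: module R "vob X D" by simp
  show ?thesis unfolding free_lift_def ntr_apply[OF D f]
    by (rule M.add.finprod_mono_neutral_cong_left) (use A f in \<open>auto simp: subset_iff\<close>)
qed

lemma free_lift_nat: "free_lift X z \<in> nat_trans R FF X"
  unfolding free_lift_def
proof (rule ntr_nat_trans[OF free_functor])
  let ?h = "\<lambda>D f. finsum (vob X D) (\<lambda>i. vmap X (c i) D (f i) (z i)) (supp D f)"
  have h: "?h D f = finsum (vob X D) (\<lambda>i. vmap X (c i) D (f i) (z i)) A"
    if "fincat D" "f \<in> el FF D" "finite A" "supp D f \<subseteq> A" "A \<subseteq> S" for D f A
    using free_lift_superset[OF that] unfolding free_lift_def ntr_apply[OF that(1,2)] .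
  fix D assume D [simp]: "fincat D"
  interpret M: module R "vob X D" by simp
  show "lin_map R (vob FF D) (vob X D) (?h D)"
  proof (rule lin_mapI)
    fix f assume f: "f \<in> el FF D"
    then show "?h D f \<in> el X D" by (auto intro!: M.finsum_closed)
    show "?h D (r \<odot>\<^bsub>vob FF D\<^esub> f) = r \<odot>\<^bsub>vob X D\<^esub> ?h D f" if r: "r \<in> carrier R" for r
    proof -
      have "?h D (r \<odot>\<^bsub>vob FF D\<^esub> f) = finsum (vob X D) (\<lambda>i. vmap X (c i) D ((r \<odot>\<^bsub>vob FF D\<^esub> f) i) (z i)) (supp D f)"
        by (rule h[OF D supp_closed(2)[OF D f r]]) (use f r in auto)
      also have "\<dots> = finsum (vob X D) (\<lambda>i. r \<odot>\<^bsub>vob X D\<^esub> vmap X (c i) D (f i) (z i)) (supp D f)"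
        by (rule M.finsum_cong') (use f r in auto)
      also have "\<dots> = r \<odot>\<^bsub>vob X D\<^esub> ?h D f"
        by (rule M.finsum_smult_ldistr[symmetric]) (use f r in auto)
      finally show ?thesis .
    qed
    fix g assume g: "g \<in> el FF D"
    let ?A = "supp D f \<union> supp D g"
    have A: "finite ?A" using f g by simp
    have "?h D (f \<oplus>\<^bsub>vob FF D\<^esub> g) = finsum (vob X D) (\<lambda>i. vmap X (c i) D ((f \<oplus>\<^bsub>vob FF D\<^esub> g) i) (z i)) ?A"
      by (rule h[OF D supp_closed(1)[OF D f g] A]) (use f g in auto)
    also have "\<dots> = finsum (vob X D) (\<lambda>i. vmap X (c i) D (f i) (z i) \<oplus>\<^bsub>vob X D\<^esub> vmap X (c i) D (g i) (z i)) ?A"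
      by (rule M.finsum_cong') (use f g in auto)
    also have "\<dots> = finsum (vob X D) (\<lambda>i. vmap X (c i) D (f i) (z i)) ?A \<oplus>\<^bsub>vob X D\<^esub> finsum (vob X D) (\<lambda>i. vmap X (c i) D (g i) (z i)) ?A"
      by (rule M.finsum_addf) (use f g in auto)
    also have "\<dots> = ?h D f \<oplus>\<^bsub>vob X D\<^esub> ?h D g"
      using h[OF D f A] h[OF D g A] by auto
    finally show "?h D (f \<oplus>\<^bsub>vob FF D\<^esub> g) = ?h D f \<oplus>\<^bsub>vob X D\<^esub> ?h D g" .
  qed
  fix E k f assume E [simp]: "fincat E" and k [simp]: "k \<in> bh D E" and f: "f \<in> el FF D"
  interpret N: module R "vob X E" by simp
  have "?h E (vmap FF D E k f) = finsum (vob X E) (\<lambda>i. vmap X (c i) E (vmap FF D E k f i) (z i)) (supp D f)"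
    by (rule h[OF E supp_closed(3)[OF D f E k]]) (use f in auto)
  also have "\<dots> = finsum (vob X E) (\<lambda>i. vmap X D E k (vmap X (c i) D (f i) (z i))) (supp D f)"
    by (rule N.finsum_cong') (use f in auto)
  also have "\<dots> = vmap X D E k (?h D f)"
    by (rule lin_map_finsum[symmetric, of R "vob X D"]) (use f in \<open>auto intro!: lin_mapI\<close>)
  finally show "?h E (vmap FF D E k f) = vmap X D E k (?h D f)" .
qed

lemma free_lift_gen: assumes i: "i \<in> S" shows "free_lift X z (c i) (free_gen i) = z i"
proof -
  interpret M: module R "vob X (c i)" using i by simp
  have "free_lift X z (c i) (free_gen i) = finsum (vob X (c i)) (\<lambda>j. vmap X (c j) (c i) (free_gen i j) (z j)) {i}"
    by (rule free_lift_superset[OF c[OF i] free_gen_closed[OF i]]) (use i in \<open>auto simp: free_gen_def\<close>)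
  also have "\<dots> = z i" using i by (simp add: free_gen_def)
  finally show ?thesis .
qed

end

lemma free_ext:
  assumes Y: "bfunctor Y" and e: "\<eta> \<in> nat_trans R FF Y" and t: "\<theta> \<in> nat_trans R FF Y"
    and eq: "\<And>i. i \<in> S \<Longrightarrow> \<eta> (c i) (free_gen i) = \<theta> (c i) (free_gen i)"
  shows "\<eta> = \<theta>"
proof (rule nat_trans_ext[OF e t])
  note ns = nt_simps[OF free_functor Y e] nt_simps[OF free_functor Y t]
  fix D f assume D: "fincat D" and f: "f \<in> el FF D"
  have *: "\<eta> D f = \<theta> D f" if "finite A" "A \<subseteq> S" "f \<in> el FF D" "supp D f \<subseteq> A" for A f
    using that
  proof (induction A arbitrary: f)
    case empty
    then have z: "f = \<zero>\<^bsub>vob FF D\<^esub>" using D by (auto intro!: extensionalityI[of _ S])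
    show ?case unfolding z ns(4)[OF D] ns(9)[OF D] ..
  next
    case (insert i A)
    let ?g = "\<lambda>j\<in>S. if j = i then \<zero>\<^bsub>bhom R (c j) D\<^esub> else f j"
    let ?h = "vmap FF (c i) D (f i) (free_gen i)"
    have i: "i \<in> S" "f i \<in> bh (c i) D" using insert by auto
    have g: "?g \<in> el FF D" "supp D ?g \<subseteq> A"
      using insert D by (auto intro: finite_subset[of _ "supp D f"])
    have h: "?h \<in> el FF D"
      by (rule supp_closed(3)[OF c[OF i(1)] free_gen_closed[OF i(1)] D i(2)])
    interpret B: module R "bhom R (c i) D" using i D by (simp add: bhom_module)
    \<comment> \<open>Splits off the summand \<open>i\<close>: the entry \<open>f i\<close> there
      results from acting by \<open>f i\<close> on the generator.\<close>
    have "f = ?g \<oplus>\<^bsub>vob FF D\<^esub> ?h"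
    proof (rule extensionalityI[of _ S])
      fix j assume j: "j \<in> S"
      interpret module R "bhom R (c j) D" using j D by (simp add: bhom_module)
      show "f j = (?g \<oplus>\<^bsub>vob FF D\<^esub> ?h) j"
        using j insert.prems D i by (simp add: free_gen_def)
    qed (use insert in simp_all)
    moreover have "\<eta> D ?h = \<theta> D ?h"
      using ns(5,10)[OF c[OF i(1)] D i(2) free_gen_closed[OF i(1)]] eq[OF i(1)] by simp
    moreover have "\<eta> D ?g = \<theta> D ?g" using insert.prems(1) by (intro insert.IH[OF _ g]) simp
    ultimately show ?case using ns(2,7)[OF D g(1) h] by simp
  qed
  show "\<eta> D f = \<theta> D f" by (rule *[of "supp D f"]) (use f in auto)
qed

text \<open>A map out of a direct sum of representables is a free choice of values at the
  generators, so lifting amounts to choosing preimages of these values.\<close>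

lemma free_lifts:
  assumes X: "bfunctor X" and Y: "bfunctor Y" and e: "nsurj X Y e"
  shows "lifts FF X Y e"
  unfolding lifts_def
proof
  note n = e[unfolded nsurj_def, THEN conjunct1]
  fix f assume f: "f \<in> nat_trans R FF Y"
  have "\<forall>i\<in>S. \<exists>z. z \<in> el X (c i) \<and> e (c i) z = f (c i) (free_gen i)"
    using e nt_closed[OF free_functor Y f c free_gen_closed] unfolding nsurj_def by (metis c)
  then obtain z where z: "\<And>i. i \<in> S \<Longrightarrow> z i \<in> el X (c i)" "\<And>i. i \<in> S \<Longrightarrow> e (c i) (z i) = f (c i) (free_gen i)"
    by metis
  note l = free_lift_nat[OF X z(1)]
  have "ncomp FF X e (free_lift X z) = f"
  proof (rule free_ext[OF Y ncomp_nat[OF free_functor X Y l n] f])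
    fix i assume i: "i \<in> S"
    have "ncomp FF X e (free_lift X z) (c i) (free_gen i) = e (c i) (free_lift X z (c i) (free_gen i))"
      by (rule ncomp_apply[OF c[OF i] free_gen_closed[OF i]])
    then show "ncomp FF X e (free_lift X z) (c i) (free_gen i) = f (c i) (free_gen i)"
      using free_lift_gen[OF X z(1) i] z(2)[OF i] by simp
  qed
  with l show "\<exists>g\<in>nat_trans R FF X. ncomp FF X e g = f" by blast
qed

end

lemma lifts_retract:
  assumes [simp]: "bfunctor P" "bfunctor F" "bfunctor X" "bfunctor Y"
    and e: "e \<in> nat_trans R X Y" and i: "i \<in> nat_trans R P F" and p: "p \<in> nat_trans R F P" and pi: "ncomp P F p i = nid P"
    and F: "lifts F X Y e"
  shows "lifts P X Y e"
  unfolding lifts_def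
proof
  note [simp] = e i p
  fix f assume f [simp]: "f \<in> nat_trans R P Y"
  have "ncomp F P f p \<in> nat_trans R F Y" by simp
  then obtain g where g [simp]: "g \<in> nat_trans R F X" and eg: "ncomp F X e g = ncomp F P f p"
    using F unfolding lifts_def by blast
  have "ncomp P X e (ncomp P F g i) = ncomp P F (ncomp F X e g) i"
    by (rule ncomp_assoc[symmetric]) simp_all
  also have "\<dots> = ncomp P P f (ncomp P F p i)"
    unfolding eg by (rule ncomp_assoc) simp_all
  also have "\<dots> = f" unfolding pi by (rule ncomp_nid(2)[OF assms(1,4) f])
  finally show "\<exists>g\<in>nat_trans R P X. ncomp P X e g = f" by (intro bexI[of _ "ncomp P F g i"]) simp_all
qed

text \<open>The free cover on a set of generators. An index is a pair of a category and an element
  over it, so \<open>fst\<close> is the family of categories and \<open>snd\<close> the family of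
  prescribed values.\<close>

lemma free_lift_nsurj:
  fixes P :: "('r, 'a) bfun"
  assumes P [simp]: "bfunctor P" and S: "S \<subseteq> (SIGMA C:fincats. el P C)"
    and G: "generates P (\<lambda>C. {x. (C, x) \<in> S})"
  shows "nsurj (free_fun S fst) P (free_lift S fst P snd)"
proof -
  have c: "fst i \<in> fincats" "snd i \<in> el P (fst i)" if "i \<in> S" for i using that S by auto
  have F: "bfunctor (free_fun S fst)" by (rule free_functor) (rule c)
  have l: "free_lift S fst P snd \<in> nat_trans R (free_fun S fst) P" by (rule free_lift_nat) (simp_all add: c)
  note ns = nt_simps[OF F P l]
  show ?thesis unfolding nsurj_def
  proof (intro conjI l ballI)
    fix D y assume "fincat D" "y \<in> el P D"
    with G show "\<exists>x\<in>el (free_fun S fst) D. free_lift S fst P snd D x = y"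
    proof (induction rule: generates_induct)
      case zero
      have "\<zero>\<^bsub>vob (free_fun S fst) D\<^esub> \<in> el (free_fun S fst) D"
        by (rule bf_simps(2)[OF F]) fact
      with ns(4)[OF \<open>fincat D\<close>] show ?case by blast
    next
      case (add x y)
      then obtain x' y' where *: "x' \<in> el (free_fun S fst) D" "free_lift S fst P snd D x' = x"
        "y' \<in> el (free_fun S fst) D" "free_lift S fst P snd D y' = y" by blast
      have "x' \<oplus>\<^bsub>vob (free_fun S fst) D\<^esub> y' \<in> el (free_fun S fst) D"
        by (rule bf_simps(3)[OF F]) fact+
      with ns(2)[OF \<open>fincat D\<close> *(1,3)] * show ?case by metis
    next
      case (act C x f)
      let ?i = "(C, x)"
      have i: "?i \<in> S" using act by simp
      have g: "free_gen S fst ?i \<in> el (free_fun S fst) C" using free_gen_closed[of S fst ?i] c(1) i by (simp del: free_fun_simps)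
      have "vmap (free_fun S fst) C D f (free_gen S fst ?i) \<in> el (free_fun S fst) D"
        by (rule bf_simps(5)[OF F _ \<open>fincat D\<close> act(4) g]) fact
      moreover have "free_lift S fst P snd D (vmap (free_fun S fst) C D f (free_gen S fst ?i)) = vmap P C D f x"
        using ns(5)[OF act(1) \<open>fincat D\<close> act(4) g] free_lift_gen[of S fst P snd ?i] c i by (simp del: free_fun_simps)
      ultimately show ?case by blast
    qed simp
  qed
qed

end

context universe
begin

section \<open>Projective functors as retracts of free ones\<close>

lemma small_free_fun:
  assumes "small S" "fincat D" "\<And>i. i \<in> S \<Longrightarrow> c i \<in> fincats"
  shows "small (el (free_fun S c) D)"
  by (rule small_finsupp[of S "\<lambda>i. bh (c i) D" _ "\<lambda>i. \<zero>\<^bsub>bhom R (c i) D\<^esub>"])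
    (use assms in \<open>auto simp: small_bhom extensional_def\<close>)

text \<open>\<open>projective\<close> only sees test objects with values in \<open>'m\<close>, while
  a direct sum of representables has families as its elements. The cover is small, so it can be
  moved into \<open>'m\<close>, split there, and the section moved back.\<close>

lemma projective_retract:
  fixes P :: "('r, 'm) bfun"
  assumes P: "projective (bfun_cat R) P" and S: "S \<subseteq> (SIGMA C:fincats. el P C)"
    and G: "generates P (\<lambda>C. {x. (C, x) \<in> S})"
  shows "\<exists>i\<in>nat_trans R P (free_fun S fst). ncomp P (free_fun S fst) (free_lift S fst P snd) i = nid P"
proof -
  let ?F = "free_fun S fst" and ?\<pi> = "free_lift S fst P snd"
  have c: "fst i \<in> fincats" "snd i \<in> el P (fst i)" if "i \<in> S" for i using that S by auto
  have bP [simp]: "bfunctor P" using P by (simp add: projective_def)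
  have F [simp]: "bfunctor ?F" by (rule free_functor) (rule c)
  have su: "nsurj ?F P ?\<pi>" by (rule free_lift_nsurj[OF bP S G])
  then have l: "?\<pi> \<in> nat_trans R ?F P" by (simp add: nsurj_def)
  have "small S" by (rule small_mono[OF small_Sigma[OF small_fincats small_type] S])
  then have sm: "\<forall>D\<in>fincats. \<exists>e :: _ \<Rightarrow> 'm. inj_on e (el ?F D)"
    using small_free_fun[of S _ fst] c(1) unfolding small_def by blast
  let ?M = "move_fun ?F :: ('r, 'm) bfun"
  have M [simp]: "bfunctor ?M" by (rule move_functor[OF F sm])
  note im = move_simps(1)[OF F sm]
  \<comment> \<open>The inverse of the transport, obtained by extending the identity of the free
    functor along \<open>mv\<close>.\<close>
  obtain \<kappa> where k: "\<kappa> \<in> nat_trans R ?M ?F" and ka: "\<And>D x. fincat D \<Longrightarrow> x \<in> el ?F D \<Longrightarrow> \<kappa> D (mv ?F D x) = x"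
    using move_lift[OF F sm F nid_nat[OF F]] by (metis nid_apply)
  let ?e = "ncomp ?M ?F ?\<pi> \<kappa>"
  have e: "?e \<in> nat_trans R ?M P" by (rule ncomp_nat[OF M F bP k l])
  have "nsurj ?M P ?e" unfolding nsurj_def
  proof (intro conjI e ballI)
    fix D y assume D: "fincat D" and y: "y \<in> el P D"
    then obtain x where x: "x \<in> el ?F D" "?\<pi> D x = y" using su unfolding nsurj_def by blast
    have m: "mv ?F D x \<in> el ?M D" using im[OF D] x by blast
    then have "?e D (mv ?F D x) = y" using D x by (simp add: ka del: free_fun_simps)
    with m show "\<exists>x\<in>el ?M D. ?e D x = y" by blast
  qed
  then have "lifts P ?M P ?e" by (rule projective_lifts[OF P M bP])
  then obtain s where s: "s \<in> nat_trans R P ?M" "ncomp P ?M ?e s = nid P"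
    unfolding lifts_def using nid_nat[OF bP] by blast
  have "ncomp P ?F ?\<pi> (ncomp P ?M \<kappa> s) = nid P"
    using ncomp_assoc[OF bP M s(1), of ?F ?\<pi> \<kappa>] s(2) by simp
  with ncomp_nat[OF bP M F s(1) k] show ?thesis by blast
qed

text \<open>The cover is indexed by all elements of \<open>P\<close>. Being a retract of a free
  functor does not refer to the type of the test objects, and free functors lift against surjections
  between functors of any type.\<close>

theorem projective_lifts_all:
  fixes P :: "('r, 'm) bfun"
  assumes P: "projective (bfun_cat R) P" and X: "bfunctor X" "bfunctor Y" and e: "nsurj X Y e"
  shows "lifts P X Y e"
proof -
  let ?S = "SIGMA C:fincats. el P C"
  have bP [simp]: "bfunctor P" using P by (simp add: projective_def)
  have c: "fst i \<in> fincats" "snd i \<in> el P (fst i)" if "i \<in> ?S" for i using that by auto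
  have "gspan P (\<lambda>C. {x. (C, x) \<in> ?S}) C x" if "fincat C" "x \<in> el P C" for C x
    using gspan.act[of C C x "\<lambda>C. {x. (C, x) \<in> ?S}" P "bident R C"] that by simp
  then have "generates P (\<lambda>C. {x. (C, x) \<in> ?S})"
    by (intro generates_trans[OF bP generates_all[OF bP]])
  from projective_retract[OF P _ this] obtain i where "i \<in> nat_trans R P (free_fun ?S fst)"
    "ncomp P (free_fun ?S fst) (free_lift ?S fst P snd) i = nid P" by blast
  then show ?thesis
    using e[unfolded nsurj_def]
    by (intro lifts_retract[OF bP free_functor[OF c(1)] X _ _ free_lift_nat[OF c(1) bP c(2)] _ free_lifts[OF c(1) X e]]) blast+
qed

end

context coefficients
begin

section \<open>The internal Hom\<close>

lemma ihom_simps [simp]: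
  "vob (ihom R M N) K = nat_mod R M (yd R K N)"
  "vmap (ihom R M N) K K' f \<eta> = ntr M (\<lambda>C x. vmap N (C \<times>\<^sub>c K) (C \<times>\<^sub>c K') (mprod R C C K K' (bident R C) f) (\<eta> C x))"
  by (simp_all add: ihom_def yd_map_def ntr_def)

lemma ihom_closed:
  assumes M [simp]: "bfunctor M" and N [simp]: "bfunctor N" and [simp]: "fincat K" "fincat K'" "f \<in> bh K K'"
    and e: "\<eta> \<in> nat_trans R M (yd R K N)"
  shows "ntr M (\<lambda>C x. vmap N (C \<times>\<^sub>c K) (C \<times>\<^sub>c K') (mprod R C C K K' (bident R C) f) (\<eta> C x)) \<in> nat_trans R M (yd R K' N)"
proof -
  note [simp] = nt_simps[OF M yd_functor[OF _ N] e, simplified]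
  show ?thesis by (rule ntr_nat_trans) (simp_all add: lin_mapI)
qed

lemma ihom_functor [simp]:
  assumes M [simp]: "bfunctor M" and N [simp]: "bfunctor N"
  shows "bfunctor (ihom R M N)"
proof (rule biset_functorI)
  note c [simp] = nt_closed[OF M yd_functor[OF _ N], simplified]
  note [simp] = ihom_closed[OF M N]
  show "module R (vob (ihom R M N) K)" if "fincat K" for K using that by (simp add: nat_mod_module)
  show "bilin_map R (bhom R K K') (vob (ihom R M N) K) (vob (ihom R M N) K') (vmap (ihom R M N) K K')"
    if "fincat K" "fincat K'" for K K'
    by (rule bilin_mapI) (use that in \<open>auto intro!: ntr_cong\<close>)
  show "vmap (ihom R M N) K K (bident R K) \<eta> = \<eta>" if "fincat K" "\<eta> \<in> el (ihom R M N) K" for K \<eta>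
  proof -
    have "vmap (ihom R M N) K K (bident R K) \<eta> = ntr M \<eta>" using that by (auto intro!: ntr_cong)
    then show ?thesis using that ntr_ext[of \<eta>] by simp
  qed
  show "vmap (ihom R M N) K K'' (bcmp R K K' K'' g f) \<eta> = vmap (ihom R M N) K' K'' g (vmap (ihom R M N) K K' f \<eta>)"
    if "fincat K" "fincat K'" "fincat K''" "f \<in> bh K K'" "g \<in> bh K' K''" "\<eta> \<in> el (ihom R M N) K" for K K' K'' f g \<eta>
    using that by (auto intro!: ntr_cong)
qed

lemma yd_nsurj:
  assumes K [simp]: "fincat K" and X [simp]: "bfunctor X" and Y [simp]: "bfunctor Y" and e: "nsurj X Y e"
  shows "nsurj (yd R K X) (yd R K Y) (ntr (yd R K X) (\<lambda>C. e (C \<times>\<^sub>c K)))"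
  unfolding nsurj_def
proof
  have n: "e \<in> nat_trans R X Y" using e by (simp add: nsurj_def)
  note [simp] = nt_simps[OF X Y n]
  show "ntr (yd R K X) (\<lambda>C. e (C \<times>\<^sub>c K)) \<in> nat_trans R (yd R K X) (yd R K Y)"
    by (rule ntr_nat_trans) (simp_all add: lin_mapI)
  show "\<forall>C\<in>fincats. \<forall>y\<in>el (yd R K Y) C. \<exists>x\<in>el (yd R K X) C. ntr (yd R K X) (\<lambda>C. e (C \<times>\<^sub>c K)) C x = y"
    using e by (auto simp: nsurj_def)
qed

text \<open>An element of the internal Hom at \<open>K\<close> is a map into the shift by
  \<open>K\<close>, and \<open>yd_nsurj\<close> keeps \<open>e\<close> surjective there.
  Surjectivity of composition with \<open>e\<close> at \<open>K\<close> is thus the lifting property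
  \<open>l\<close>.\<close>

lemma ihom_nsurj:
  assumes Q [simp]: "bfunctor Q" and X [simp]: "bfunctor X" and Y [simp]: "bfunctor Y" and e: "nsurj X Y e"
    and l: "\<And>K. fincat K \<Longrightarrow> lifts Q (yd R K X) (yd R K Y) (ntr (yd R K X) (\<lambda>C. e (C \<times>\<^sub>c K)))"
  shows "nsurj (ihom R Q X) (ihom R Q Y) (ntr (ihom R Q X) (\<lambda>K \<eta>. ntr Q (\<lambda>C x. e (C \<times>\<^sub>c K) (\<eta> C x))))"
  unfolding nsurj_def
proof
  let ?E = "\<lambda>K \<eta>. ntr Q (\<lambda>C x. e (C \<times>\<^sub>c K) (\<eta> C x))"
  have n: "e \<in> nat_trans R X Y" using e by (simp add: nsurj_def)
  note [simp] = nt_simps[OF X Y n]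
  have y: "ntr (yd R K X) (\<lambda>C. e (C \<times>\<^sub>c K)) \<in> nat_trans R (yd R K X) (yd R K Y)" if "fincat K" for K
    using yd_nsurj[OF that X Y e] by (simp add: nsurj_def)
  have E: "?E K \<eta> = ncomp Q (yd R K X) (ntr (yd R K X) (\<lambda>C. e (C \<times>\<^sub>c K))) \<eta>" if "fincat K" "\<eta> \<in> nat_trans R Q (yd R K X)" for K \<eta>
    unfolding ncomp_def using nt_closed[OF Q yd_functor[OF _ X] that(2)] that by (auto intro!: ntr_cong)
  have Ec [simp]: "?E K \<eta> \<in> nat_trans R Q (yd R K Y)" if "fincat K" "\<eta> \<in> nat_trans R Q (yd R K X)" for K \<eta>
    unfolding E[OF that] using that y by (intro ncomp_nat) simp_all
  note c [simp] = nt_closed[OF Q yd_functor[OF _ X], simplified]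
  show "ntr (ihom R Q X) ?E \<in> nat_trans R (ihom R Q X) (ihom R Q Y)"
    by (rule ntr_nat_trans) (auto intro!: lin_mapI ntr_cong)
  show "\<forall>K\<in>fincats. \<forall>\<theta>\<in>el (ihom R Q Y) K. \<exists>\<eta>\<in>el (ihom R Q X) K. ntr (ihom R Q X) ?E K \<eta> = \<theta>"
  proof (intro ballI)
    fix K \<theta> assume K: "fincat K" and t: "\<theta> \<in> el (ihom R Q Y) K"
    then obtain \<eta> where "\<eta> \<in> nat_trans R Q (yd R K X)" "ncomp Q (yd R K X) (ntr (yd R K X) (\<lambda>C. e (C \<times>\<^sub>c K))) \<eta> = \<theta>"
      using l[OF K] unfolding lifts_def by auto
    then show "\<exists>\<eta>\<in>el (ihom R Q X) K. ntr (ihom R Q X) ?E K \<eta> = \<theta>"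
      using K by (intro bexI[of _ \<eta>]) (simp_all add: E)
  qed
qed

end

context universe
begin

theorem projective_tens:
  fixes P Q :: "('r, 'm) bfun"
  assumes P: "projective (bfun_cat R) P" and Q: "projective (bfun_cat R) Q"
  shows "projective (bfun_cat R) (tens R Q P)"
proof (rule lifts_projective)
  have bP [simp]: "bfunctor P" and bQ [simp]: "bfunctor Q" using P Q by (simp_all add: projective_def)
  show "bfunctor (tens R Q P)" by simp
  fix X Y :: "('r, 'm) bfun" and e
  assume X [simp]: "bfunctor X" and Y [simp]: "bfunctor Y" and e: "nsurj X Y e"
  let ?E = "ntr (ihom R Q X) (\<lambda>K \<eta>. ntr Q (\<lambda>C x. e (C \<times>\<^sub>c K) (\<eta> C x)))"
  have n [simp]: "e \<in> nat_trans R X Y" using e by (simp add: nsurj_def)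
  note [simp] = nt_simps[OF X Y n]
  have "nsurj (ihom R Q X) (ihom R Q Y) ?E"
    by (rule ihom_nsurj[OF bQ X Y e], rule projective_lifts[OF Q]) (simp_all add: yd_nsurj[OF _ X Y e])
  \<comment> \<open>The elements of \<open>ihom R Q X\<close> are transformations, not elements of
    \<open>'m\<close>, so \<open>P\<close> must lift beyond the type in which it is assumed
    projective.\<close>
  then have L: "lifts P (ihom R Q X) (ihom R Q Y) ?E"
    by (intro projective_lifts_all[OF P]) simp_all
  show "lifts (tens R Q P) X Y e"
    unfolding lifts_def
  proof
    fix f assume f [simp]: "f \<in> nat_trans R (tens R Q P) Y"
    note fs [simp] = nt_simps[OF tens_functor[OF bQ bP] Y f]
    \<comment> \<open>The transpose of \<open>f\<close> under the adjunction between tensor product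
      and internal Hom. Its lift \<open>g\<close> is transposed back by
      \<open>tens_univ\<close>.\<close>
    let ?f = "\<lambda>C x. ntr Q (\<lambda>D y. f (D \<times>\<^sub>c C) (tu Q P D C y x))"
    have fc [simp]: "?f C x \<in> nat_trans R Q (yd R C Y)" if "fincat C" "x \<in> el P C" for C x
      by (rule ntr_nat_trans) (use that in \<open>simp_all add: lin_mapI tu_left\<close>)
    have "ntr P ?f \<in> nat_trans R P (ihom R Q Y)"
      by (rule ntr_nat_trans) (auto intro!: lin_mapI ntr_cong simp: tu_right)
    then obtain g where g: "g \<in> nat_trans R P (ihom R Q X)" and eg: "ncomp P (ihom R Q X) ?E g = ntr P ?f"
      using L unfolding lifts_def by blast
    note gs [simp] = nt_simps[OF bP ihom_functor[OF bQ X] g, simplified]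
    note gss [simp] = nt_simps[OF bQ yd_functor[OF _ X] gs(1), simplified]
    have "bifam Q P X (\<lambda>D C y x. g C x D y)"
      by (rule bifamI) (auto intro!: bilin_mapI)
    from tens_univ[OF bQ bP X this] obtain h where h [simp]: "h \<in> nat_trans R (tens R Q P) X"
      and hu: "\<And>D C y x. \<lbrakk>fincat D; fincat C; y \<in> el Q D; x \<in> el P C\<rbrakk> \<Longrightarrow>
        h (D \<times>\<^sub>c C) (tu Q P D C y x) = g C x D y" by blast
    have "ncomp (tens R Q P) X e h = f"
    proof (rule tens_eqI[of Q P Y])
      fix D C y x assume c [simp]: "fincat D" "fincat C" "y \<in> el Q D" "x \<in> el P C"
      have "ncomp P (ihom R Q X) ?E g C x D y = ntr P ?f C x D y" unfolding eg ..
      then show "ncomp (tens R Q P) X e h (D \<times>\<^sub>c C) (tu Q P D C y x) = f (D \<times>\<^sub>c C) (tu Q P D C y x)"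
        by (simp add: hu)
    qed simp_all
    then show "\<exists>g\<in>nat_trans R (tens R Q P) X. ncomp (tens R Q P) X e g = f" by (intro bexI[of _ h]) simp_all
  qed
qed

end

context coefficients
begin

section \<open>Projectivity of the internal Hom\<close>

lemma op_op [simp]: "op_cat (op_cat C) = C"
  by (simp add: op_cat_def)

lemma lin_map_sum:
  assumes A: "module R A" and B: "module R B" and h: "\<And>i. i \<in> S \<Longrightarrow> lin_map R A B (h i)" and S: "finite S"
  shows "lin_map R A B (\<lambda>x. finsum B (\<lambda>i. h i x) S)"
proof -
  interpret B: module R B by fact
  note s = lin_map_simps[OF A B h]
  show ?thesis
  proof (rule lin_mapI)
    fix x assume x: "x \<in> carrier A"
    show "finsum B (\<lambda>i. h i x) S \<in> carrier B" using x s by (intro B.finsum_closed) auto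
    show "finsum B (\<lambda>i. h i (r \<odot>\<^bsub>A\<^esub> x)) S = r \<odot>\<^bsub>B\<^esub> finsum B (\<lambda>i. h i x) S" if r: "r \<in> carrier R" for r
    proof -
      have "finsum B (\<lambda>i. h i (r \<odot>\<^bsub>A\<^esub> x)) S = finsum B (\<lambda>i. r \<odot>\<^bsub>B\<^esub> h i x) S"
        by (rule B.finsum_cong') (use x r s in auto)
      also have "\<dots> = r \<odot>\<^bsub>B\<^esub> finsum B (\<lambda>i. h i x) S"
        by (rule B.finsum_smult_ldistr[symmetric]) (use x r s S in auto)
      finally show ?thesis .
    qed
    fix y assume y: "y \<in> carrier A"
    have "finsum B (\<lambda>i. h i (x \<oplus>\<^bsub>A\<^esub> y)) S = finsum B (\<lambda>i. h i x \<oplus>\<^bsub>B\<^esub> h i y) S"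
      by (rule B.finsum_cong') (use x y s in auto)
    also have "\<dots> = finsum B (\<lambda>i. h i x) S \<oplus>\<^bsub>B\<^esub> finsum B (\<lambda>i. h i y) S"
      by (rule B.finsum_addf) (use x y s in auto)
    finally show "finsum B (\<lambda>i. h i (x \<oplus>\<^bsub>A\<^esub> y)) S = finsum B (\<lambda>i. h i x) S \<oplus>\<^bsub>B\<^esub> finsum B (\<lambda>i. h i y) S" .
  qed
qed

text \<open>\<open>fin_gen\<close> is tested on the subfunctor spanned by \<open>S\<close>; its
  values are submodules because \<open>gspan\<close> is closed under scalars and hence under
  negation.\<close>

lemma fin_gen_generates:
  assumes M [simp]: "bfunctor M" and f: "fin_gen R M"
  shows "\<exists>S. finite S \<and> S \<subseteq> (SIGMA C:fincats. el M C) \<and> generates M (\<lambda>C. {x. (C, x) \<in> S})"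
proof -
  from f obtain S where S: "finite S" "S \<subseteq> (SIGMA C:fincats. el M C)"
    and sub: "\<forall>N. (\<forall>C\<in>fincats. submodule (N C) R (vob M C)) \<and>
      (\<forall>C\<in>fincats. \<forall>D\<in>fincats. \<forall>f\<in>bh C D. \<forall>x\<in>N C. vmap M C D f x \<in> N D) \<and> (\<forall>(C, x)\<in>S. x \<in> N C) \<longrightarrow>
      (\<forall>C\<in>fincats. N C = el M C)"
    unfolding fin_gen_def by (elim exE conjE) (rule that)
  let ?G = "\<lambda>C. {x. (C, x) \<in> S}"
  have "\<forall>C\<in>fincats. Collect (gspan M ?G C) = el M C"
  proof (intro sub[THEN spec, THEN mp] conjI)
    show "\<forall>C\<in>fincats. submodule (Collect (gspan M ?G C)) R (vob M C)"
    proof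
      fix C assume [simp]: "fincat C"
      interpret V: module R "vob M C" by simp
      have inv: "gspan M ?G C (\<ominus>\<^bsub>vob M C\<^esub> x)" if x: "gspan M ?G C x" for x
        using gspan_smult[OF M x, of "\<ominus> \<one>"] gspan_closed[OF M x] by (simp add: V.smult_l_minus)
      show "submodule (Collect (gspan M ?G C)) R (vob M C)"
        by (rule V.submoduleI)
          (auto intro: gspan.zero gspan.add gspan_smult[OF M] inv dest: gspan_closed[OF M])
    qed
    show "\<forall>C\<in>fincats. \<forall>D\<in>fincats. \<forall>f\<in>bh C D. \<forall>x\<in>Collect (gspan M ?G C). vmap M C D f x \<in> Collect (gspan M ?G D)"
      by (auto intro: gspan_vmap[OF M])
    have "gspan M ?G C x" if "(C, x) \<in> S" for C x
      using gspan.act[of C C x ?G M "bident R C"] that S by auto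
    then show "\<forall>(C, x)\<in>S. x \<in> Collect (gspan M ?G C)" by auto
  qed
  with S show ?thesis unfolding generates_def by blast
qed

lemma mdual_bident [simp]:
  assumes C: "fincat C"
  shows "mdual R C C (bident R C) = bident R (op_cat C)"
proof -
  have "bdual (idb C) = idb (op_cat C)"
    by (rule biset_eqI[of _ "op_cat C" "op_cat C"]) (use C in \<open>auto simp: Hom_def\<close>)
  then show ?thesis using C by (simp add: bident_def)
qed

text \<open>The shift with the fixed factor on the left. It is the target of evaluation: an element
  of \<open>ihom R P Q\<close> at \<open>K\<close>, evaluated at an element of \<open>P\<close> over
  \<open>C\<close>, lies in \<open>Q\<close> over \<open>C \<times>\<^sub>c K\<close>.\<close>

definition yd_left :: "fcat \<Rightarrow> ('r, 'm) bfun \<Rightarrow> ('r, 'm) bfun" where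
  "yd_left C M = \<lparr>vob = (\<lambda>K. vob M (C \<times>\<^sub>c K)),
     vmap = (\<lambda>K K' f. vmap M (C \<times>\<^sub>c K) (C \<times>\<^sub>c K') (mprod R C C K K' (bident R C) f))\<rparr>"

lemma yd_left_simps [simp]:
  "vob (yd_left C M) K = vob M (C \<times>\<^sub>c K)"
  "vmap (yd_left C M) K K' f = vmap M (C \<times>\<^sub>c K) (C \<times>\<^sub>c K') (mprod R C C K K' (bident R C) f)"
  by (simp_all add: yd_left_def)

lemma yd_left_functor [simp]: "fincat C \<Longrightarrow> bfunctor M \<Longrightarrow> bfunctor (yd_left C M)"
  by (rule biset_functorI) (auto intro!: bilin_mapI)

text \<open>\<^term>\<open>yd_left C\<close> is left adjoint to \<^term>\<open>yd R (op_cat C)\<close>, with unit \<^const>\<open>coev\<close> and counit \<^const>\<open>ev\<close>.\<close>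

lemma yd_left_lifts:
  assumes C [simp]: "fincat C" and Q [simp]: "bfunctor Q" and X [simp]: "bfunctor X" and Y [simp]: "bfunctor Y"
    and e: "e \<in> nat_trans R X Y"
    and l: "lifts Q (yd R (op_cat C) X) (yd R (op_cat C) Y) (ntr (yd R (op_cat C) X) (\<lambda>A. e (A \<times>\<^sub>c op_cat C)))"
  shows "lifts (yd_left C Q) X Y e"
  unfolding lifts_def
proof
  let ?C = "op_cat C"
  note [simp] = nt_simps[OF X Y e]
  \<comment> \<open>The duality data are used for \<open>op_cat C\<close>, whose opposite is
    literally \<open>C\<close>. Hence \<open>C\<close> appears as the left factor.\<close>
  have coev' [simp]: "coev A ?C \<in> bh A (C \<times>\<^sub>c A \<times>\<^sub>c ?C)" if "fincat A" for A
    using coev_closed[of A ?C] that by simp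
  have ev' [simp]: "ev ?C K \<in> bh ((C \<times>\<^sub>c K) \<times>\<^sub>c ?C) K" if "fincat K" for K
    using ev_closed[of ?C K] that by simp
  have coevn: "bcmp R A (C \<times>\<^sub>c A \<times>\<^sub>c ?C) (C \<times>\<^sub>c B \<times>\<^sub>c ?C)
      (mprod R C C (A \<times>\<^sub>c ?C) (B \<times>\<^sub>c ?C) (bident R C) (mprod R A B ?C ?C f (bident R ?C))) (coev A ?C) =
      bcmp R A B (C \<times>\<^sub>c B \<times>\<^sub>c ?C) (coev B ?C) f" if [simp]: "fincat A" "fincat B" "f \<in> bh A B" for A B f
    using coev_natural[of A B ?C ?C f "bident R ?C"] by (simp add: mdual_bident)
  have evn: "bcmp R ((C \<times>\<^sub>c K) \<times>\<^sub>c ?C) K K' g (ev ?C K) = bcmp R ((C \<times>\<^sub>c K) \<times>\<^sub>c ?C) ((C \<times>\<^sub>c K') \<times>\<^sub>c ?C) K' (ev ?C K')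
      (mprod R (C \<times>\<^sub>c K) (C \<times>\<^sub>c K') ?C ?C (mprod R C C K K' (bident R C) g) (bident R ?C))"
    if "fincat K" "fincat K'" "g \<in> bh K K'" for K K' g
    using ev_natural[of ?C K K' g] that by simp
  have ce: "bcmp R (C \<times>\<^sub>c K) (C \<times>\<^sub>c (C \<times>\<^sub>c K) \<times>\<^sub>c ?C) (C \<times>\<^sub>c K)
      (mprod R C C ((C \<times>\<^sub>c K) \<times>\<^sub>c ?C) K (bident R C) (ev ?C K)) (coev (C \<times>\<^sub>c K) ?C) = bident R (C \<times>\<^sub>c K)" if "fincat K" for K
    using coev_ev[of ?C K] that by simp
  fix k assume k: "k \<in> nat_trans R (yd_left C Q) Y"
  note ks [simp] = nt_simps[OF yd_left_functor[OF C Q] Y k, simplified]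
  \<comment> \<open>The transpose of \<open>k\<close>, formed with the unit of the
    adjunction.\<close>
  let ?k = "ntr Q (\<lambda>A q. k (A \<times>\<^sub>c ?C) (vmap Q A (C \<times>\<^sub>c A \<times>\<^sub>c ?C) (coev A ?C) q))"
  have "?k \<in> nat_trans R Q (yd R ?C Y)"
    by (rule ntr_nat_trans) (simp_all add: lin_mapI ks(5)[symmetric] coevn del: ks(5))
  then obtain g where g: "g \<in> nat_trans R Q (yd R ?C X)"
    and eg: "ncomp Q (yd R ?C X) (ntr (yd R ?C X) (\<lambda>A. e (A \<times>\<^sub>c ?C))) g = ?k"
    using l unfolding lifts_def by blast
  note gs [simp] = nt_simps[OF Q yd_functor[OF op_cat_fincats[OF C] X] g, simplified]
  \<comment> \<open>The lift transposed back with the counit; the triangle identity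
    \<open>ce\<close> makes it lift \<open>k\<close>.\<close>
  let ?g = "ntr (yd_left C Q) (\<lambda>K q. vmap X ((C \<times>\<^sub>c K) \<times>\<^sub>c ?C) K (ev ?C K) (g (C \<times>\<^sub>c K) q))"
  have gn: "?g \<in> nat_trans R (yd_left C Q) X"
    by (rule ntr_nat_trans) (simp_all add: lin_mapI evn)
  have "ncomp (yd_left C Q) X e ?g = k"
  proof (rule nat_trans_ext[OF ncomp_nat[OF yd_left_functor[OF C Q] X Y gn e] k])
    fix K q assume K [simp]: "fincat K" and "q \<in> el (yd_left C Q) K"
    then have q [simp]: "q \<in> el Q (C \<times>\<^sub>c K)" by simp
    have "ncomp Q (yd R ?C X) (ntr (yd R ?C X) (\<lambda>A. e (A \<times>\<^sub>c ?C))) g (C \<times>\<^sub>c K) q = ?k (C \<times>\<^sub>c K) q" unfolding eg ..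
    then have "e ((C \<times>\<^sub>c K) \<times>\<^sub>c ?C) (g (C \<times>\<^sub>c K) q) =
        k ((C \<times>\<^sub>c K) \<times>\<^sub>c ?C) (vmap Q (C \<times>\<^sub>c K) (C \<times>\<^sub>c (C \<times>\<^sub>c K) \<times>\<^sub>c ?C) (coev (C \<times>\<^sub>c K) ?C) q)" by simp
    then show "ncomp (yd_left C Q) X e ?g K q = k K q"
      by (simp add: ks(5)[symmetric] ce del: ks(5))
  qed
  with gn show "\<exists>g\<in>nat_trans R (yd_left C Q) X. ncomp (yd_left C Q) X e g = k" by blast
qed

end

context universe
begin

theorem projective_ihom:
  fixes P Q :: "('r, 'm) bfun"
  assumes P: "projective (bfun_cat R) P" and fg: "fin_gen R P" and Q: "projective (bfun_cat R) Q"
  shows "projective (bfun_cat R) (ihom R P Q)"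
proof (rule lifts_projective)
  have bP [simp]: "bfunctor P" and bQ [simp]: "bfunctor Q" using P Q by (simp_all add: projective_def)
  show "bfunctor (ihom R P Q)" by simp
  obtain S where S: "finite S" "S \<subseteq> (SIGMA C:fincats. el P C)" "generates P (\<lambda>C. {x. (C, x) \<in> S})"
    using fin_gen_generates[OF bP fg] by blast
  have c [simp]: "fst i \<in> fincats" "snd i \<in> el P (fst i)" if "i \<in> S" for i using that S by auto
  have F: "bfunctor (free_fun S fst)" by (rule free_functor) (rule c)
  have l: "free_lift S fst P snd \<in> nat_trans R (free_fun S fst) P" by (rule free_lift_nat) (simp_all add: c)
  \<comment> \<open>A section of the free cover on the generators. Its entries
    \<open>s D y i\<close> are coordinates of \<open>y\<close>, that is, the linear forms of a dual
    basis.\<close>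
  obtain s where s: "s \<in> nat_trans R P (free_fun S fst)" "ncomp P (free_fun S fst) (free_lift S fst P snd) s = nid P"
    using projective_retract[OF P S(2,3)] by blast
  note ss = nt_simps[OF bP F s(1)]
  have s1 [simp]: "s D y i \<in> bh (fst i) D" if "i \<in> S" "fincat D" "y \<in> el P D" for D y i
    using ss(1)[of D y] that by simp
  have s2 [simp]: "s D (y \<oplus>\<^bsub>vob P D\<^esub> y') i = s D y i \<oplus>\<^bsub>bhom R (fst i) D\<^esub> s D y' i"
    if "i \<in> S" "fincat D" "y \<in> el P D" "y' \<in> el P D" for D y y' i
    using ss(2)[of D y y'] that by simp
  have s3 [simp]: "s D (r \<odot>\<^bsub>vob P D\<^esub> y) i = r \<odot>\<^bsub>bhom R (fst i) D\<^esub> s D y i"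
    if "i \<in> S" "fincat D" "y \<in> el P D" "r \<in> carrier R" for D y r i
    using ss(3)[of D r y] that by simp
  have s5 [simp]: "s E (vmap P D E f y) i = bcmp R (fst i) D E f (s D y i)"
    if "i \<in> S" "fincat D" "fincat E" "y \<in> el P D" "f \<in> bh D E" for D E y f i
    using ss(5)[of D E f y] that by simp
  \<comment> \<open>The dual basis identity. Since \<open>S\<close> is finite, the sum may run over
    all of \<open>S\<close> instead of the support of the coordinates.\<close>
  have basis: "finsum (vob P D) (\<lambda>i. vmap P (fst i) D (s D y i) (snd i)) S = y"
    if D: "fincat D" and y: "y \<in> el P D" for D y
  proof -
    have "free_lift S fst P snd D (s D y) = finsum (vob P D) (\<lambda>i. vmap P (fst i) D (s D y i) (snd i)) S"
      by (rule free_lift_superset) (use S(1) D ss(1)[OF D y] in auto)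
    moreover have "free_lift S fst P snd D (s D y) = y"
      using ncomp_apply[OF D y, of "free_fun S fst" "free_lift S fst P snd" s] s(2) D y by simp
    ultimately show ?thesis by simp
  qed
  let ?H = "ihom R P Q"
  \<comment> \<open>\<open>p i\<close> sends \<open>q\<close> to the transformation that acts on
    \<open>q\<close> by the \<open>i\<close>-th coordinate. Evaluation at the generators goes the
    other way, and the sum of the composites is the identity, which exhibits the retract.\<close>
  define p where "p i K q = ntr P (\<lambda>D y. vmap Q (fst i \<times>\<^sub>c K) (D \<times>\<^sub>c K) (mprod R (fst i) D K K (s D y i) (bident R K)) q)" for i K q
  have p [simp]: "p i K q \<in> nat_trans R P (yd R K Q)" if "i \<in> S" "fincat K" "q \<in> el Q (fst i \<times>\<^sub>c K)" for i K q
    unfolding p_def by (rule ntr_nat_trans) (use that in \<open>simp_all add: lin_mapI\<close>)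
  have pn: "ntr (yd_left (fst i) Q) (p i) \<in> nat_trans R (yd_left (fst i) Q) ?H" if i: "i \<in> S" for i
    by (rule ntr_nat_trans) (use i in \<open>auto intro!: lin_mapI ntr_cong simp: p_def[of i] p[unfolded p_def]\<close>)
  \<comment> \<open>Test functors now have values in the type of natural transformations. The
    projectivity of \<open>Q\<close> is assumed over \<open>'m\<close> only, so it enters through
    \<open>projective_lifts_all\<close>.\<close>
  fix X Y :: "('r, fcat \<Rightarrow> 'm \<Rightarrow> 'm) bfun" and e
  assume X [simp]: "bfunctor X" and Y [simp]: "bfunctor Y" and e: "nsurj X Y e"
  have en: "e \<in> nat_trans R X Y" using e by (simp add: nsurj_def)
  note es = nt_simps[OF X Y en]
  have L: "lifts (yd_left (fst i) Q) X Y e" if i: "i \<in> S" for i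
    by (rule yd_left_lifts[OF c(1)[OF i] bQ X Y en], rule projective_lifts_all[OF Q])
      (simp_all add: yd_nsurj[OF op_cat_fincats[OF c(1)[OF i]] X Y e] i)
  show "lifts ?H X Y e"
    unfolding lifts_def
  proof
    fix \<phi> assume \<phi>: "\<phi> \<in> nat_trans R ?H Y"
    note ps = nt_simps[OF ihom_functor[OF bP bQ] Y \<phi>]
    have "\<forall>i\<in>S. \<exists>g. g \<in> nat_trans R (yd_left (fst i) Q) X \<and>
        ncomp (yd_left (fst i) Q) X e g = ncomp (yd_left (fst i) Q) ?H \<phi> (ntr (yd_left (fst i) Q) (p i))"
    proof
      fix i assume i: "i \<in> S"
      have "ncomp (yd_left (fst i) Q) ?H \<phi> (ntr (yd_left (fst i) Q) (p i)) \<in> nat_trans R (yd_left (fst i) Q) Y"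
        using i pn[OF i] \<phi> by simp
      with L[OF i] show "\<exists>g. g \<in> nat_trans R (yd_left (fst i) Q) X \<and>
        ncomp (yd_left (fst i) Q) X e g = ncomp (yd_left (fst i) Q) ?H \<phi> (ntr (yd_left (fst i) Q) (p i))"
        unfolding lifts_def by blast
    qed
    then obtain g where g: "\<And>i. i \<in> S \<Longrightarrow> g i \<in> nat_trans R (yd_left (fst i) Q) X"
      and eg: "\<And>i. i \<in> S \<Longrightarrow> ncomp (yd_left (fst i) Q) X e (g i) = ncomp (yd_left (fst i) Q) ?H \<phi> (ntr (yd_left (fst i) Q) (p i))"
      by metis
    have egs: "e K (g i K q) = \<phi> K (p i K q)" if i: "i \<in> S" and K: "fincat K" and q: "q \<in> el Q (fst i \<times>\<^sub>c K)" for i K q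
    proof -
      have "ncomp (yd_left (fst i) Q) X e (g i) K q = ncomp (yd_left (fst i) Q) ?H \<phi> (ntr (yd_left (fst i) Q) (p i)) K q"
        unfolding eg[OF i] ..
      then show ?thesis using K q by simp
    qed
    note gs [simp] = nt_simps[OF yd_left_functor[OF c(1) bQ] X g, simplified]
    have hc [simp]: "\<eta> (fst i) (snd i) \<in> el Q (fst i \<times>\<^sub>c K)"
      if "i \<in> S" "fincat K" "\<eta> \<in> nat_trans R P (yd R K Q)" for \<eta> i K
      using nt_closed[OF bP yd_functor[OF that(2) bQ] that(3), of "fst i" "snd i"] that by simp
    \<comment> \<open>Evaluate at each generator, apply the lift \<open>g i\<close> belonging to it,
      and add up. The sum is over the finite set \<open>S\<close>.\<close>
    let ?h = "\<lambda>K \<eta>. finsum (vob X K) (\<lambda>i. g i K (\<eta> (fst i) (snd i))) S"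
    have hn: "ntr ?H ?h \<in> nat_trans R ?H X"
    proof (rule ntr_nat_trans[OF ihom_functor[OF bP bQ]])
      fix K assume K [simp]: "fincat K"
      show "lin_map R (vob ?H K) (vob X K) (?h K)"
      proof (rule lin_map_sum[OF _ _ _ S(1)])
        fix i assume "i \<in> S"
        then show "lin_map R (vob ?H K) (vob X K) (\<lambda>\<eta>. g i K (\<eta> (fst i) (snd i)))"
          by (intro lin_mapI) simp_all
      qed (simp_all add: nat_mod_module)
      fix K' f \<eta> assume K' [simp]: "fincat K'" and f [simp]: "f \<in> bh K K'" and "\<eta> \<in> el ?H K"
      then have \<eta> [simp]: "\<eta> \<in> nat_trans R P (yd R K Q)" by simp
      interpret XK': module R "vob X K'" by simp
      have "?h K' (vmap ?H K K' f \<eta>) = finsum (vob X K') (\<lambda>i. vmap X K K' f (g i K (\<eta> (fst i) (snd i)))) S"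
        by (rule XK'.finsum_cong') auto
      also have "\<dots> = vmap X K K' f (?h K \<eta>)"
        by (rule lin_map_finsum[symmetric, of R "vob X K"]) (auto intro!: lin_mapI S(1))
      finally show "?h K' (vmap ?H K K' f \<eta>) = vmap X K K' f (?h K \<eta>)" .
    qed
    have "ncomp ?H X e (ntr ?H ?h) = \<phi>"
    proof (rule nat_trans_ext[OF ncomp_nat[OF ihom_functor[OF bP bQ] X Y hn en] \<phi>])
      fix K \<eta> assume K [simp]: "fincat K" and h: "\<eta> \<in> el ?H K"
      then have \<eta> [simp]: "\<eta> \<in> nat_trans R P (yd R K Q)" by simp
      interpret YK: module R "vob Y K" by simp
      interpret HK: module R "nat_mod R P (yd R K Q)" by (rule nat_mod_module) simp_all
      let ?p = "\<lambda>i. p i K (\<eta> (fst i) (snd i))"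
      let ?s = "finsum (nat_mod R P (yd R K Q)) ?p S"
      have pc: "?p i \<in> carrier (nat_mod R P (yd R K Q))" if "i \<in> S" for i using that by simp
      have s: "?s \<in> nat_trans R P (yd R K Q)" using HK.finsum_closed[of ?p S] pc by auto
      \<comment> \<open>The transformation is rebuilt from its values at the generators: naturality
        and linearity of \<open>\<eta>\<close> move the sum inside, where \<open>basis\<close>
        applies.\<close>
      have "?s = \<eta>"
      proof (rule nat_trans_ext[OF s \<eta>])
        fix D y assume D [simp]: "fincat D" and y [simp]: "y \<in> el P D"
        note hs = nt_simps[OF bP yd_functor[OF K bQ] \<eta>]
        note yc [simp] = nt_closed[OF bP yd_functor[OF K bQ] _ D, simplified]
        interpret QD: module R "vob Q (D \<times>\<^sub>c K)" by simp
        have "?s D y = finsum (vob Q (D \<times>\<^sub>c K)) (\<lambda>i. ?p i D y) S"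
          by (rule lin_map_finsum[of R _ _ "\<lambda>\<theta>. \<theta> D y"])
            (auto intro!: lin_mapI nat_mod_module S(1))
        also have "\<dots> = finsum (vob Q (D \<times>\<^sub>c K)) (\<lambda>i. \<eta> D (vmap P (fst i) D (s D y i) (snd i))) S"
          by (rule QD.finsum_cong') (auto simp: p_def hs(5))
        also have "\<dots> = \<eta> D (finsum (vob P D) (\<lambda>i. vmap P (fst i) D (s D y i) (snd i)) S)"
          by (rule lin_map_finsum[symmetric, of R "vob P D"]) (auto intro!: S(1) nt_lin[OF \<eta>, simplified])
        also have "\<dots> = \<eta> D y" by (simp add: basis)
        finally show "?s D y = \<eta> D y" .
      qed
      then have "\<phi> K \<eta> = \<phi> K ?s" by simp
      also have "\<dots> = finsum (vob Y K) (\<lambda>i. \<phi> K (?p i)) S"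
        by (rule lin_map_finsum[of R "nat_mod R P (yd R K Q)"])
          (use nt_lin[OF \<phi> K] pc S(1) in \<open>auto intro!: nat_mod_module\<close>)
      also have "\<dots> = finsum (vob Y K) (\<lambda>i. e K (g i K (\<eta> (fst i) (snd i)))) S"
        by (rule YK.finsum_cong') (simp_all add: egs ps(1) Pi_iff)
      also have "\<dots> = e K (?h K \<eta>)"
        by (rule lin_map_finsum[symmetric, of R "vob X K"]) (auto intro!: S(1) nt_lin[OF en])
      finally show "ncomp ?H X e (ntr ?H ?h) K \<eta> = \<phi> K \<eta>" using h by simp
    qed
    with hn show "\<exists>g\<in>nat_trans R ?H X. ncomp ?H X e g = \<phi>" by blast
  qed
qed

end

theorem corollary9p21:
  fixes R :: "'r ring"
  assumes "cring R"
    and "infinite (UNIV :: 'm set)"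
    and "\<exists>e :: 'r \<Rightarrow> 'm. inj_on e (carrier R)"
  shows "(\<exists>a l r s. symmetric_monoidal (bfun_cat R :: (('r, 'm) bfun, ('r, 'm) bfun_arr) cat)
            (tens R) (tens_arr R) (burnside R) a l r s)
    \<and> (\<forall>L L' M M' :: ('r, 'm) bfun.
          biset_functor R L \<and> biset_functor R L' \<and> biset_functor R M \<and> biset_functor R M' \<longrightarrow>
          bilin_map R (nat_mod R L L') (nat_mod R M M') (nat_mod R (tens R L M) (tens R L' M'))
            (tens_map R L L' M M'))
    \<and> (\<forall>P Q :: ('r, 'm) bfun. projective (bfun_cat R) P \<and> projective (bfun_cat R) Q \<longrightarrow>
          projective (bfun_cat R) (tens R P Q))
    \<and> (\<forall>P Q :: ('r, 'm) bfun. projective (bfun_cat R) P \<and> fin_gen R P \<and> projective (bfun_cat R) Q \<longrightarrow>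
          projective (bfun_cat R) (ihom R P Q))"
proof -
  interpret universe R "TYPE('m)"
    using assms by (simp add: universe_def universe_axioms_def coefficients_def)
  show ?thesis
    using symmetric_monoidal_bfun bilin_tens_map projective_tens projective_ihom by blast
qed

end
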